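(* Let $T$ be an EMR map with repeller $\Lambda$ and let $\phi\in\mathcal{R}$. Then for every $\alpha\in(-\infty,\alpha_M)$, $$b(\alpha)=\dim_H J(\alpha)=\sup\left\{\frac{h(\mu)}{\lambda(\mu)}:\ \mu\in\mathcal{M}_T,\ \int\phi\,d\mu=\alpha\ \text{and}\ \lambda(\mu)<\infty\right\}.$$
   Context: Let $I=[0,1]$. A map $T:I\to I$ is an EMR (expanding-Markov-Renyi) map if there is a countable family $\{I_i\}_{i\in\mathbb{N}}$ of closed intervals $I_i\subset I$ with pairwise disjoint interiors such that: (1) $T$ is $C^2$ on $\bigcup_i \mathrm{int}\,I_i$; (2) there exist $\xi>1$ and $N\in\mathbb{N}$ such that $|(T^n)'(x)|>\xi^n$ for every $x\in\bigcup_i I_i$ and $n\ge N$; (3) $T$ is Markov and can be coded by a full-shift on a countable alphabet; (4) (Renyi condition) there is $K>0$ with $\sup_{n\in\mathbb{N}}\sup_{x,y,z\in I_n}\frac{|T''(x)|}{|T'(y)||T'(z)|}\le K$. The repeller is $\Lambda=\{x\in\bigcup_i I_i: T^n(x)\text{ is well defined for every }n\in\mathbb{N}\}$. Standing assumption: $0$ is the unique accumulation point of the set $E$ of endpoints of the intervals $I_i$. Coding: $(\Sigma,\sigma)$ is the full shift on $\Sigma=\mathbb{N}^{\mathbb{N}}$; there is a continuous map $\pi:\Sigma\to\Lambda$ with $\pi\circ\sigma=T\circ\pi$, which is a homeomorphism from $\Sigma$ onto $\Lambda\setminus\bigcup_n T^{-n}E$. For $\psi:\Sigma\to\mathbb{R}$,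 $V_n(\psi)=\sup\{|\psi(x)-\psi(y)|: x,y \text{ agree in their first } n \text{ coordinates}\}$; $\psi$ has summable variations if $\sum_{n=2}^\infty V_n(\psi)<\infty$. $\mathcal{R}$ is the set of $\phi:\Lambda\to\mathbb{R}$ such that $\phi<0$, $\phi\circ\pi$ has summable variations and $\lim_{x\to0}\phi(x)=-\infty$. $\mathcal{M}_T$ is the set of $T$-invariant probability measures, $h(\mu)$ the measure-theoretic entropy, $\lambda(\mu)=\int\log|T'|\,d\mu$. Let $\alpha_M=\sup\{\lim_{n\to\infty}\frac1n\sum_{i=0}^{n-1}\phi(T^ix): x\in\Lambda\}$ (over those $x$ for which the limit exists), $J(\alpha)=\{x\in\Lambda:\lim_{n\to\infty}\frac1n\sum_{i=0}^{n-1}\phi(T^ix)=\alpha\}$ and $b(\alpha)=\dim_H J(\alpha)$ (Hausdorff dimension). *)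

theory Defs
  imports "HOL-Probability.Probability"
begin

section \<open>Hausdorff dimension\<close>

text \<open>Only bounded covering sets are admitted, because the library's diameter is
  unspecified on unbounded sets.  At \<open>s = 0\<close> the convention is \<open>|U|\<^sup>0 = 1\<close> for nonempty
  \<open>U\<close> (whereas \<open>0 powr 0 = 0\<close> in the library).\<close>

definition diam_power :: "real \<Rightarrow> 'a::metric_space set \<Rightarrow> real" where
  "diam_power s U = (if U = {} then 0 else if s = 0 then 1 else diameter U powr s)"

definition hausdorff_premeasure :: "real \<Rightarrow> real \<Rightarrow> 'a::metric_space set \<Rightarrow> ennreal" where
  "hausdorff_premeasure \<delta> s A =
     (INF U\<in>{U :: nat \<Rightarrow> 'a set. (\<forall>i. bounded (U i) \<and> diameter (U i) \<le> \<delta>) \<and> A \<subseteq> (\<Union>i. U i)}.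
        (\<Sum>i. ennreal (diam_power s (U i))))"

definition hausdorff_measure :: "real \<Rightarrow> 'a::metric_space set \<Rightarrow> ennreal" where
  "hausdorff_measure s A = (SUP \<delta>\<in>{0<..}. hausdorff_premeasure \<delta> s A)"

definition hausdorff_dim :: "'a::metric_space set \<Rightarrow> ereal" where
  "hausdorff_dim A = Inf {ereal s | s. 0 \<le> s \<and> hausdorff_measure s A = 0}"


section \<open>Measure-theoretic entropy\<close>

definition invariant_prob :: "('a \<Rightarrow> 'a) \<Rightarrow> 'a measure \<Rightarrow> bool" where
  "invariant_prob T \<mu> \<longleftrightarrow> prob_space \<mu> \<and> T \<in> measurable \<mu> \<mu> \<and> distr \<mu> \<mu> T = \<mu>"

definition finite_partition :: "'a measure \<Rightarrow> 'a set set \<Rightarrow> bool" where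
  "finite_partition \<mu> P \<longleftrightarrow> finite P \<and> P \<subseteq> sets \<mu> \<and> partition_on (space \<mu>) P"

definition partition_entropy :: "'a measure \<Rightarrow> 'a set set \<Rightarrow> real" where
  "partition_entropy \<mu> P = - (\<Sum>A\<in>P. measure \<mu> A * ln (measure \<mu> A))"

definition pullback_partition :: "'a measure \<Rightarrow> ('a \<Rightarrow> 'a) \<Rightarrow> 'a set set \<Rightarrow> 'a set set" where
  "pullback_partition \<mu> f P = (\<lambda>A. f -` A \<inter> space \<mu>) ` P - {{}}"

definition dynamical_join :: "'a measure \<Rightarrow> ('a \<Rightarrow> 'a) \<Rightarrow> 'a set set \<Rightarrow> nat \<Rightarrow> 'a set set" where
  "dynamical_join \<mu> T P n =
     common_refinement ((\<lambda>i. pullback_partition \<mu> (T ^^ i) P) ` {..<n})"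

definition entropy_wrt_partition :: "'a measure \<Rightarrow> ('a \<Rightarrow> 'a) \<Rightarrow> 'a set set \<Rightarrow> real" where
  "entropy_wrt_partition \<mu> T P =
     lim (\<lambda>n. partition_entropy \<mu> (dynamical_join \<mu> T P n) / real n)"

definition ks_entropy :: "('a \<Rightarrow> 'a) \<Rightarrow> 'a measure \<Rightarrow> ereal" where
  "ks_entropy T \<mu> = (SUP P\<in>{P. finite_partition \<mu> P}. ereal (entropy_wrt_partition \<mu> T P))"


section \<open>Expanding Markov Renyi maps\<close>

definition endpoints :: "(nat \<Rightarrow> real set) \<Rightarrow> real set" where
  "endpoints I = (\<Union>i. frontier (I i))"

definition repeller :: "(real \<Rightarrow> real) \<Rightarrow> (nat \<Rightarrow> real set) \<Rightarrow> real set" where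
  "repeller T I = {x. \<forall>n. (T ^^ n) x \<in> (\<Union>i. I i)}"

definition endpoint_preimages :: "(real \<Rightarrow> real) \<Rightarrow> (nat \<Rightarrow> real set) \<Rightarrow> real set" where
  "endpoint_preimages T I = (\<Union>n. (T ^^ n) -` endpoints I)"

definition shift :: "(nat \<Rightarrow> 'a) \<Rightarrow> nat \<Rightarrow> 'a" where
  "shift \<omega> = (\<lambda>n. \<omega> (Suc n))"

text \<open>The coding of the repeller by the full shift on \<open>nat \<Rightarrow> nat\<close> (with its product
  topology): \<open>\<pi> \<omega>\<close> has itinerary \<open>\<omega>\<close>.  The inverse of \<open>\<pi>\<close> exists only off the
  preimages of the endpoints; on the symbolic side the corresponding sequences have to be
  removed as well (there are none for the Gauss map, but for maps with increasing full branches
  the fixed point 1 is an endpoint with a code).\<close>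

definition full_shift_coding ::
  "(real \<Rightarrow> real) \<Rightarrow> (nat \<Rightarrow> real set) \<Rightarrow> ((nat \<Rightarrow> nat) \<Rightarrow> real) \<Rightarrow> bool" where
  "full_shift_coding T I \<pi> \<longleftrightarrow>
     continuous_on UNIV \<pi> \<and>
     range \<pi> = repeller T I \<and>
     \<pi> \<circ> shift = T \<circ> \<pi> \<and>
     (\<forall>\<omega> n. (T ^^ n) (\<pi> \<omega>) \<in> I (\<omega> n)) \<and>
     (\<exists>\<rho>. homeomorphism (- (\<pi> -` endpoint_preimages T I))
             (repeller T I - endpoint_preimages T I) \<pi> \<rho>)"

definition markov_map :: "(real \<Rightarrow> real) \<Rightarrow> (nat \<Rightarrow> real set) \<Rightarrow> bool" where
  "markov_map T I \<longleftrightarrow>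
     (\<forall>i j. T ` interior (I i) \<inter> interior (I j) \<noteq> {} \<longrightarrow>
            interior (I j) \<subseteq> T ` interior (I i))"

definition C2_on :: "(real \<Rightarrow> real) \<Rightarrow> real set \<Rightarrow> bool" where
  "C2_on f U \<longleftrightarrow>
     (\<forall>x\<in>U. f differentiable at x \<and> deriv f differentiable at x) \<and>
     continuous_on U (deriv (deriv f))"

text \<open>Derivatives at endpoints of the intervals are limits from the interior of the interval, so
  the expansion and Renyi conditions are stated at interior points; the expansion condition
  concerns those points at which \<open>T ^^ n\<close> is defined and differentiable by the chain rule.
  The clause \<open>deriv T y \<noteq> 0\<close> excludes the totalised value of a division by zero.\<close>

definition emr_map :: "(real \<Rightarrow> real) \<Rightarrow> (nat \<Rightarrow> real set) \<Rightarrow> bool" where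
  "emr_map T I \<longleftrightarrow>
     T ` {0..1} \<subseteq> {0..1} \<and>
     (\<forall>i. \<exists>a b. a < b \<and> I i = {a..b} \<and> {a..b} \<subseteq> {0..1}) \<and>
     (\<forall>i j. i \<noteq> j \<longrightarrow> interior (I i) \<inter> interior (I j) = {}) \<and>
     C2_on T (\<Union>i. interior (I i)) \<and>
     (\<exists>\<xi>>1. \<exists>N. \<forall>n\<ge>N. \<forall>x. (\<forall>k<n. (T ^^ k) x \<in> (\<Union>i. interior (I i))) \<longrightarrow>
        \<bar>deriv (T ^^ n) x\<bar> > \<xi> ^ n) \<and>
     markov_map T I \<and> (\<exists>\<pi>. full_shift_coding T I \<pi>) \<and>
     (\<exists>K>0. \<forall>n. \<forall>x\<in>interior (I n). \<forall>y\<in>interior (I n). \<forall>z\<in>interior (I n).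
        deriv T y \<noteq> 0 \<and> \<bar>deriv (deriv T) x\<bar> / (\<bar>deriv T y\<bar> * \<bar>deriv T z\<bar>) \<le> K)"


section \<open>Potentials\<close>

definition variation :: "nat \<Rightarrow> ((nat \<Rightarrow> nat) \<Rightarrow> real) \<Rightarrow> ennreal" where
  "variation n \<psi> = (SUP (x, y)\<in>{(x, y). \<forall>i<n. x i = y i}. ennreal \<bar>\<psi> x - \<psi> y\<bar>)"

definition summable_variations :: "((nat \<Rightarrow> nat) \<Rightarrow> real) \<Rightarrow> bool" where
  "summable_variations \<psi> \<longleftrightarrow> (\<Sum>n. variation (n + 2) \<psi>) < \<infinity>"

text \<open>A function on the repeller is represented by a function on the reals whose values off
  the repeller are irrelevant.\<close>

definition class_R ::
  "(real \<Rightarrow> real) \<Rightarrow> (nat \<Rightarrow> real set) \<Rightarrow> ((nat \<Rightarrow> nat) \<Rightarrow> real) \<Rightarrow> (real \<Rightarrow> real) set" where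
  "class_R T I \<pi> =
     {\<phi>. (\<forall>x\<in>repeller T I. \<phi> x < 0) \<and>
          summable_variations (\<phi> \<circ> \<pi>) \<and>
          filterlim \<phi> at_bot (at 0 within repeller T I)}"


section \<open>Invariant measures and Birkhoff averages\<close>

definition invariant_measures :: "(real \<Rightarrow> real) \<Rightarrow> (nat \<Rightarrow> real set) \<Rightarrow> real measure set" where
  "invariant_measures T I =
     {\<mu>. space \<mu> = repeller T I \<and> sets \<mu> = sets (restrict_space borel (repeller T I)) \<and>
          invariant_prob T \<mu>}"

text \<open>On the interior of the intervals this is the ordinary derivative.  The relative derivative
  is needed because an endpoint can carry invariant mass; such an endpoint is the right end of the
  union of the intervals, where the relative derivative is the one-sided one.\<close>

definition branch_deriv :: "(real \<Rightarrow> real) \<Rightarrow> (nat \<Rightarrow> real set) \<Rightarrow> real \<Rightarrow> real" where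
  "branch_deriv T I x = vector_derivative T (at x within (\<Union>i. I i))"

definition lyapunov :: "(real \<Rightarrow> real) \<Rightarrow> (nat \<Rightarrow> real set) \<Rightarrow> real measure \<Rightarrow> ereal" where
  "lyapunov T I \<mu> =
     enn2ereal (\<integral>\<^sup>+x. ennreal (ln \<bar>branch_deriv T I x\<bar>) \<partial>\<mu>) -
     enn2ereal (\<integral>\<^sup>+x. ennreal (- ln \<bar>branch_deriv T I x\<bar>) \<partial>\<mu>)"

definition birkhoff_limit :: "(real \<Rightarrow> real) \<Rightarrow> (real \<Rightarrow> real) \<Rightarrow> real \<Rightarrow> real \<Rightarrow> bool" where
  "birkhoff_limit T \<phi> x \<alpha> \<longleftrightarrow>
     (\<lambda>n. (\<Sum>i<n. \<phi> ((T ^^ i) x)) / real n) \<longlonglongrightarrow> \<alpha>"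

definition alpha_max :: "(real \<Rightarrow> real) \<Rightarrow> (nat \<Rightarrow> real set) \<Rightarrow> (real \<Rightarrow> real) \<Rightarrow> ereal" where
  "alpha_max T I \<phi> = Sup {ereal a | a. \<exists>x\<in>repeller T I. birkhoff_limit T \<phi> x a}"

definition level_set ::
  "(real \<Rightarrow> real) \<Rightarrow> (nat \<Rightarrow> real set) \<Rightarrow> (real \<Rightarrow> real) \<Rightarrow> real \<Rightarrow> real set" where
  "level_set T I \<phi> \<alpha> = {x \<in> repeller T I. birkhoff_limit T \<phi> x \<alpha>}"

definition birkhoff_spectrum ::
  "(real \<Rightarrow> real) \<Rightarrow> (nat \<Rightarrow> real set) \<Rightarrow> (real \<Rightarrow> real) \<Rightarrow> real \<Rightarrow> ereal" where
  "birkhoff_spectrum T I \<phi> \<alpha> = hausdorff_dim (level_set T I \<phi> \<alpha>)"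

end

theory Submission
  imports Defs
begin

text \<open>Bounded distortion makes the length of the cylinder interval of a word comparable to the inverse
  derivative of the corresponding branch and almost multiplicative under concatenation; the Birkhoff
  sums of the potential are almost additive on words beginning with a fixed letter. Both sides of the
  formula are therefore the supremum of those \<open>s\<close> for which there are finitely many words of one large
  length \<open>n\<close>, with Birkhoff sums \<open>n (\<alpha> \<plusminus> \<epsilon>)\<close> and with \<open>\<Sum> |U\<^sub>w|\<^sup>s \<ge> 1\<close>. If there are none, the cylinders of
  such words form efficient covers of the level set. If there are some, appending correcting words
  gives two families which push the Birkhoff sum up and down; a random concatenation that chooses the
  family by the sign of the accumulated deviation lives on the level set and obeys the mass
  distribution principle, while a convex combination of the two Bernoulli measures on the families is
  an invariant measure with integral \<open>\<alpha>\<close>. Conversely an invariant measure with \<open>h > s \<lambda>\<close> distributes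
  long words with entropy larger than \<open>s\<close> times the mean logarithmic size, and a weak law of large
  numbers for independent concatenations of these words produces the required families.\<close>

section \<open>Entropy of finite-valued functions\<close>

text \<open>The alphabet is infinite, \<open>\<phi>\<close> is unbounded below, its first variation
  may be infinite and \<open>\<pi>\<close> may fail to be injective. These obstacles shape the words
  that are used. All of them begin with one letter \<open>e0\<close>, so that any two continuations
  of a block still agree in the letter after it, which is what makes Birkhoff sums almost additive.
  Since \<open>e0 \<noteq> mx\<close>, a code in which \<open>e0\<close> recurs can be read off from
  its point: ambiguity can occur only for points that reach the right end \<open>M\<close>, and
  their codes end in \<open>mx\<close> forever. Concatenation costs a fixed error per word
  (\<open>B\<close> for sums, \<open>3 * D0\<close> for logarithmic lengths), which is negligible
  per letter once the words are long. The criterion has two forms: \<open>approx_good\<close> is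
  what coverings and invariant measures deliver, \<open>good\<close> is what the constructions
  consume. Passing from the first to the second costs an arbitrarily small part of the exponent,
  because the loss caused by the correcting words is dominated by the exponential shrinking of
  cylinders.\<close>

text \<open>Fekete's lemma. Dividing \<open>n\<close> by a \<open>k\<close> at which the quotient is
  nearly the infimum leaves a remainder whose cost is the constant \<open>C\<close>; the term
  \<open>a 0\<close> is carried along because it is not assumed to vanish.\<close>

lemma subadditive_limit:
  fixes a :: "nat \<Rightarrow> real"
  assumes sub: "\<And>m n. a (m + n) \<le> a m + a n" and nonneg: "\<And>n. 0 \<le> a n"
  obtains l where "(\<lambda>n. a n / real n) \<longlonglongrightarrow> l" and "\<And>n. n \<ge> 1 \<Longrightarrow> l \<le> a n / real n"
proof -
  define l where "l = Inf ((\<lambda>n. a n / real n) ` {1..})"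
  have bdd: "bdd_below ((\<lambda>n. a n / real n) ` {1..})"
    by (rule bdd_belowI[of _ 0]) (use nonneg in auto)
  have low: "l \<le> a n / real n" if "n \<ge> 1" for n
    unfolding l_def using that by (intro cInf_lower bdd) auto
  have mult: "a (q * k) \<le> real q * a k + a 0" for q k
  proof (induction q)
    case (Suc q)
    then show ?case using sub[of k "q * k"] by (simp add: algebra_simps)
  qed simp
  have "(\<lambda>n. a n / real n) \<longlonglongrightarrow> l"
  proof (rule LIMSEQ_I)
    fix e :: real assume e: "e > 0"
    have "\<exists>y\<in>(\<lambda>n. a n / real n) ` {1..}. y < l + e / 2"
      unfolding l_def by (rule cInf_lessD) (use e in \<open>auto simp: image_iff\<close>)
    then obtain k where k: "k \<ge> 1" "a k / real k < l + e / 2" by auto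
    define C where "C = (\<Sum>j<k. a j) + a 0"
    have C: "a j + a 0 \<le> C" if "j < k" for j
      unfolding C_def using that nonneg by (auto intro!: member_le_sum)
    have C0: "C \<ge> 0" unfolding C_def using nonneg by (auto intro!: add_nonneg_nonneg sum_nonneg)
    obtain n0 where n0: "real n0 > 2 * C / e" using reals_Archimedean2 by blast
    have "norm (a n / real n - l) < e" if n: "n \<ge> max n0 1" for n
    proof -
      have "a n \<le> a (n div k * k) + a (n mod k)"
        using sub[of "n div k * k" "n mod k"] by simp
      also have "\<dots> \<le> real (n div k) * a k + C"
        using mult[of "n div k" k] C[of "n mod k"] k(1) by simp
      also have "real (n div k) * a k \<le> real n / real k * a k"
        by (intro mult_right_mono nonneg of_nat_div_le_of_nat)
      finally have "a n / real n \<le> a k / real k + C / real n"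
        using n by (simp add: field_simps)
      moreover have "C / real n < e / 2"
      proof -
        have "2 * C / e < real n" using n n0 by linarith
        then show ?thesis using e n C0 by (simp add: field_simps)
      qed
      ultimately have "a n / real n < l + e" using k(2) by linarith
      moreover have "l \<le> a n / real n" using low n by simp
      ultimately show ?thesis by simp
    qed
    then show "\<exists>no. \<forall>n\<ge>no. norm (a n / real n - l) < e" by blast
  qed
  with low that show ?thesis by blast
qed

text \<open>Shannon entropy of the partition into level sets of \<open>f\<close>. With functions in
  place of set partitions, refinements become pairs and coarsenings become compositions.\<close>

definition fent :: "'a measure \<Rightarrow> ('a \<Rightarrow> 'b) \<Rightarrow> real" where
  "fent \<mu> f = - (\<Sum>v\<in>f ` space \<mu>. measure \<mu> (f -` {v} \<inter> space \<mu>) * ln (measure \<mu> (f -` {v} \<inter> space \<mu>)))"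

lemma fent_cong: "(\<And>x. x \<in> space \<mu> \<Longrightarrow> f x = g x) \<Longrightarrow> fent \<mu> f = fent \<mu> g"
proof -
  assume *: "\<And>x. x \<in> space \<mu> \<Longrightarrow> f x = g x"
  then have "f ` space \<mu> = g ` space \<mu>" by auto
  moreover have "f -` {v} \<inter> space \<mu> = g -` {v} \<inter> space \<mu>" for v using * by auto
  ultimately show ?thesis by (simp add: fent_def)
qed

context prob_space
begin

lemma info_exp1: "information_space M (exp 1)"
  by standard simp

lemma fent_eq_entropy:
  assumes "simple_function M f"
  shows "fent M f = entropy (exp 1) (count_space (f ` space M)) f"
proof -
  interpret information_space M "exp 1" by (rule info_exp1)
  show ?thesis
    by (simp add: entropy_simple_distributed[OF simple_distributedI[OF assms measure_nonneg refl]]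
        fent_def log_def)
qed

text \<open>The data processing inequality. Later comparisons of entropies are made by exhibiting a
  decoding function \<open>h\<close>.\<close>

lemma fent_comp_le:
  assumes f: "simple_function M f" and g: "\<And>x. x \<in> space M \<Longrightarrow> g x = h (f x)"
  shows "fent M g \<le> fent M f"
proof -
  interpret information_space M "exp 1" by (rule info_exp1)
  have "fent M g = fent M (h \<circ> f)" using g by (intro fent_cong) simp
  also have "\<dots> \<le> fent M f"
    using entropy_data_processing[OF f, of h] f
    by (simp add: fent_eq_entropy simple_function_compose)
  finally show ?thesis .
qed

lemma fent_pair_le:
  assumes f: "simple_function M f" and g: "simple_function M g"
  shows "fent M (\<lambda>x. (f x, g x)) \<le> fent M f + fent M g"
proof -
  interpret information_space M "exp 1" by (rule info_exp1)
  show ?thesis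
    using entropy_chain_rule[OF f g] conditional_entropy_less_eq_entropy[OF g f]
      simple_function_Pair[OF f g]
    by (simp add: fent_eq_entropy f g)
qed

lemma fent_nonneg: "0 \<le> fent M f"
proof -
  have "measure M A * ln (measure M A) \<le> 0" for A
    using prob_le_1[of A] measure_nonneg[of M A]
    by (cases "measure M A = 0") (auto simp: mult_le_0_iff ln_le_zero_iff zero_less_measure_iff)
  then show ?thesis by (auto simp: fent_def intro!: sum_nonpos)
qed

end

lemma fent_comp_distr:
  assumes g: "g \<in> measurable N M" and f: "simple_function M f"
  shows "fent (distr N M g) f = fent N (\<lambda>x. f (g x))"
proof -
  have sets: "f -` {v} \<inter> space M \<in> sets M" for v
    using f by (rule simple_functionD(2))
  have m: "measure (distr N M g) (f -` {v} \<inter> space M) = measure N ((\<lambda>x. f (g x)) -` {v} \<inter> space N)" for v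
    using g sets[of v] measurable_space[OF g] by (subst measure_distr) (auto intro!: arg_cong[where f="measure N"])
  have sub: "(\<lambda>x. f (g x)) ` space N \<subseteq> f ` space M" using measurable_space[OF g] by auto
  have z: "measure N ((\<lambda>x. f (g x)) -` {v} \<inter> space N) = 0" if "v \<notin> (\<lambda>x. f (g x)) ` space N" for v
  proof -
    have "(\<lambda>x. f (g x)) -` {v} \<inter> space N = {}" using that by auto
    then show ?thesis by simp
  qed
  show ?thesis
    unfolding fent_def space_distr m
    by (intro arg_cong[where f=uminus] sum.mono_neutral_right)
       (use sub f z simple_functionD(1) in auto)
qed

text \<open>The right-hand side is the tangent at \<open>y\<close> of the convex function
  \<open>x * ln x\<close>.\<close>

lemma xlnx_ge: "x * ln x \<ge> x * ln y + x - y" if "x \<ge> 0" "y > 0" for x y :: real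
proof (cases "x = 0")
  case False
  then have "x > 0" using that by simp
  have "ln (y / x) \<le> y / x - 1" using \<open>x > 0\<close> \<open>y > 0\<close> by (intro ln_le_minus_one) simp
  then have "ln y - ln x \<le> y / x - 1" using \<open>x > 0\<close> \<open>y > 0\<close> by (simp add: ln_div)
  then have "x * (ln y - ln x) \<le> x * (y / x - 1)" using \<open>x > 0\<close> by (intro mult_left_mono) auto
  then show ?thesis using \<open>x > 0\<close> by (simp add: algebra_simps)
qed (use that in simp)

lemma xlnx_convex:
  fixes c x :: "'k \<Rightarrow> real"
  assumes "finite K" "\<And>k. k \<in> K \<Longrightarrow> 0 \<le> c k" "(\<Sum>k\<in>K. c k) = 1" "\<And>k. k \<in> K \<Longrightarrow> 0 \<le> x k"
  shows "(\<Sum>k\<in>K. c k * x k) * ln (\<Sum>k\<in>K. c k * x k) \<le> (\<Sum>k\<in>K. c k * (x k * ln (x k)))"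
proof -
  let ?y = "\<Sum>k\<in>K. c k * x k"
  have nn: "?y \<ge> 0" using assms by (auto intro!: sum_nonneg)
  show ?thesis
  proof (cases "?y = 0")
    case True
    then have "c k * x k = 0" if "k \<in> K" for k
      using sum_nonneg_eq_0_iff[of K "\<lambda>k. c k * x k"] assms that by auto
    then have "(\<Sum>k\<in>K. c k * (x k * ln (x k))) = 0"
      by (intro sum.neutral) (metis mult.assoc mult_zero_left)
    then show ?thesis using True by simp
  next
    case False
    then have y: "?y > 0" using nn by simp
    have "(\<Sum>k\<in>K. c k * (x k * ln ?y + x k - ?y)) \<le> (\<Sum>k\<in>K. c k * (x k * ln (x k)))"
      using xlnx_ge[OF _ y] assms by (intro sum_mono mult_left_mono) auto
    moreover have "(\<Sum>k\<in>K. c k * (x k * ln ?y + x k - ?y)) = ?y * ln ?y + ?y - (\<Sum>k\<in>K. c k) * ?y"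
    proof -
      have "c k * (x k * ln ?y + x k - ?y) = c k * x k * ln ?y + c k * x k - c k * ?y" for k
        by (simp add: algebra_simps)
      then show ?thesis by (simp only: sum.distrib sum_subtractf sum_distrib_right)
    qed
    ultimately show ?thesis using assms(3) by simp
  qed
qed

text \<open>Concavity of entropy in the measure, inherited from \<open>- x * ln x\<close>. It bounds
  the entropy of a mixture of non-invariant measures from below.\<close>

lemma fent_mixture_ge:
  fixes \<nu> :: "'k \<Rightarrow> 'a measure"
  assumes K: "finite K" "\<And>k. k \<in> K \<Longrightarrow> 0 \<le> c k" "(\<Sum>k\<in>K. c k) = 1"
    and sp: "\<And>k. k \<in> K \<Longrightarrow> space (\<nu> k) = space \<mu>" and fin: "finite (f ` space \<mu>)"
    and m: "\<And>v. measure \<mu> (f -` {v} \<inter> space \<mu>) = (\<Sum>k\<in>K. c k * measure (\<nu> k) (f -` {v} \<inter> space \<mu>))"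
  shows "(\<Sum>k\<in>K. c k * fent (\<nu> k) f) \<le> fent \<mu> f"
proof -
  let ?A = "\<lambda>v. f -` {v} \<inter> space \<mu>"
  have "(\<Sum>v\<in>f ` space \<mu>. measure \<mu> (?A v) * ln (measure \<mu> (?A v)))
      \<le> (\<Sum>v\<in>f ` space \<mu>. \<Sum>k\<in>K. c k * (measure (\<nu> k) (?A v) * ln (measure (\<nu> k) (?A v))))"
    unfolding m using K by (intro sum_mono xlnx_convex) auto
  also have "\<dots> = (\<Sum>k\<in>K. \<Sum>v\<in>f ` space \<mu>. c k * (measure (\<nu> k) (?A v) * ln (measure (\<nu> k) (?A v))))"
    by (rule sum.swap)
  also have "\<dots> = (\<Sum>k\<in>K. c k * (- fent (\<nu> k) f))"
    using sp by (intro sum.cong refl) (simp add: fent_def sum_distrib_left)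
  finally show ?thesis by (simp add: fent_def sum_negf)
qed

subsection \<open>Dynamical joins\<close>

text \<open>Turns a set partition into a function, so that the entropy of a dynamical join becomes
  \<open>fent\<close> of the itinerary through the partition.\<close>

definition cell :: "'a set set \<Rightarrow> 'a \<Rightarrow> 'a set" where
  "cell P x = (THE A. A \<in> P \<and> x \<in> A)"

lemma cell_props:
  assumes "partition_on X P" "x \<in> X"
  shows "cell P x \<in> P" "x \<in> cell P x"
proof -
  have "\<exists>A. A \<in> P \<and> x \<in> A" using assms by (auto simp: partition_on_def)
  moreover have "A = B" if "A \<in> P \<and> x \<in> A" "B \<in> P \<and> x \<in> B" for A B
    using assms(1) that by (auto simp: partition_on_def disjoint_def)
  ultimately have "\<exists>!A. A \<in> P \<and> x \<in> A" by auto
  then have "cell P x \<in> P \<and> x \<in> cell P x" unfolding cell_def by (rule theI')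
  then show "cell P x \<in> P" "x \<in> cell P x" by auto
qed

lemma cell_eq:
  assumes "partition_on X P" "A \<in> P" "x \<in> A"
  shows "cell P x = A"
proof -
  have "x \<in> X" using assms by (auto simp: partition_on_def)
  then have "cell P x \<in> P" "x \<in> cell P x" by (simp_all add: cell_props[OF assms(1)])
  then show ?thesis using assms unfolding partition_on_def disjoint_def by blast
qed

lemma partition_entropy_eq_fent:
  assumes P: "partition_on (space \<mu>) P"
    and f: "\<And>x y. x \<in> space \<mu> \<Longrightarrow> y \<in> space \<mu> \<Longrightarrow> f x = f y \<longleftrightarrow> cell P x = cell P y"
  shows "partition_entropy \<mu> P = fent \<mu> f"
proof -
  have eq: "f -` {f x} \<inter> space \<mu> = cell P x" if "x \<in> space \<mu>" for x
  proof -
    have "y \<in> cell P x \<longleftrightarrow> y \<in> space \<mu> \<and> f y = f x" for y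
      using f[of y x] that cell_props[OF P that] cell_eq[OF P, of "cell P x" y] cell_props[OF P, of y] P
      by (auto simp: partition_on_def)
    then show ?thesis by auto
  qed
  have img: "P = (\<lambda>v. f -` {v} \<inter> space \<mu>) ` (f ` space \<mu>)"
  proof (intro equalityI subsetI)
    fix A assume A: "A \<in> P"
    have "A \<noteq> {}" "A \<subseteq> space \<mu>" using P A by (auto simp: partition_on_def)
    then obtain x where x: "x \<in> A" "x \<in> space \<mu>" by blast
    then show "A \<in> (\<lambda>v. f -` {v} \<inter> space \<mu>) ` (f ` space \<mu>)"
      using eq[OF x(2)] cell_eq[OF P A x(1)] by (intro image_eqI[of _ _ "f x"]) auto
  next
    fix A assume "A \<in> (\<lambda>v. f -` {v} \<inter> space \<mu>) ` (f ` space \<mu>)"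
    then show "A \<in> P" using eq cell_props(1)[OF P] by auto
  qed
  have inj: "inj_on (\<lambda>v. f -` {v} \<inter> space \<mu>) (f ` space \<mu>)"
    by (rule inj_onI) auto
  show ?thesis
    unfolding partition_entropy_def fent_def
    by (subst img) (simp add: sum.reindex[OF inj])
qed

lemma partition_on_pullback:
  assumes f: "\<And>x. x \<in> space \<mu> \<Longrightarrow> f x \<in> space \<mu>" and P: "partition_on (space \<mu>) P"
  shows "partition_on (space \<mu>) (pullback_partition \<mu> f P)"
proof (rule partition_onI)
  show "\<Union> (pullback_partition \<mu> f P) = space \<mu>"
  proof (intro equalityI subsetI)
    fix x assume x: "x \<in> space \<mu>"
    then have "x \<in> f -` cell P (f x) \<inter> space \<mu>" "cell P (f x) \<in> P" using f cell_props[OF P] by auto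
    then show "x \<in> \<Union> (pullback_partition \<mu> f P)"
      unfolding pullback_partition_def by (intro UnionI[of "f -` cell P (f x) \<inter> space \<mu>"]) auto
  qed (auto simp: pullback_partition_def)
  fix p q assume pq: "p \<in> pullback_partition \<mu> f P" "q \<in> pullback_partition \<mu> f P" "p \<noteq> q"
  then obtain A B where AB: "A \<in> P" "B \<in> P" "p = f -` A \<inter> space \<mu>" "q = f -` B \<inter> space \<mu>"
    by (auto simp: pullback_partition_def)
  then have "A \<noteq> B" using pq(3) by auto
  then have "A \<inter> B = {}" using P AB(1,2) by (auto simp: partition_on_def disjoint_def)
  then show "disjnt p q" using AB by (auto simp: disjnt_def)
qed (auto simp: pullback_partition_def)

lemma cell_pullback:
  assumes f: "\<And>x. x \<in> space \<mu> \<Longrightarrow> f x \<in> space \<mu>" and P: "partition_on (space \<mu>) P" and x: "x \<in> space \<mu>"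
  shows "cell (pullback_partition \<mu> f P) x = f -` cell P (f x) \<inter> space \<mu>"
  using cell_props[OF P f[OF x]] x
  by (intro cell_eq[OF partition_on_pullback[OF f P]]) (auto simp: pullback_partition_def)

lemma mem_common_refinement_iff:
  assumes part: "\<And>P. P \<in> \<P> \<Longrightarrow> partition_on S P" and A: "A \<in> common_refinement \<P>"
    and x: "x \<in> A" and y: "y \<in> S" and ne: "\<P> \<noteq> {}"
  shows "y \<in> A \<longleftrightarrow> (\<forall>P\<in>\<P>. cell P x = cell P y)"
proof -
  obtain f where f: "f \<in> (\<Pi> P\<in>\<P>. P)" "A = \<Inter> (f ` \<P>)"
    using A by (auto simp: common_refinement)
  have "cell P x = f P" if "P \<in> \<P>" for P
    using f x that by (intro cell_eq[OF part[OF that]]) auto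
  moreover have "y \<in> f P \<longleftrightarrow> cell P y = f P" if "P \<in> \<P>" for P
    using cell_eq[OF part[OF that], of "f P" y] cell_props[OF part[OF that] y] f(1) that by auto
  ultimately show ?thesis using f(2) by auto
qed

definition names :: "('a \<Rightarrow> 'a) \<Rightarrow> ('a \<Rightarrow> 'b) \<Rightarrow> nat \<Rightarrow> 'a \<Rightarrow> 'b list" where
  "names T f n x = map (\<lambda>i. f ((T ^^ i) x)) [0..<n]"

lemma names_eq_iff: "names T f n x = names T f n y \<longleftrightarrow> (\<forall>i<n. f ((T ^^ i) x) = f ((T ^^ i) y))"
  by (auto simp: names_def list_eq_iff_nth_eq)

lemma length_names [simp]: "length (names T f n x) = n"
  by (simp add: names_def)

text \<open>Points lie in the same set of the join exactly if their names agree. The case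
  \<open>n = 0\<close> is excluded because the common refinement of the empty family is in general
  no partition of the space.\<close>

lemma partition_entropy_join:
  assumes P: "partition_on (space \<mu>) P" and T: "\<And>x. x \<in> space \<mu> \<Longrightarrow> T x \<in> space \<mu>" and n: "n \<ge> 1"
  shows "partition_entropy \<mu> (dynamical_join \<mu> T P n) = fent \<mu> (names T (cell P) n)"
proof -
  have Ti: "(T ^^ i) x \<in> space \<mu>" if "x \<in> space \<mu>" for i x
    using that by (induction i) (auto intro: T)
  let ?\<P> = "(\<lambda>i. pullback_partition \<mu> (T ^^ i) P) ` {..<n}"
  have part: "partition_on (space \<mu>) Q" if "Q \<in> ?\<P>" for Q
    using that Ti P by (auto intro!: partition_on_pullback)
  have ne: "?\<P> \<noteq> {}" using n by (auto simp: lessThan_empty_iff)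
  have J: "partition_on (space \<mu>) (dynamical_join \<mu> T P n)"
    unfolding dynamical_join_def by (rule partition_on_common_refinement[OF part ne])
  show ?thesis
  proof (rule partition_entropy_eq_fent[OF J])
    fix x y assume xy: "x \<in> space \<mu>" "y \<in> space \<mu>"
    let ?J = "dynamical_join \<mu> T P n"
    have "cell ?J x = cell ?J y \<longleftrightarrow> y \<in> cell ?J x"
      using cell_props[OF J xy(1)] cell_props[OF J xy(2)] cell_eq[OF J, of "cell ?J x" y] by metis
    also have "\<dots> \<longleftrightarrow> (\<forall>Q\<in>?\<P>. cell Q x = cell Q y)"
      using cell_props[OF J xy(1)] unfolding dynamical_join_def
      by (intro mem_common_refinement_iff[OF part _ _ xy(2) ne]) auto
    also have "\<dots> \<longleftrightarrow> (\<forall>i<n. cell P ((T ^^ i) x) = cell P ((T ^^ i) y))"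
    proof -
      have "cell (pullback_partition \<mu> (T ^^ i) P) x = cell (pullback_partition \<mu> (T ^^ i) P) y
          \<longleftrightarrow> cell P ((T ^^ i) x) = cell P ((T ^^ i) y)" for i
      proof -
        have e: "cell (pullback_partition \<mu> (T ^^ i) P) z = (T ^^ i) -` cell P ((T ^^ i) z) \<inter> space \<mu>"
          if "z \<in> space \<mu>" for z
          by (rule cell_pullback[OF Ti P that])
        show ?thesis
      proof
        assume "cell (pullback_partition \<mu> (T ^^ i) P) x = cell (pullback_partition \<mu> (T ^^ i) P) y"
        then have "(T ^^ i) -` cell P ((T ^^ i) x) \<inter> space \<mu> = (T ^^ i) -` cell P ((T ^^ i) y) \<inter> space \<mu>"
          using e[OF xy(1)] e[OF xy(2)] by simp
        moreover have "y \<in> (T ^^ i) -` cell P ((T ^^ i) y) \<inter> space \<mu>"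
          using cell_props(2)[OF P Ti[OF xy(2), of i]] xy(2) by simp
        ultimately have "y \<in> (T ^^ i) -` cell P ((T ^^ i) x) \<inter> space \<mu>" by simp
        then show "cell P ((T ^^ i) x) = cell P ((T ^^ i) y)"
          using cell_eq[OF P cell_props(1)[OF P Ti[OF xy(1)]], of "(T ^^ i) y" i] by simp
      next
        assume "cell P ((T ^^ i) x) = cell P ((T ^^ i) y)"
        then show "cell (pullback_partition \<mu> (T ^^ i) P) x = cell (pullback_partition \<mu> (T ^^ i) P) y"
          using e[OF xy(1)] e[OF xy(2)] by simp
      qed
      qed
      then show ?thesis by auto
    qed
    finally show "names T (cell P) n x = names T (cell P) n y \<longleftrightarrow> cell ?J x = cell ?J y"
      by (simp add: names_eq_iff)
  qed
qed

lemma simple_function_cell: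
  assumes "finite_partition \<mu> P"
  shows "simple_function \<mu> (cell P)"
proof -
  have P: "partition_on (space \<mu>) P" "finite P" "P \<subseteq> sets \<mu>" using assms by (auto simp: finite_partition_def)
  have "cell P ` space \<mu> \<subseteq> P" using cell_props(1)[OF P(1)] by auto
  moreover have "cell P -` {cell P x} \<inter> space \<mu> = cell P x" if "x \<in> space \<mu>" for x
    using cell_props[OF P(1)] cell_eq[OF P(1)] that P(1) by (auto simp: partition_on_def)
  ultimately show ?thesis
    unfolding simple_function_def using P cell_props(1)[OF P(1)] by (auto intro: finite_subset)
qed

lemma simple_function_names:
  assumes f: "simple_function \<mu> f" and T: "T \<in> measurable \<mu> \<mu>"
  shows "simple_function \<mu> (names T f n)"
proof (induction n)
  case 0
  have "names T f 0 = (\<lambda>x. [])" by (auto simp: names_def)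
  then show ?case by simp
next
  case (Suc n)
  have Tn: "(T ^^ n) \<in> measurable \<mu> \<mu>" by (rule measurable_compose_n[OF T])
  have "simple_function \<mu> (\<lambda>x. f ((T ^^ n) x))"
    using simple_function_comp[OF Tn f] by (simp add: comp_def)
  then have "simple_function \<mu> (\<lambda>x. (\<lambda>(u, v). u @ [v]) (names T f n x, f ((T ^^ n) x)))"
    using simple_function_compose[OF simple_function_Pair[OF Suc], of _ "\<lambda>(u, v). u @ [v]"]
    by (simp add: comp_def)
  moreover have "names T f (Suc n) = (\<lambda>x. (\<lambda>(u, v). u @ [v]) (names T f n x, f ((T ^^ n) x)))"
    by (auto simp: names_def)
  ultimately show ?case by simp
qed

lemma names_add: "names T f (m + n) x = names T f m x @ names T f n ((T ^^ m) x)"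
proof -
  have "(T ^^ (i - m)) ((T ^^ m) x) = (T ^^ i) x" if "m \<le> i" for i
    using that by (simp flip: funpow_add comp_apply[of "T ^^ _" "T ^^ _"])
  then show ?thesis by (simp add: names_def list_eq_iff_nth_eq nth_append)
qed

text \<open>A name of length \<open>m + n\<close> splits into the names of \<open>x\<close> and of
  \<open>(T ^^ m) x\<close>, and by invariance the second one has the law of a name of length
  \<open>n\<close>.\<close>

lemma fent_names_subadditive:
  assumes inv: "invariant_prob T \<mu>" and f: "simple_function \<mu> f"
  shows "fent \<mu> (names T f (m + n)) \<le> fent \<mu> (names T f m) + fent \<mu> (names T f n)"
proof -
  interpret prob_space \<mu> using inv by (simp add: invariant_prob_def)
  have T: "T \<in> measurable \<mu> \<mu>" and d: "distr \<mu> \<mu> T = \<mu>" using inv by (auto simp: invariant_prob_def)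
  have dm: "distr \<mu> \<mu> (T ^^ m) = \<mu>"
  proof (induction m)
    case 0
    then show ?case using distr_id[of \<mu>] by (simp add: id_def)
  next
    case (Suc m)
    have "distr \<mu> \<mu> (T \<circ> (T ^^ m)) = distr (distr \<mu> \<mu> (T ^^ m)) \<mu> T"
      using T by (intro distr_distr[symmetric]) (auto intro: measurable_compose_n)
    then show ?case using Suc d by (simp only: funpow.simps)
  qed
  have Tm: "(T ^^ m) \<in> measurable \<mu> \<mu>" by (rule measurable_compose_n[OF T])
  note s = simple_function_names[OF f T]
  have s2: "simple_function \<mu> (\<lambda>x. names T f n ((T ^^ m) x))"
    using simple_function_comp[OF Tm s] by (simp add: comp_def)
  have "fent \<mu> (names T f (m + n)) \<le> fent \<mu> (\<lambda>x. (names T f m x, names T f n ((T ^^ m) x)))"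
    by (rule fent_comp_le[where h="\<lambda>(u, v). u @ v"])
       (auto simp: names_add intro!: simple_function_Pair s s2)
  also have "\<dots> \<le> fent \<mu> (names T f m) + fent \<mu> (\<lambda>x. names T f n ((T ^^ m) x))"
    by (rule fent_pair_le[OF s s2])
  also have "fent \<mu> (\<lambda>x. names T f n ((T ^^ m) x)) = fent \<mu> (names T f n)"
    using fent_comp_distr[OF Tm s[of n]] dm by simp
  finally show ?thesis by simp
qed

text \<open>The value of \<open>lim\<close> is meaningful only after convergence is known. Fekete's
  lemma provides it, and since the limit is an infimum it also bounds every finite stage from
  below.\<close>

lemma entropy_wrt_partition_props:
  assumes inv: "invariant_prob T \<mu>" and P: "finite_partition \<mu> P"
  shows "(\<lambda>n. fent \<mu> (names T (cell P) n) / real n) \<longlonglongrightarrow> entropy_wrt_partition \<mu> T P"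
    and "n \<ge> 1 \<Longrightarrow> real n * entropy_wrt_partition \<mu> T P \<le> fent \<mu> (names T (cell P) n)"
proof -
  interpret prob_space \<mu> using inv by (simp add: invariant_prob_def)
  have T: "T \<in> measurable \<mu> \<mu>" using inv by (auto simp: invariant_prob_def)
  have part: "partition_on (space \<mu>) P" using P by (simp add: finite_partition_def)
  obtain l where l: "(\<lambda>n. fent \<mu> (names T (cell P) n) / real n) \<longlonglongrightarrow> l"
      "\<And>n. n \<ge> 1 \<Longrightarrow> l \<le> fent \<mu> (names T (cell P) n) / real n"
    using subadditive_limit[of "\<lambda>n. fent \<mu> (names T (cell P) n)",
        OF fent_names_subadditive[OF inv simple_function_cell[OF P]] fent_nonneg] by blast
  have "(\<lambda>n. partition_entropy \<mu> (dynamical_join \<mu> T P n) / real n) \<longlonglongrightarrow> l"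
  proof (rule Lim_transform_eventually[OF l(1)])
    show "\<forall>\<^sub>F n in sequentially. fent \<mu> (names T (cell P) n) / real n
        = partition_entropy \<mu> (dynamical_join \<mu> T P n) / real n"
      using eventually_ge_at_top[of 1]
      by eventually_elim (simp add: partition_entropy_join[OF part measurable_space[OF T]])
  qed
  then have eq: "entropy_wrt_partition \<mu> T P = l"
    unfolding entropy_wrt_partition_def by (rule limI)
  show "(\<lambda>n. fent \<mu> (names T (cell P) n) / real n) \<longlonglongrightarrow> entropy_wrt_partition \<mu> T P"
    using l(1) eq by simp
  show "real n * entropy_wrt_partition \<mu> T P \<le> fent \<mu> (names T (cell P) n)" if "n \<ge> 1"
    using l(2)[OF that] that eq by (simp add: field_simps)
qed

text \<open>The constant \<open>d\<close> leaves room for the incomplete blocks at both ends of a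
  name.\<close>

lemma ks_entropy_ge:
  assumes inv: "invariant_prob T \<mu>" and P: "finite_partition \<mu> P"
    and low: "\<And>n. real n * c - d \<le> fent \<mu> (names T (cell P) n)"
  shows "ereal c \<le> ks_entropy T \<mu>"
proof -
  have "c \<le> entropy_wrt_partition \<mu> T P"
  proof (rule LIMSEQ_le[OF _ entropy_wrt_partition_props(1)[OF inv P]])
    have "(\<lambda>n. c - d * (1 / real n)) \<longlonglongrightarrow> c - d * 0"
      by (intro tendsto_intros lim_1_over_n)
    then show "(\<lambda>n. c - d / real n) \<longlonglongrightarrow> c" by simp
    have "c - d / real n \<le> fent \<mu> (names T (cell P) n) / real n" if "n \<ge> 1" for n
    proof -
      have "c - d / real n = (real n * c - d) / real n" using that by (simp add: field_simps)
      then show ?thesis using divide_right_mono[OF low[of n], of "real n"] by simp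
    qed
    then show "\<exists>N. \<forall>n\<ge>N. c - d / real n \<le> fent \<mu> (names T (cell P) n) / real n" by blast
  qed
  then have "ereal c \<le> ereal (entropy_wrt_partition \<mu> T P)" by simp
  also have "\<dots> \<le> ks_entropy T \<mu>"
    unfolding ks_entropy_def using P by (intro SUP_upper) auto
  finally show ?thesis .
qed

section \<open>Cylinder intervals and bounded distortion\<close>

locale emr_coding =
  fixes T :: "real \<Rightarrow> real" and I :: "nat \<Rightarrow> real set" and \<pi> :: "(nat \<Rightarrow> nat) \<Rightarrow> real"
  assumes emr: "emr_map T I"
    and acc: "{x. x islimpt endpoints I} = {0}"
    and cod: "full_shift_coding T I \<pi>"
begin

section \<open>Position of the intervals and the rightmost endpoint\<close>

definition lo :: "nat \<Rightarrow> real" where "lo i = Inf (I i)"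
definition hi :: "nat \<Rightarrow> real" where "hi i = Sup (I i)"
abbreviation J :: "nat \<Rightarrow> real set" where "J i \<equiv> {lo i<..<hi i}"
abbreviation \<Lambda> :: "real set" where "\<Lambda> \<equiv> repeller T I"

lemma I_props: "I i = {lo i..hi i}" "lo i < hi i" "0 \<le> lo i" "hi i \<le> 1"
proof -
  have "\<forall>i. \<exists>a b. a < b \<and> I i = {a..b} \<and> {a..b} \<subseteq> {0..1}"
    using emr by (simp add: emr_map_def)
  then obtain a b where ab: "a < b" "I i = {a..b}" "{a..b} \<subseteq> {0..1}" by metis
  have "lo i = a" "hi i = b" using ab by (simp_all add: lo_def hi_def)
  with ab show "I i = {lo i..hi i}" "lo i < hi i" "0 \<le> lo i" "hi i \<le> 1" by auto
qed

lemma interior_I: "interior (I i) = J i"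
  using I_props(1)[of i] by (metis interior_atLeastAtMost_real)

lemma endpoints_eq: "endpoints I = (\<Union>i. {lo i, hi i})"
proof -
  have "frontier (I i) = {lo i, hi i}" for i
  proof -
    have "closure (I i) = {lo i..hi i}" using I_props(1)[of i] by (metis closure_closed closed_atLeastAtMost)
    then show ?thesis using I_props(2)[of i] by (auto simp: frontier_def interior_I)
  qed
  then show ?thesis by (simp add: endpoints_def)
qed

lemma mem_I: "x \<in> I i \<longleftrightarrow> lo i \<le> x \<and> x \<le> hi i"
  using I_props(1)[of i] by auto

lemma order_I:
  assumes "i \<noteq> j"
  shows "hi i \<le> lo j \<or> hi j \<le> lo i"
proof (rule ccontr)
  assume "\<not> ?thesis"
  then have "(max (lo i) (lo j) + min (hi i) (hi j)) / 2 \<in> J i \<inter> J j"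
    using I_props(2)[of i] I_props(2)[of j] by auto
  moreover have "J i \<inter> J j = {}"
    using emr assms unfolding emr_map_def by (metis interior_I)
  ultimately show False by blast
qed

lemma J_disjoint: "x \<in> J i \<Longrightarrow> x \<in> J j \<Longrightarrow> i = j"
  using order_I[of i j] by force

lemma endpoint_notin_J: "x \<in> endpoints I \<Longrightarrow> x \<notin> J i"
proof -
  have "lo j \<notin> J i" "hi j \<notin> J i" for j
    using order_I[of i j] I_props(2)[of i] I_props(2)[of j] by (cases "i = j"; auto)+
  then show "x \<in> endpoints I \<Longrightarrow> x \<notin> J i" by (auto simp: endpoints_eq)
qed

lemma endpoints_limit0: "e > 0 \<Longrightarrow> \<exists>y\<in>endpoints I. y \<noteq> 0 \<and> \<bar>y\<bar> < e"
proof -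
  have "0 islimpt endpoints I" using acc by auto
  then show "e > 0 \<Longrightarrow> ?thesis" by (auto simp: islimpt_approachable dist_real_def)
qed

lemma endpoints_ge0: "y \<in> endpoints I \<Longrightarrow> 0 \<le> y"
  using I_props(2,3) by (force simp: endpoints_eq intro: order.trans less_imp_le)

text \<open>An interval starting at 0 would contain in its interior some of the endpoints that
  accumulate at 0.\<close>

lemma lo_pos: "0 < lo i"
proof (rule ccontr)
  assume "\<not> 0 < lo i"
  then have z: "lo i = 0" using I_props(3)[of i] by simp
  obtain y where y: "y \<in> endpoints I" "y \<noteq> 0" "\<bar>y\<bar> < hi i"
    using endpoints_limit0[of "hi i"] I_props(2)[of i] z by auto
  then have "y \<in> J i" using endpoints_ge0[of y] z by auto
  then show False using endpoint_notin_J y(1) by blast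
qed

text \<open>Take two endpoints \<open>0 < z < y < e\<close>. The interval ending or starting at
  \<open>z\<close> cannot contain \<open>y\<close> in its interior, so it stays below
  \<open>y\<close>.\<close>

lemma hi_small: "e > 0 \<Longrightarrow> \<exists>i. hi i < e"
proof -
  assume "e > 0"
  then obtain y where y: "y \<in> endpoints I" "y \<noteq> 0" "\<bar>y\<bar> < e" using endpoints_limit0 by blast
  have "y > 0" using y endpoints_ge0[of y] by simp
  then obtain z where z: "z \<in> endpoints I" "z \<noteq> 0" "\<bar>z\<bar> < y" using endpoints_limit0 by blast
  then obtain i where i: "z = lo i \<or> z = hi i" by (auto simp: endpoints_eq)
  have "hi i \<le> y"
  proof (rule ccontr)
    assume "\<not> hi i \<le> y"
    moreover have "lo i < y" using i z I_props(2)[of i] calculation by auto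
    ultimately show False using endpoint_notin_J[OF y(1), of i] by auto
  qed
  then have "hi i < e" using y(3) \<open>y > 0\<close> by auto
  then show ?thesis by blast
qed

lemma hi_inj: "hi i = hi j \<Longrightarrow> i = j"
  using order_I[of i j] I_props(2)[of i] I_props(2)[of j] by force

text \<open>Right ends are pairwise distinct, so infinitely many of them in \<open>{c..1}\<close>
  would create an accumulation point of endpoints other than 0.\<close>

lemma finite_hi_ge: "c > 0 \<Longrightarrow> finite {i. c \<le> hi i}"
proof (rule ccontr)
  assume c: "c > 0" and inf: "infinite {i. c \<le> hi i}"
  have "inj_on hi {i. c \<le> hi i}" using hi_inj by (auto intro: inj_onI)
  then have "infinite (hi ` {i. c \<le> hi i})" using inf by (simp add: finite_image_iff)
  moreover have "hi ` {i. c \<le> hi i} \<subseteq> {c..1}" using I_props(4) by auto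
  ultimately obtain x where x: "x \<in> {c..1}" "x islimpt hi ` {i. c \<le> hi i}"
    using Heine_Borel_imp_Bolzano_Weierstrass[OF compact_Icc[of c 1]] by blast
  then have "x islimpt endpoints I" by (rule_tac islimpt_subset) (auto simp: endpoints_eq)
  then have "x = 0" using acc by auto
  then show False using x c by auto
qed

lemma ex_max_hi: "\<exists>m. \<forall>i. hi i \<le> hi m"
proof -
  let ?A = "{i. hi 0 \<le> hi i}"
  have f: "finite ?A" using finite_hi_ge[of "hi 0"] lo_pos[of 0] I_props(2)[of 0] by simp
  then have "Max (hi ` ?A) \<in> hi ` ?A" by (intro Max_in) auto
  then obtain m where m: "hi m = Max (hi ` ?A)" "hi 0 \<le> hi m" by auto
  have "hi i \<le> hi m" for i
  proof (cases "hi 0 \<le> hi i")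
    case True then show ?thesis unfolding m(1) using f by (intro Max_ge) auto
  qed (use m(2) in auto)
  then show ?thesis by blast
qed

text \<open>The index of the rightmost interval. Its right end \<open>M\<close> takes the role of 1:
  every branch covers \<open>{0<..<M}\<close>, and every endpoint that has a code turns out to be
  mapped to \<open>M\<close>.\<close>

definition mx :: nat where "mx = (SOME m. \<forall>i. hi i \<le> hi m)"
definition M :: real where "M = hi mx"

lemma hi_le_M: "hi i \<le> M"
  unfolding M_def mx_def using someI_ex[OF ex_max_hi] by blast

lemma M_bounds: "0 < M" "M \<le> 1"
  using lo_pos[of mx] I_props(2)[of mx] I_props(4)[of mx] by (auto simp: M_def)

lemma J_sub: "J i \<subseteq> {0<..<M}"
  using lo_pos[of i] hi_le_M[of i] by auto

lemma cod_cont: "continuous_on UNIV \<pi>"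
  and cod_range: "range \<pi> = \<Lambda>"
  and cod_shift: "\<pi> (shift \<omega>) = T (\<pi> \<omega>)"
  and cod_mem: "(T ^^ n) (\<pi> \<omega>) \<in> I (\<omega> n)"
  using cod unfolding full_shift_coding_def by (auto simp: fun_eq_iff)

definition shiftn :: "nat \<Rightarrow> (nat \<Rightarrow> nat) \<Rightarrow> nat \<Rightarrow> nat" where
  "shiftn n \<omega> = (\<lambda>k. \<omega> (n + k))"

lemma T_pow_\<pi>: "(T ^^ n) (\<pi> \<omega>) = \<pi> (shiftn n \<omega>)"
proof (induction n)
  case 0
  then show ?case by (simp add: shiftn_def)
next
  case (Suc n)
  have "shift (shiftn n \<omega>) = shiftn (Suc n) \<omega>" by (simp add: shift_def shiftn_def)
  then show ?case using Suc cod_shift[of "shiftn n \<omega>"] by simp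
qed

lemma \<Lambda>_T: "x \<in> \<Lambda> \<Longrightarrow> (T ^^ n) x \<in> \<Lambda>"
  using cod_range T_pow_\<pi> by (metis imageE rangeI)

lemma \<Lambda>_pos: "x \<in> \<Lambda> \<Longrightarrow> 0 < x \<and> x \<le> M"
proof -
  assume "x \<in> \<Lambda>"
  then obtain \<omega> where "x = \<pi> \<omega>" using cod_range by blast
  then have "x \<in> I (\<omega> 0)" using cod_mem[of 0 \<omega>] by simp
  then show ?thesis using lo_pos[of "\<omega> 0"] hi_le_M[of "\<omega> 0"] by (auto simp: mem_I)
qed

subsection \<open>The branches\<close>

lemma T_deriv: "x \<in> J i \<Longrightarrow> (T has_real_derivative deriv T x) (at x)"
  and T_deriv2: "x \<in> J i \<Longrightarrow> (deriv T has_real_derivative deriv (deriv T) x) (at x)"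
proof -
  have "C2_on T (\<Union>i. J i)" using emr by (simp add: emr_map_def interior_I)
  then show "x \<in> J i \<Longrightarrow> (T has_real_derivative deriv T x) (at x)"
    "x \<in> J i \<Longrightarrow> (deriv T has_real_derivative deriv (deriv T) x) (at x)"
    unfolding C2_on_def by (auto simp: DERIV_deriv_iff_real_differentiable)
qed

lemma ex_renyi: "\<exists>K>0. \<forall>i. \<forall>x\<in>J i. \<forall>y\<in>J i. \<forall>z\<in>J i.
    deriv T y \<noteq> 0 \<and> \<bar>deriv (deriv T) x\<bar> / (\<bar>deriv T y\<bar> * \<bar>deriv T z\<bar>) \<le> K"
  using emr by (simp add: emr_map_def interior_I)

definition K where "K = (SOME K. K > 0 \<and> (\<forall>i. \<forall>x\<in>J i. \<forall>y\<in>J i. \<forall>z\<in>J i.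
    deriv T y \<noteq> 0 \<and> \<bar>deriv (deriv T) x\<bar> / (\<bar>deriv T y\<bar> * \<bar>deriv T z\<bar>) \<le> K))"

lemma K_props: "K > 0" "x \<in> J i \<Longrightarrow> y \<in> J i \<Longrightarrow> z \<in> J i \<Longrightarrow>
    \<bar>deriv (deriv T) x\<bar> / (\<bar>deriv T y\<bar> * \<bar>deriv T z\<bar>) \<le> K"
  using someI_ex[OF ex_renyi[unfolded Bex_def]] unfolding K_def by blast+

lemma deriv_nz: "x \<in> J i \<Longrightarrow> deriv T x \<noteq> 0"
  using ex_renyi by blast

definition sg :: "nat \<Rightarrow> real" where "sg i = sgn (deriv T ((lo i + hi i) / 2))"

text \<open>On \<open>J i\<close> the derivative is continuous and never 0, so its sign is constant
  by connectedness. Multiplying by \<open>sg i\<close> treats increasing and decreasing branches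
  alike.\<close>

lemma sg_pos: "x \<in> J i \<Longrightarrow> 0 < sg i * deriv T x"
proof -
  assume x: "x \<in> J i"
  let ?y = "(lo i + hi i) / 2"
  have y: "?y \<in> J i" using I_props(2)[of i] by auto
  have "continuous_on (J i) (deriv T)"
    using T_deriv2 by (intro continuous_at_imp_continuous_on ballI) (blast intro: DERIV_isCont)
  then have conn: "connected (deriv T ` J i)" by (intro connected_continuous_image) auto
  have nz: "0 \<notin> deriv T ` J i" using deriv_nz by (metis imageE)
  have "sgn (deriv T x) = sgn (deriv T ?y)"
  proof (rule ccontr)
    assume "\<not> ?thesis"
    then have "(deriv T x < 0 \<and> 0 < deriv T ?y) \<or> (deriv T ?y < 0 \<and> 0 < deriv T x)"
      using deriv_nz[OF x] deriv_nz[OF y] by (auto simp: sgn_if split: if_splits)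
    then have "0 \<in> deriv T ` J i"
      using connectedD_interval[OF conn, of _ _ 0] x y by (meson imageI less_imp_le)
    then show False using nz by blast
  qed
  then show ?thesis using deriv_nz[OF x] by (simp add: sg_def sgn_mult_abs flip: abs_sgn) (simp add: sgn_if split: if_splits)
qed

lemma sg_cases: "sg i = 1 \<or> sg i = -1"
proof -
  have "(lo i + hi i) / 2 \<in> J i" using I_props(2)[of i] by auto
  then show ?thesis using deriv_nz unfolding sg_def by (metis sgn_if)
qed

lemma T_mono: "x \<in> J i \<Longrightarrow> y \<in> J i \<Longrightarrow> x < y \<Longrightarrow> sg i * T x < sg i * T y"
proof -
  assume xy: "x \<in> J i" "y \<in> J i" "x < y"
  show "sg i * T x < sg i * T y"
  proof (rule DERIV_pos_imp_increasing[OF xy(3)])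
    fix z assume "x \<le> z" "z \<le> y"
    then have z: "z \<in> J i" using xy by auto
    show "\<exists>d. ((\<lambda>x. sg i * T x) has_real_derivative d) (at z) \<and> d > 0"
      using DERIV_cmult[OF T_deriv[OF z], of "sg i"] sg_pos[OF z] by blast
  qed
qed

lemma T_inj: "inj_on T (J i)"
proof (rule inj_onI, rule ccontr)
  fix x y assume "x \<in> J i" "y \<in> J i" "T x = T y" "x \<noteq> y"
  then show False using T_mono[of x i y] T_mono[of y i x] by (cases "x < y") auto
qed

lemma T_cont: "continuous_on (J i) T"
  using T_deriv by (intro continuous_at_imp_continuous_on ballI) (blast intro: DERIV_isCont)

lemma countable_endpoints: "countable (endpoints I)"
  by (simp add: endpoints_eq)

text \<open>Induction on the time at which an endpoint is reached: \<open>T\<close> is injective on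
  each of the countably many \<open>J i\<close>, so preimages of countable sets stay
  countable.\<close>

lemma countable_bad: "countable (\<Lambda> \<inter> endpoint_preimages T I)"
proof -
  have "countable {x \<in> \<Lambda>. (T ^^ n) x \<in> endpoints I}" for n
  proof (induction n)
    case 0
    show ?case by (rule countable_subset[OF _ countable_endpoints]) auto
  next
    case (Suc n)
    let ?S = "{x \<in> \<Lambda>. (T ^^ n) x \<in> endpoints I}"
    have "countable {x \<in> J i. T x \<in> ?S}" for i
    proof -
      have "countable (T ` {x \<in> J i. T x \<in> ?S})" by (rule countable_subset[OF _ Suc]) auto
      moreover have "inj_on T {x \<in> J i. T x \<in> ?S}" using T_inj by (rule inj_on_subset) auto
      ultimately show ?thesis by (rule countable_image_inj_on)
    qed
    then have "countable (endpoints I \<union> (\<Union>i. {x \<in> J i. T x \<in> ?S}))"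
      using countable_endpoints by auto
    moreover have "{x \<in> \<Lambda>. (T ^^ Suc n) x \<in> endpoints I} \<subseteq> endpoints I \<union> (\<Union>i. {x \<in> J i. T x \<in> ?S})"
    proof
      fix x assume x: "x \<in> {x \<in> \<Lambda>. (T ^^ Suc n) x \<in> endpoints I}"
      then obtain \<omega> where "x = \<pi> \<omega>" using cod_range by blast
      then have "x \<in> I (\<omega> 0)" using cod_mem[of 0 \<omega>] by simp
      then have "x \<in> endpoints I \<or> x \<in> J (\<omega> 0)" by (auto simp: mem_I endpoints_eq order.order_iff_strict)
      moreover have "T x \<in> ?S" using x \<Lambda>_T[of x 1] by (simp add: funpow_swap1)
      ultimately show "x \<in> endpoints I \<union> (\<Union>i. {x \<in> J i. T x \<in> ?S})" by blast
    qed
    ultimately show ?case by (rule countable_subset[rotated])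
  qed
  then have "countable (\<Union>n. {x \<in> \<Lambda>. (T ^^ n) x \<in> endpoints I})" by auto
  then show ?thesis by (rule countable_subset[rotated]) (auto simp: endpoint_preimages_def)
qed

text \<open>A diagonal argument: the \<open>k\<close>-th bad point leaves some interval at time \<open>n + k\<close>, and that
  interval is prescribed at this time.\<close>

lemma dense_good: "\<exists>\<omega>. (\<forall>k<n. \<omega> k = u k) \<and> \<pi> \<omega> \<notin> endpoint_preimages T I"
proof (cases "\<Lambda> \<inter> endpoint_preimages T I = {}")
  case True
  then have "\<pi> u \<notin> endpoint_preimages T I" using cod_range by auto
  then show ?thesis by blast
next
  case False
  define c where "c = from_nat_into (\<Lambda> \<inter> endpoint_preimages T I)"
  have c: "range c = \<Lambda> \<inter> endpoint_preimages T I"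
    unfolding c_def using False countable_bad by (rule range_from_nat_into)
  define \<omega> where "\<omega> k = (if k < n then u k else SOME j. (T ^^ k) (c (k - n)) \<notin> I j)" for k
  have "\<pi> \<omega> \<noteq> c k" for k
  proof
    assume eq: "\<pi> \<omega> = c k"
    have "(T ^^ (n + k)) (c k) \<in> \<Lambda>" using c by (intro \<Lambda>_T) auto
    then obtain j where "hi j < (T ^^ (n + k)) (c k)" using \<Lambda>_pos hi_small by blast
    then have "(T ^^ (n + k)) (c k) \<notin> I j" by (auto simp: mem_I)
    then have "(T ^^ (n + k)) (c k) \<notin> I (SOME j. (T ^^ (n + k)) (c k) \<notin> I j)" by (rule someI)
    moreover have "\<omega> (n + k) = (SOME j. (T ^^ (n + k)) (c k) \<notin> I j)" by (simp add: \<omega>_def)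
    ultimately show False using cod_mem[of "n + k" \<omega>] eq by simp
  qed
  then have "\<pi> \<omega> \<notin> endpoint_preimages T I" using c cod_range by (metis IntI rangeE rangeI)
  moreover have "\<forall>k<n. \<omega> k = u k" by (simp add: \<omega>_def)
  ultimately show ?thesis by blast
qed

lemma good_J: "\<pi> \<omega> \<notin> endpoint_preimages T I \<Longrightarrow> (T ^^ n) (\<pi> \<omega>) \<in> J (\<omega> n)"
proof -
  assume "\<pi> \<omega> \<notin> endpoint_preimages T I"
  then have "(T ^^ n) (\<pi> \<omega>) \<notin> endpoints I" by (auto simp: endpoint_preimages_def)
  then have "(T ^^ n) (\<pi> \<omega>) \<noteq> lo (\<omega> n)" "(T ^^ n) (\<pi> \<omega>) \<noteq> hi (\<omega> n)" by (auto simp: endpoints_eq)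
  then show ?thesis using cod_mem[of n \<omega>] by (simp add: mem_I order.order_iff_strict)
qed

text \<open>A good code starting with \<open>i\<close>, \<open>j\<close> supplies a point of
  \<open>J i\<close> with image in \<open>J j\<close>; the Markov property does the rest.\<close>

lemma J_image: "J j \<subseteq> T ` J i"
proof -
  obtain \<omega> where \<omega>: "\<forall>k<2. \<omega> k = (if k = 0 then i else j)" "\<pi> \<omega> \<notin> endpoint_preimages T I"
    using dense_good[of 2 "\<lambda>k. if k = 0 then i else j"] by blast
  have "\<pi> \<omega> \<in> J i" "T (\<pi> \<omega>) \<in> J j"
    using good_J[OF \<omega>(2), of 0] good_J[OF \<omega>(2), of 1] \<omega>(1) by auto
  then have "T ` J i \<inter> J j \<noteq> {}" by blast
  then show ?thesis using emr unfolding emr_map_def markov_map_def interior_I by blast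
qed

text \<open>The image of \<open>J i\<close> is connected, contains intervals arbitrarily close to 0
  and contains the rightmost interval, which reaches up to \<open>M\<close>.\<close>

lemma T_onto: "{0<..<M} \<subseteq> T ` J i"
proof
  fix y assume y: "y \<in> {0<..<M}"
  then obtain j where j: "hi j < y" using hi_small by auto
  have "max y (lo mx) < M" using y I_props(2)[of mx] by (auto simp: M_def)
  then obtain z where "max y (lo mx) < z" "z < M" using dense by blast
  then have z: "z \<in> J mx" "y < z" by (auto simp: M_def)
  have x: "(lo j + hi j) / 2 \<in> J j" using I_props(2)[of j] by auto
  have "connected (T ` J i)" using T_cont by (intro connected_continuous_image) auto
  then show "y \<in> T ` J i"
  proof (rule connectedD_interval[of _ "(lo j + hi j) / 2" z])
    show "(lo j + hi j) / 2 \<in> T ` J i" using J_image[of j i] x by blast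
    show "z \<in> T ` J i" using J_image[of mx i] z(1) by blast
  qed (use x z j in auto)
qed

subsection \<open>Cylinders\<close>

text \<open>Cylinders are built from open intervals, so that all derivatives along them exist.
  Taking \<open>{0<..<M}\<close> for the empty word makes every cylinder of a word of length
  \<open>n\<close> be mapped onto the same set by \<open>T ^^ n\<close>.\<close>

fun U :: "nat list \<Rightarrow> real set" where
  "U [] = {0<..<M}"
| "U (i # w) = J i \<inter> T -` U w"

lemma U_sub: "U w \<subseteq> {0<..<M}"
  using J_sub by (cases w) auto

lemma mem_U_iff: "x \<in> U w \<longleftrightarrow> (\<forall>k<length w. (T ^^ k) x \<in> J (w ! k)) \<and> (T ^^ length w) x \<in> {0<..<M}"
proof (induction w arbitrary: x)
  case (Cons i w)
  have "x \<in> U (i # w) \<longleftrightarrow> x \<in> J i \<and> (\<forall>k<length w. (T ^^ k) (T x) \<in> J (w ! k)) \<and> (T ^^ length w) (T x) \<in> {0<..<M}"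
    using Cons[of "T x"] by simp
  also have "\<dots> \<longleftrightarrow> (\<forall>k<length (i # w). (T ^^ k) x \<in> J ((i # w) ! k)) \<and> (T ^^ length (i # w)) x \<in> {0<..<M}"
    by (simp add: All_less_Suc2 funpow_swap1)
  finally show ?case .
qed simp

lemma U_append: "U (v @ w) = U v \<inter> (T ^^ length v) -` U w"
proof (induction v)
  case (Cons i v)
  then show ?case by (auto simp: funpow_swap1)
qed (use U_sub in auto)

lemma U_image1: "T ` U (i # w) = U w"
  using T_onto[of i] U_sub[of w] by auto

lemma U_image: "(T ^^ length w) ` U w = {0<..<M}"
proof (induction w)
  case (Cons i w)
  have "(T ^^ length (i # w)) ` U (i # w) = (T ^^ length w) ` (T ` U (i # w))"
    by (simp add: image_image funpow_swap1 del: U.simps)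
  then show ?case using Cons U_image1 by simp
qed simp

lemma U_nonempty: "U w \<noteq> {}"
  using U_image[of w] M_bounds by (metis image_is_empty greaterThanLessThan_empty_iff not_le)

text \<open>Each branch is monotone up to the sign \<open>sg i\<close>, so betweenness passes
  through \<open>T\<close>, possibly with the two ends exchanged.\<close>

lemma U_between: "x \<in> U w \<Longrightarrow> z \<in> U w \<Longrightarrow> x \<le> y \<Longrightarrow> y \<le> z \<Longrightarrow> y \<in> U w"
proof (induction w arbitrary: x y z)
  case (Cons i w)
  show ?case
  proof (cases "y = x \<or> y = z")
    case False
    then have lt: "x < y" "y < z" using Cons.prems by auto
    have y: "y \<in> J i" using Cons.prems by auto
    have m: "sg i * T x < sg i * T y" "sg i * T y < sg i * T z"
      using Cons.prems lt y by (auto intro!: T_mono)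
    have "T x \<in> U w" "T z \<in> U w" using Cons.prems by auto
    then have "T y \<in> U w"
      using Cons.IH[of "T x" "T z" "T y"] Cons.IH[of "T z" "T x" "T y"] m sg_cases[of i] by auto
    then show ?thesis using y by simp
  qed (use Cons.prems in auto)
qed auto

lemma U_mem_J: "x \<in> U w \<Longrightarrow> k < length w \<Longrightarrow> (T ^^ k) x \<in> J (w ! k)"
  by (simp add: mem_U_iff)

lemma U_drop: "x \<in> U w \<Longrightarrow> k \<le> length w \<Longrightarrow> (T ^^ k) x \<in> U (drop k w)"
  using U_append[of "take k w" "drop k w"] by auto

lemma U_disjoint:
  assumes "length v = length w" "x \<in> U v" "x \<in> U w"
  shows "v = w"
proof (rule nth_equalityI[OF assms(1)])
  fix k assume "k < length v"
  then show "v ! k = w ! k" using U_mem_J[OF assms(2), of k] U_mem_J[OF assms(3), of k] assms(1) J_disjoint by auto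
qed

definition pre :: "(nat \<Rightarrow> nat) \<Rightarrow> nat \<Rightarrow> nat list" where "pre \<omega> n = map \<omega> [0..<n]"

lemma length_pre [simp]: "length (pre \<omega> n) = n" by (simp add: pre_def)
lemma nth_pre [simp]: "k < n \<Longrightarrow> pre \<omega> n ! k = \<omega> k" by (simp add: pre_def)

lemma pre_eq_iff: "pre \<omega> n = pre \<omega>' n \<longleftrightarrow> (\<forall>k<n. \<omega> k = \<omega>' k)"
  by (auto simp: list_eq_iff_nth_eq)

lemma good_U: "\<pi> \<omega> \<notin> endpoint_preimages T I \<Longrightarrow> \<pi> \<omega> \<in> U (pre \<omega> n)"
  using good_J J_sub unfolding mem_U_iff by fastforce

text \<open>Good codes are dense and \<open>\<pi>\<close> is continuous. In this way estimates on
  open cylinders reach all coded points, also those whose orbit meets an endpoint.\<close>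

lemma good_seq: "\<exists>\<rho>. (\<forall>k. pre (\<rho> k) k = pre \<omega> k \<and> \<pi> (\<rho> k) \<notin> endpoint_preimages T I) \<and>
    (\<forall>m. (\<lambda>k. (T ^^ m) (\<pi> (\<rho> k))) \<longlonglongrightarrow> (T ^^ m) (\<pi> \<omega>))"
proof -
  have "\<forall>k. \<exists>\<rho>. pre \<rho> k = pre \<omega> k \<and> \<pi> \<rho> \<notin> endpoint_preimages T I"
    using dense_good[of _ \<omega>] by (simp add: pre_eq_iff)
  then obtain \<rho> where \<rho>: "\<And>k. pre (\<rho> k) k = pre \<omega> k \<and> \<pi> (\<rho> k) \<notin> endpoint_preimages T I" by metis
  have "(\<lambda>k. shiftn m (\<rho> k)) \<longlonglongrightarrow> shiftn m \<omega>" for m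
  proof -
    have "limitin (product_topology (\<lambda>i. euclidean) UNIV) (\<lambda>k. shiftn m (\<rho> k)) (shiftn m \<omega>) sequentially
        \<longleftrightarrow> (\<forall>i. limitin euclidean (\<lambda>k. \<rho> k (m + i)) (\<omega> (m + i)) sequentially)"
      by (simp add: limitin_componentwise shiftn_def)
    moreover have "(\<lambda>k. \<rho> k i) \<longlonglongrightarrow> \<omega> i" for i
    proof -
      have "\<forall>\<^sub>F k in sequentially. \<rho> k i = \<omega> i"
        using eventually_gt_at_top[of i] by eventually_elim (metis \<rho> pre_eq_iff)
      then show "(\<lambda>k. \<rho> k i) \<longlonglongrightarrow> \<omega> i" by (rule tendsto_eventually)
    qed
    ultimately show ?thesis by (simp add: euclidean_product_topology limitin_canonical_iff)
  qed
  then have "(\<lambda>k. \<pi> (shiftn m (\<rho> k))) \<longlonglongrightarrow> \<pi> (shiftn m \<omega>)" for m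
    by (intro continuous_on_tendsto_compose[OF cod_cont]) auto
  then have "\<forall>m. (\<lambda>k. (T ^^ m) (\<pi> (\<rho> k))) \<longlonglongrightarrow> (T ^^ m) (\<pi> \<omega>)" by (simp add: T_pow_\<pi>)
  with \<rho> show ?thesis by blast
qed

lemma \<pi>_closure: "\<pi> \<omega> \<in> closure (U (pre \<omega> n))"
proof -
  obtain \<rho> where \<rho>: "\<And>k. pre (\<rho> k) k = pre \<omega> k" "\<And>k. \<pi> (\<rho> k) \<notin> endpoint_preimages T I"
    "\<forall>m. (\<lambda>k. (T ^^ m) (\<pi> (\<rho> k))) \<longlonglongrightarrow> (T ^^ m) (\<pi> \<omega>)" using good_seq[of \<omega>] by blast
  have "\<pi> (\<rho> (n + k)) \<in> U (pre \<omega> n)" for k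
  proof -
    have "pre (\<rho> (n + k)) n = pre \<omega> n" using \<rho>(1)[of "n + k"] by (simp add: pre_eq_iff)
    then show ?thesis using good_U[OF \<rho>(2), of "n + k" n] by simp
  qed
  moreover have "(\<lambda>k. \<pi> (\<rho> (n + k))) \<longlonglongrightarrow> \<pi> \<omega>"
    using LIMSEQ_ignore_initial_segment[OF spec[OF \<rho>(3), of 0], of n] by (simp add: add.commute)
  ultimately show ?thesis unfolding closure_sequential by (intro exI[of _ "\<lambda>k. \<pi> (\<rho> (n + k))"]) auto
qed

section \<open>Lengths of cylinders\<close>

definition r :: "nat list \<Rightarrow> real" where "r w = Sup (U w) - Inf (U w)"

lemma U_bdd: "bdd_above (U w)" "bdd_below (U w)"
  using U_sub[of w] by (auto intro!: bdd_aboveI[of _ M] bdd_belowI[of _ 0])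

lemma r_ge: "x \<in> closure (U w) \<Longrightarrow> y \<in> closure (U w) \<Longrightarrow> \<bar>x - y\<bar> \<le> r w"
proof -
  have "U w \<subseteq> {Inf (U w)..Sup (U w)}" using U_bdd[of w] by (auto intro: cInf_lower cSup_upper)
  then have "closure (U w) \<subseteq> {Inf (U w)..Sup (U w)}" by (rule closure_minimal) simp
  then have "z \<in> closure (U w) \<Longrightarrow> Inf (U w) \<le> z \<and> z \<le> Sup (U w)" for z by auto
  from this[of x] this[of y]
  show "x \<in> closure (U w) \<Longrightarrow> y \<in> closure (U w) \<Longrightarrow> \<bar>x - y\<bar> \<le> r w" by (simp add: r_def abs_le_iff)
qed

lemma r_ge': "x \<in> U w \<Longrightarrow> y \<in> U w \<Longrightarrow> \<bar>x - y\<bar> \<le> r w"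
  by (meson r_ge closure_subset subsetD)

lemma r_le: "(\<And>x y. x \<in> U w \<Longrightarrow> y \<in> U w \<Longrightarrow> \<bar>x - y\<bar> \<le> c) \<Longrightarrow> r w \<le> c"
proof -
  assume *: "\<And>x y. x \<in> U w \<Longrightarrow> y \<in> U w \<Longrightarrow> \<bar>x - y\<bar> \<le> c"
  have "Sup (U w) \<le> c + Inf (U w)"
  proof (rule cSup_least[OF U_nonempty])
    fix x assume x: "x \<in> U w"
    have "x - c \<le> Inf (U w)" using *[OF x] by (intro cInf_greatest[OF U_nonempty]) (force simp: abs_le_iff)
    then show "x \<le> c + Inf (U w)" by simp
  qed
  then show ?thesis by (simp add: r_def)
qed

text \<open>The image of the cylinder is the whole open interval, so it contains \<open>e\<close>
  and \<open>M - e\<close> for every small \<open>e > 0\<close>; their distance exceeds any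
  \<open>c < M\<close> once \<open>e\<close> is small enough.\<close>

lemma M_le: "(\<And>x y. x \<in> U w \<Longrightarrow> y \<in> U w \<Longrightarrow> \<bar>(T ^^ length w) x - (T ^^ length w) y\<bar> \<le> c) \<Longrightarrow> M \<le> c"
proof (rule ccontr)
  assume *: "\<And>x y. x \<in> U w \<Longrightarrow> y \<in> U w \<Longrightarrow> \<bar>(T ^^ length w) x - (T ^^ length w) y\<bar> \<le> c" and "\<not> M \<le> c"
  define e where "e = min ((M - c) / 4) (M / 4)"
  have e: "0 < e" "2 * e < M - c" "e < M / 2" using \<open>\<not> M \<le> c\<close> M_bounds by (auto simp: e_def min_def)
  then have "e \<in> {0<..<M}" "M - e \<in> {0<..<M}" using M_bounds by auto
  then obtain x y where "x \<in> U w" "y \<in> U w" "(T ^^ length w) x = e" "(T ^^ length w) y = M - e"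
    using U_image[of w] by (metis imageE)
  then show False using *[of x y] e by auto
qed

section \<open>Logarithmic derivatives along orbits and bounded distortion\<close>

definition lnT :: "real \<Rightarrow> real" where "lnT x = ln \<bar>deriv T x\<bar>"
definition LS :: "nat \<Rightarrow> real \<Rightarrow> real" where "LS n x = (\<Sum>k<n. lnT ((T ^^ k) x))"

lemma LS_Suc: "LS (Suc n) x = LS n x + lnT ((T ^^ n) x)"
  by (simp add: LS_def)

lemma LS_add: "LS (m + n) x = LS m x + LS n ((T ^^ m) x)"
proof (induction n)
  case (Suc n)
  have "(T ^^ (m + n)) x = (T ^^ n) ((T ^^ m) x)" by (simp add: funpow_add add.commute[of m])
  then show ?case using Suc LS_Suc[of "m + n" x] LS_Suc[of n "(T ^^ m) x"] by simp
qed (simp add: LS_def)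

lemma T_pow_deriv:
  "(\<And>k. k < n \<Longrightarrow> (T ^^ k) x \<in> (\<Union>i. J i)) \<Longrightarrow>
    ((T ^^ n) has_real_derivative (\<Prod>k<n. deriv T ((T ^^ k) x))) (at x)"
proof (induction n)
  case (Suc n)
  obtain i where i: "(T ^^ n) x \<in> J i" using Suc.prems[of n] by auto
  have "((\<lambda>y. T ((T ^^ n) y)) has_real_derivative deriv T ((T ^^ n) x) * (\<Prod>k<n. deriv T ((T ^^ k) x))) (at x)"
    using Suc by (intro DERIV_chain2[where f=T and g="T ^^ n", OF T_deriv[OF i]]) auto
  then show ?case by (simp add: comp_def mult.commute)
qed (simp add: id_def)

lemma exp_LS:
  assumes "\<And>k. k < n \<Longrightarrow> (T ^^ k) x \<in> (\<Union>i. J i)"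
  shows "exp (LS n x) = \<bar>\<Prod>k<n. deriv T ((T ^^ k) x)\<bar>"
proof -
  have "exp (lnT ((T ^^ k) x)) = \<bar>deriv T ((T ^^ k) x)\<bar>" if "k < n" for k
    using assms[OF that] deriv_nz by (auto simp: lnT_def)
  then show ?thesis by (simp add: LS_def exp_sum abs_prod)
qed

lemma ex_expansion: "\<exists>\<xi>>1. \<exists>N. \<forall>n\<ge>N. \<forall>x. (\<forall>k<n. (T ^^ k) x \<in> (\<Union>i. J i)) \<longrightarrow> \<bar>deriv (T ^^ n) x\<bar> > \<xi> ^ n"
  using emr by (simp add: emr_map_def interior_I)

definition \<xi> where "\<xi> = (SOME \<xi>. \<xi> > 1 \<and> (\<exists>N. \<forall>n\<ge>N. \<forall>x. (\<forall>k<n. (T ^^ k) x \<in> (\<Union>i. J i)) \<longrightarrow> \<bar>deriv (T ^^ n) x\<bar> > \<xi> ^ n))"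

lemma \<xi>_props: "\<xi> > 1 \<and> (\<exists>N. \<forall>n\<ge>N. \<forall>x. (\<forall>k<n. (T ^^ k) x \<in> (\<Union>i. J i)) \<longrightarrow> \<bar>deriv (T ^^ n) x\<bar> > \<xi> ^ n)"
  unfolding \<xi>_def by (rule someI_ex[OF ex_expansion[unfolded Bex_def]])

lemma \<xi>_gt1: "\<xi> > 1" using \<xi>_props by blast

definition NE where "NE = (SOME N. \<forall>n\<ge>N. \<forall>x. (\<forall>k<n. (T ^^ k) x \<in> (\<Union>i. J i)) \<longrightarrow> \<bar>deriv (T ^^ n) x\<bar> > \<xi> ^ n)"

lemma LS_expansion:
  assumes n: "n \<ge> NE" and x: "\<And>k. k < n \<Longrightarrow> (T ^^ k) x \<in> (\<Union>i. J i)"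
  shows "\<xi> ^ n < exp (LS n x)"
proof -
  have "\<exists>N. \<forall>n\<ge>N. \<forall>x. (\<forall>k<n. (T ^^ k) x \<in> (\<Union>i. J i)) \<longrightarrow> \<bar>deriv (T ^^ n) x\<bar> > \<xi> ^ n"
    using \<xi>_props by blast
  then have "\<forall>n\<ge>NE. \<forall>x. (\<forall>k<n. (T ^^ k) x \<in> (\<Union>i. J i)) \<longrightarrow> \<bar>deriv (T ^^ n) x\<bar> > \<xi> ^ n"
    unfolding NE_def by (rule someI_ex)
  then have "\<bar>deriv (T ^^ n) x\<bar> > \<xi> ^ n" using n x by blast
  moreover have "deriv (T ^^ n) x = (\<Prod>k<n. deriv T ((T ^^ k) x))"
    using T_pow_deriv[OF x] by (intro DERIV_imp_deriv) auto
  moreover have "exp (LS n x) = \<bar>\<Prod>k<n. deriv T ((T ^^ k) x)\<bar>" using x by (rule exp_LS)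
  ultimately show ?thesis by simp
qed

lemma U_LS_mvt:
  assumes "x \<in> U w" "y \<in> U w"
  shows "\<exists>z\<in>U w. \<bar>(T ^^ length w) x - (T ^^ length w) y\<bar> = exp (LS (length w) z) * \<bar>x - y\<bar>"
proof -
  have *: "\<exists>z\<in>U w. \<bar>(T ^^ length w) x - (T ^^ length w) y\<bar> = exp (LS (length w) z) * \<bar>x - y\<bar>"
    if "x \<in> U w" "y \<in> U w" "x < y" for x y
  proof -
    have J: "(T ^^ k) z \<in> (\<Union>i. J i)" if "z \<in> U w" "k < length w" for z k
      using U_mem_J[OF that] by blast
    have zU: "z \<in> U w" if "x \<le> z" "z \<le> y" for z using U_between \<open>x \<in> U w\<close> \<open>y \<in> U w\<close> that by blast
    obtain z where z: "x < z" "z < y"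
      "(T ^^ length w) y - (T ^^ length w) x = (y - x) * (\<Prod>k<length w. deriv T ((T ^^ k) z))"
      using MVT2[OF \<open>x < y\<close>, of "T ^^ length w" "\<lambda>z. \<Prod>k<length w. deriv T ((T ^^ k) z)"]
        T_pow_deriv J zU by (metis (no_types, lifting))
    have "z \<in> U w" using zU z by auto
    moreover have "\<bar>(T ^^ length w) x - (T ^^ length w) y\<bar> = \<bar>y - x\<bar> * \<bar>\<Prod>k<length w. deriv T ((T ^^ k) z)\<bar>"
      using z(3) by (metis abs_minus_commute abs_mult)
    ultimately show ?thesis
      using exp_LS[OF J[OF \<open>z \<in> U w\<close>]] by (intro bexI[of _ z]) (auto simp: abs_minus_commute mult.commute)
  qed
  show ?thesis
    using *[of x y] *[of y x] assms by (cases x y rule: linorder_cases) (auto simp: abs_minus_commute)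
qed

definition C0 where "C0 = \<xi> ^ NE"

lemma C0_ge1: "C0 \<ge> 1" using \<xi>_gt1 by (simp add: C0_def)

lemma r_small: "r w \<le> C0 * (1 / \<xi>) ^ length w"
proof (rule r_le)
  fix x y assume xy: "x \<in> U w" "y \<in> U w"
  let ?n = "length w"
  have ab: "\<bar>a - b\<bar> \<le> 1" if "a \<in> {0<..<M}" "b \<in> {0<..<M}" for a b
    using that M_bounds by auto
  show "\<bar>x - y\<bar> \<le> C0 * (1 / \<xi>) ^ ?n"
  proof (cases "NE \<le> ?n")
    case True
    obtain z where z: "z \<in> U w" "\<bar>(T ^^ ?n) x - (T ^^ ?n) y\<bar> = exp (LS ?n z) * \<bar>x - y\<bar>"
      using U_LS_mvt[OF xy] by blast
    have "\<bar>(T ^^ ?n) x - (T ^^ ?n) y\<bar> \<le> 1" using U_image[of w] xy by (intro ab) auto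
    moreover have "\<xi> ^ ?n \<le> exp (LS ?n z)"
      using LS_expansion[OF True] U_mem_J[OF z(1)] by (meson UNIV_I UN_I less_imp_le)
    then have "\<xi> ^ ?n * \<bar>x - y\<bar> \<le> exp (LS ?n z) * \<bar>x - y\<bar>" by (rule mult_right_mono) simp
    ultimately have "\<xi> ^ ?n * \<bar>x - y\<bar> \<le> 1" using z by simp
    then have "\<bar>x - y\<bar> \<le> (1 / \<xi>) ^ ?n" using \<xi>_gt1 by (simp add: field_simps power_divide)
    also have "\<dots> \<le> C0 * (1 / \<xi>) ^ ?n"
      using C0_ge1 \<xi>_gt1 mult_right_mono[of 1 C0 "(1 / \<xi>) ^ ?n"] by simp
    finally show ?thesis .
  next
    case False
    have "\<bar>x - y\<bar> \<le> 1" using xy U_sub[of w] by (intro ab) auto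
    also have "1 \<le> C0 * (1 / \<xi>) ^ ?n"
      using power_increasing[of ?n NE \<xi>] False \<xi>_gt1 by (simp add: C0_def field_simps power_divide)
    finally show ?thesis .
  qed
qed

text \<open>The mean value theorem is applied once to \<open>ln \<bar>deriv T\<bar>\<close> and once
  to \<open>T\<close>. The intermediate points \<open>v\<close> and \<open>z\<close> differ, which
  is why the Renyi quotient must be bounded at independent arguments.\<close>

lemma lnT_lip:
  assumes "x \<in> J i" "y \<in> J i"
  shows "\<bar>lnT x - lnT y\<bar> \<le> K * \<bar>T x - T y\<bar>"
proof -
  have *: "\<bar>lnT x - lnT y\<bar> \<le> K * \<bar>T x - T y\<bar>" if xy: "x \<in> J i" "y \<in> J i" "x < y" for x y
  proof -
    have J: "z \<in> J i" if "x \<le> z" "z \<le> y" for z using xy that by auto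
    have lnT_eq: "lnT z = ln (sg i * deriv T z)" if "z \<in> J i" for z
      using sg_pos[OF that] sg_cases[of i] by (auto simp: lnT_def abs_if)
    have "\<exists>z>x. z < y \<and> T y - T x = (y - x) * deriv T z"
      by (rule MVT2[OF xy(3)]) (use T_deriv J in blast)
    then obtain z where z: "x < z" "z < y" "T y - T x = (y - x) * deriv T z" by blast
    have "\<exists>z>x. z < y \<and> ln (sg i * deriv T y) - ln (sg i * deriv T x) = (y - x) * (deriv (deriv T) z / deriv T z)"
    proof (rule MVT2[OF xy(3)])
      fix u assume "x \<le> u" "u \<le> y"
      then have u: "u \<in> J i" by (rule J)
      have "((\<lambda>u. ln (sg i * deriv T u)) has_real_derivative (1 / (sg i * deriv T u)) * (sg i * deriv (deriv T) u)) (at u)"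
        by (rule DERIV_chain2[OF DERIV_ln_divide[OF sg_pos[OF u]] DERIV_cmult[OF T_deriv2[OF u]]])
      moreover have "(1 / (sg i * deriv T u)) * (sg i * deriv (deriv T) u) = deriv (deriv T) u / deriv T u"
        using sg_cases[of i] by auto
      ultimately show "((\<lambda>u. ln (sg i * deriv T u)) has_real_derivative deriv (deriv T) u / deriv T u) (at u)" by simp
    qed
    then obtain v where v: "x < v" "v < y" "lnT y - lnT x = (y - x) * (deriv (deriv T) v / deriv T v)"
      using lnT_eq xy by auto
    have "z \<in> J i" "v \<in> J i" using J z v by auto
    then have K: "\<bar>deriv (deriv T) v\<bar> / (\<bar>deriv T v\<bar> * \<bar>deriv T z\<bar>) \<le> K"
      by (intro K_props(2)[of v i v z])
    have "\<bar>deriv (deriv T) v / deriv T v\<bar> \<le> K * \<bar>deriv T z\<bar>"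
      using K deriv_nz[OF \<open>z \<in> J i\<close>] deriv_nz[OF \<open>v \<in> J i\<close>] by (simp add: field_simps abs_divide)
    then have "(y - x) * \<bar>deriv (deriv T) v / deriv T v\<bar> \<le> (y - x) * (K * \<bar>deriv T z\<bar>)"
      using xy by (intro mult_left_mono) auto
    moreover have "\<bar>lnT x - lnT y\<bar> = (y - x) * \<bar>deriv (deriv T) v / deriv T v\<bar>"
      using v(3) xy(3) by (metis abs_minus_commute abs_mult abs_of_pos diff_gt_0_iff_gt)
    moreover have "\<bar>T x - T y\<bar> = (y - x) * \<bar>deriv T z\<bar>"
      using z(3) xy(3) by (metis abs_minus_commute abs_mult abs_of_pos diff_gt_0_iff_gt)
    ultimately show ?thesis by (simp only: mult.left_commute[of K])
  qed
  show ?thesis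
    using *[of x y] *[of y x] assms by (cases x y rule: linorder_cases) (auto simp: abs_minus_commute)
qed

definition D1 where "D1 = K * C0 * (1 / (1 - 1 / \<xi>))"

text \<open>The \<open>k\<close>-th summands differ by at most \<open>K\<close> times the distance
  of the next iterates, hence the index \<open>Suc k\<close>. Those iterates share a cylinder of
  word length \<open>n - Suc k\<close>, so the errors form a geometric series.\<close>

lemma LS_distortion:
  assumes xy: "x \<in> U w" "y \<in> U w"
  shows "\<bar>LS (length w) x - LS (length w) y\<bar> \<le> D1"
proof -
  let ?n = "length w" and ?q = "1 / \<xi>"
  have q: "0 < ?q" "?q < 1" using \<xi>_gt1 by auto
  have "\<bar>LS ?n x - LS ?n y\<bar> \<le> (\<Sum>k<?n. \<bar>lnT ((T ^^ k) x) - lnT ((T ^^ k) y)\<bar>)"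
    by (simp add: LS_def flip: sum_subtractf)
  also have "\<dots> \<le> (\<Sum>k<?n. K * (C0 * ?q ^ (?n - Suc k)))"
  proof (rule sum_mono)
    fix k assume "k \<in> {..<?n}"
    then have k: "k < ?n" by simp
    have "\<bar>lnT ((T ^^ k) x) - lnT ((T ^^ k) y)\<bar> \<le> K * \<bar>T ((T ^^ k) x) - T ((T ^^ k) y)\<bar>"
      using xy k by (intro lnT_lip[of _ "w ! k"] U_mem_J)
    also have "\<bar>T ((T ^^ k) x) - T ((T ^^ k) y)\<bar> \<le> r (drop (Suc k) w)"
      using U_drop[OF xy(1), of "Suc k"] U_drop[OF xy(2), of "Suc k"] k by (intro r_ge') auto
    also have "\<dots> \<le> C0 * ?q ^ (?n - Suc k)" using r_small[of "drop (Suc k) w"] by simp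
    finally show "\<bar>lnT ((T ^^ k) x) - lnT ((T ^^ k) y)\<bar> \<le> K * (C0 * ?q ^ (?n - Suc k))"
      using K_props(1) by simp
  qed
  also have "\<dots> = K * C0 * (\<Sum>k<?n. ?q ^ k)"
    using sum.nat_diff_reindex[of "\<lambda>k. ?q ^ k" ?n] by (simp only: mult.assoc flip: sum_distrib_left)
  also have "\<dots> \<le> K * C0 * (1 / (1 - ?q))"
  proof -
    have "(\<Sum>k<?n. ?q ^ k) \<le> (\<Sum>k. ?q ^ k)" using q by (intro sum_le_suminf summable_geometric) auto
    also have "\<dots> = 1 / (1 - ?q)" using q by (intro suminf_geometric) auto
    finally show ?thesis using K_props(1) C0_ge1 by (intro mult_left_mono) auto
  qed
  finally show ?thesis by (simp add: D1_def)
qed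

lemma D1_nonneg: "D1 \<ge> 0"
  using LS_distortion[of _ "[]"] U_nonempty[of "[]"] by fastforce

definition D0 where "D0 = D1 + \<bar>ln M\<bar>"

lemma D0_nonneg: "D0 \<ge> 0" using D1_nonneg by (simp add: D0_def)

text \<open>The map \<open>T ^^ n\<close> stretches the cylinder to length \<open>M\<close>, and by
  bounded distortion its derivative is comparable to the one at \<open>x\<close>.\<close>

lemma r_LS_bounds:
  assumes x: "x \<in> U w"
  shows "M * exp (- LS (length w) x - D1) \<le> r w" "r w \<le> M * exp (- LS (length w) x + D1)"
proof -
  let ?n = "length w"
  have LS: "LS ?n x - D1 \<le> LS ?n z" "LS ?n z \<le> LS ?n x + D1" if "z \<in> U w" for z
    using LS_distortion[OF x that] by auto
  have "M \<le> exp (LS ?n x + D1) * r w"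
  proof (rule M_le)
    fix a b assume ab: "a \<in> U w" "b \<in> U w"
    obtain z where z: "z \<in> U w" "\<bar>(T ^^ ?n) a - (T ^^ ?n) b\<bar> = exp (LS ?n z) * \<bar>a - b\<bar>"
      using U_LS_mvt[OF ab] by blast
    then show "\<bar>(T ^^ ?n) a - (T ^^ ?n) b\<bar> \<le> exp (LS ?n x + D1) * r w"
      using LS(2)[OF z(1)] r_ge'[OF ab] by (auto intro!: mult_mono)
  qed
  then have "M * exp (- LS ?n x - D1) \<le> (exp (LS ?n x + D1) * r w) * exp (- LS ?n x - D1)"
    by (intro mult_right_mono) auto
  also have "\<dots> = r w" by (simp add: mult.commute mult.left_commute flip: exp_add)
  finally show "M * exp (- LS ?n x - D1) \<le> r w" .
  show "r w \<le> M * exp (- LS ?n x + D1)"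
  proof (rule r_le)
    fix a b assume ab: "a \<in> U w" "b \<in> U w"
    obtain z where z: "z \<in> U w" "\<bar>(T ^^ ?n) a - (T ^^ ?n) b\<bar> = exp (LS ?n z) * \<bar>a - b\<bar>"
      using U_LS_mvt[OF ab] by blast
    have "(T ^^ ?n) a \<in> {0<..<M}" "(T ^^ ?n) b \<in> {0<..<M}" using U_image[of w] ab by auto
    then have "exp (LS ?n z) * \<bar>a - b\<bar> \<le> M" using z(2) by auto
    then have "exp (LS ?n x - D1) * \<bar>a - b\<bar> \<le> M"
      using LS(1)[OF z(1)] mult_right_mono[of "exp (LS ?n x - D1)" "exp (LS ?n z)" "\<bar>a - b\<bar>"] by simp
    then have "(exp (LS ?n x - D1) * \<bar>a - b\<bar>) * exp (- LS ?n x + D1) \<le> M * exp (- LS ?n x + D1)"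
      by (intro mult_right_mono) auto
    then show "\<bar>a - b\<bar> \<le> M * exp (- LS ?n x + D1)"
      by (simp add: mult.commute mult.left_commute flip: exp_add)
  qed
qed

lemma r_pos: "0 < r w"
proof -
  obtain x where "x \<in> U w" using U_nonempty by blast
  then show ?thesis using r_LS_bounds(1) M_bounds by (meson exp_gt_zero less_le_trans mult_pos_pos)
qed

lemma r_le1: "r w \<le> 1"
proof (rule r_le)
  fix x y assume "x \<in> U w" "y \<in> U w"
  then have "x \<in> {0<..<M}" "y \<in> {0<..<M}" using U_sub[of w] by auto
  then show "\<bar>x - y\<bar> \<le> 1" using M_bounds by auto
qed

lemma LS_r: "x \<in> U w \<Longrightarrow> \<bar>LS (length w) x + ln (r w)\<bar> \<le> D0"
proof -
  assume x: "x \<in> U w"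
  have "ln (M * exp (- LS (length w) x - D1)) \<le> ln (r w)" "ln (r w) \<le> ln (M * exp (- LS (length w) x + D1))"
    using r_LS_bounds[OF x] r_pos[of w] M_bounds by (auto intro!: ln_mono)
  then have "ln M - LS (length w) x - D1 \<le> ln (r w)" "ln (r w) \<le> ln M - LS (length w) x + D1"
    using M_bounds by (simp_all add: ln_mult)
  then show ?thesis by (auto simp: D0_def abs_le_iff)
qed

text \<open>Lengths are compared with derivatives for the three words involved, and the logarithmic
  derivatives are exactly additive; each comparison costs \<open>D0\<close>.\<close>

lemma r_append: "\<bar>ln (r (v @ w)) - ln (r v) - ln (r w)\<bar> \<le> 3 * D0"
proof -
  obtain x where x: "x \<in> U (v @ w)" using U_nonempty by blast
  then have xv: "x \<in> U v" and xw: "(T ^^ length v) x \<in> U w" by (auto simp: U_append)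
  show ?thesis
    using LS_r[OF x] LS_r[OF xv] LS_r[OF xw] LS_add[of "length v" "length w" x] by (auto simp: abs_le_iff)
qed

definition D where "D = exp (3 * D0)"

lemma D_ge1: "D \<ge> 1" using D0_nonneg by (simp add: D_def)

lemma r_append_ge: "r v * r w / D \<le> r (v @ w)"
proof -
  have "ln (r v * r w / D) = ln (r v) + ln (r w) - 3 * D0" using r_pos[of v] r_pos[of w] by (simp add: D_def ln_mult ln_div)
  also have "\<dots> \<le> ln (r (v @ w))" using r_append[of v w] by linarith
  finally show ?thesis using r_pos[of v] r_pos[of w] r_pos[of "v @ w"] D_ge1 by (subst (asm) ln_le_cancel_iff) auto
qed

end

section \<open>Endpoints and the relative derivative\<close>

context emr_coding
begin

text \<open>Otherwise the image is a value that the branch already takes at an inner point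
  \<open>z\<close>. Monotonicity then traps the good approximants in a compact part of
  \<open>J (\<omega> 0)\<close>, and their limit could not be an endpoint.\<close>

lemma endpoint_T_eq_M:
  assumes "\<pi> \<omega> \<in> endpoints I"
  shows "T (\<pi> \<omega>) = M"
proof (rule ccontr)
  assume ne: "T (\<pi> \<omega>) \<noteq> M"
  let ?i = "\<omega> 0"
  obtain \<rho> where \<rho>: "\<And>k. pre (\<rho> k) k = pre \<omega> k" "\<And>k. \<pi> (\<rho> k) \<notin> endpoint_preimages T I"
    "\<And>m. (\<lambda>k. (T ^^ m) (\<pi> (\<rho> k))) \<longlonglongrightarrow> (T ^^ m) (\<pi> \<omega>)" using good_seq[of \<omega>] by blast
  define y where "y k = \<pi> (\<rho> (Suc k))" for k
  have y: "y k \<in> J ?i" for k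
  proof -
    have "\<rho> (Suc k) 0 = \<omega> 0" using \<rho>(1)[of "Suc k"] by (simp add: pre_eq_iff)
    then show ?thesis using good_J[OF \<rho>(2), of 0 "Suc k"] by (simp add: y_def)
  qed
  have lim: "y \<longlonglongrightarrow> \<pi> \<omega>" "(\<lambda>k. T (y k)) \<longlonglongrightarrow> T (\<pi> \<omega>)"
    using LIMSEQ_Suc[OF \<rho>(3)[of 0]] LIMSEQ_Suc[OF \<rho>(3)[of 1]] by (simp_all add: y_def[abs_def])
  have "T (\<pi> \<omega>) \<in> \<Lambda>" using \<Lambda>_T[of "\<pi> \<omega>" 1] cod_range by auto
  then have "T (\<pi> \<omega>) \<in> {0<..<M}" using \<Lambda>_pos ne by force
  then obtain z where z: "z \<in> J ?i" "T z = T (\<pi> \<omega>)" using T_onto[of ?i] by auto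
  define z1 z2 where "z1 = (lo ?i + z) / 2" and "z2 = (z + hi ?i) / 2"
  have z12: "z1 \<in> J ?i" "z2 \<in> J ?i" "z1 < z" "z < z2" using z(1) by (auto simp: z1_def z2_def)
  have m: "sg ?i * T z1 < sg ?i * T z" "sg ?i * T z < sg ?i * T z2"
    using z12 z(1) by (auto intro!: T_mono)
  have l: "(\<lambda>k. sg ?i * T (y k)) \<longlonglongrightarrow> sg ?i * T z"
    using lim(2) z(2) by (auto intro!: tendsto_intros)
  have "\<forall>\<^sub>F k in sequentially. sg ?i * T z1 < sg ?i * T (y k) \<and> sg ?i * T (y k) < sg ?i * T z2"
    using order_tendstoD(1)[OF l m(1)] order_tendstoD(2)[OF l m(2)] by eventually_elim simp
  then have ev: "\<forall>\<^sub>F k in sequentially. y k \<in> {z1..z2}"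
  proof eventually_elim
    case (elim k)
    then have "\<not> y k < z1" "\<not> z2 < y k"
      using T_mono[OF y z12(1), of k] T_mono[OF z12(2) y, of k] by auto
    then show ?case by auto
  qed
  then have "\<pi> \<omega> \<in> {z1..z2}"
    using lim(1) by (rule Lim_in_closed_set[OF closed_atLeastAtMost _ sequentially_bot])
  then have "\<pi> \<omega> \<in> J ?i" using z12 by auto
  then show False using endpoint_notin_J[OF assms] by blast
qed

lemma M_endpoint: "M \<in> endpoints I"
  by (auto simp: M_def endpoints_eq)

lemma M_in_I: "M \<in> I i \<Longrightarrow> i = mx"
  using hi_le_M[of i] hi_inj[of i mx] by (auto simp: mem_I M_def)

lemma T_M: "M \<in> \<Lambda> \<Longrightarrow> T M = M"
  using endpoint_T_eq_M M_endpoint cod_range by (metis imageE)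

lemma T_pow_M: "M \<in> \<Lambda> \<Longrightarrow> (T ^^ n) M = M"
  by (induction n) (auto simp: T_M)

lemma code_M: "\<pi> \<omega> = M \<Longrightarrow> \<omega> k = mx"
proof -
  assume *: "\<pi> \<omega> = M"
  then have "M \<in> \<Lambda>" using cod_range by (metis rangeI)
  then have "(T ^^ k) (\<pi> \<omega>) = M" using T_pow_M * by simp
  then show ?thesis using cod_mem[of k \<omega>] M_in_I by simp
qed

lemma bad_reaches_M: "x \<in> \<Lambda> \<Longrightarrow> x \<in> endpoint_preimages T I \<Longrightarrow> \<exists>n. (T ^^ n) x = M"
proof -
  assume "x \<in> \<Lambda>" "x \<in> endpoint_preimages T I"
  moreover then obtain \<omega> where "x = \<pi> \<omega>" using cod_range by blast
  ultimately obtain n where "x = \<pi> \<omega>" "(T ^^ n) x \<in> endpoints I"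
    by (auto simp: endpoint_preimages_def)
  then have "T ((T ^^ n) x) = M" using endpoint_T_eq_M[of "shiftn n \<omega>"] by (simp add: T_pow_\<pi>)
  then have "(T ^^ Suc n) x = M" by simp
  then show ?thesis by blast
qed

text \<open>A bad orbit reaches \<open>M\<close>, which is then fixed and belongs to no interval but
  \<open>I mx\<close>; from that time on the code is constant.\<close>

lemma code_bad: "\<pi> \<omega> \<in> endpoint_preimages T I \<Longrightarrow> \<exists>n. \<forall>k\<ge>n. \<omega> k = mx"
proof -
  assume "\<pi> \<omega> \<in> endpoint_preimages T I"
  then obtain n where "\<pi> (shiftn n \<omega>) = M" using bad_reaches_M[of "\<pi> \<omega>"] cod_range T_pow_\<pi> by auto
  then have "shiftn n \<omega> k = mx" for k by (rule code_M)
  then have "\<omega> k = mx" if "k \<ge> n" for k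
    using that by (metis le_add_diff_inverse shiftn_def)
  then show ?thesis by blast
qed

section \<open>The relative derivative at the right end\<close>

abbreviation bd :: "real \<Rightarrow> real" where "bd \<equiv> branch_deriv T I"
definition lnB :: "real \<Rightarrow> real" where "lnB x = ln \<bar>bd x\<bar>"
definition LB :: "nat \<Rightarrow> real \<Rightarrow> real" where "LB n x = (\<Sum>k<n. lnB ((T ^^ k) x))"

lemma bd_interior: "x \<in> J i \<Longrightarrow> bd x = deriv T x"
proof -
  assume x: "x \<in> J i"
  have "J i \<subseteq> I i" by (auto simp: mem_I)
  then have "J i \<subseteq> (\<Union>i. I i)" by blast
  then have "x \<in> interior (\<Union>i. I i)" using x by (meson interiorI open_greaterThanLessThan)
  then have "at x within (\<Union>i. I i) = at x" by (rule at_within_interior)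
  moreover have "(T has_vector_derivative deriv T x) (at x)"
    using T_deriv[OF x] by (simp add: has_real_derivative_iff_has_vector_derivative)
  ultimately show ?thesis by (simp add: branch_deriv_def vector_derivative_at)
qed

lemma lnB_interior: "x \<in> J i \<Longrightarrow> lnB x = lnT x"
  by (simp add: lnB_def lnT_def bd_interior)

text \<open>By the Renyi condition \<open>lnT\<close> is Lipschitz in terms of the values of
  \<open>T\<close>, so it has a limit \<open>l\<close> along points whose images tend to
  \<open>M\<close>. This \<open>l\<close> is the logarithm of the relative derivative, and the
  comparison between derivatives and cylinder lengths passes to the limit.\<close>

lemma bd_M:
  assumes M: "M \<in> \<Lambda>"
  shows "\<bar>real n * lnB M + ln (r (replicate n mx))\<bar> \<le> D0"
proof -
  obtain \<omega> where \<omega>: "\<pi> \<omega> = M" using M cod_range by (metis imageE)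
  have pre: "pre \<omega> k = replicate k mx" for k
    using code_M[OF \<omega>] by (simp add: list_eq_iff_nth_eq)
  obtain \<rho> where \<rho>: "\<And>k. pre (\<rho> k) k = pre \<omega> k" "\<And>k. \<pi> (\<rho> k) \<notin> endpoint_preimages T I"
    "\<And>m. (\<lambda>k. (T ^^ m) (\<pi> (\<rho> k))) \<longlonglongrightarrow> (T ^^ m) (\<pi> \<omega>)" using good_seq[of \<omega>] by blast
  have lim: "(\<lambda>k. (T ^^ m) (\<pi> (\<rho> k))) \<longlonglongrightarrow> M" for m using \<rho>(3)[of m] \<omega> T_pow_M[OF M] by simp
  have Jm: "(T ^^ m) (\<pi> (\<rho> k)) \<in> J mx" if "m < k" for m k
  proof -
    have "\<rho> k m = mx" using \<rho>(1)[of k] that code_M[OF \<omega>, of m] by (simp add: pre_eq_iff)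
    then show ?thesis using good_J[OF \<rho>(2), of m k] by simp
  qed
  define y where "y k = \<pi> (\<rho> (k + 2))" for k
  have y: "y k \<in> J mx" for k using Jm[of 0 "k + 2"] by (simp add: y_def)
  have Ty: "T (y k) < M" for k using Jm[of 1 "k + 2"] by (simp add: y_def M_def)
  have ylim: "y \<longlonglongrightarrow> M" "(\<lambda>k. T (y k)) \<longlonglongrightarrow> M"
    using LIMSEQ_ignore_initial_segment[OF lim[of 0], of 2] LIMSEQ_ignore_initial_segment[OF lim[of 1], of 2]
    by (simp_all add: y_def[abs_def])
  have ylt: "y k < M" for k using y[of k] by (simp add: M_def)
  have sg: "sg mx = 1"
  proof (rule ccontr)
    assume "sg mx \<noteq> 1"
    then have s: "sg mx = -1" using sg_cases by blast
    have "\<forall>\<^sub>F k in sequentially. y 0 < y k" using order_tendstoD(1)[OF ylim(1) ylt[of 0]] .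
    then have "\<forall>\<^sub>F k in sequentially. T (y k) \<le> T (y 0)"
      by eventually_elim (use T_mono[OF y[of 0] y] s in force)
    then have "M \<le> T (y 0)" by (rule tendsto_upperbound[OF ylim(2)]) simp
    then show False using Ty[of 0] by simp
  qed
  have mono: "T a < T b" if "a \<in> J mx" "b \<in> J mx" "a < b" for a b using T_mono[OF that] sg by simp
  have T_lt: "T a < M" if "a \<in> J mx" for a
  proof -
    have "a < M" using that by (simp add: M_def)
    then have "\<forall>\<^sub>F k in sequentially. a < y k" using order_tendstoD(1)[OF ylim(1)] by blast
    then obtain k where "a < y k" by (auto simp: eventually_sequentially)
    then show ?thesis using mono[OF that y] Ty[of k] by (meson less_trans)
  qed
  have "Cauchy (\<lambda>k. lnT (y k))"
  proof (rule metric_CauchyI)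
    fix e :: real assume e: "0 < e"
    have "Cauchy (\<lambda>k. T (y k))" using ylim(2) by (rule LIMSEQ_imp_Cauchy)
    then obtain N where N: "\<And>m n. m \<ge> N \<Longrightarrow> n \<ge> N \<Longrightarrow> dist (T (y m)) (T (y n)) < e / K"
      using e K_props(1) by (metis metric_CauchyD divide_pos_pos)
    have "dist (lnT (y m)) (lnT (y n)) < e" if "m \<ge> N" "n \<ge> N" for m n
    proof -
      have "dist (lnT (y m)) (lnT (y n)) \<le> K * dist (T (y m)) (T (y n))"
        using lnT_lip[OF y y, of m n] by (simp add: dist_real_def)
      also have "\<dots> < e" using N[OF that] K_props(1) by (simp add: field_simps)
      finally show ?thesis .
    qed
    then show "\<exists>M. \<forall>m\<ge>M. \<forall>n\<ge>M. dist (lnT (y m)) (lnT (y n)) < e" by blast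
  qed
  then obtain l where l: "(\<lambda>k. lnT (y k)) \<longlonglongrightarrow> l" using Cauchy_convergent convergent_def by blast
  have lip: "\<bar>lnT a - l\<bar> \<le> K * (M - T a)" if "a \<in> J mx" for a
  proof (rule LIMSEQ_le)
    show "(\<lambda>k. \<bar>lnT a - lnT (y k)\<bar>) \<longlonglongrightarrow> \<bar>lnT a - l\<bar>" by (intro tendsto_intros l)
    have "(\<lambda>k. K * \<bar>T a - T (y k)\<bar>) \<longlonglongrightarrow> K * \<bar>T a - M\<bar>" by (intro tendsto_intros ylim)
    then show "(\<lambda>k. K * \<bar>T a - T (y k)\<bar>) \<longlonglongrightarrow> K * (M - T a)" using T_lt[OF that] by (simp add: abs_if)
    show "\<exists>N. \<forall>n\<ge>N. \<bar>lnT a - lnT (y n)\<bar> \<le> K * \<bar>T a - T (y n)\<bar>" using lnT_lip[OF that y] by blast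
  qed
  have near: "\<exists>d<M. lo mx \<le> d \<and> (\<forall>a. d < a \<and> a < M \<longrightarrow> a \<in> J mx \<and> M - T a < e)" if "e > 0" for e
  proof -
    have "\<forall>\<^sub>F k in sequentially. M - e < T (y k)" using that by (intro order_tendstoD(1)[OF ylim(2)]) simp
    then obtain k where k: "M - e < T (y k)" by (auto simp: eventually_sequentially)
    have "a \<in> J mx \<and> M - T a < e" if "y k < a \<and> a < M" for a
    proof -
      have "a \<in> J mx" using that y[of k] by (auto simp: M_def)
      then show ?thesis using mono[OF y, of a k] that k by auto
    qed
    then show ?thesis using ylt[of k] y[of k] by (intro exI[of _ "y k"]) auto
  qed
  have derivT: "deriv T a = exp (lnT a)" if "a \<in> J mx" for a
    using sg_pos[OF that] sg by (simp add: lnT_def)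
  have "((\<lambda>a. (T a - T M) / (a - M)) \<longlongrightarrow> exp l) (at M within I mx)"
  proof (rule tendstoI)
    fix e :: real assume "e > 0"
    have "isCont exp l" by (rule isCont_exp)
    then obtain d where d: "d > 0" "\<And>u. \<bar>u - l\<bar> < d \<Longrightarrow> \<bar>exp u - exp l\<bar> < e"
      using \<open>e > 0\<close> unfolding continuous_at_eps_delta dist_real_def by blast
    obtain c where c: "c < M" "lo mx \<le> c" "\<And>a. c < a \<Longrightarrow> a < M \<Longrightarrow> a \<in> J mx \<and> M - T a < d / K"
      using near[of "d / K"] d(1) K_props(1) by auto
    \<comment> \<open>The difference quotient equals the derivative at some \<open>z\<close> between
      \<open>a\<close> and \<open>M\<close>, and \<open>lnT z\<close> differs from \<open>l\<close>
      by at most \<open>K * (M - T z) < d\<close>.\<close>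
    have main: "dist ((T a - T M) / (a - M)) (exp l) < e" if a: "c < a" "a < M" for a
    proof -
      have cont: "continuous_on {a..M} T"
        unfolding continuous_on_eq_continuous_within
      proof
        fix x assume x: "x \<in> {a..M}"
        show "continuous (at x within {a..M}) T"
        proof (cases "x = M")
          case True
          have "(T \<longlongrightarrow> M) (at M within {a..M})"
          proof (rule tendstoI)
            fix e' :: real assume "e' > 0"
            then obtain c' where c': "c' < M" "\<And>b. c' < b \<Longrightarrow> b < M \<Longrightarrow> b \<in> J mx \<and> M - T b < e'"
              using near by meson
            show "\<forall>\<^sub>F x in at M within {a..M}. dist (T x) M < e'"
              unfolding eventually_at_topological
            proof (intro exI conjI ballI impI)
              show "open {c'<..}" "M \<in> {c'<..}" using c' by auto
              fix b assume "b \<in> {c'<..}" "b \<noteq> M" "b \<in> {a..M}"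
              then have "b \<in> J mx \<and> M - T b < e'" using c'(2)[of b] by auto
              then show "dist (T b) M < e'" using T_lt[of b] by (simp add: dist_real_def)
            qed
          qed
          then show ?thesis using True T_M[OF M] by (simp add: continuous_within)
        next
          case False
          then have "x \<in> J mx" using x c(3)[of x] a by auto
          then show ?thesis using T_deriv DERIV_isCont continuous_at_imp_continuous_within by blast
        qed
      qed
      have "\<exists>z>a. z < M \<and> T M - T a = (M - a) * exp (lnT z)"
      proof -
        have diff: "\<And>x. a < x \<Longrightarrow> x < M \<Longrightarrow> T differentiable (at x)"
          using c(3) a T_deriv real_differentiable_def less_trans by metis
        obtain L z where z: "a < z" "z < M" "(T has_real_derivative L) (at z)" "T M - T a = (M - a) * L"
          using MVT[OF a(2) cont diff] by blast
        have "z \<in> J mx" using c(3)[of z] z a by auto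
        then have "L = exp (lnT z)" using DERIV_unique[OF z(3) T_deriv] derivT by metis
        then show ?thesis using z by blast
      qed
      then obtain z where z: "a < z" "z < M" "T M - T a = (M - a) * exp (lnT z)" by blast
      have zJ: "z \<in> J mx" "M - T z < d / K" using c(3)[of z] z a by auto
      have "\<bar>lnT z - l\<bar> \<le> K * (M - T z)" by (rule lip[OF zJ(1)])
      also have "\<dots> < d" using zJ(2) K_props(1) by (simp add: field_simps)
      finally have "\<bar>exp (lnT z) - exp l\<bar> < e" by (rule d(2))
      moreover have "(T a - T M) / (a - M) = exp (lnT z)" using z(3) a by (simp add: field_simps)
      ultimately show ?thesis by (simp add: dist_real_def)
    qed
    show "\<forall>\<^sub>F a in at M within I mx. dist ((T a - T M) / (a - M)) (exp l) < e"
      unfolding eventually_at_topological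
    proof (intro exI conjI ballI impI)
      show "open {c<..}" "M \<in> {c<..}" using c by auto
      fix b assume "b \<in> {c<..}" "b \<noteq> M" "b \<in> I mx"
      then show "dist ((T b - T M) / (b - M)) (exp l) < e" by (intro main) (auto simp: mem_I M_def)
    qed
  qed
  then have der: "(T has_vector_derivative exp l) (at M within I mx)"
    by (simp add: has_field_derivative_iff flip: has_real_derivative_iff_has_vector_derivative)
  \<comment> \<open>No other interval enters the region to the right of
    \<open>lo mx\<close>.\<close>
  have "at M within (\<Union>i. I i) = at M within I mx"
  proof (rule at_within_nhd)
    show "M \<in> {lo mx<..}" "open {lo mx<..}" using I_props(2)[of mx] by (auto simp: M_def)
    have "x \<in> I mx" if "x \<in> I i" "lo mx < x" for x i
      using order_I[of i mx] hi_le_M[of i] that by (cases "i = mx") (auto simp: mem_I M_def)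
    then show "(\<Union>i. I i) \<inter> {lo mx<..} - {M} = I mx \<inter> {lo mx<..} - {M}" by auto
  qed
  moreover have "at M within I mx \<noteq> bot"
  proof -
    have "M islimpt J mx" using I_props(2)[of mx] by (simp add: M_def islimpt_greaterThanLessThan2)
    then have "M islimpt I mx" by (rule islimpt_subset) (auto simp: mem_I)
    then show ?thesis by (simp add: trivial_limit_within)
  qed
  ultimately have "bd M = exp l"
    unfolding branch_deriv_def using der by (metis vector_derivative_within)
  then have lnBM: "lnB M = l" by (simp add: lnB_def)
  \<comment> \<open>The \<open>j\<close>-th approximant follows the letter \<open>mx\<close> for
    \<open>j\<close> steps. For \<open>j \<ge> n\<close> its sum is therefore governed by the
    cylinder of \<open>replicate n mx\<close>, and it tends to \<open>real n * l\<close>.\<close>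
  have "(\<lambda>j. LS n (\<pi> (\<rho> j)) + ln (r (replicate n mx))) \<longlonglongrightarrow> real n * l + ln (r (replicate n mx))"
  proof -
    have "(\<lambda>j. lnT ((T ^^ k) (\<pi> (\<rho> j)))) \<longlonglongrightarrow> l" for k
    proof (rule LIM_zero_cancel, rule Lim_null_comparison)
      show "\<forall>\<^sub>F j in sequentially. norm (lnT ((T ^^ k) (\<pi> (\<rho> j))) - l) \<le> K * (M - (T ^^ Suc k) (\<pi> (\<rho> j)))"
        using eventually_gt_at_top[of k] by eventually_elim (use lip[OF Jm] in simp)
      have "(\<lambda>j. K * (M - (T ^^ Suc k) (\<pi> (\<rho> j)))) \<longlonglongrightarrow> K * (M - M)" by (intro tendsto_intros lim)
      then show "(\<lambda>j. K * (M - (T ^^ Suc k) (\<pi> (\<rho> j)))) \<longlonglongrightarrow> 0" by simp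
    qed
    then have "(\<lambda>j. LS n (\<pi> (\<rho> j))) \<longlonglongrightarrow> (\<Sum>k<n. l)" unfolding LS_def by (intro tendsto_sum)
    then show ?thesis by (intro tendsto_add tendsto_const) simp
  qed
  then have "(\<lambda>j. \<bar>LS n (\<pi> (\<rho> j)) + ln (r (replicate n mx))\<bar>) \<longlonglongrightarrow> \<bar>real n * l + ln (r (replicate n mx))\<bar>"
    by (rule tendsto_rabs)
  moreover have "\<forall>\<^sub>F j in sequentially. \<bar>LS n (\<pi> (\<rho> j)) + ln (r (replicate n mx))\<bar> \<le> D0"
    using eventually_ge_at_top[of n]
  proof eventually_elim
    case (elim j)
    have "pre (\<rho> j) n = replicate n mx"
      using \<rho>(1)[of j] elim code_M[OF \<omega>] by (auto simp: pre_eq_iff simp flip: pre)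
    then show ?case using LS_r[OF good_U[OF \<rho>(2), of j n]] by simp
  qed
  ultimately show ?thesis unfolding lnBM by (rule tendsto_upperbound) simp
qed

text \<open>The points that carry every invariant measure: outside the bad set the itinerary is unique,
  and the only bad point with positive mass can be the fixed point \<open>M\<close>.\<close>

definition \<Lambda>' :: "real set" where "\<Lambda>' = {x \<in> \<Lambda>. x \<notin> endpoint_preimages T I \<or> x = M}"

text \<open>The default \<open>mx\<close> is the correct letter at \<open>M\<close>, so that
  itineraries are right also at this one endpoint.\<close>

definition letter :: "real \<Rightarrow> nat" where
  "letter x = (if \<exists>i. x \<in> J i then THE i. x \<in> J i else mx)"

lemma letter_J: "x \<in> J i \<Longrightarrow> letter x = i"
proof -
  assume x: "x \<in> J i"
  then have "(THE i. x \<in> J i) = i" using J_disjoint by (intro the_equality) auto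
  then show ?thesis using x by (auto simp: letter_def)
qed

definition itin :: "real \<Rightarrow> nat \<Rightarrow> nat" where "itin x k = letter ((T ^^ k) x)"

lemma itin_good: "\<pi> \<omega> \<notin> endpoint_preimages T I \<Longrightarrow> itin (\<pi> \<omega>) = \<omega>"
  using good_J[of \<omega>] letter_J by (auto simp: itin_def)

lemma itin_M: "M \<in> \<Lambda> \<Longrightarrow> itin M = (\<lambda>_. mx)"
proof -
  have "letter M = mx" using endpoint_notin_J[OF M_endpoint] unfolding letter_def by metis
  then show "M \<in> \<Lambda> \<Longrightarrow> ?thesis" by (simp add: fun_eq_iff itin_def T_pow_M)
qed

lemma \<pi>_itin: "x \<in> \<Lambda>' \<Longrightarrow> \<pi> (itin x) = x"
proof -
  assume x: "x \<in> \<Lambda>'"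
  then obtain \<omega> where \<omega>: "x = \<pi> \<omega>" using cod_range by (auto simp: \<Lambda>'_def)
  show ?thesis
  proof (cases "x = M")
    case True
    then have "\<omega> = (\<lambda>_. mx)" using code_M[of \<omega>] \<omega> by auto
    then show ?thesis using itin_M x True \<omega> by (auto simp: \<Lambda>'_def)
  next
    case False
    then show ?thesis using itin_good[of \<omega>] x \<omega> by (auto simp: \<Lambda>'_def)
  qed
qed

lemma LB_r: "x \<in> \<Lambda>' \<Longrightarrow> \<bar>LB n x + ln (r (pre (itin x) n))\<bar> \<le> D0"
proof -
  assume x: "x \<in> \<Lambda>'"
  show ?thesis
  proof (cases "x = M")
    case True
    have M: "M \<in> \<Lambda>" using x True by (auto simp: \<Lambda>'_def)
    have "pre (itin M) n = replicate n mx" using itin_M[OF M] by (simp add: list_eq_iff_nth_eq)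
    then show ?thesis using bd_M[OF M, of n] True by (simp add: LB_def T_pow_M[OF M])
  next
    case False
    then have g: "\<pi> (itin x) \<notin> endpoint_preimages T I" using x \<pi>_itin by (auto simp: \<Lambda>'_def)
    have "lnB ((T ^^ k) x) = lnT ((T ^^ k) x)" for k
      using good_J[OF g, of k] \<pi>_itin[OF x] lnB_interior by simp
    then have "LB n x = LS n x" by (simp add: LB_def LS_def)
    then show ?thesis using LS_r[OF good_U[OF g, of n]] \<pi>_itin[OF x] by simp
  qed
qed

lemma itin_T: "itin ((T ^^ k) x) j = itin x (k + j)"
  by (simp add: itin_def funpow_add add.commute[of k])

section \<open>Measurability of the map and of the itinerary\<close>

lemma T_measurable: "T \<in> measurable (restrict_space borel \<Lambda>) (restrict_space borel \<Lambda>)"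
proof (rule measurable_restrict_space2)
  show "T \<in> space (restrict_space borel \<Lambda>) \<rightarrow> \<Lambda>" using \<Lambda>_T[of _ 1] by (auto simp: space_restrict_space)
  show "T \<in> borel_measurable (restrict_space borel \<Lambda>)"
  proof (rule measurableI)
    fix S :: "real set" assume S: "S \<in> sets borel"
    let ?J = "\<Union>i. J i"
    have oJ: "open ?J" by auto
    have "continuous_on ?J T"
      using T_deriv by (intro continuous_at_imp_continuous_on ballI) (blast intro: DERIV_isCont)
    then have "T \<in> borel_measurable (restrict_space borel ?J)" by (rule borel_measurable_continuous_on_restrict)
    then have "T -` S \<inter> space (restrict_space borel ?J) \<in> sets (restrict_space borel ?J)"
      using S by (rule measurable_sets)
    then have 1: "T -` S \<inter> ?J \<in> sets borel"
      using oJ by (simp add: space_restrict_space sets_restrict_space_iff)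
    have 2: "T -` S \<inter> endpoints I \<in> sets borel"
      by (rule sets.countable) (auto intro: countable_subset[OF _ countable_endpoints])
    have "T -` S \<inter> \<Lambda> = ((T -` S \<inter> ?J) \<union> (T -` S \<inter> endpoints I)) \<inter> \<Lambda>"
    proof -
      have "x \<in> ?J \<or> x \<in> endpoints I" if "x \<in> \<Lambda>" for x
      proof -
        obtain \<omega> where "x = \<pi> \<omega>" using \<open>x \<in> \<Lambda>\<close> cod_range by blast
        then have "lo (\<omega> 0) \<le> x" "x \<le> hi (\<omega> 0)" using cod_mem[of 0 \<omega>] by (simp_all add: mem_I)
        then have "x \<in> J (\<omega> 0) \<or> x = lo (\<omega> 0) \<or> x = hi (\<omega> 0)" by auto
        then show ?thesis by (auto simp: endpoints_eq)
      qed
      then show ?thesis by blast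
    qed
    then show "T -` S \<inter> space (restrict_space borel \<Lambda>) \<in> sets (restrict_space borel \<Lambda>)"
      using sets.Un[OF 1 2] unfolding space_restrict_space sets_restrict_space
      by (intro image_eqI[where x="(T -` S \<inter> ?J) \<union> (T -` S \<inter> endpoints I)"]) (simp_all add: Int_commute)
  qed simp
qed

lemma letter_measurable: "letter \<in> measurable borel (count_space UNIV)"
proof -
  have "letter -` {i} \<in> sets borel" for i
  proof -
    have "letter -` {i} = J i \<union> (if i = mx then - (\<Union>i. J i) else {})"
    proof (rule set_eqI)
      fix x
      show "x \<in> letter -` {i} \<longleftrightarrow> x \<in> J i \<union> (if i = mx then - (\<Union>i. J i) else {})"
      proof (cases "\<exists>j. x \<in> J j")
        case True
        then obtain j where j: "x \<in> J j" by blast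
        then have "x \<in> J i \<longleftrightarrow> i = j" using J_disjoint by blast
        moreover have "x \<notin> - (\<Union>i. J i)" using j by blast
        ultimately show ?thesis using letter_J[OF j] by (simp split: if_splits) blast
      next
        case False
        then have "letter x = mx" "x \<notin> J i" "x \<in> - (\<Union>i. J i)" by (auto simp: letter_def)
        then show ?thesis by simp
      qed
    qed
    moreover have "J i \<in> sets borel" "- (\<Union>i. J i) \<in> sets borel" by auto
    ultimately show ?thesis by auto
  qed
  then show ?thesis by (intro measurable_count_space_eq_countable[THEN iffD2]) auto
qed

end

section \<open>Birkhoff sums over words\<close>

locale emr_level = emr_coding +
  fixes \<phi> :: "real \<Rightarrow> real" and \<alpha> :: real
  assumes phi: "\<phi> \<in> class_R T I \<pi>" and alpha: "ereal \<alpha> < alpha_max T I \<phi>"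
begin

lemma phi_neg: "x \<in> \<Lambda> \<Longrightarrow> \<phi> x < 0"
  using phi by (auto simp: class_R_def)

lemma \<pi>_in: "\<pi> \<omega> \<in> \<Lambda>"
  using cod_range by (metis rangeI)

text \<open>The potential tends to \<open>-\<infinity>\<close> at 0 and only finitely many intervals
  reach beyond a given distance from 0. A value above \<open>C\<close> thus confines the first
  letter to a finite set; this replaces compactness of the alphabet.\<close>

lemma phi_low: "\<exists>F. finite F \<and> (\<forall>\<omega>. \<omega> 0 \<notin> F \<longrightarrow> \<phi> (\<pi> \<omega>) < C)"
proof -
  have "filterlim \<phi> at_bot (at 0 within \<Lambda>)" using phi by (auto simp: class_R_def)
  then have "\<forall>\<^sub>F x in at 0 within \<Lambda>. \<phi> x < C" by (simp add: filterlim_at_bot_dense)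
  then obtain d where d: "d > 0" "\<And>x. x \<in> \<Lambda> \<Longrightarrow> x \<noteq> 0 \<Longrightarrow> dist x 0 < d \<Longrightarrow> \<phi> x < C"
    by (auto simp: eventually_at)
  have "\<phi> (\<pi> \<omega>) < C" if "\<omega> 0 \<notin> {i. d \<le> hi i}" for \<omega>
  proof (rule d(2)[OF \<pi>_in])
    have "\<pi> \<omega> \<in> I (\<omega> 0)" using cod_mem[of 0 \<omega>] by simp
    then have "0 < \<pi> \<omega>" "\<pi> \<omega> < d" using that \<Lambda>_pos[OF \<pi>_in] by (auto simp: mem_I)
    then show "\<pi> \<omega> \<noteq> 0" "dist (\<pi> \<omega>) 0 < d" by auto
  qed
  then show ?thesis using finite_hi_ge[OF d(1)] by blast
qed

section \<open>Almost additivity of Birkhoff sums\<close>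

definition S :: "nat \<Rightarrow> (nat \<Rightarrow> nat) \<Rightarrow> real" where "S n \<omega> = (\<Sum>k<n. \<phi> (\<pi> (shiftn k \<omega>)))"
definition B :: real where "B = enn2real (\<Sum>n. variation (n + 2) (\<phi> \<circ> \<pi>))"

lemma B_nonneg: "0 \<le> B" by (simp add: B_def)

lemma shiftn_shiftn: "shiftn m (shiftn n \<omega>) = shiftn (n + m) \<omega>"
  by (simp add: shiftn_def add.assoc)

lemma S_add: "S (m + n) \<omega> = S m \<omega> + S n (shiftn m \<omega>)"
proof (induction n)
  case (Suc n)
  then show ?case by (simp add: S_def shiftn_shiftn)
qed (simp add: S_def)

lemma ex_variation_bound:
  "\<exists>V. summable V \<and> (\<forall>n. 0 \<le> V n) \<and> suminf V = B \<and>
    (\<forall>n \<omega> \<omega>'. (\<forall>k<n + 2. \<omega> k = \<omega>' k) \<longrightarrow> \<bar>\<phi> (\<pi> \<omega>) - \<phi> (\<pi> \<omega>')\<bar> \<le> V n)"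
proof -
  let ?v = "\<lambda>j. variation j (\<phi> \<circ> \<pi>)"
  have fin: "(\<Sum>n. ?v (n + 2)) < \<infinity>" using phi by (auto simp: class_R_def summable_variations_def)
  have vf: "?v (n + 2) < \<infinity>" for n
  proof -
    have "(\<Sum>i\<in>{n}. ?v (i + 2)) \<le> (\<Sum>n. ?v (n + 2))" by (intro sum_le_suminf) auto
    then show ?thesis using fin by (simp add: le_less_trans)
  qed
  define V where "V n = enn2real (?v (n + 2))" for n
  have V: "ennreal (V n) = ?v (n + 2)" for n using vf[of n] by (simp add: V_def)
  have V0: "0 \<le> V n" for n by (simp add: V_def)
  have sV: "summable V"
    using fin by (intro summable_suminf_not_top) (simp_all only: V, simp_all add: V_def)
  have "(\<Sum>n. ?v (n + 2)) = ennreal (suminf V)"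
    unfolding V[symmetric] by (rule suminf_ennreal2[OF V0 sV])
  then have "suminf V = B" using suminf_nonneg[OF sV V0] by (simp add: B_def)
  moreover have "\<bar>\<phi> (\<pi> \<omega>) - \<phi> (\<pi> \<omega>')\<bar> \<le> V n" if "\<forall>k<n + 2. \<omega> k = \<omega>' k" for n \<omega> \<omega>'
  proof -
    have "ennreal \<bar>\<phi> (\<pi> \<omega>) - \<phi> (\<pi> \<omega>')\<bar> \<le> ?v (n + 2)"
      unfolding variation_def by (rule SUP_upper2[of "(\<omega>, \<omega>')"]) (use that in auto)
    then have "ennreal \<bar>\<phi> (\<pi> \<omega>) - \<phi> (\<pi> \<omega>')\<bar> \<le> ennreal (V n)" by (simp only: V)
    then show ?thesis by (subst (asm) ennreal_le_iff) (simp_all add: V_def)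
  qed
  ultimately show ?thesis using sV V0 by blast
qed

text \<open>Agreement in \<open>n + 1\<close> rather than \<open>n\<close> coordinates is needed, because the first variation may be
  infinite.\<close>

lemma S_close:
  assumes "\<And>k. k \<le> n \<Longrightarrow> \<omega> k = \<omega>' k"
  shows "\<bar>S n \<omega> - S n \<omega>'\<bar> \<le> B"
proof -
  obtain V where V: "summable V" "\<And>n. 0 \<le> V n" "suminf V = B"
    "\<And>n \<omega> \<omega>'. (\<forall>k<n + 2. \<omega> k = \<omega>' k) \<Longrightarrow> \<bar>\<phi> (\<pi> \<omega>) - \<phi> (\<pi> \<omega>')\<bar> \<le> V n"
    using ex_variation_bound by auto
  have "\<bar>S n \<omega> - S n \<omega>'\<bar> \<le> (\<Sum>k<n. \<bar>\<phi> (\<pi> (shiftn k \<omega>)) - \<phi> (\<pi> (shiftn k \<omega>'))\<bar>)"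
    unfolding S_def by (simp flip: sum_subtractf)
  also have "\<dots> \<le> (\<Sum>k<n. V (n - Suc k))"
    using assms by (intro sum_mono V(4)) (auto simp: shiftn_def)
  also have "\<dots> = (\<Sum>k<n. V k)" by (rule sum.nat_diff_reindex)
  also have "\<dots> \<le> suminf V" using V(1,2) by (intro sum_le_suminf) auto
  finally show ?thesis by (simp only: V(3))
qed

text \<open>A code in which \<open>e0 \<noteq> mx\<close> recurs is good; every word used below begins with \<open>e0\<close>.\<close>

definition e0 :: nat where "e0 = Suc mx"
definition ext :: "nat list \<Rightarrow> nat \<Rightarrow> nat" where "ext w = (\<lambda>n. if n < length w then w ! n else e0)"
text \<open>The deviation from the target level, taken at the point whose code continues with
  \<open>e0\<close> forever. This padding agrees with every continuation by a word beginning with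
  \<open>e0\<close> in the one extra letter that \<open>S_close\<close> asks for.\<close>

definition E :: "nat list \<Rightarrow> real" where "E w = S (length w) (ext w) - real (length w) * \<alpha>"
definition EW :: "nat \<Rightarrow> nat list set" where "EW L = {w. length w = L \<and> w \<noteq> [] \<and> hd w = e0}"

lemma EW_D: "w \<in> EW L \<Longrightarrow> length w = L" "w \<in> EW L \<Longrightarrow> w \<noteq> []" "w \<in> EW L \<Longrightarrow> hd w = e0"
  by (auto simp: EW_def)

lemma good_code: "(\<And>n. \<exists>k\<ge>n. \<omega> k \<noteq> mx) \<Longrightarrow> \<pi> \<omega> \<notin> endpoint_preimages T I"
  using code_bad by metis

lemma shiftn_ext_append: "shiftn (length v) (ext (v @ w)) = ext w"
  by (auto simp: shiftn_def ext_def fun_eq_iff nth_append)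

lemma E_append:
  assumes "w \<noteq> []" "hd w = e0"
  shows "\<bar>E (v @ w) - E v - E w\<bar> \<le> B"
proof -
  have "\<bar>S (length v) (ext (v @ w)) - S (length v) (ext v)\<bar> \<le> B"
  proof (rule S_close)
    fix k assume "k \<le> length v"
    then show "ext (v @ w) k = ext v k"
      using assms by (cases "k = length v") (auto simp: ext_def nth_append hd_conv_nth)
  qed
  then show ?thesis
    by (simp add: E_def S_add shiftn_ext_append algebra_simps)
qed

lemma E_Nil [simp]: "E [] = 0" by (simp add: E_def S_def)

lemma E_concat:
  assumes "\<And>w. w \<in> set ws \<Longrightarrow> w \<noteq> [] \<and> hd w = e0"
  shows "\<bar>E (concat ws) - (\<Sum>w\<leftarrow>ws. E w)\<bar> \<le> B * real (length ws)"
  using assms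
proof (induction ws)
  case (Cons w ws)
  show ?case
  proof (cases "ws = []")
    case False
    then have "concat ws \<noteq> []" "hd (concat ws) = e0"
      using Cons.prems by (cases ws; simp)+
    then have "\<bar>E (w @ concat ws) - E w - E (concat ws)\<bar> \<le> B" by (rule E_append)
    then show ?thesis using Cons.IH Cons.prems by (auto simp: algebra_simps abs_le_iff)
  qed (use B_nonneg in simp)
qed simp

text \<open>Times at which the last letter lies in a fixed finite set are used, since the potential is not
  controlled by the last letter alone.\<close>

lemma approx_prefix:
  assumes lim: "birkhoff_limit T \<phi> (\<pi> \<omega>) a" and eps: "\<epsilon> > 0"
  shows "\<exists>n\<ge>N. \<bar>E (e0 # pre \<omega> n) - real n * (a - \<alpha>)\<bar> \<le> \<epsilon> * real n"
proof -
  have lim': "(\<lambda>n. S n \<omega> / real n) \<longlonglongrightarrow> a"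
    using lim by (simp add: birkhoff_limit_def S_def T_pow_\<pi>)
  obtain F where F: "finite F" "\<And>\<omega>. \<omega> 0 \<notin> F \<Longrightarrow> \<phi> (\<pi> \<omega>) < a - 1" using phi_low by blast
  \<comment> \<open>If the letters stayed outside \<open>F\<close> from some time on, every further
    summand would be below \<open>a - 1\<close> and the averages would end up below
    \<open>a - 1 / 2\<close>.\<close>
  have often: "\<exists>k\<ge>N. \<omega> k \<in> F" for N
  proof (rule ccontr)
    assume "\<not> ?thesis"
    then have "\<phi> (\<pi> (shiftn k \<omega>)) < a - 1" if "k \<ge> N" for k
      using that by (intro F(2)) (auto simp: shiftn_def)
    then have S: "S (N + n) \<omega> \<le> S N \<omega> + real n * (a - 1)" for n
    proof -
      have "S n (shiftn N \<omega>) \<le> (\<Sum>k<n. a - 1)"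
        unfolding S_def by (intro sum_mono) (simp add: shiftn_shiftn \<open>\<And>k. k \<ge> N \<Longrightarrow> \<phi> (\<pi> (shiftn k \<omega>)) < a - 1\<close> less_imp_le)
      then show ?thesis by (simp add: S_add)
    qed
    obtain n1 where n1: "\<And>n. n \<ge> n1 \<Longrightarrow> \<bar>S n \<omega> / real n - a\<bar> < 1 / 2"
      using LIMSEQ_D[OF lim', of "1 / 2"] by auto
    define X where "X = S N \<omega> - real N * (a - 1 / 2)"
    obtain n2 where n2: "real n2 > 2 * X" using reals_Archimedean2 by blast
    define n where "n = n1 + n2 + 1"
    have "a - 1 / 2 < S (N + n) \<omega> / real (N + n)" proof -
      have "\<bar>S (N + n) \<omega> / real (N + n) - a\<bar> < 1 / 2" by (rule n1) (simp add: n_def)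
      then show ?thesis by linarith
    qed
    then have "(a - 1 / 2) * real (N + n) < S (N + n) \<omega>" by (simp add: n_def pos_less_divide_eq del: of_nat_add)
    also have "\<dots> \<le> S N \<omega> + real n * (a - 1)" by (rule S)
    finally have "real n / 2 < X" by (simp add: X_def field_simps)
    moreover have "real n \<ge> real n2" by (simp add: n_def)
    ultimately have False using n2 by linarith
    then show False by simp
  qed
  define CF where "CF = (\<Sum>i\<in>F. \<bar>\<phi> (\<pi> (ext [i]))\<bar>)"
  have CF: "\<bar>\<phi> (\<pi> (ext [i]))\<bar> \<le> CF" if "i \<in> F" for i
    unfolding CF_def using that F(1) by (intro member_le_sum) auto
  let ?\<omega>' = "case_nat e0 \<omega>"
  define Q where "Q = B + \<bar>\<phi> (\<pi> ?\<omega>')\<bar> + CF + \<bar>a\<bar> + \<bar>\<alpha>\<bar>"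
  obtain n1 where n1: "\<And>n. n \<ge> n1 \<Longrightarrow> \<bar>S n \<omega> / real n - a\<bar> < \<epsilon> / 2"
    using LIMSEQ_D[OF lim', of "\<epsilon> / 2"] eps by auto
  obtain n2 where n2: "real n2 > 2 * Q / \<epsilon>" using reals_Archimedean2 by blast
  obtain k where k: "k \<ge> N + n1 + n2 + 1" "\<omega> k \<in> F" using often by blast
  let ?n = "Suc k" and ?w = "e0 # pre \<omega> (Suc k)"
  have 1: "\<bar>S ?n (ext ?w) - S ?n ?\<omega>'\<bar> \<le> B"
  proof (rule S_close)
    fix j assume "j \<le> ?n"
    then show "ext ?w j = ?\<omega>' j" by (cases j) (auto simp: ext_def)
  qed
  have sh: "shiftn ?n (ext ?w) = ext [\<omega> k]"
  proof -
    have "?w = (e0 # pre \<omega> k) @ [\<omega> k]" by (simp add: pre_def)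
    then show ?thesis using shiftn_ext_append[of "e0 # pre \<omega> k" "[\<omega> k]"] by simp
  qed
  have "S (?n + 1) (ext ?w) = S ?n (ext ?w) + S 1 (ext [\<omega> k])"
    unfolding S_add[of ?n 1] sh ..
  moreover have "S 1 \<eta> = \<phi> (\<pi> \<eta>)" for \<eta> by (simp add: S_def shiftn_def)
  ultimately have 2: "S (?n + 1) (ext ?w) = S ?n (ext ?w) + \<phi> (\<pi> (ext [\<omega> k]))" by simp
  have "shiftn 1 ?\<omega>' = \<omega>" by (simp add: shiftn_def)
  then have 3: "S ?n ?\<omega>' = \<phi> (\<pi> ?\<omega>') + S k \<omega>"
    using S_add[of 1 k ?\<omega>'] by (simp add: S_def shiftn_def)
  have "\<bar>S k \<omega> / real k - a\<bar> < \<epsilon> / 2" using k by (intro n1) auto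
  then have "\<bar>(S k \<omega> - real k * a) / real k\<bar> < \<epsilon> / 2" using k by (simp add: diff_divide_distrib)
  then have 4: "\<bar>S k \<omega> - real k * a\<bar> \<le> \<epsilon> / 2 * real k" using k by (simp add: abs_divide field_simps)
  have 5: "E ?w = S (?n + 1) (ext ?w) - (real ?n + 1) * \<alpha>" by (simp add: E_def)
  have "\<bar>E ?w - real ?n * (a - \<alpha>)\<bar> \<le> B + \<bar>\<phi> (\<pi> ?\<omega>')\<bar> + CF + \<bar>a\<bar> + \<bar>\<alpha>\<bar> + \<epsilon> / 2 * real k"
  proof -
    have "E ?w - real ?n * (a - \<alpha>) = (S ?n (ext ?w) - S ?n ?\<omega>') + \<phi> (\<pi> (ext [\<omega> k])) + \<phi> (\<pi> ?\<omega>')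
        + (S k \<omega> - real k * a) - a - \<alpha>"
      unfolding 5 2 3 by (simp add: algebra_simps)
    then show ?thesis using 1 4 CF[OF k(2)] by linarith
  qed
  also have "\<dots> \<le> \<epsilon> * real ?n"
  proof -
    have "2 * Q / \<epsilon> < real k" using k n2 by linarith
    then have "2 * Q < \<epsilon> * real k" using eps by (simp add: field_simps)
    then show ?thesis using eps by (simp add: Q_def algebra_simps)
  qed
  finally show ?thesis using k by (intro exI[of _ ?n]) auto
qed

subsection \<open>Words with prescribed deviation\<close>

text \<open>Some orbit has an average \<open>a > \<alpha>\<close>; its long prefixes deviate upwards
  by at least half of \<open>n * (a - \<alpha>)\<close>.\<close>

lemma ex_high: "\<exists>v. v \<noteq> [] \<and> hd v = e0 \<and> E v \<ge> C"
proof -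
  obtain a x where a: "\<alpha> < a" "x \<in> \<Lambda>" "birkhoff_limit T \<phi> x a"
    using alpha unfolding alpha_max_def less_Sup_iff by auto
  obtain \<omega> where x: "x = \<pi> \<omega>" using a(2) cod_range by blast
  obtain N where N: "real N > 2 * C / (a - \<alpha>)" using reals_Archimedean2 by blast
  obtain n where n: "n \<ge> N" "\<bar>E (e0 # pre \<omega> n) - real n * (a - \<alpha>)\<bar> \<le> (a - \<alpha>) / 2 * real n"
    using approx_prefix[of \<omega> a "(a - \<alpha>) / 2" N] a x by auto
  have "2 * C / (a - \<alpha>) < real n" using n N by linarith
  then have "C < (a - \<alpha>) / 2 * real n" using a by (simp add: field_simps)
  then have "C \<le> E (e0 # pre \<omega> n)" 
  proof -
    have "(a - \<alpha>) / 2 * real n = real n * (a - \<alpha>) / 2" by simp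
    with n(2) show "C < (a - \<alpha>) / 2 * real n \<Longrightarrow> ?thesis" by linarith
  qed
  then show ?thesis by (intro exI[of _ "e0 # pre \<omega> n"]) auto
qed

text \<open>A single letter whose interval is close to 0 pushes the sum down as far as desired,
  which is why every level below \<open>alpha_max\<close> is reached.\<close>

lemma ex_low: "\<exists>u. u \<noteq> [] \<and> hd u = e0 \<and> E u \<le> - C"
proof -
  \<comment> \<open>The term \<open>2 * \<alpha>\<close> cancels the normalisation in
    \<open>E\<close> of a word of length 2.\<close>
  obtain F where F: "finite F" "\<And>\<omega>. \<omega> 0 \<notin> F \<Longrightarrow> \<phi> (\<pi> \<omega>) < - C + 2 * \<alpha>" using phi_low by blast
  obtain i where i: "i \<notin> F" using F(1) by (meson ex_new_if_finite infinite_UNIV_nat)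
  have "shiftn 1 (ext [e0, i]) = ext [i]" using shiftn_ext_append[of "[e0]" "[i]"] by simp
  then have "S 2 (ext [e0, i]) = \<phi> (\<pi> (ext [e0, i])) + \<phi> (\<pi> (ext [i]))"
    by (simp add: S_def numeral_2_eq_2) (simp add: shiftn_def)
  moreover have "\<phi> (\<pi> (ext [i])) < - C + 2 * \<alpha>" using i by (intro F(2)) (simp add: ext_def)
  moreover have "\<phi> (\<pi> (ext [e0, i])) < 0" by (rule phi_neg[OF \<pi>_in])
  ultimately have "E [e0, i] \<le> - C" by (simp add: E_def numeral_2_eq_2)
  then show ?thesis by (intro exI[of _ "[e0, i]"]) auto
qed

lemma concat_replicate_EW:
  assumes "v \<noteq> []" "hd v = e0" "k \<ge> 1"
  shows "concat (replicate k v) \<in> EW (k * length v)"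
  using assms by (cases k) (auto simp: EW_def length_concat sum_list_replicate)

lemma E_replicate:
  assumes "v \<noteq> []" "hd v = e0"
  shows "\<bar>E (concat (replicate k v)) - real k * E v\<bar> \<le> B * real k"
  using E_concat[of "replicate k v"] assms by (auto simp: sum_list_replicate split: if_splits)

text \<open>Repeating each word as often as the other one is long gives equal lengths. Starting from
  deviation \<open>C + B\<close> pays the concatenation error \<open>B\<close> of each
  repetition.\<close>

lemma ex_correctors:
  assumes C: "C \<ge> 0"
  shows "\<exists>l\<ge>1. \<exists>v u. v \<in> EW l \<and> u \<in> EW l \<and> E v \<ge> C \<and> E u \<le> - C"
proof -
  obtain v where v: "v \<noteq> []" "hd v = e0" "E v \<ge> C + B" using ex_high by blast
  obtain u where u: "u \<noteq> []" "hd u = e0" "E u \<le> - (C + B)" using ex_low by blast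
  let ?v = "concat (replicate (length u) v)" and ?u = "concat (replicate (length v) u)"
  have lens: "length u \<ge> 1" "length v \<ge> 1" using u(1) v(1) by (simp_all add: Suc_leI)
  have "C \<le> real (length u) * C" "C \<le> real (length v) * C"
    using lens C mult_right_mono[of 1 "real (length u)" C] mult_right_mono[of 1 "real (length v)" C] by auto
  moreover have "real (length u) * (C + B) \<le> real (length u) * E v" using v(3) by (intro mult_left_mono) auto
  moreover have "real (length v) * E u \<le> real (length v) * (- (C + B))" using u(3) by (intro mult_left_mono) auto
  ultimately have "C \<le> E ?v" "E ?u \<le> - C"
    using E_replicate[OF v(1,2), of "length u"] E_replicate[OF u(1,2), of "length v"]
    by (auto simp: abs_le_iff algebra_simps)
  moreover have "?v \<in> EW (length u * length v)" "?u \<in> EW (length u * length v)"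
    using concat_replicate_EW[OF v(1,2) lens(1)] concat_replicate_EW[OF u(1,2) lens(2)] by (simp_all add: mult.commute)
  moreover have "length u * length v \<ge> 1" using lens by (metis One_nat_def mult_le_mono nat_mult_1)
  ultimately show ?thesis by blast
qed

text \<open>The steering condition: words of a common length that push the Birkhoff sum up, and words that
  push it down, each family carrying enough \<open>s\<close>-dimensional mass.\<close>

definition good :: "real \<Rightarrow> bool" where
  "good s \<longleftrightarrow> (\<exists>L\<ge>1. \<exists>Wp Wm. finite Wp \<and> finite Wm \<and> Wp \<subseteq> EW L \<and> Wm \<subseteq> EW L \<and>
     (\<forall>w\<in>Wp. E w \<ge> B) \<and> (\<forall>w\<in>Wm. E w \<le> - B) \<and>
     (\<Sum>w\<in>Wp. (r w / D) powr s) \<ge> 1 \<and> (\<Sum>w\<in>Wm. (r w / D) powr s) \<ge> 1)"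

lemma goodI:
  assumes "L \<ge> 1" "finite Wp" "finite Wm" "Wp \<subseteq> EW L" "Wm \<subseteq> EW L"
    "\<And>w. w \<in> Wp \<Longrightarrow> E w \<ge> B" "\<And>w. w \<in> Wm \<Longrightarrow> E w \<le> - B"
    "(\<Sum>w\<in>Wp. (r w / D) powr s) \<ge> 1" "(\<Sum>w\<in>Wm. (r w / D) powr s) \<ge> 1"
  shows "good s"
  unfolding good_def
  by (rule exI[of _ L], rule conjI[OF assms(1)], rule exI[of _ Wp], rule exI[of _ Wm]) (intro conjI ballI assms)

text \<open>Weaker than steering in that one family of nearly neutral words suffices and the weights
  carry no distortion constant; in return such families must exist at arbitrarily large lengths and
  for every rate \<open>\<epsilon>\<close>.\<close>

definition approx_good :: "real \<Rightarrow> bool" where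
  "approx_good s \<longleftrightarrow> (\<forall>\<epsilon>>0. \<forall>L0. \<exists>L\<ge>L0. \<exists>W. finite W \<and> W \<subseteq> EW L \<and>
     (\<forall>w\<in>W. \<bar>E w\<bar> \<le> \<epsilon> * real L) \<and> (\<Sum>w\<in>W. r w powr s) \<ge> 1)"

lemma rD: "0 < r w / D" "r w / D \<le> 1"
  using r_pos[of w] r_le1[of w] D_ge1 by (auto simp: field_simps)

lemma good_0: "good 0"
proof -
  obtain l v u where l: "l \<ge> 1" "v \<in> EW l" "u \<in> EW l" "E v \<ge> B" "E u \<le> - B"
    using ex_correctors[OF B_nonneg] by blast
  then show ?thesis
    using r_pos[of v] r_pos[of u] D_ge1 by (intro goodI[of l "{v}" "{u}"]) auto
qed

lemma good_mono: "good s \<Longrightarrow> t \<le> s \<Longrightarrow> good t"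
proof -
  assume "good s" and t: "t \<le> s"
  then obtain L Wp Wm where g: "L \<ge> 1" "finite Wp" "finite Wm" "Wp \<subseteq> EW L" "Wm \<subseteq> EW L"
    "\<forall>w\<in>Wp. E w \<ge> B" "\<forall>w\<in>Wm. E w \<le> - B"
    "(\<Sum>w\<in>Wp. (r w / D) powr s) \<ge> 1" "(\<Sum>w\<in>Wm. (r w / D) powr s) \<ge> 1" unfolding good_def by blast
  have "(r w / D) powr s \<le> (r w / D) powr t" for w using t rD[of w] by (intro powr_mono') auto
  then have "(\<Sum>w\<in>W. (r w / D) powr s) \<le> (\<Sum>w\<in>W. (r w / D) powr t)" for W by (rule sum_mono)
  then have "1 \<le> (\<Sum>w\<in>Wp. (r w / D) powr t)" "1 \<le> (\<Sum>w\<in>Wm. (r w / D) powr t)"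
    using g(8,9) order_trans by blast+
  then show ?thesis unfolding good_def using g by blast
qed

lemma ln_r_small: "ln (r w) \<le> ln C0 - real (length w) * ln \<xi>"
proof -
  have "ln (r w) \<le> ln (C0 * (1 / \<xi>) ^ length w)"
    using r_small[of w] r_pos[of w] by (intro ln_mono) auto
  also have "\<dots> = ln C0 + real (length w) * ln (1 / \<xi>)"
    using C0_ge1 \<xi>_gt1 by (simp add: ln_mult ln_realpow)
  finally show ?thesis using \<xi>_gt1 by (simp add: ln_div)
qed

lemma r_Nil: "r [] = M"
  using M_bounds by (simp add: r_def)

lemma ln_r_replicate: "ln (r (concat (replicate k v))) \<ge> ln M + real k * (ln (r v) - 3 * D0)"
proof (induction k)
  case (Suc k)
  then show ?case using r_append[of v "concat (replicate k v)"] by (simp add: algebra_simps abs_le_iff)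
qed (simp add: r_Nil)

text \<open>Appending \<open>k\<close> copies of a corrector overrules the deviation of
  \<open>w\<close> and shrinks the cylinder by about \<open>exp (- A * k)\<close> with
  \<open>k\<close> of order \<open>\<epsilon> * L\<close>. Lowering the exponent gains
  \<open>exp ((s - s') * L * ln \<xi>)\<close> up to constants, which wins for small
  \<open>\<epsilon>\<close>.\<close>

lemma good_of_approx_good:
  assumes ag: "approx_good s" and s': "0 \<le> s'" "s' < s"
  shows "good s'"
proof -
  obtain l v u where l: "l \<ge> 1" "v \<in> EW l" "u \<in> EW l" "E v \<ge> B + 1" "E u \<le> - (B + 1)"
    using ex_correctors[of "B + 1"] B_nonneg by auto
  \<comment> \<open>Bounds the loss in logarithmic length per appended copy, distortion
    included.\<close>
  define A where "A = max (- ln (r v)) (- ln (r u)) + 3 * D0"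
  have "ln (r v) \<le> 0" using r_pos[of v] r_le1[of v] by simp
  then have A: "A \<ge> 0" using D0_nonneg by (simp add: A_def)
  \<comment> \<open>With this choice the correctors consume at most half of the gain; the summand 1
    keeps the denominator positive when \<open>s' * A = 0\<close>.\<close>
  define \<epsilon> where "\<epsilon> = (s - s') * ln \<xi> / (2 * (s' * A + 1))"
  have lnx: "ln \<xi> > 0" using \<xi>_gt1 by simp
  have sA: "s' * A + 1 > 0" using s' A by (simp add: add_nonneg_pos)
  have eps: "\<epsilon> > 0" using s' lnx sA by (simp add: \<epsilon>_def)
  have epsA: "s' * A * \<epsilon> \<le> (s - s') * ln \<xi> / 2"
  proof -
    have "s' * A * \<epsilon> \<le> (s' * A + 1) * \<epsilon>" using eps by (simp add: algebra_simps)
    also have "\<dots> = (s - s') * ln \<xi> / 2" using sA unfolding \<epsilon>_def by (simp add: divide_simps)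
    finally show ?thesis .
  qed
  \<comment> \<open>Collects what does not grow with \<open>L\<close>; the other half of the gain
    has to exceed it.\<close>
  define Q where "Q = s' * (6 * D0 + (2 * B + 2) * A - ln M) + (s - s') * ln C0"
  obtain L0 where L0: "real L0 > Q / ((s - s') * ln \<xi> / 2)" using reals_Archimedean2 by blast
  obtain L W where L: "L \<ge> L0" and W: "finite W" "W \<subseteq> EW L" "\<And>w. w \<in> W \<Longrightarrow> \<bar>E w\<bar> \<le> \<epsilon> * real L"
    "(\<Sum>w\<in>W. r w powr s) \<ge> 1" using ag eps unfolding approx_good_def by meson
  \<comment> \<open>Each copy moves the sum by at least 1 after its concatenation error. Of the
    \<open>\<epsilon> * L + 2 * B\<close> units, the first part undoes \<open>E w\<close>, one
    \<open>B\<close> pays for the last concatenation and one \<open>B\<close> remains.\<close>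
  define k where "k = nat \<lceil>\<epsilon> * real L + 2 * B\<rceil> + 1"
  have k: "real k \<ge> \<epsilon> * real L + 2 * B" "real k \<le> \<epsilon> * real L + 2 * B + 2"
  proof -
    have "0 \<le> \<epsilon> * real L + 2 * B" using eps B_nonneg by simp
    then have "real k = real_of_int \<lceil>\<epsilon> * real L + 2 * B\<rceil> + 1" by (simp add: k_def)
    then show "real k \<ge> \<epsilon> * real L + 2 * B" "real k \<le> \<epsilon> * real L + 2 * B + 2"
      using le_of_int_ceiling[of "\<epsilon> * real L + 2 * B"] of_int_ceiling_le_add_one[of "\<epsilon> * real L + 2 * B"]
      by linarith+
  qed
  have k1: "k \<ge> 1" by (simp add: k_def)
  have QL: "Q \<le> (s - s') * ln \<xi> / 2 * real L"
  proof -
    have "Q / ((s - s') * ln \<xi> / 2) \<le> real L" using L0 L by linarith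
    then show ?thesis using s' lnx by (simp add: field_simps)
  qed
  have main: "(\<Sum>x\<in>(\<lambda>w. w @ concat (replicate k z)) ` W. (r x / D) powr s') \<ge> 1"
    if z: "z = v \<or> z = u" for z
  proof -
    have lnz: "ln (r z) - 3 * D0 \<ge> - A" using z by (auto simp: A_def)
    have *: "r w powr s \<le> (r (w @ concat (replicate k z)) / D) powr s'" if w: "w \<in> W" for w
    proof -
      let ?x = "w @ concat (replicate k z)"
      have len: "length w = L" using W(2) w EW_D(1) by blast
      have "ln (r ?x) \<ge> ln (r w) - 3 * D0 + ln (r (concat (replicate k z)))"
        using r_append[of w "concat (replicate k z)"] by (simp add: abs_le_iff)
      moreover have "ln (r (concat (replicate k z))) \<ge> ln M + real k * (- A)"
        using ln_r_replicate[of k z] mult_left_mono[OF lnz, of "real k"] by simp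
      moreover have "real k * A \<le> (\<epsilon> * real L + 2 * B + 2) * A" using k(2) A by (rule mult_right_mono)
      ultimately have 1: "ln (r ?x) - 3 * D0 \<ge> ln (r w) - 6 * D0 + ln M - (\<epsilon> * real L + 2 * B + 2) * A" by simp
      have "(s - s') * ln (r w) \<le> (s - s') * (ln C0 - real L * ln \<xi>)"
        using ln_r_small[of w] s' len by (intro mult_left_mono) auto
      moreover have "s' * A * \<epsilon> * real L \<le> (s - s') * ln \<xi> / 2 * real L" using epsA by (rule mult_right_mono) simp
      ultimately have "s * ln (r w) \<le> s' * (ln (r w) - 6 * D0 + ln M - (\<epsilon> * real L + 2 * B + 2) * A)"
        using QL by (simp add: Q_def algebra_simps)
      also have "\<dots> \<le> s' * (ln (r ?x) - 3 * D0)" using 1 s' by (intro mult_left_mono)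
      finally have "s * ln (r w) \<le> s' * ln (r ?x / D)" using r_pos[of ?x] by (simp add: D_def ln_div)
      then show ?thesis using r_pos[of w] rD(1)[of ?x] r_pos[of ?x] D_ge1 by (simp add: powr_def)
    qed
    have "inj_on (\<lambda>w. w @ concat (replicate k z)) W" by (auto intro: inj_onI)
    then have "(\<Sum>x\<in>(\<lambda>w. w @ concat (replicate k z)) ` W. (r x / D) powr s') =
        (\<Sum>w\<in>W. (r (w @ concat (replicate k z)) / D) powr s')" by (simp add: sum.reindex)
    also have "\<dots> \<ge> (\<Sum>w\<in>W. r w powr s)" using * by (rule sum_mono)
    finally show ?thesis using W(4) by linarith
  qed
  have EWx: "(\<lambda>w. w @ concat (replicate k z)) ` W \<subseteq> EW (L + k * l)" if "z \<in> EW l" for z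
  proof -
    have "concat (replicate k z) \<in> EW (k * l)"
      using concat_replicate_EW[of z k] k1 EW_D[OF that] by simp
    then show ?thesis using W(2) by (fastforce simp: EW_def)
  qed
  have Ex: "\<bar>E (w @ concat (replicate k z)) - E w - E (concat (replicate k z))\<bar> \<le> B" if "z \<in> EW l" for z w
    using concat_replicate_EW[of z k] k1 EW_D[OF that] by (intro E_append) (auto simp: EW_def)
  have up: "E (w @ concat (replicate k v)) \<ge> B" if "w \<in> W" for w
  proof -
    have "real k * (B + 1) \<le> real k * E v" using l(4) by (intro mult_left_mono) auto
    then have "E (concat (replicate k v)) \<ge> real k"
      using E_replicate[of v k] EW_D[OF l(2)] by (auto simp: abs_le_iff algebra_simps)
    then show ?thesis using Ex[OF l(2), of w] W(3)[OF that] k(1) by (auto simp: abs_le_iff)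
  qed
  have down: "E (w @ concat (replicate k u)) \<le> - B" if "w \<in> W" for w
  proof -
    have "real k * E u \<le> real k * (- (B + 1))" using l(5) by (intro mult_left_mono) auto
    then have "E (concat (replicate k u)) \<le> - real k"
      using E_replicate[of u k] EW_D[OF l(3)] by (auto simp: abs_le_iff algebra_simps)
    then show ?thesis using Ex[OF l(3), of w] W(3)[OF that] k(1) by (auto simp: abs_le_iff)
  qed
  have "1 \<le> k * l" using k1 l(1) by (metis One_nat_def mult_le_mono nat_mult_1)
  then have "1 \<le> L + k * l" by linarith
  then show ?thesis
    using main EWx l(2,3) W(1) up down
    by (intro goodI[of "L + k * l" "(\<lambda>w. w @ concat (replicate k v)) ` W" "(\<lambda>w. w @ concat (replicate k u)) ` W"]) (auto simp del: One_nat_def)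
qed

end

section \<open>The upper bound for the dimension\<close>

context emr_level
begin

lemma geometric_tail:
  fixes p :: real
  assumes "0 \<le> p" "p < 1" "finite F" "\<And>L. L \<in> F \<Longrightarrow> N \<le> L"
  shows "(\<Sum>L\<in>F. p ^ L) \<le> p ^ N * (1 / (1 - p))"
proof -
  have "(\<Sum>L\<in>F. p ^ L) = (\<Sum>j\<in>(\<lambda>L. L - N) ` F. p ^ (N + j))"
    by (rule sum.reindex_bij_witness[of _ "\<lambda>j. N + j" "\<lambda>L. L - N"]) (use assms(4) in auto)
  also have "\<dots> = p ^ N * (\<Sum>j\<in>(\<lambda>L. L - N) ` F. p ^ j)"
    by (simp add: power_add sum_distrib_left)
  also have "(\<Sum>j\<in>(\<lambda>L. L - N) ` F. p ^ j) \<le> (\<Sum>j. p ^ j)"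
    using assms by (intro sum_le_suminf summable_geometric) auto
  also have "(\<Sum>j. p ^ j) = 1 / (1 - p)" using assms by (intro suminf_geometric) auto
  finally show ?thesis using assms by (simp add: mult_left_mono)
qed

lemma diameter_cylinder: "diameter (closure (U w)) \<le> r w"
  using r_ge[of _ w] r_pos[of w] by (intro diameter_le) (auto simp: dist_real_def)

lemma bounded_cylinder: "bounded (closure (U w))"
proof -
  have "U w \<subseteq> {0..M}" using U_sub[of w] by auto
  then have "bounded (U w)" by (rule bounded_subset[OF compact_imp_bounded[OF compact_Icc]])
  then show ?thesis by (rule bounded_closure)
qed

text \<open>Every point of the level set has arbitrarily long prefixes of small deviation, so their
  cylinders cover it at any scale. At each length \<open>L\<close> the \<open>s\<close>-mass is
  bounded by 1, and the surplus \<open>t - s\<close> of the exponent contributes the factor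
  \<open>p ^ L\<close>, which is summable.\<close>

lemma hausdorff_measure_level_eq_0:
  assumes nag: "\<not> approx_good s" and s: "0 \<le> s" and t: "s < t"
  shows "hausdorff_measure t (level_set T I \<phi> \<alpha>) = 0"
proof -
  let ?J = "level_set T I \<phi> \<alpha>"
  obtain \<epsilon> L0 where eps: "\<epsilon> > 0" and L0: "\<And>L W. L \<ge> L0 \<Longrightarrow> finite W \<Longrightarrow> W \<subseteq> EW L \<Longrightarrow>
      (\<And>w. w \<in> W \<Longrightarrow> \<bar>E w\<bar> \<le> \<epsilon> * real L) \<Longrightarrow> (\<Sum>w\<in>W. r w powr s) < 1"
    using nag unfolding approx_good_def by (meson not_le)
  define q where "q = 1 / \<xi>"
  have q: "0 < q" "q < 1" using \<xi>_gt1 by (auto simp: q_def)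
  \<comment> \<open>The covering uses the cylinder of the prefix, whereas the mass bound concerns
    the prefix with \<open>e0\<close> put in front; \<open>c\<close> compares the two
    lengths.\<close>
  define c where "c = D / r [e0]"
  have c: "c > 0" using D_ge1 r_pos[of "[e0]"] by (simp add: c_def)
  have rc: "r (tl w) \<le> c * r w" if "w \<in> EW L" for w L
  proof -
    have "w = [e0] @ tl w" using EW_D(2,3)[OF that] by (cases w) auto
    then have "r [e0] * r (tl w) / D \<le> r w" using r_append_ge[of "[e0]" "tl w"] by simp
    then show ?thesis using D_ge1 r_pos[of "[e0]"] by (simp add: c_def field_simps)
  qed
  define p where "p = q powr (t - s)"
  have p: "0 < p" "p < 1" using q t powr_less_mono2[of "t - s" q 1] by (auto simp: p_def)
  define Kt where "Kt = c powr t * C0 powr (t - s)"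
  have Kt: "Kt > 0" using c C0_ge1 by (simp add: Kt_def)
  have pre: "hausdorff_premeasure \<delta> t ?J \<le> ennreal \<eta>" if \<delta>: "\<delta> > 0" and \<eta>: "\<eta> > 0" for \<delta> \<eta>
  proof -
    have "(\<lambda>N. c * C0 * q ^ N) \<longlonglongrightarrow> c * C0 * 0" "(\<lambda>N. Kt * (p ^ N * (1 / (1 - p)))) \<longlonglongrightarrow> Kt * (0 * (1 / (1 - p)))"
      using p q by (intro tendsto_mult tendsto_const LIMSEQ_power_zero; simp)+
    then have "\<forall>\<^sub>F N in sequentially. c * C0 * q ^ N < \<delta>" "\<forall>\<^sub>F N in sequentially. Kt * (p ^ N * (1 / (1 - p))) < \<eta>"
      using \<delta> \<eta> by (auto dest: order_tendstoD(2))
    then have "\<forall>\<^sub>F N in sequentially. c * C0 * q ^ N < \<delta> \<and> Kt * (p ^ N * (1 / (1 - p))) < \<eta> \<and> L0 \<le> N"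
      using eventually_ge_at_top[of L0] by eventually_elim auto
    then obtain N where N: "c * C0 * q ^ N < \<delta>" "Kt * (p ^ N * (1 / (1 - p))) < \<eta>" "L0 \<le> N"
      by (auto simp: eventually_sequentially)
    define GW where "GW = {w. w \<in> EW (length w) \<and> N \<le> length w \<and> \<bar>E w\<bar> \<le> \<epsilon> * real (length w)}"
    \<comment> \<open>The countable family \<open>GW\<close> is enumerated through
      \<open>to_nat\<close>; an index without a word receives the empty set, whose
      \<open>diam_power\<close> is 0.\<close>
    define V where "V i = (if \<exists>w\<in>GW. to_nat w = i then closure (U (tl (from_nat i))) else {})" for i
    have rGW: "r (tl w) \<le> c * C0 * q ^ length w" if "w \<in> GW" for w
    proof -
      have "r (tl w) \<le> c * r w" using that by (intro rc) (auto simp: GW_def)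
      also have "\<dots> \<le> c * (C0 * q ^ length w)" using r_small[of w] c by (simp add: q_def)
      finally show ?thesis by simp
    qed
    have Vd: "bounded (V i) \<and> diameter (V i) \<le> \<delta>" for i
    proof (cases "\<exists>w\<in>GW. to_nat w = i")
      case True
      then obtain w where w: "w \<in> GW" "to_nat w = i" by blast
      then have V: "V i = closure (U (tl w))" by (auto simp: V_def)
      have "q ^ length w \<le> q ^ N" using w(1) q by (intro power_decreasing) (auto simp: GW_def)
      then have "c * C0 * q ^ length w \<le> c * C0 * q ^ N" using c C0_ge1 by (intro mult_left_mono) auto
      then have "diameter (V i) \<le> \<delta>" unfolding V using diameter_cylinder[of "tl w"] rGW[OF w(1)] N(1) by linarith
      then show ?thesis using V bounded_cylinder by simp
    next
      case False
      then show ?thesis using \<delta> by (simp add: V_def)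
    qed
    have cov: "?J \<subseteq> (\<Union>i. V i)"
    proof
      fix x assume x: "x \<in> ?J"
      then obtain \<omega> where \<omega>: "x = \<pi> \<omega>" using cod_range by (auto simp: level_set_def)
      obtain n where n: "n \<ge> N" "\<bar>E (e0 # pre \<omega> n) - real n * (\<alpha> - \<alpha>)\<bar> \<le> \<epsilon> * real n"
        using approx_prefix[of \<omega> \<alpha> \<epsilon> N] x \<omega> eps by (auto simp: level_set_def)
      let ?w = "e0 # pre \<omega> n"
      have "\<epsilon> * real n \<le> \<epsilon> * real (length ?w)" using eps by simp
      then have "?w \<in> GW" using n by (simp add: GW_def EW_def del: of_nat_Suc)
      moreover have "x \<in> closure (U (tl ?w))" using \<pi>_closure[of \<omega> n] \<omega> by simp
      ultimately have "x \<in> V (to_nat ?w)" by (auto simp: V_def)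
      then show "x \<in> (\<Union>i. V i)" by blast
    qed
    have dp: "diam_power t (V i) \<le> (if \<exists>w\<in>GW. to_nat w = i then r (tl (from_nat i)) powr t else 0)" for i
    proof (cases "\<exists>w\<in>GW. to_nat w = i")
      case True
      then have V: "V i = closure (U (tl (from_nat i)))" by (auto simp: V_def)
      then have "V i \<noteq> {}" using U_nonempty by simp
      then have "diam_power t (V i) = diameter (V i) powr t" using s t by (simp add: diam_power_def)
      also have "\<dots> \<le> r (tl (from_nat i)) powr t"
        using V diameter_cylinder bounded_cylinder s t by (auto intro!: powr_mono2 diameter_ge_0)
      finally show ?thesis using True by simp
    qed (simp add: V_def diam_power_def)
    \<comment> \<open>There may be infinitely many such words of one length, while the mass bound
      concerns finite families; hence the passage through partial sums.\<close>
    have partial: "(\<Sum>i<n. diam_power t (V i)) \<le> \<eta>" for n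
    proof -
      let ?A = "{i \<in> {..<n}. \<exists>w\<in>GW. to_nat w = i}"
      define G where "G = (from_nat ` ?A :: nat list set)"
      have G: "finite G" "G \<subseteq> GW" by (auto simp: G_def)
      have "(\<Sum>i<n. diam_power t (V i)) \<le> (\<Sum>i<n. if \<exists>w\<in>GW. to_nat w = i then r (tl (from_nat i)) powr t else 0)"
        using dp by (rule sum_mono)
      also have "\<dots> = (\<Sum>i\<in>?A. r (tl (from_nat i)) powr t)"
        by (subst sum.If_cases) (auto intro!: sum.cong)
      also have "\<dots> = (\<Sum>w\<in>G. r (tl w) powr t)"
        unfolding G_def by (subst sum.reindex) (auto simp: inj_on_def)
      also have "\<dots> = (\<Sum>L\<in>length ` G. \<Sum>w\<in>{w\<in>G. length w = L}. r (tl w) powr t)"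
        by (rule sum.image_gen[OF G(1)])
      also have "\<dots> \<le> (\<Sum>L\<in>length ` G. Kt * p ^ L)"
      proof (rule sum_mono)
        fix L assume L: "L \<in> length ` G"
        then have NL: "N \<le> L" using G by (auto simp: GW_def)
        let ?W = "{w\<in>G. length w = L}"
        have "(\<Sum>w\<in>?W. r (tl w) powr t) \<le> (\<Sum>w\<in>?W. Kt * p ^ L * r w powr s)"
        proof (rule sum_mono)
          fix w assume w: "w \<in> ?W"
          have "r (tl w) powr t \<le> (c * r w) powr t"
            using rc[of w L] w G s t r_pos[of "tl w"] by (intro powr_mono2) (auto simp: GW_def)
          also have "\<dots> = c powr t * (r w powr s * r w powr (t - s))"
            using c r_pos[of w] by (simp add: powr_mult flip: powr_add)
          also have "r w powr (t - s) \<le> (C0 * q ^ L) powr (t - s)"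
            using r_small[of w] w t r_pos[of w] by (intro powr_mono2) (auto simp: q_def)
          also have "(C0 * q ^ L) powr (t - s) = C0 powr (t - s) * p ^ L"
            using C0_ge1 q by (simp add: powr_mult p_def powr_powr powr_realpow[symmetric] mult.commute)
          finally show "r (tl w) powr t \<le> Kt * p ^ L * r w powr s"
            using c by (simp add: Kt_def mult_left_mono mult_right_mono algebra_simps)
        qed
        also have "\<dots> = Kt * p ^ L * (\<Sum>w\<in>?W. r w powr s)" by (simp add: sum_distrib_left)
        also have "\<dots> \<le> Kt * p ^ L * 1"
        proof (rule mult_left_mono)
          show "(\<Sum>w\<in>?W. r w powr s) \<le> 1"
            using L0[of L ?W] NL N(3) G by (fastforce simp: GW_def intro: less_imp_le)
        qed (use Kt p in auto)
        finally show "(\<Sum>w\<in>?W. r (tl w) powr t) \<le> Kt * p ^ L" by simp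
      qed
      also have "\<dots> = Kt * (\<Sum>L\<in>length ` G. p ^ L)" by (simp add: sum_distrib_left)
      also have "\<dots> \<le> Kt * (p ^ N * (1 / (1 - p)))"
        using G p Kt by (intro mult_left_mono geometric_tail) (auto simp: GW_def)
      also have "\<dots> \<le> \<eta>" using N(2) by simp
      finally show ?thesis .
    qed
    have dnn: "diam_power t (V i) \<ge> 0" for i by (simp add: diam_power_def)
    have "hausdorff_premeasure \<delta> t ?J \<le> (\<Sum>i. ennreal (diam_power t (V i)))"
      unfolding hausdorff_premeasure_def by (rule INF_lower) (use Vd cov in auto)
    also have "\<dots> \<le> ennreal \<eta>"
      unfolding suminf_eq_SUP
      by (rule SUP_least) (use partial dnn in \<open>auto simp: sum_ennreal intro!: ennreal_leI\<close>)
    finally show ?thesis .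
  qed
  have "hausdorff_premeasure \<delta> t ?J = 0" if "\<delta> > 0" for \<delta>
  proof -
    have "hausdorff_premeasure \<delta> t ?J \<le> 0"
      by (rule ennreal_le_epsilon) (use pre[OF that] in auto)
    then show ?thesis by simp
  qed
  then show ?thesis unfolding hausdorff_measure_def by simp
qed

lemma dim_level_le:
  assumes "\<not> approx_good s" "0 \<le> s" "s < t"
  shows "hausdorff_dim (level_set T I \<phi> \<alpha>) \<le> ereal t"
  unfolding hausdorff_dim_def
  by (rule Inf_lower) (use hausdorff_measure_level_eq_0[OF assms] assms in auto)

end

section \<open>The lower bound for the dimension\<close>

lemma ex_pmf_proportional:
  fixes f :: "'a \<Rightarrow> real"
  assumes "finite W" "\<And>w. w \<in> W \<Longrightarrow> 0 \<le> f w" "0 < sum f W"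
  shows "\<exists>P. set_pmf P \<subseteq> W \<and> (\<forall>w\<in>W. pmf P w = f w / sum f W)"
proof -
  define g where "g w = (if w \<in> W then f w / sum f W else 0)" for w
  have g0: "g w \<ge> 0" for w using assms by (simp add: g_def)
  have "(\<integral>\<^sup>+w. ennreal (g w) \<partial>count_space UNIV) = (\<Sum>w\<in>W. ennreal (g w))"
    using assms(1) by (intro nn_integral_count_space') (auto simp: g_def)
  also have "\<dots> = ennreal (\<Sum>w\<in>W. g w)" using g0 by (rule sum_ennreal)
  also have "(\<Sum>w\<in>W. g w) = 1" using assms(3) by (simp add: g_def flip: sum_divide_distrib)
  finally have "pmf (embed_pmf g) w = g w" for w using g0 by (intro pmf_embed_pmf) auto
  then show ?thesis
    by (intro exI[of _ "embed_pmf g"]) (auto simp: g_def set_pmf_iff split: if_splits)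
qed

lemma length_concat_const: "(\<And>w. w \<in> set ws \<Longrightarrow> length w = L) \<Longrightarrow> length (concat ws) = length ws * L"
  by (induction ws) auto

lemma pmf_le_of_proportional:
  assumes "set_pmf P \<subseteq> W" "\<forall>w\<in>W. pmf P w = f w / sum f W" "1 \<le> sum f W" "\<And>w. 0 \<le> f w"
  shows "pmf P w \<le> f w"
proof (cases "w \<in> W")
  case True
  have "f w / sum f W \<le> f w / 1" using assms(3,4) by (intro divide_left_mono) auto
  then show ?thesis using True assms(2) by simp
next
  case False
  then have "pmf P w = 0" using assms(1) by (auto simp: set_pmf_iff)
  then show ?thesis using assms(4) by simp
qed

context emr_level
begin

text \<open>The intervals are disjoint, have length at least \<open>\<kappa> * \<rho>\<close> and
  all lie within \<open>2 * \<rho>\<close> of \<open>ctr\<close>, so comparing Lebesgue measures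
  bounds their number.\<close>

lemma count_cylinders:
  assumes C: "finite C" and disj: "\<And>k k'. k \<in> C \<Longrightarrow> k' \<in> C \<Longrightarrow> k \<noteq> k' \<Longrightarrow> U (f k) \<inter> U (f k') = {}"
    and size: "\<And>k. k \<in> C \<Longrightarrow> \<kappa> * \<rho> \<le> r (f k) \<and> r (f k) \<le> \<rho>"
    and hit: "\<And>k. k \<in> C \<Longrightarrow> \<exists>z\<in>closure (U (f k)). \<bar>z - ctr\<bar> \<le> \<rho>" and rho: "\<rho> > 0"
  shows "\<kappa> * real (card C) \<le> 4"
proof -
  define V where "V w = {Inf (U w)<..<Sup (U w)}" for w
  have VU: "V w \<subseteq> U w" for w
  proof
    fix y assume y: "y \<in> V w"
    then obtain a b where "a \<in> U w" "a < y" "b \<in> U w" "y < b"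
      using cInf_lessD[OF U_nonempty, of w y] less_cSupD[OF U_nonempty, of y w] by (auto simp: V_def)
    then show "y \<in> U w" using U_between[of a w b y] by auto
  qed
  have mV: "measure lborel (V w) = r w" for w
    using r_pos[of w] by (simp add: V_def r_def)
  have "(\<Sum>k\<in>C. \<kappa> * \<rho>) \<le> (\<Sum>k\<in>C. measure lborel (V (f k)))"
    unfolding mV using size by (intro sum_mono) auto
  also have "\<dots> = measure lborel (\<Union>k\<in>C. V (f k))"
  proof (rule measure_finite_Union[symmetric, OF C])
    show "disjoint_family_on (\<lambda>k. V (f k)) C"
      unfolding disjoint_family_on_def using disj VU by blast
  next
    fix k
    have "Inf (U (f k)) \<le> Sup (U (f k))" using r_pos[of "f k"] by (simp add: r_def)
    then show "emeasure lborel (V (f k)) \<noteq> \<infinity>" by (simp add: V_def)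
  qed (auto simp: V_def)
  also have "\<dots> \<le> measure lborel {ctr - 2 * \<rho>..ctr + 2 * \<rho>}"
  proof (rule measure_mono_fmeasurable)
    show "(\<Union>k\<in>C. V (f k)) \<subseteq> {ctr - 2 * \<rho>..ctr + 2 * \<rho>}"
    proof
      fix y assume "y \<in> (\<Union>k\<in>C. V (f k))"
      then obtain k where k: "k \<in> C" "y \<in> U (f k)" using VU by blast
      obtain z where z: "z \<in> closure (U (f k))" "\<bar>z - ctr\<bar> \<le> \<rho>" using hit k(1) by blast
      have "y \<in> closure (U (f k))" using k(2) closure_subset by blast
      then have "\<bar>y - z\<bar> \<le> \<rho>" using r_ge[OF _ z(1)] size[OF k(1)] by force
      then show "y \<in> {ctr - 2 * \<rho>..ctr + 2 * \<rho>}" using z(2) by auto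
    qed
    show "(\<Union>k\<in>C. V (f k)) \<in> sets lborel" using C by (auto simp: V_def)
    show "{ctr - 2 * \<rho>..ctr + 2 * \<rho>} \<in> fmeasurable lborel"
      using rho by (intro fmeasurableI) auto
  qed
  also have "\<dots> = 4 * \<rho>" using rho by simp
  finally have "real (card C) * (\<kappa> * \<rho>) \<le> 4 * \<rho>" by simp
  then show ?thesis using rho by (simp add: mult.left_commute mult.assoc[symmetric] mult.commute)
qed

lemma r_concat_ge: "r (concat ws) \<ge> M * (\<Prod>i<length ws. r (ws ! i) / D)"
proof (induction ws)
  case (Cons w ws)
  have "M * (\<Prod>i<length (w # ws). r ((w # ws) ! i) / D) = r w / D * (M * (\<Prod>i<length ws. r (ws ! i) / D))"
    unfolding list.size(4) add.right_neutral add_Suc_right prod.lessThan_Suc_shift by simp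
  also have "\<dots> \<le> r w / D * r (concat ws)" using Cons rD(1)[of w] by (intro mult_left_mono) auto
  also have "\<dots> \<le> r (w @ concat ws)" using r_append_ge[of w "concat ws"] by simp
  finally show ?case by simp
qed (simp add: r_Nil)

definition \<Phi> :: "nat \<Rightarrow> nat list set \<Rightarrow> real" where
  "\<Phi> L W = (\<Sum>w\<in>W. \<Sum>i<L. \<bar>\<phi> (\<pi> (ext (drop i w)))\<bar>)"

lemma \<Phi>_nonneg: "\<Phi> L W \<ge> 0" unfolding \<Phi>_def by (intro sum_nonneg) simp

lemma S_single: "S 1 \<omega> = \<phi> (\<pi> \<omega>)"
  by (simp add: S_def shiftn_def)

text \<open>The potential is controlled by two coordinates up to \<open>B\<close>. Inside a block of
  \<open>W\<close> both are known, and at its last position the second one is the initial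
  \<open>e0\<close> of the next block; this leaves finitely many cases.\<close>

lemma phi_blocks:
  assumes W: "finite W" "W \<subseteq> EW L" and L: "L \<ge> 1"
    and blocks: "\<And>n. \<exists>w\<in>W. \<forall>i<L. \<omega> (n * L + i) = w ! i"
  shows "\<bar>\<phi> (\<pi> (shiftn k \<omega>))\<bar> \<le> \<Phi> L W + B"
proof -
  define n i where "n = k div L" and "i = k mod L"
  have k: "k = n * L + i" and i: "i < L" using L by (simp_all add: n_def i_def)
  obtain w where w: "w \<in> W" "\<And>i. i < L \<Longrightarrow> \<omega> (n * L + i) = w ! i" using blocks[of n] by blast
  obtain w' where w': "w' \<in> W" "\<And>i. i < L \<Longrightarrow> \<omega> (Suc n * L + i) = w' ! i" using blocks[of "Suc n"] by blast
  have len: "length w = L" using W(2) w(1) EW_D(1) by blast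
  have "w' \<in> EW L" using W(2) w'(1) by blast
  then have "w' ! 0 = e0" using EW_D(2,3)[of w' L] by (simp add: hd_conv_nth)
  then have hd: "\<omega> (Suc n * L) = e0" using w'(2)[of 0] L by simp
  have "\<bar>S 1 (shiftn k \<omega>) - S 1 (ext (drop i w))\<bar> \<le> B"
  proof (rule S_close)
    fix j :: nat assume j: "j \<le> 1"
    show "shiftn k \<omega> j = ext (drop i w) j"
    proof (cases "i + j < L")
      case True
      then show ?thesis using w(2)[OF True] len by (auto simp: shiftn_def k ext_def add.assoc)
    next
      case False
      then have "k + j = Suc n * L" using k i j by auto
      then show ?thesis using hd False len by (auto simp: shiftn_def ext_def)
    qed
  qed
  moreover have "\<bar>\<phi> (\<pi> (ext (drop i w)))\<bar> \<le> \<Phi> L W"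
  proof -
    have "\<bar>\<phi> (\<pi> (ext (drop i w)))\<bar> \<le> (\<Sum>i<L. \<bar>\<phi> (\<pi> (ext (drop i w)))\<bar>)"
      using i by (intro member_le_sum) auto
    also have "\<dots> \<le> \<Phi> L W" unfolding \<Phi>_def using w(1) W(1) by (intro member_le_sum) (auto intro: sum_nonneg)
    finally show ?thesis .
  qed
  ultimately show ?thesis unfolding S_single by linarith
qed

end

text \<open>Random words are drawn from both steering families; the sign of the accumulated deviation
  decides which of the two is appended, so the Birkhoff sums stay within a bounded distance of
  \<open>n \<alpha>\<close>.\<close>

locale steering = emr_level +
  fixes s :: real and L :: nat and Wp Wm :: "nat list set"
  assumes s: "0 \<le> s" and L: "L \<ge> 1" and fin: "finite Wp" "finite Wm"
    and EWp: "Wp \<subseteq> EW L" and EWm: "Wm \<subseteq> EW L"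
    and up: "\<And>w. w \<in> Wp \<Longrightarrow> E w \<ge> B" and down: "\<And>w. w \<in> Wm \<Longrightarrow> E w \<le> - B"
    and mass: "(\<Sum>w\<in>Wp. (r w / D) powr s) \<ge> 1" "(\<Sum>w\<in>Wm. (r w / D) powr s) \<ge> 1"
begin

definition Pp :: "nat list pmf" where
  "Pp = (SOME P. set_pmf P \<subseteq> Wp \<and> (\<forall>w\<in>Wp. pmf P w = (r w / D) powr s / (\<Sum>w\<in>Wp. (r w / D) powr s)))"
definition Pm :: "nat list pmf" where
  "Pm = (SOME P. set_pmf P \<subseteq> Wm \<and> (\<forall>w\<in>Wm. pmf P w = (r w / D) powr s / (\<Sum>w\<in>Wm. (r w / D) powr s)))"

lemma Pp_props: "set_pmf Pp \<subseteq> Wp \<and> (\<forall>w\<in>Wp. pmf Pp w = (r w / D) powr s / (\<Sum>w\<in>Wp. (r w / D) powr s))"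
  unfolding Pp_def by (rule someI_ex[OF ex_pmf_proportional[OF fin(1)]]) (use mass(1) in simp_all)

lemma Pm_props: "set_pmf Pm \<subseteq> Wm \<and> (\<forall>w\<in>Wm. pmf Pm w = (r w / D) powr s / (\<Sum>w\<in>Wm. (r w / D) powr s))"
  unfolding Pm_def by (rule someI_ex[OF ex_pmf_proportional[OF fin(2)]]) (use mass(2) in simp_all)

lemma pmf_le: "pmf Pp w \<le> (r w / D) powr s" "pmf Pm w \<le> (r w / D) powr s"
  using pmf_le_of_proportional[of Pp Wp "\<lambda>w. (r w / D) powr s"] Pp_props mass(1)
    pmf_le_of_proportional[of Pm Wm "\<lambda>w. (r w / D) powr s"] Pm_props mass(2) by auto

text \<open>At every step a candidate from each family is drawn, so that the space is a plain
  product; the dependence on the past sits entirely in the deterministic selection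
  \<open>sel\<close>.\<close>

definition \<Omega> :: "(nat \<Rightarrow> nat list \<times> nat list) measure" where
  "\<Omega> = PiM UNIV (\<lambda>_. measure_pmf (pair_pmf Pp Pm))"

sublocale \<Omega>: product_prob_space "\<lambda>_::nat. measure_pmf (pair_pmf Pp Pm)" UNIV
  by unfold_locales

lemma prob_\<Omega>: "prob_space \<Omega>"
  unfolding \<Omega>_def by (rule \<Omega>.P.prob_space_axioms)

lemma space_\<Omega> [simp]: "space \<Omega> = UNIV"
  by (simp add: \<Omega>_def space_PiM)

definition sel :: "nat list list \<Rightarrow> nat list \<times> nat list \<Rightarrow> nat list" where
  "sel ws p = (if E (concat ws) \<le> 0 then fst p else snd p)"

primrec cw :: "(nat \<Rightarrow> nat list \<times> nat list) \<Rightarrow> nat \<Rightarrow> nat list list" where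
  "cw u 0 = []"
| "cw u (Suc n) = cw u n @ [sel (cw u n) (u n)]"

lemma length_cw [simp]: "length (cw u n) = n"
  by (induction n) auto

lemma take_cw: "m \<le> n \<Longrightarrow> take m (cw u n) = cw u m"
proof (induction n)
  case (Suc n)
  then show ?case by (cases "m = Suc n") auto
qed simp

definition node :: "nat list list \<Rightarrow> (nat \<Rightarrow> nat list \<times> nat list) set" where
  "node ws = {u. cw u (length ws) = ws}"

lemma node_eq: "node ws = {u \<in> space \<Omega>. \<forall>i\<in>{..<length ws}. u i \<in> {p. sel (take i ws) p = ws ! i}}"
proof -
  have "cw u n = take n ws \<longleftrightarrow> (\<forall>i<n. sel (take i ws) (u i) = ws ! i)" if "n \<le> length ws" for u n
    using that
  proof (induction n)
    case (Suc n)
    have "take (Suc n) ws = take n ws @ [ws ! n]" using Suc.prems by (simp add: take_Suc_conv_app_nth)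
    then have "cw u (Suc n) = take (Suc n) ws \<longleftrightarrow> cw u n = take n ws \<and> sel (take n ws) (u n) = ws ! n" by auto
    then show ?case using Suc by (auto simp: less_Suc_eq)
  qed simp
  from this[of "length ws"] show ?thesis by (auto simp: node_def)
qed

lemma node_sets: "node ws \<in> sets \<Omega>"
  unfolding node_eq \<Omega>_def by measurable

text \<open>Along a fixed \<open>ws\<close> the selection rule at step \<open>i\<close> is
  determined by \<open>take i ws\<close>, so the event is a product of conditions on single
  coordinates. The factor \<open>1 / D\<close> in each weight compensates the distortion of each
  concatenation.\<close>

lemma node_prob: "measure \<Omega> (node ws) \<le> (r (concat ws) / M) powr s"
proof -
  have *: "measure (measure_pmf (pair_pmf Pp Pm)) {p. sel v p = w} \<le> (r w / D) powr s" for v w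
  proof (cases "E (concat v) \<le> 0")
    case True
    then have "measure (measure_pmf (pair_pmf Pp Pm)) {p. sel v p = w} = measure (map_pmf fst (pair_pmf Pp Pm)) {w}"
      by (subst measure_map_pmf) (auto simp: sel_def vimage_def)
    then show ?thesis using pmf_le(1)[of w] by (simp add: map_fst_pair_pmf measure_pmf_single)
  next
    case False
    then have "measure (measure_pmf (pair_pmf Pp Pm)) {p. sel v p = w} = measure (map_pmf snd (pair_pmf Pp Pm)) {w}"
      by (subst measure_map_pmf) (auto simp: sel_def vimage_def)
    then show ?thesis using pmf_le(2)[of w] by (simp add: map_snd_pair_pmf measure_pmf_single)
  qed
  interpret P: prob_space \<Omega> by (rule prob_\<Omega>)
  have "emeasure \<Omega> (node ws) = (\<Prod>i<length ws. emeasure (measure_pmf (pair_pmf Pp Pm)) {p. sel (take i ws) p = ws ! i})"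
    unfolding node_eq \<Omega>_def by (rule \<Omega>.emeasure_PiM_Collect) auto
  also have "\<dots> = ennreal (\<Prod>i<length ws. measure (measure_pmf (pair_pmf Pp Pm)) {p. sel (take i ws) p = ws ! i})"
    by (simp add: measure_pmf.emeasure_eq_measure prod_ennreal)
  finally have "measure \<Omega> (node ws) = (\<Prod>i<length ws. measure (measure_pmf (pair_pmf Pp Pm)) {p. sel (take i ws) p = ws ! i})"
    by (simp add: measure_def prod_nonneg)
  also have "\<dots> \<le> (\<Prod>i<length ws. (r (ws ! i) / D) powr s)"
    by (intro prod_mono conjI *) simp
  also have "\<dots> = (\<Prod>i<length ws. r (ws ! i) / D) powr s"
    by (rule prod_powr_distrib[symmetric])
  also have "\<dots> \<le> (r (concat ws) / M) powr s"
  proof (rule powr_mono2[OF s])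
    show "0 \<le> (\<Prod>i<length ws. r (ws ! i) / D)" using rD(1) by (intro prod_nonneg) (auto intro: less_imp_le)
    show "(\<Prod>i<length ws. r (ws ! i) / D) \<le> r (concat ws) / M"
      using r_concat_ge[of ws] M_bounds by (simp add: pos_le_divide_eq mult.commute)
  qed
  finally show ?thesis .
qed

definition ok :: "(nat \<Rightarrow> nat list \<times> nat list) \<Rightarrow> bool" where
  "ok u \<longleftrightarrow> (\<forall>i. fst (u i) \<in> Wp \<and> snd (u i) \<in> Wm)"

lemma AE_ok: "AE u in \<Omega>. ok u"
proof -
  have "AE u in \<Omega>. fst (u i) \<in> Wp \<and> snd (u i) \<in> Wm" for i
    unfolding \<Omega>_def
  proof (rule AE_PiM_component)
    show "AE p in measure_pmf (pair_pmf Pp Pm). fst p \<in> Wp \<and> snd p \<in> Wm"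
      using Pp_props Pm_props by (auto simp: AE_measure_pmf_iff)
  qed (auto intro: measure_pmf.prob_space_axioms)
  then show ?thesis unfolding ok_def by (simp add: AE_all_countable)
qed

abbreviation W :: "nat list set" where "W \<equiv> Wp \<union> Wm"

lemma W_EW: "w \<in> W \<Longrightarrow> w \<in> EW L" using EWp EWm by auto
lemma finW: "finite W" using fin by auto

lemma sel_W: "ok u \<Longrightarrow> sel ws (u n) \<in> W"
  by (auto simp: ok_def sel_def)

lemma cw_W: "ok u \<Longrightarrow> set (cw u n) \<subseteq> W"
  by (induction n) (use sel_W in auto)

lemma length_concat_cw: "ok u \<Longrightarrow> length (concat (cw u n)) = n * L"
  using length_concat_const[of "cw u n" L] cw_W[of u n] W_EW EW_D(1) by fastforce

definition R :: real where "R = (\<Sum>w\<in>W. \<bar>E w\<bar>) + B"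

text \<open>The chosen word has deviation at least \<open>B\<close> in the direction towards 0, so
  the concatenation error cannot carry the sum farther away; crossing 0 overshoots by at most one
  word and one \<open>B\<close>.\<close>

lemma E_cw: "ok u \<Longrightarrow> \<bar>E (concat (cw u n))\<bar> \<le> R"
proof (induction n)
  case 0
  have "0 \<le> (\<Sum>w\<in>W. \<bar>E w\<bar>)" by (rule sum_nonneg) simp
  then show ?case using B_nonneg by (simp add: R_def)
next
  case (Suc n)
  let ?w = "sel (cw u n) (u n)"
  have w: "?w \<in> W" using sel_W Suc.prems by blast
  have Ew: "\<bar>E ?w\<bar> \<le> (\<Sum>w\<in>W. \<bar>E w\<bar>)" using finW w by (intro member_le_sum) auto
  have app: "\<bar>E (concat (cw u n) @ ?w) - E (concat (cw u n)) - E ?w\<bar> \<le> B"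
    using EW_D[OF W_EW[OF w]] by (intro E_append) auto
  have IH: "\<bar>E (concat (cw u n))\<bar> \<le> R" using Suc by blast
  show ?case
  proof (cases "E (concat (cw u n)) \<le> 0")
    case True
    then have "E ?w \<ge> B" using Suc.prems up by (auto simp: ok_def sel_def)
    then show ?thesis using True app IH Ew by (simp add: R_def abs_le_iff)
  next
    case False
    then have "E ?w \<le> - B" using Suc.prems down by (auto simp: ok_def sel_def)
    then show ?thesis using False app IH Ew by (simp add: R_def abs_le_iff)
  qed
qed

definition om :: "(nat \<Rightarrow> nat list \<times> nat list) \<Rightarrow> nat \<Rightarrow> nat" where
  "om u k = concat (cw u (Suc (k div L))) ! k"

lemma om_block: "ok u \<Longrightarrow> i < L \<Longrightarrow> om u (n * L + i) = sel (cw u n) (u n) ! i"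
proof -
  assume u: "ok u" and i: "i < L"
  have "(n * L + i) div L = n" using i by simp
  then show ?thesis using length_concat_cw[OF u, of n] by (simp add: om_def nth_append)
qed

lemma pre_om: "ok u \<Longrightarrow> pre (om u) (n * L) = concat (cw u n)"
proof (induction n)
  case (Suc n)
  have w: "length (sel (cw u n) (u n)) = L" using sel_W[OF Suc.prems] W_EW EW_D(1) by blast
  have "pre (om u) (Suc n * L) = pre (om u) (n * L) @ map (\<lambda>i. om u (n * L + i)) [0..<L]"
    by (auto simp: pre_def list_eq_iff_nth_eq nth_append add.commute[of L])
  also have "map (\<lambda>i. om u (n * L + i)) [0..<L] = sel (cw u n) (u n)"
    using om_block[OF Suc.prems] w by (simp add: list_eq_iff_nth_eq)
  finally show ?case using Suc by simp
qed (simp add: pre_def)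

lemma om_hd: "ok u \<Longrightarrow> om u (n * L) = e0"
  using om_block[of u 0 n] L sel_W[of u "cw u n" n] W_EW EW_D[of _ L] by (metis add.right_neutral hd_conv_nth less_le_trans zero_less_one)

lemma phi_om: "ok u \<Longrightarrow> \<bar>\<phi> (\<pi> (shiftn k (om u)))\<bar> \<le> \<Phi> L W + B"
  using W_EW sel_W om_block by (intro phi_blocks finW L) blast+

text \<open>At multiples of \<open>L\<close> the sum is that of a concatenation with bounded
  deviation. Between them fewer than \<open>L\<close> summands are added, each bounded because only
  finitely many words occur.\<close>

lemma S_om: "ok u \<Longrightarrow> \<bar>S n (om u) - real n * \<alpha>\<bar> \<le> B + R + real L * (\<Phi> L W + B + \<bar>\<alpha>\<bar>)"
proof -
  assume u: "ok u"
  define m j where "m = n div L" and "j = n mod L"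
  have n: "n = m * L + j" and j: "j < L" using L by (simp_all add: m_def j_def)
  let ?c = "concat (cw u m)"
  have "\<bar>S (m * L) (om u) - S (m * L) (ext ?c)\<bar> \<le> B"
  proof (rule S_close)
    fix k assume "k \<le> m * L"
    then show "om u k = ext ?c k"
      using pre_om[OF u, of m] om_hd[OF u, of m] length_concat_cw[OF u, of m] nth_pre[of k "m * L" "om u"]
      by (cases "k = m * L") (auto simp: ext_def simp flip: pre_om)
  qed
  then have 1: "\<bar>S (m * L) (om u) - real (m * L) * \<alpha> - E ?c\<bar> \<le> B"
    using length_concat_cw[OF u, of m] by (simp add: E_def)
  have "\<bar>S j (shiftn (m * L) (om u))\<bar> \<le> (\<Sum>k<j. \<Phi> L W + B)"
    unfolding S_def shiftn_shiftn by (rule order_trans[OF sum_abs]) (intro sum_mono phi_om[OF u])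
  also have "\<dots> \<le> real L * (\<Phi> L W + B)" using j \<Phi>_nonneg[of L W] B_nonneg by (simp add: mult_right_mono)
  finally have 2: "\<bar>S j (shiftn (m * L) (om u))\<bar> \<le> real L * (\<Phi> L W + B)" .
  have 3: "\<bar>real j * \<alpha>\<bar> \<le> real L * \<bar>\<alpha>\<bar>" using j by (simp add: abs_mult mult_right_mono)
  have "S n (om u) - real n * \<alpha> = (S (m * L) (om u) - real (m * L) * \<alpha> - E ?c) + E ?c + S j (shiftn (m * L) (om u)) - real j * \<alpha>"
    unfolding n S_add by (simp add: algebra_simps)
  then show ?thesis using 1 2 3 E_cw[OF u, of m] by (simp add: algebra_simps abs_le_iff)
qed

lemma om_level: "ok u \<Longrightarrow> \<pi> (om u) \<in> level_set T I \<phi> \<alpha>"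
proof -
  assume u: "ok u"
  define Q where "Q = B + R + real L * (\<Phi> L W + B + \<bar>\<alpha>\<bar>)"
  have "(\<lambda>n. S n (om u) / real n) \<longlonglongrightarrow> \<alpha>"
  proof (rule LIM_zero_cancel, rule Lim_null_comparison)
    show "\<forall>\<^sub>F n in sequentially. norm (S n (om u) / real n - \<alpha>) \<le> Q * (1 / real n)"
      using eventually_gt_at_top[of 0]
    proof eventually_elim
      case (elim n)
      have "S n (om u) / real n - \<alpha> = (S n (om u) - real n * \<alpha>) / real n" using elim by (simp add: diff_divide_distrib)
      then show ?case using S_om[OF u, of n] elim by (simp add: Q_def abs_divide divide_right_mono)
    qed
    show "(\<lambda>n. Q * (1 / real n)) \<longlonglongrightarrow> 0"
      using tendsto_mult[OF tendsto_const[of Q] lim_1_over_n] by simp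
  qed
  then show ?thesis using \<pi>_in by (simp add: level_set_def birkhoff_limit_def S_def T_pow_\<pi>)
qed

section \<open>Mass distribution on the level set\<close>

lemma W_nonempty: "W \<noteq> {}" using mass(1) by auto

text \<open>Since \<open>W\<close> is finite, appending one of its words shrinks a cylinder by a
  factor no smaller than \<open>\<kappa>\<close>.\<close>

definition \<kappa> :: real where "\<kappa> = Min (r ` W) / D"

lemma \<kappa>: "\<kappa> > 0" "w \<in> W \<Longrightarrow> \<kappa> \<le> r w / D"
proof -
  have "Min (r ` W) \<in> r ` W" using finW W_nonempty by (intro Min_in) auto
  then show "\<kappa> > 0" using r_pos D_ge1 by (auto simp: \<kappa>_def)
  show "w \<in> W \<Longrightarrow> \<kappa> \<le> r w / D" unfolding \<kappa>_def using finW D_ge1 by (intro divide_right_mono) auto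
qed

definition C' :: real where "C' = (4 / \<kappa> + 1) * (1 / M) powr s"

lemma C'_pos: "C' > 0" using \<kappa>(1) M_bounds by (simp add: C'_def add_pos_pos)

text \<open>Each path is stopped when its cylinder first has length at most \<open>\<rho>\<close>.
  The stopped cylinders are disjoint and longer than a fixed fraction of \<open>\<rho>\<close>, so
  boundedly many of them concern \<open>V\<close>, and each has mass at most
  \<open>(\<rho> / M) powr s\<close>. The conclusion is about a measurable superset because
  \<open>V\<close> is arbitrary.\<close>

lemma set_mass:
  assumes V: "bounded V" "diameter V \<le> \<rho>" and rho: "\<rho> > 0"
  shows "\<exists>A\<in>sets \<Omega>. {u. ok u \<and> \<pi> (om u) \<in> V} \<subseteq> A \<and> measure \<Omega> A \<le> C' * \<rho> powr s"
proof -
  interpret P: prob_space \<Omega> by (rule prob_\<Omega>)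
  have pw: "(\<rho> / M) powr s = (1 / M) powr s * \<rho> powr s"
    using rho M_bounds by (simp add: powr_divide)
  have C'1: "(\<rho> / M) powr s \<le> C' * \<rho> powr s"
  proof -
    have "1 * ((1 / M) powr s * \<rho> powr s) \<le> (4 / \<kappa> + 1) * ((1 / M) powr s * \<rho> powr s)"
      using \<kappa>(1) by (intro mult_right_mono) auto
    then show ?thesis by (simp add: pw C'_def mult.assoc)
  qed
  show ?thesis
  proof (cases "\<rho> \<ge> M")
    case True
    \<comment> \<open>Here paths would stop at time 0, where there is no preceding cylinder to
      compare with; the total mass 1 is small enough.\<close>
    have "1 \<le> (\<rho> / M) powr s" using True M_bounds s by (intro ge_one_powr_ge_zero) auto
    then show ?thesis using C'1 P.prob_space sets.top[of \<Omega>] by (intro bexI[of _ "space \<Omega>"]) auto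
  next
    case False
    have ex: "\<exists>n. r (concat (cw u n)) \<le> \<rho>" if "ok u" for u
    proof -
      have "(\<lambda>n. C0 * (1 / \<xi>) ^ n) \<longlonglongrightarrow> C0 * 0"
        using \<xi>_gt1 by (intro tendsto_mult tendsto_const LIMSEQ_power_zero) simp
      then have "\<forall>\<^sub>F n in sequentially. C0 * (1 / \<xi>) ^ n < \<rho>" using rho by (intro order_tendstoD(2)) auto
      then obtain n where n: "C0 * (1 / \<xi>) ^ n < \<rho>" by (auto simp: eventually_sequentially)
      have "r (concat (cw u n)) \<le> C0 * (1 / \<xi>) ^ (n * L)" using r_small[of "concat (cw u n)"] length_concat_cw[OF that] by simp
      also have "\<dots> \<le> C0 * (1 / \<xi>) ^ n" using L \<xi>_gt1 C0_ge1 by (intro mult_left_mono power_decreasing) auto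
      finally show ?thesis using n by (intro exI[of _ n]) simp
    qed
    define N where "N u = (LEAST n. r (concat (cw u n)) \<le> \<rho>)" for u
    have N: "r (concat (cw u (N u))) \<le> \<rho>" if "ok u" for u
      unfolding N_def by (rule LeastI_ex[OF ex[OF that]])
    have N_least: "N u \<le> n" if "r (concat (cw u n)) \<le> \<rho>" for u n
      unfolding N_def using that by (rule Least_le)
    have big: "\<kappa> * \<rho> \<le> r (concat (cw u (N u)))" if "ok u" for u
    proof -
      have "N u \<noteq> 0"
      proof
        assume "N u = 0"
        then show False using N[OF that] False by (simp add: r_Nil)
      qed
      then obtain n where n: "N u = Suc n" by (cases "N u") auto
      then have "\<rho> < r (concat (cw u n))" using N_least[of u n] by force
      let ?w = "sel (cw u n) (u n)"
      have "\<kappa> * \<rho> \<le> (r ?w / D) * r (concat (cw u n))"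
        using \<kappa> sel_W[OF that, of "cw u n" n] rho \<open>\<rho> < _\<close> rD(1)[of ?w] by (intro mult_mono) auto
      also have "\<dots> \<le> r (concat (cw u n) @ ?w)" using r_append_ge[of "concat (cw u n)" ?w] by (simp add: mult.commute)
      finally show ?thesis using n by simp
    qed
    define H where "H = {u. ok u \<and> \<pi> (om u) \<in> V}"
    define CC where "CC = (\<lambda>u. cw u (N u)) ` H"
    \<comment> \<open>If two stopped cylinders meet, the shorter word is a prefix of the longer one,
      so the longer path should have stopped earlier. Equal concatenations come from equal lists
      because all blocks have length \<open>L\<close>.\<close>
    have disj: "U (concat a) \<inter> U (concat b) = {}" if ab: "a \<in> CC" "b \<in> CC" "a \<noteq> b" for a b
    proof -
      have *: "U (concat a) \<inter> U (concat b) = {}"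
        if uv: "ok u" "ok v" "a = cw u (N u)" "b = cw v (N v)" "a \<noteq> b" "N u \<le> N v" for u v a b
      proof (rule ccontr)
        assume "U (concat a) \<inter> U (concat b) \<noteq> {}"
        then obtain x where x: "x \<in> U (concat a)" "x \<in> U (concat b)" by blast
        have split: "cw v (N v) = cw v (N u) @ drop (N u) (cw v (N v))"
          using take_cw[OF uv(6), of v] by (metis append_take_drop_id)
        then have "concat b = concat (cw v (N u)) @ concat (drop (N u) (cw v (N v)))"
          unfolding uv(4) by (metis concat_append)
        then have "x \<in> U (concat (cw v (N u)))" using x(2) U_append by auto
        then have "concat a = concat (cw v (N u))"
          using x(1) U_disjoint[of "concat a" "concat (cw v (N u))" x] uv by (simp add: length_concat_cw)
        then have "N v \<le> N u" using N[OF uv(1)] N_least[of v "N u"] uv(3) by simp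
        then have eq: "N u = N v" using uv(6) by simp
        have "concat a = concat b" using \<open>concat a = _\<close> eq uv(4) by simp
        moreover have "\<forall>(x, y)\<in>set (zip a b). length x = length y"
        proof -
          have "length x = L" if "x \<in> set a \<union> set b" for x
            using that cw_W[OF uv(1)] cw_W[OF uv(2)] W_EW EW_D(1) uv(3,4) by blast
          then have "length x = length y" if "(x, y) \<in> set (zip a b)" for x y
            using set_zip_leftD[OF that] set_zip_rightD[OF that] by simp
          then show ?thesis by blast
        qed
        ultimately have "a = b" using eq uv(3,4) by (intro concat_injective) auto
        then show False using uv(5) by blast
      qed
      obtain u v where uv: "ok u" "ok v" "a = cw u (N u)" "b = cw v (N v)" using ab by (auto simp: CC_def H_def)
      show ?thesis using *[OF uv(1,2,3,4) ab(3)] *[OF uv(2,1,4,3)] ab(3) by (cases "N u \<le> N v") auto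
    qed
    have card: "\<kappa> * real (card G) \<le> 4" if G: "G \<subseteq> CC" "finite G" for G
    proof (cases "G = {}")
      case False
      then obtain ctr where ctr: "ctr \<in> V" using G by (auto simp: CC_def H_def)
      show ?thesis
      proof (rule count_cylinders[where f=concat and \<rho>=\<rho> and ctr=ctr, OF G(2) _ _ _ rho])
        fix k assume "k \<in> G"
        then obtain u where u: "ok u" "\<pi> (om u) \<in> V" "k = cw u (N u)" using G by (auto simp: CC_def H_def)
        show "\<kappa> * \<rho> \<le> r (concat k) \<and> r (concat k) \<le> \<rho>" using N big u by simp
        have "\<pi> (om u) \<in> closure (U (concat k))"
          using \<pi>_closure[of "om u" "N u * L"] pre_om[OF u(1)] u(3) by simp
        moreover have "\<bar>\<pi> (om u) - ctr\<bar> \<le> \<rho>"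
          using diameter_bounded_bound[OF V(1) u(2) ctr] V(2) by (simp add: dist_real_def)
        ultimately show "\<exists>z\<in>closure (U (concat k)). \<bar>z - ctr\<bar> \<le> \<rho>" by blast
      qed (use disj G in blast)
    qed simp
    \<comment> \<open>Finiteness of \<open>CC\<close> is itself a consequence of the bound on all
      its finite subsets.\<close>
    have "finite CC \<and> card CC \<le> nat \<lfloor>4 / \<kappa>\<rfloor>"
    proof (rule finite_if_finite_subsets_card_bdd)
      fix G assume "G \<subseteq> CC" "finite G"
      then have "real (card G) \<le> 4 / \<kappa>" using card \<kappa>(1) by (simp add: field_simps)
      then show "card G \<le> nat \<lfloor>4 / \<kappa>\<rfloor>" by linarith
    qed
    then have CC: "finite CC" "\<kappa> * real (card CC) \<le> 4" using card by auto
    let ?A = "\<Union>k\<in>CC. node k"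
    have "measure \<Omega> ?A \<le> (\<Sum>k\<in>CC. measure \<Omega> (node k))"
      using CC(1) node_sets by (intro P.finite_measure_subadditive_finite) auto
    also have "\<dots> \<le> (\<Sum>k\<in>CC. (\<rho> / M) powr s)"
    proof (rule sum_mono)
      fix k assume "k \<in> CC"
      then have "r (concat k) \<le> \<rho>" using N by (auto simp: CC_def H_def)
      then have "(r (concat k) / M) powr s \<le> (\<rho> / M) powr s"
        using M_bounds r_pos[of "concat k"] s by (intro powr_mono2 divide_right_mono) auto
      then show "measure \<Omega> (node k) \<le> (\<rho> / M) powr s" using node_prob[of k] by linarith
    qed
    also have "\<dots> = real (card CC) * ((1 / M) powr s * \<rho> powr s)" by (simp add: pw)
    also have "\<dots> \<le> (4 / \<kappa> + 1) * ((1 / M) powr s * \<rho> powr s)"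
    proof (rule mult_right_mono)
      have "real (card CC) \<le> 4 / \<kappa>" using CC(2) \<kappa>(1) by (simp add: field_simps)
      then show "real (card CC) \<le> 4 / \<kappa> + 1" by simp
    qed simp
    finally have "measure \<Omega> ?A \<le> C' * \<rho> powr s" by (simp add: C'_def mult.assoc)
    moreover have "{u. ok u \<and> \<pi> (om u) \<in> V} \<subseteq> ?A" by (auto simp: node_def CC_def H_def)
    moreover have "?A \<in> sets \<Omega>" using CC(1) node_sets by auto
    ultimately show ?thesis by blast
  qed
qed

text \<open>The preceding bound asks for a positive radius, but a covering set may have diameter 0;
  \<open>e\<close> pays for a slightly larger radius. The exponent 0 is separate because of the
  convention in \<open>diam_power\<close>.\<close>

lemma set_mass_diam:
  assumes V: "bounded V" and e: "e > 0"
  shows "\<exists>A\<in>sets \<Omega>. {u. ok u \<and> \<pi> (om u) \<in> V} \<subseteq> A \<and> measure \<Omega> A \<le> C' * (diam_power s V + e)"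
proof (cases "V = {}")
  case True
  then show ?thesis using C'_pos e by (intro bexI[of _ "{}"]) (auto simp: diam_power_def)
next
  case False
  have d0: "diameter V \<ge> 0" using V by (rule diameter_ge_0)
  have "\<exists>\<rho>>0. diameter V \<le> \<rho> \<and> \<rho> powr s \<le> diam_power s V + e"
  proof (cases "s = 0")
    case True
    then show ?thesis using False d0 e by (intro exI[of _ "diameter V + 1"]) (auto simp: diam_power_def)
  next
    case nz: False
    have "((\<lambda>\<rho>. \<rho> powr s) \<longlongrightarrow> diameter V powr s) (at_right (diameter V))"
      using nz s d0 by (intro tendsto_powr' tendsto_intros) (auto simp: eventually_at_right_less intro!: eventually_at_rightI[of _ "diameter V + 1"])
    then have "\<forall>\<^sub>F \<rho> in at_right (diameter V). \<rho> powr s < diameter V powr s + e"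
      using e by (intro order_tendstoD(2)) auto
    moreover have "\<forall>\<^sub>F \<rho> in at_right (diameter V). diameter V < \<rho>" by (rule eventually_at_right_less)
    ultimately have "\<forall>\<^sub>F \<rho> in at_right (diameter V). \<rho> powr s < diameter V powr s + e \<and> diameter V < \<rho>"
      by eventually_elim simp
    then obtain \<rho> where "\<rho> powr s < diameter V powr s + e \<and> diameter V < \<rho>"
      using eventually_happens trivial_limit_at_right_real by blast
    then show ?thesis using d0 nz False by (intro exI[of _ \<rho>]) (auto simp: diam_power_def)
  qed
  then obtain \<rho> where rho: "\<rho> > 0" "diameter V \<le> \<rho>" "\<rho> powr s \<le> diam_power s V + e" by blast
  then obtain A where A: "A \<in> sets \<Omega>" "{u. ok u \<and> \<pi> (om u) \<in> V} \<subseteq> A" "measure \<Omega> A \<le> C' * \<rho> powr s"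
    using set_mass[OF V] by blast
  have "C' * \<rho> powr s \<le> C' * (diam_power s V + e)" using rho(3) C'_pos by (intro mult_left_mono) auto
  then show ?thesis using A by (intro bexI[of _ A]) auto
qed

lemma hausdorff_measure_pos: "hausdorff_measure s (level_set T I \<phi> \<alpha>) \<noteq> 0"
proof
  let ?J = "level_set T I \<phi> \<alpha>"
  interpret P: prob_space \<Omega> by (rule prob_\<Omega>)
  assume H0: "hausdorff_measure s ?J = 0"
  have "hausdorff_premeasure 1 s ?J \<le> hausdorff_measure s ?J"
    unfolding hausdorff_measure_def by (rule SUP_upper) simp
  then have pm: "hausdorff_premeasure 1 s ?J = 0" using H0 by simp
  \<comment> \<open>Both the sum over the cover and the total of the added errors are at most
    \<open>\<eta>\<close>, so the whole space would have mass at most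
    \<open>C' * (\<eta> + \<eta>) = 1 / 2\<close>.\<close>
  define \<eta> where "\<eta> = 1 / (4 * C')"
  have eta: "\<eta> > 0" using C'_pos by (simp add: \<eta>_def)
  have "hausdorff_premeasure 1 s ?J < ennreal \<eta>" using pm eta by simp
  then obtain V where V: "\<And>i. bounded (V i)" "?J \<subseteq> (\<Union>i. V i)" "(\<Sum>i. ennreal (diam_power s (V i))) < ennreal \<eta>"
    unfolding hausdorff_premeasure_def INF_less_iff by auto
  have "\<forall>i. \<exists>A\<in>sets \<Omega>. {u. ok u \<and> \<pi> (om u) \<in> V i} \<subseteq> A \<and> measure \<Omega> A \<le> C' * (diam_power s (V i) + \<eta> * (1 / 2) ^ Suc i)"
    using set_mass_diam[OF V(1)] eta by simp
  from choice[OF this[unfolded Bex_def]] obtain A where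
    "\<forall>i. A i \<in> sets \<Omega> \<and> {u. ok u \<and> \<pi> (om u) \<in> V i} \<subseteq> A i \<and> measure \<Omega> (A i) \<le> C' * (diam_power s (V i) + \<eta> * (1 / 2) ^ Suc i)" ..
  then have A: "\<And>i. A i \<in> sets \<Omega>" "\<And>i. {u. ok u \<and> \<pi> (om u) \<in> V i} \<subseteq> A i"
    "\<And>i. measure \<Omega> (A i) \<le> C' * (diam_power s (V i) + \<eta> * (1 / 2) ^ Suc i)" by simp_all
  have "AE u in \<Omega>. u \<in> (\<Union>i. A i)"
    using AE_ok
  proof eventually_elim
    case (elim u)
    then have "\<pi> (om u) \<in> (\<Union>i. V i)" using om_level V(2) by blast
    then show ?case using elim A(2) by blast
  qed
  moreover have sA: "(\<Union>i. A i) \<in> sets \<Omega>" using A(1) by auto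
  ultimately have "measure \<Omega> (\<Union>i. A i) = 1" by (simp add: P.prob_eq_1)
  then have "1 = emeasure \<Omega> (\<Union>i. A i)" by (simp add: P.emeasure_eq_measure)
  also have "\<dots> \<le> (\<Sum>i. emeasure \<Omega> (A i))" by (rule emeasure_subadditive_countably) (use A(1) in auto)
  also have "\<dots> \<le> (\<Sum>i. ennreal C' * (ennreal (diam_power s (V i)) + ennreal (\<eta> * (1 / 2) ^ Suc i)))"
  proof (rule suminf_le)
    fix i
    have dn: "diam_power s (V i) \<ge> 0" by (simp add: diam_power_def)
    have "emeasure \<Omega> (A i) \<le> ennreal (C' * (diam_power s (V i) + \<eta> * (1 / 2) ^ Suc i))"
      unfolding P.emeasure_eq_measure using A(3) by (rule ennreal_leI)
    also have "\<dots> = ennreal C' * (ennreal (diam_power s (V i)) + ennreal (\<eta> * (1 / 2) ^ Suc i))"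
      using C'_pos dn eta by (subst ennreal_mult) (auto simp: ennreal_plus simp del: power_Suc)
    finally show "emeasure \<Omega> (A i) \<le> ennreal C' * (ennreal (diam_power s (V i)) + ennreal (\<eta> * (1 / 2) ^ Suc i))" .
  qed auto
  also have "\<dots> = ennreal C' * ((\<Sum>i. ennreal (diam_power s (V i))) + (\<Sum>i. ennreal (\<eta> * (1 / 2) ^ Suc i)))"
    by (simp add: suminf_add ennreal_suminf_cmult)
  also have "(\<Sum>i. ennreal (\<eta> * (1 / 2) ^ Suc i)) = ennreal \<eta>"
  proof -
    have "(\<lambda>i. \<eta> * (1 / 2) ^ Suc i) sums (\<eta> * 1)" by (intro sums_mult power_half_series)
    then show ?thesis using eta by (subst suminf_ennreal2) (auto simp: sums_iff simp del: power_Suc)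
  qed
  also have "ennreal C' * ((\<Sum>i. ennreal (diam_power s (V i))) + ennreal \<eta>) \<le> ennreal C' * (ennreal \<eta> + ennreal \<eta>)"
    using V(3) by (intro mult_left_mono add_right_mono) auto
  also have "\<dots> = ennreal (C' * (\<eta> + \<eta>))" using C'_pos eta by (simp add: ennreal_mult flip: ennreal_plus)
  also have "C' * (\<eta> + \<eta>) = 1 / 2" using C'_pos by (simp add: \<eta>_def field_simps)
  finally have "ennreal 1 \<le> ennreal (1 / 2)" by simp
  then show False by (subst (asm) ennreal_le_iff) auto
qed

end

context emr_level
begin

lemma hausdorff_measure_level_neq_0:
  assumes "good s" "0 \<le> s"
  shows "hausdorff_measure s (level_set T I \<phi> \<alpha>) \<noteq> 0"
proof -
  obtain L Wp Wm where g: "L \<ge> 1" "finite Wp" "finite Wm" "Wp \<subseteq> EW L" "Wm \<subseteq> EW L"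
    "\<forall>w\<in>Wp. E w \<ge> B" "\<forall>w\<in>Wm. E w \<le> - B"
    "(\<Sum>w\<in>Wp. (r w / D) powr s) \<ge> 1" "(\<Sum>w\<in>Wm. (r w / D) powr s) \<ge> 1"
    using assms(1) unfolding good_def by blast
  interpret steering T I \<pi> \<phi> \<alpha> s L Wp Wm
    by unfold_locales (use g assms in auto)
  show ?thesis by (rule hausdorff_measure_pos)
qed

lemma dim_level_ge:
  assumes "good s"
  shows "ereal s \<le> hausdorff_dim (level_set T I \<phi> \<alpha>)"
  unfolding hausdorff_dim_def
proof (rule Inf_greatest)
  fix x assume "x \<in> {ereal s |s. 0 \<le> s \<and> hausdorff_measure s (level_set T I \<phi> \<alpha>) = 0}"
  then obtain t where t: "x = ereal t" "0 \<le> t" "hausdorff_measure t (level_set T I \<phi> \<alpha>) = 0" by blast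
  have "\<not> t \<le> s" using hausdorff_measure_level_neq_0[OF good_mono[OF assms] t(2)] t(3) by blast
  then show "ereal s \<le> x" using t(1) by simp
qed

end

section \<open>Invariant measures\<close>

text \<open>Realised by choosing \<open>j\<close> with probability \<open>c j\<close> and then a
  point with law \<open>\<nu> j\<close>. Outside \<open>J\<close> the kernel is filled with one
  fixed \<open>\<nu> j0\<close>, so that it consists of probability measures everywhere.\<close>

lemma ex_mixture:
  fixes \<nu> :: "'k \<Rightarrow> 'a measure" and c :: "'k \<Rightarrow> real"
  assumes J: "finite J" "\<And>j. j \<in> J \<Longrightarrow> 0 \<le> c j" "sum c J = 1"
    and \<nu>: "\<And>j. j \<in> J \<Longrightarrow> prob_space (\<nu> j)" "\<And>j. j \<in> J \<Longrightarrow> sets (\<nu> j) = sets K"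
  shows "\<exists>\<mu>. prob_space \<mu> \<and> sets \<mu> = sets K \<and>
    (\<forall>A\<in>sets K. measure \<mu> A = (\<Sum>j\<in>J. c j * measure (\<nu> j) A)) \<and>
    (\<forall>f\<in>borel_measurable K. (\<forall>j\<in>J. integrable (\<nu> j) f) \<longrightarrow>
       has_bochner_integral \<mu> f (\<Sum>j\<in>J. c j * (\<integral>x. f x \<partial>\<nu> j) :: real))"
proof -
  obtain C where C: "set_pmf C \<subseteq> J" "\<And>j. j \<in> J \<Longrightarrow> pmf C j = c j"
    using ex_pmf_proportional[OF J(1), of c] J by auto
  obtain j0 where j0: "j0 \<in> J" using J(3) by fastforce
  define N where "N j = (if j \<in> J then \<nu> j else \<nu> j0)" for j
  have N: "prob_space (N j)" "sets (N j) = sets K" for j using \<nu> j0 by (auto simp: N_def)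
  have ker: "N \<in> measurable (measure_pmf C) (prob_algebra K)"
    using N by (simp add: space_prob_algebra)
  have ker': "N \<in> measurable (measure_pmf C) (subprob_algebra K)" by (rule measurable_prob_algebraD[OF ker])
  have CC: "measure_pmf C \<in> space (prob_algebra (measure_pmf C))"
    by (simp add: space_prob_algebra measure_pmf.prob_space_axioms)
  define \<mu> where "\<mu> = measure_pmf C \<bind> N"
  have p: "prob_space \<mu>" and s: "sets \<mu> = sets K"
    unfolding \<mu>_def by (rule prob_space_bind'[OF CC ker], rule sets_bind'[OF CC ker])
  interpret P: prob_space \<mu> by (rule p)
  have nn: "(\<integral>\<^sup>+x. f x \<partial>\<mu>) = (\<Sum>j\<in>J. ennreal (c j) * (\<integral>\<^sup>+x. f x \<partial>\<nu> j))" if "f \<in> borel_measurable K" for f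
  proof -
    have "(\<integral>\<^sup>+x. f x \<partial>\<mu>) = (\<integral>\<^sup>+j. \<integral>\<^sup>+x. f x \<partial>N j \<partial>measure_pmf C)"
      unfolding \<mu>_def by (rule nn_integral_bind[OF that ker'])
    also have "\<dots> = (\<Sum>j\<in>J. (\<integral>\<^sup>+x. f x \<partial>N j) * ennreal (pmf C j))"
      using C(1) J(1) by (intro nn_integral_measure_pmf_support) auto
    finally show ?thesis using C(2) by (simp add: N_def mult.commute)
  qed
  have 1: "measure \<mu> A = (\<Sum>j\<in>J. c j * measure (\<nu> j) A)" if A: "A \<in> sets K" for A
  proof -
    have "emeasure \<mu> A = (\<integral>\<^sup>+x. indicator A x \<partial>\<mu>)" using A s by simp
    also have "\<dots> = (\<Sum>j\<in>J. ennreal (c j) * (\<integral>\<^sup>+x. indicator A x \<partial>\<nu> j))" using A by (intro nn) simp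
    also have "\<dots> = (\<Sum>j\<in>J. ennreal (c j * measure (\<nu> j) A))"
    proof (rule sum.cong[OF refl])
      fix j assume j: "j \<in> J"
      interpret Q: prob_space "\<nu> j" by (rule \<nu>(1)[OF j])
      show "ennreal (c j) * (\<integral>\<^sup>+x. indicator A x \<partial>\<nu> j) = ennreal (c j * measure (\<nu> j) A)"
        using A \<nu>(2)[OF j] J(2)[OF j] by (simp add: Q.emeasure_eq_measure ennreal_mult)
    qed
    also have "\<dots> = ennreal (\<Sum>j\<in>J. c j * measure (\<nu> j) A)" using J(2) by (intro sum_ennreal) simp
    finally show ?thesis using J(2) by (simp add: P.emeasure_eq_measure sum_nonneg)
  qed
  have pos: "has_bochner_integral \<mu> f (\<Sum>j\<in>J. c j * (\<integral>x. f x \<partial>\<nu> j))"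
    if f: "f \<in> borel_measurable K" "\<And>x. 0 \<le> f x" "\<forall>j\<in>J. integrable (\<nu> j) f" for f :: "'a \<Rightarrow> real"
  proof (rule has_bochner_integral_nn_integral)
    show "f \<in> borel_measurable \<mu>" using f(1) s measurable_cong_sets by blast
    have "(\<integral>\<^sup>+x. ennreal (f x) \<partial>\<mu>) = (\<Sum>j\<in>J. ennreal (c j) * (\<integral>\<^sup>+x. ennreal (f x) \<partial>\<nu> j))"
      using f(1) by (intro nn) simp
    also have "\<dots> = (\<Sum>j\<in>J. ennreal (c j * (\<integral>x. f x \<partial>\<nu> j)))"
      using f J(2) by (intro sum.cong refl) (simp add: nn_integral_eq_integral ennreal_mult)
    also have "\<dots> = ennreal (\<Sum>j\<in>J. c j * (\<integral>x. f x \<partial>\<nu> j))" using J(2) f(2) by (intro sum_ennreal) simp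
    finally show "(\<integral>\<^sup>+x. ennreal (f x) \<partial>\<mu>) = ennreal (\<Sum>j\<in>J. c j * (\<integral>x. f x \<partial>\<nu> j))" .
  qed (use f(2) J(2) in \<open>auto intro!: sum_nonneg\<close>)
  have 2: "has_bochner_integral \<mu> f (\<Sum>j\<in>J. c j * (\<integral>x. f x \<partial>\<nu> j))"
    if f: "f \<in> borel_measurable K" "\<forall>j\<in>J. integrable (\<nu> j) f" for f :: "'a \<Rightarrow> real"
  proof -
    have "has_bochner_integral \<mu> (\<lambda>x. max (f x) 0 - max (- f x) 0)
        ((\<Sum>j\<in>J. c j * (\<integral>x. max (f x) 0 \<partial>\<nu> j)) - (\<Sum>j\<in>J. c j * (\<integral>x. max (- f x) 0 \<partial>\<nu> j)))"
      using f by (intro has_bochner_integral_diff pos) auto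
    moreover have "max (f x) 0 - max (- f x) 0 = f x" for x by simp
    moreover have "(\<Sum>j\<in>J. c j * (\<integral>x. max (f x) 0 \<partial>\<nu> j)) - (\<Sum>j\<in>J. c j * (\<integral>x. max (- f x) 0 \<partial>\<nu> j))
        = (\<Sum>j\<in>J. c j * (\<integral>x. f x \<partial>\<nu> j))"
    proof -
      have "(\<integral>x. max (f x) 0 \<partial>\<nu> j) - (\<integral>x. max (- f x) 0 \<partial>\<nu> j) = (\<integral>x. f x \<partial>\<nu> j)" if "j \<in> J" for j
      proof -
        have "(\<integral>x. max (f x) 0 \<partial>\<nu> j) - (\<integral>x. max (- f x) 0 \<partial>\<nu> j) = (\<integral>x. max (f x) 0 - max (- f x) 0 \<partial>\<nu> j)"
          using f(2) that by (intro Bochner_Integration.integral_diff[symmetric]) auto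
        also have "\<dots> = (\<integral>x. f x \<partial>\<nu> j)" by (intro Bochner_Integration.integral_cong) auto
        finally show ?thesis .
      qed
      then show ?thesis by (simp flip: sum_subtractf right_diff_distrib)
    qed
    ultimately show ?thesis by simp
  qed
  show ?thesis using p s 1 2 by (intro exI[of _ \<mu>]) blast
qed

text \<open>Entropy as mean information; for independent blocks the information of a list is a sum
  over the blocks.\<close>

lemma fent_eq_integral:
  assumes "prob_space N" and f: "simple_function N f"
  shows "fent N f = (\<integral>x. - ln (measure N (f -` {f x} \<inter> space N)) \<partial>N)"
proof -
  interpret prob_space N by fact
  have fin: "finite (f ` space N)" using f by (rule simple_functionD(1))
  have m: "f -` {v} \<inter> space N \<in> sets N" for v using f by (rule simple_functionD(2))
  let ?m = "\<lambda>v. measure N (f -` {v} \<inter> space N)"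
  have "(\<integral>x. - ln (?m (f x)) \<partial>N) = (\<integral>x. (\<Sum>v\<in>f ` space N. - ln (?m v) * indicator (f -` {v} \<inter> space N) x) \<partial>N)"
  proof (rule Bochner_Integration.integral_cong[OF refl])
    fix x assume x: "x \<in> space N"
    have "(\<Sum>v\<in>f ` space N. - ln (?m v) * indicator (f -` {v} \<inter> space N) x)
        = (\<Sum>v\<in>{f x}. - ln (?m v) * indicator (f -` {v} \<inter> space N) x)"
      using fin x by (intro sum.mono_neutral_right) (auto simp: indicator_def)
    then show "- ln (?m (f x)) = (\<Sum>v\<in>f ` space N. - ln (?m v) * indicator (f -` {v} \<inter> space N) x)"
      using x by (simp add: indicator_def)
  qed
  also have "\<dots> = (\<Sum>v\<in>f ` space N. - ln (?m v) * ?m v)"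
    using m by (subst Bochner_Integration.integral_sum) (auto simp: less_top[symmetric])
  also have "\<dots> = fent N f" by (simp add: fent_def sum_negf mult.commute)
  finally show ?thesis by simp
qed

text \<open>Returns from functions to the set partitions over which \<open>ks_entropy\<close> takes
  its supremum; a level set is decoded by evaluating \<open>f\<close> at any of its points.\<close>

lemma ex_finite_partition_of_simple:
  assumes inv: "invariant_prob T \<mu>" and f: "simple_function \<mu> f"
  shows "\<exists>Q. finite_partition \<mu> Q \<and> (\<forall>n. fent \<mu> (names T f n) \<le> fent \<mu> (names T (cell Q) n))"
proof -
  interpret prob_space \<mu> using inv by (simp add: invariant_prob_def)
  have T: "T \<in> measurable \<mu> \<mu>" using inv by (simp add: invariant_prob_def)
  define Q where "Q = (\<lambda>v. f -` {v} \<inter> space \<mu>) ` (f ` space \<mu>)"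
  have part: "partition_on (space \<mu>) Q"
    by (rule partition_onI) (auto simp: Q_def disjnt_def)
  have Q: "finite_partition \<mu> Q"
    unfolding finite_partition_def using part simple_functionD[OF f] by (auto simp: Q_def)
  have "fent \<mu> (names T f n) \<le> fent \<mu> (names T (cell Q) n)" for n
  proof (rule fent_comp_le[where h="map (\<lambda>A. f (SOME x. x \<in> A))"])
    show "simple_function \<mu> (names T (cell Q) n)" by (rule simple_function_names[OF simple_function_cell[OF Q] T])
    fix x assume x: "x \<in> space \<mu>"
    have sp: "(T ^^ i) x \<in> space \<mu>" for i using measurable_space[OF measurable_compose_n[OF T] x] .
    have "f (SOME z. z \<in> cell Q y) = f y" if y: "y \<in> space \<mu>" for y
    proof -
      have c: "cell Q y \<in> Q" "y \<in> cell Q y" using cell_props[OF part y] by auto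
      then have "(SOME z. z \<in> cell Q y) \<in> cell Q y" by (intro someI)
      with c show ?thesis by (auto simp: Q_def)
    qed
    then show "names T f n x = map (\<lambda>A. f (SOME x. x \<in> A)) (names T (cell Q) n x)"
      using sp by (simp add: names_def)
  qed
  then show ?thesis using Q by blast
qed

context emr_coding
begin

section \<open>Invariant measures on the repeller and their Lyapunov exponents\<close>

abbreviation \<B> :: "real measure" where "\<B> \<equiv> restrict_space borel \<Lambda>"

lemma invariant_measures_D:
  assumes "\<mu> \<in> invariant_measures T I"
  shows "space \<mu> = \<Lambda>" "sets \<mu> = sets \<B>" "prob_space \<mu>" "T \<in> measurable \<mu> \<mu>" "distr \<mu> \<mu> T = \<mu>" "invariant_prob T \<mu>"
  using assms by (auto simp: invariant_measures_def invariant_prob_def)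

lemma distr_T_pow:
  assumes "\<mu> \<in> invariant_measures T I"
  shows "T ^^ n \<in> measurable \<mu> \<mu>" "distr \<mu> \<mu> (T ^^ n) = \<mu>"
proof -
  note m = invariant_measures_D[OF assms]
  show Tn: "T ^^ n \<in> measurable \<mu> \<mu>" for n by (rule measurable_compose_n[OF m(4)])
  show "distr \<mu> \<mu> (T ^^ n) = \<mu>"
  proof (induction n)
    case 0
    then show ?case using distr_id[of \<mu>] by (simp add: id_def)
  next
    case (Suc n)
    have "distr \<mu> \<mu> (T \<circ> (T ^^ n)) = distr (distr \<mu> \<mu> (T ^^ n)) \<mu> T"
      by (rule distr_distr[symmetric, OF m(4) Tn])
    then show ?case using Suc m(5) by (simp only: funpow.simps)
  qed
qed

lemma singleton_sets: "x \<in> \<Lambda> \<Longrightarrow> {x} \<in> sets \<B>"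
  by (auto simp: sets_restrict_space intro!: image_eqI[of _ _ "{x}"])

text \<open>If \<open>M\<close> lies in the repeller it is fixed, so the preimage of
  \<open>{M}\<close> under \<open>T ^^ n\<close> contains \<open>M\<close> and by invariance has the
  same mass. The other points that reach \<open>M\<close> therefore form a null set.\<close>

lemma AE_\<Lambda>':
  assumes mu: "\<mu> \<in> invariant_measures T I"
  shows "AE x in \<mu>. x \<in> \<Lambda>'"
proof -
  note m = invariant_measures_D[OF mu]
  interpret prob_space \<mu> by (rule m(3))
  have null: "AE x in \<mu>. (T ^^ n) x = M \<longrightarrow> x = M" for n
  proof (cases "M \<in> \<Lambda>")
    case True
    have s1: "{M} \<in> sets \<mu>" using singleton_sets[OF True] m(2) by simp
    let ?A = "(T ^^ n) -` {M} \<inter> space \<mu>"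
    have s2: "?A \<in> sets \<mu>" by (rule measurable_sets[OF distr_T_pow(1)[OF mu] s1])
    have "measure \<mu> ?A = measure (distr \<mu> \<mu> (T ^^ n)) {M}"
      using measure_distr[OF distr_T_pow(1)[OF mu, of n] s1] by simp
    then have eq: "measure \<mu> ?A = measure \<mu> {M}" using distr_T_pow(2)[OF mu] by simp
    have "measure \<mu> (?A - {M}) = measure \<mu> ?A - measure \<mu> {M}"
      using T_pow_M[OF True, of n] True m(1) by (intro finite_measure_Diff s1 s2) auto
    then have "?A - {M} \<in> null_sets \<mu>" using eq s1 s2 by (auto simp: null_sets_def emeasure_eq_measure)
    then have "AE x in \<mu>. x \<notin> ?A - {M}" by (rule AE_not_in)
    then show ?thesis by (rule AE_mp) (auto intro!: AE_I2)
  next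
    case False
    have "(T ^^ n) x \<noteq> M" if "x \<in> space \<mu>" for x using \<Lambda>_T[of x n] that False unfolding m(1) by metis
    then show ?thesis by (auto intro!: AE_I2)
  qed
  then have "AE x in \<mu>. \<forall>n. (T ^^ n) x = M \<longrightarrow> x = M" unfolding AE_all_countable by blast
  with AE_space[of \<mu>] show ?thesis
  proof eventually_elim
    case (elim x)
    then show ?case using bad_reaches_M[of x] m(1) unfolding \<Lambda>'_def by blast
  qed
qed

lemma pre_itin_measurable: "(\<lambda>x. pre (itin x) n) \<in> measurable \<B> (count_space UNIV)"
proof -
  have T: "(T ^^ k) \<in> measurable \<B> \<B>" for k by (rule measurable_compose_n[OF T_measurable])
  have l: "(\<lambda>x. itin x k) \<in> measurable \<B> (count_space UNIV)" for k
    unfolding itin_def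
    by (rule measurable_compose[OF T measurable_restrict_space1[OF letter_measurable]])
  have "(\<lambda>x. pre (itin x) n) -` {w} \<inter> space \<B> \<in> sets \<B>" for w
  proof (cases "length w = n")
    case True
    then have "(\<lambda>x. pre (itin x) n) -` {w} \<inter> space \<B> = {x \<in> space \<B>. \<forall>k\<in>{..<n}. itin x k = w ! k}"
      by (auto simp: list_eq_iff_nth_eq)
    also have "\<dots> \<in> sets \<B>"
    proof (rule sets.sets_Collect_finite_All)
      fix k
      have "{x \<in> space \<B>. itin x k = w ! k} = (\<lambda>x. itin x k) -` {w ! k} \<inter> space \<B>" by auto
      then show "{x \<in> space \<B>. itin x k = w ! k} \<in> sets \<B>" using measurable_sets[OF l, of "{w ! k}" k] by simp
    qed simp
    finally show ?thesis .
  next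
    case False
    then have "(\<lambda>x. pre (itin x) n) -` {w} \<inter> space \<B> = {}" by auto
    then show ?thesis by simp
  qed
  then show ?thesis by (subst measurable_count_space_eq_countable) auto
qed

lemma lnB_measurable: "lnB \<in> borel_measurable \<B>"
proof -
  let ?J = "\<Union>i. J i"
  have "deriv T \<in> borel_measurable (restrict_space borel ?J)"
    using T_deriv2 by (intro borel_measurable_continuous_on_restrict continuous_at_imp_continuous_on ballI)
      (blast intro: DERIV_isCont)
  then have "(\<lambda>x. if x \<in> ?J then deriv T x else 0) \<in> borel_measurable borel"
    by (subst (asm) measurable_restrict_space_iff[where c=0]) auto
  then have "(\<lambda>x. ln \<bar>if x \<in> ?J then deriv T x else 0\<bar>) \<in> borel_measurable borel"
    by (intro borel_measurable_ln borel_measurable_abs)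
  then have "(\<lambda>x. ln \<bar>if x \<in> ?J then deriv T x else 0\<bar>) \<in> borel_measurable \<B>"
    by (rule measurable_restrict_space1)
  then show ?thesis
  proof (rule measurable_discrete_difference)
    show "countable (\<Lambda> \<inter> endpoint_preimages T I)" by (rule countable_bad)
    show "{x} \<in> sets \<B>" if "x \<in> \<Lambda> \<inter> endpoint_preimages T I" for x using that by (intro singleton_sets) auto
    fix x assume x: "x \<in> space \<B>" "x \<notin> \<Lambda> \<inter> endpoint_preimages T I"
    then obtain \<omega> where "x = \<pi> \<omega>" using cod_range by (auto simp: space_restrict_space)
    then obtain i where "x \<in> J i" using x good_J[of \<omega> 0] by (auto simp: space_restrict_space)
    then show "ln \<bar>if x \<in> ?J then deriv T x else 0\<bar> = lnB x" by (auto simp: lnB_def bd_interior)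
  qed auto
qed

lemma lyapunov_eq:
  assumes "integrable \<mu> lnB"
  shows "lyapunov T I \<mu> = ereal (\<integral>x. lnB x \<partial>\<mu>)"
proof -
  have f: "(\<integral>\<^sup>+x. ennreal (lnB x) \<partial>\<mu>) < \<infinity>" "(\<integral>\<^sup>+x. ennreal (- lnB x) \<partial>\<mu>) < \<infinity>"
    using assms by (auto simp: real_integrable_def less_top)
  have e: "enn2ereal u = ereal (enn2real u)" if "u < \<infinity>" for u
    using that by (cases u) (auto simp: enn2ereal_ennreal)
  have "lyapunov T I \<mu> = ereal (enn2real (\<integral>\<^sup>+x. ennreal (lnB x) \<partial>\<mu>)) - ereal (enn2real (\<integral>\<^sup>+x. ennreal (- lnB x) \<partial>\<mu>))"
    unfolding lyapunov_def lnB_def[symmetric] e[OF f(1)] e[OF f(2)] ..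
  then show ?thesis by (simp add: real_lebesgue_integral_def[OF assms])
qed

lemma LB_ge:
  assumes "x \<in> \<Lambda>'"
  shows "LB n x \<ge> - D0" "LB n x \<ge> real n * ln \<xi> - ln C0 - D0"
proof -
  have "\<bar>LB n x + ln (r (pre (itin x) n))\<bar> \<le> D0" by (rule LB_r[OF assms])
  moreover have "ln (r (pre (itin x) n)) \<le> 0" using r_pos r_le1 by simp
  moreover have "ln (r (pre (itin x) n)) \<le> ln C0 - real n * ln \<xi>"
  proof -
    have "ln (r (pre (itin x) n)) \<le> ln (C0 * (1 / \<xi>) ^ n)"
      using r_small[of "pre (itin x) n"] r_pos[of "pre (itin x) n"] by (intro ln_mono) auto
    also have "\<dots> = ln C0 + real n * ln (1 / \<xi>)" using C0_ge1 \<xi>_gt1 by (simp add: ln_mult ln_realpow)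
    finally show ?thesis using \<xi>_gt1 by (simp add: ln_div)
  qed
  ultimately show "LB n x \<ge> - D0" "LB n x \<ge> real n * ln \<xi> - ln C0 - D0" by linarith+
qed

text \<open>Almost everywhere \<open>lnB \<ge> - D0\<close>. The negative part thus has finite
  integral, and a finite exponent then excludes an infinite positive part.\<close>

lemma integrable_lnB:
  assumes mu: "\<mu> \<in> invariant_measures T I" and fin: "lyapunov T I \<mu> < \<infinity>"
  shows "integrable \<mu> lnB"
proof -
  note m = invariant_measures_D[OF mu]
  interpret prob_space \<mu> by (rule m(3))
  have "(\<integral>\<^sup>+x. ennreal (- lnB x) \<partial>\<mu>) \<le> (\<integral>\<^sup>+x. ennreal D0 \<partial>\<mu>)"
  proof (rule nn_integral_mono_AE)
    show "AE x in \<mu>. ennreal (- lnB x) \<le> ennreal D0"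
      using AE_\<Lambda>'[OF mu] 
    proof eventually_elim
      case (elim x)
      then show ?case using LB_ge(1)[of x 1] by (intro ennreal_leI) (simp add: LB_def)
    qed
  qed
  also have "\<dots> < \<infinity>" by (simp add: emeasure_space_1)
  finally have neg: "(\<integral>\<^sup>+x. ennreal (- lnB x) \<partial>\<mu>) < \<infinity>" .
  have pos: "(\<integral>\<^sup>+x. ennreal (lnB x) \<partial>\<mu>) < \<infinity>"
  proof (rule ccontr)
    assume "\<not> ?thesis"
    then have "(\<integral>\<^sup>+x. ennreal (lnB x) \<partial>\<mu>) = \<infinity>" by (simp add: less_top[symmetric])
    then show False using fin neg unfolding lyapunov_def lnB_def[symmetric]
      by (cases "\<integral>\<^sup>+x. ennreal (- lnB x) \<partial>\<mu>") (auto simp: enn2ereal_ennreal)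
  qed
  have "lnB \<in> borel_measurable \<mu>" using lnB_measurable m(2) measurable_cong_sets by blast
  then show ?thesis using pos neg by (simp add: real_integrable_def less_top)
qed

lemma integral_iterate:
  fixes f :: "real \<Rightarrow> real"
  assumes mu: "\<mu> \<in> invariant_measures T I" and f: "integrable \<mu> f"
  shows "integrable \<mu> (\<lambda>x. f ((T ^^ k) x))" "(\<integral>x. f ((T ^^ k) x) \<partial>\<mu>) = (\<integral>x. f x \<partial>\<mu>)"
proof -
  note T = distr_T_pow[OF mu, of k]
  have fm: "f \<in> borel_measurable \<mu>" using f by simp
  show "integrable \<mu> (\<lambda>x. f ((T ^^ k) x))"
    using integrable_distr[OF T(1)] f T(2) by simp
  have "(\<integral>x. f x \<partial>distr \<mu> \<mu> (T ^^ k)) = (\<integral>x. f ((T ^^ k) x) \<partial>\<mu>)"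
    by (rule integral_distr[OF T(1) fm])
  then show "(\<integral>x. f ((T ^^ k) x) \<partial>\<mu>) = (\<integral>x. f x \<partial>\<mu>)" using T(2) by simp
qed

lemma integral_LB:
  assumes mu: "\<mu> \<in> invariant_measures T I" and f: "integrable \<mu> lnB"
  shows "integrable \<mu> (LB n)" "(\<integral>x. LB n x \<partial>\<mu>) = real n * (\<integral>x. lnB x \<partial>\<mu>)"
proof -
  show "integrable \<mu> (LB n)" unfolding LB_def[abs_def] using integral_iterate(1)[OF mu f] by simp
  show "(\<integral>x. LB n x \<partial>\<mu>) = real n * (\<integral>x. lnB x \<partial>\<mu>)"
    unfolding LB_def using integral_iterate[OF mu f] by simp
qed

text \<open>Expansion is visible only for large iterates: \<open>n\<close> is taken beyond the
  constants \<open>ln C0 + D0\<close>, and invariance turns the integral of \<open>LB n\<close> into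
  \<open>n\<close> times that of \<open>lnB\<close>.\<close>

lemma lyapunov_pos:
  assumes mu: "\<mu> \<in> invariant_measures T I" and f: "integrable \<mu> lnB"
  shows "0 < (\<integral>x. lnB x \<partial>\<mu>)"
proof -
  interpret prob_space \<mu> by (rule invariant_measures_D(3)[OF mu])
  have lnx: "ln \<xi> > 0" using \<xi>_gt1 by simp
  obtain n where n: "real n > (ln C0 + D0) / ln \<xi>" using reals_Archimedean2 by blast
  have "0 < real n * ln \<xi> - ln C0 - D0" using n lnx by (simp add: field_simps)
  also have "\<dots> = (\<integral>x. real n * ln \<xi> - ln C0 - D0 \<partial>\<mu>)" by (simp add: prob_space)
  also have "\<dots> \<le> (\<integral>x. LB n x \<partial>\<mu>)"
  proof (rule integral_mono_AE)
    show "AE x in \<mu>. real n * ln \<xi> - ln C0 - D0 \<le> LB n x"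
      using AE_\<Lambda>'[OF mu] by eventually_elim (rule LB_ge(2))
  qed (use integral_LB(1)[OF mu f] in simp_all)
  also have "\<dots> = real n * (\<integral>x. lnB x \<partial>\<mu>)" by (rule integral_LB(2)[OF mu f])
  finally show ?thesis by (simp add: zero_less_mult_iff)
qed

end

context emr_level
begin

text \<open>Off a countable set, \<open>\<phi>\<close> is the limit of functions of finitely many
  letters, because the variations tend to 0.\<close>

lemma phi_measurable: "\<phi> \<in> borel_measurable \<B>"
proof -
  obtain V where V: "summable V"
    and close: "\<And>n \<omega> \<omega>'. (\<forall>k<n + 2. \<omega> k = \<omega>' k) \<Longrightarrow> \<bar>\<phi> (\<pi> \<omega>) - \<phi> (\<pi> \<omega>')\<bar> \<le> V n"
    using ex_variation_bound by auto
  have V0: "V \<longlonglongrightarrow> 0" using V by (rule summable_LIMSEQ_zero)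
  have "(\<lambda>x. \<phi> (\<pi> (itin x))) \<in> borel_measurable \<B>"
  proof (rule borel_measurable_LIMSEQ_real)
    show "(\<lambda>x. \<phi> (\<pi> (ext (pre (itin x) (n + 2))))) \<in> borel_measurable \<B>" for n
      by (rule measurable_compose[OF pre_itin_measurable]) simp
    fix x
    show "(\<lambda>n. \<phi> (\<pi> (ext (pre (itin x) (n + 2))))) \<longlonglongrightarrow> \<phi> (\<pi> (itin x))"
    proof (rule LIM_zero_cancel, rule Lim_null_comparison[OF _ V0])
      show "\<forall>\<^sub>F n in sequentially. norm (\<phi> (\<pi> (ext (pre (itin x) (n + 2)))) - \<phi> (\<pi> (itin x))) \<le> V n"
        by (intro always_eventually allI) (use close in \<open>auto simp: ext_def\<close>)
    qed
  qed
  then show ?thesis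
  proof (rule measurable_discrete_difference)
    show "countable (\<Lambda> \<inter> endpoint_preimages T I)" by (rule countable_bad)
    show "{x} \<in> sets \<B>" if "x \<in> \<Lambda> \<inter> endpoint_preimages T I" for x using that by (intro singleton_sets) auto
    fix x assume "x \<in> space \<B>" "x \<notin> \<Lambda> \<inter> endpoint_preimages T I"
    then have "x \<in> \<Lambda>'" by (auto simp: space_restrict_space \<Lambda>'_def)
    then show "\<phi> (\<pi> (itin x)) = \<phi> x" by (simp add: \<pi>_itin)
  qed auto
qed

end

section \<open>Measures from steering words\<close>

context steering
begin

section \<open>Bernoulli measures on the two steering families\<close>

definition Wb :: "bool \<Rightarrow> nat list set" where "Wb b = (if b then Wp else Wm)"
definition Pb :: "bool \<Rightarrow> nat list pmf" where "Pb b = (if b then Pp else Pm)"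
definition Zb :: "bool \<Rightarrow> real" where "Zb b = (\<Sum>w\<in>Wb b. (r w / D) powr s)"

lemma Wb_props: "finite (Wb b)" "Wb b \<subseteq> EW L" "Wb b \<noteq> {}" "Wb b \<subseteq> W"
  using fin EWp EWm mass by (auto simp: Wb_def)

lemma Zb_ge1: "Zb b \<ge> 1" using mass by (simp add: Zb_def Wb_def)

lemma pmf_Pb: "w \<in> Wb b \<Longrightarrow> pmf (Pb b) w = (r w / D) powr s / Zb b" "set_pmf (Pb b) \<subseteq> Wb b"
  using Pp_props Pm_props by (auto simp: Wb_def Pb_def Zb_def split: if_splits)

text \<open>Replaces improper words by a default, so that every path, not merely almost every one,
  yields a code made of blocks from \<open>Wb b\<close>.\<close>

definition cl :: "bool \<Rightarrow> nat list \<Rightarrow> nat list" where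
  "cl b w = (if w \<in> Wb b then w else (SOME w. w \<in> Wb b))"

lemma cl_in: "cl b w \<in> Wb b"
  using Wb_props(3)[of b] by (auto simp: cl_def some_in_eq)

definition Bn :: "bool \<Rightarrow> (nat \<Rightarrow> nat list) measure" where
  "Bn b = PiM UNIV (\<lambda>_. measure_pmf (Pb b))"

lemma prob_Bn: "prob_space (Bn b)"
  unfolding Bn_def by (intro prob_space_PiM measure_pmf.prob_space_axioms)

lemma space_Bn [simp]: "space (Bn b) = UNIV"
  by (simp add: Bn_def space_PiM)

lemma component_Bn: "(\<lambda>u. g (u i)) \<in> measurable (Bn b) (count_space UNIV)"
  unfolding Bn_def by (rule measurable_compose[OF measurable_component_singleton]) simp_all

definition ow :: "bool \<Rightarrow> (nat \<Rightarrow> nat list) \<Rightarrow> nat \<Rightarrow> nat" where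
  "ow b u k = cl b (u (k div L)) ! (k mod L)"

lemma ow_block: "i < L \<Longrightarrow> ow b u (n * L + i) = cl b (u n) ! i"
  by (simp add: ow_def)

lemma ow_blocks: "\<exists>w\<in>Wb b. \<forall>i<L. ow b u (n * L + i) = w ! i"
  using ow_block cl_in by blast

lemma cl_EW: "cl b w \<in> EW L" using cl_in Wb_props(2) by blast

lemma ow_hd: "ow b u (n * L) = e0"
  using ow_block[of 0 b u n] L EW_D[OF cl_EW[of b "u n"]] by (simp add: hd_conv_nth)

lemma ow_good: "\<pi> (shiftn k (ow b u)) \<notin> endpoint_preimages T I"
proof (rule good_code)
  fix n
  have "k + n \<le> (k + n) * L" using L by simp
  then obtain m where m: "ow b u m = e0" "k + n \<le> m" using ow_hd by blast
  then have "shiftn k (ow b u) (m - k) \<noteq> mx" "m - k \<ge> n"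
    by (auto simp: shiftn_def e0_def)
  then show "\<exists>j\<ge>n. shiftn k (ow b u) j \<noteq> mx" by blast
qed

definition X :: "bool \<Rightarrow> nat \<Rightarrow> (nat \<Rightarrow> nat list) \<Rightarrow> real" where "X b k u = \<pi> (shiftn k (ow b u))"

lemma X_T: "(T ^^ j) (X b k u) = X b (k + j) u"
  by (simp add: X_def T_pow_\<pi> shiftn_shiftn)

lemma itin_X: "itin (X b k u) = shiftn k (ow b u)"
  unfolding X_def by (rule itin_good[OF ow_good])

lemma X_measurable: "X b k \<in> measurable (Bn b) \<B>"
proof (rule measurable_restrict_space2)
  show "X b k \<in> space (Bn b) \<rightarrow> \<Lambda>" using \<pi>_in by (auto simp: X_def)
  have "(\<lambda>u. shiftn k (ow b u)) \<in> borel_measurable (Bn b)"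
  proof (rule measurable_coordinatewise_then_product)
    fix i
    have "(\<lambda>u. cl b (u ((k + i) div L)) ! ((k + i) mod L)) \<in> measurable (Bn b) (count_space UNIV)"
      by (rule component_Bn)
    then have "(\<lambda>u. cl b (u ((k + i) div L)) ! ((k + i) mod L)) \<in> measurable (Bn b) borel"
      by (rule measurable_compose) simp
    then show "(\<lambda>u. shiftn k (ow b u) i) \<in> borel_measurable (Bn b)" by (simp add: shiftn_def ow_def)
  qed
  moreover have "\<pi> \<in> borel_measurable borel" by (rule borel_measurable_continuous_onI[OF cod_cont])
  ultimately show "X b k \<in> borel_measurable (Bn b)" unfolding X_def by (rule measurable_compose)
qed

lemma distr_shift_Bn: "distr (Bn b) (Bn b) (\<lambda>u i. u (Suc i)) = Bn b"
proof -
  have "distr (PiM UNIV (\<lambda>_::nat. measure_pmf (Pb b))) (PiM UNIV (\<lambda>_::nat. measure_pmf (Pb b))) (\<lambda>\<omega>. \<lambda>n\<in>UNIV. \<omega> (Suc n))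
      = PiM UNIV (\<lambda>_. measure_pmf (Pb b))"
    by (rule distr_PiM_reindex[where f=Suc]) (auto intro: measure_pmf.prob_space_axioms)
  then show ?thesis by (simp add: Bn_def restrict_UNIV)
qed

lemma shift_Bn_measurable: "(\<lambda>u i. u (Suc i)) \<in> measurable (Bn b) (Bn b)"
  unfolding Bn_def by (rule measurable_PiM_single') (auto simp: space_PiM)

lemma X_add_L: "X b (L + k) u = X b k (\<lambda>i. u (Suc i))"
proof -
  have "ow b u (L + j) = ow b (\<lambda>i. u (Suc i)) j" for j using L by (simp add: ow_def)
  then show ?thesis by (simp add: X_def shiftn_def add.assoc)
qed

lemma distr_X_L: "distr (Bn b) \<B> (X b L) = distr (Bn b) \<B> (X b 0)"
proof -
  have "distr (Bn b) \<B> (X b L) = distr (Bn b) \<B> (X b 0 \<circ> (\<lambda>u i. u (Suc i)))"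
    using X_add_L[of b 0] by (intro distr_cong) (auto simp: comp_def)
  also have "\<dots> = distr (distr (Bn b) (Bn b) (\<lambda>u i. u (Suc i))) \<B> (X b 0)"
    by (rule distr_distr[symmetric, OF X_measurable shift_Bn_measurable])
  finally show ?thesis by (simp add: distr_shift_Bn)
qed

text \<open>The second component is the phase. The law at phase 0 is preserved by
  \<open>T ^^ L\<close> but not necessarily by \<open>T\<close>; averaging over the phases
  \<open>k < L\<close> will give invariance under \<open>T\<close>.\<close>

definition \<nu> :: "bool \<times> nat \<Rightarrow> real measure" where "\<nu> j = distr (Bn (fst j)) \<B> (X (fst j) (snd j))"

lemma \<nu>_props: "prob_space (\<nu> j)" "sets (\<nu> j) = sets \<B>" "space (\<nu> j) = \<Lambda>"
  unfolding \<nu>_def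
  by (rule prob_space.prob_space_distr[OF prob_Bn X_measurable]) (simp_all add: space_restrict_space)

lemma integrable_\<nu>:
  fixes f :: "real \<Rightarrow> real"
  assumes f: "f \<in> borel_measurable \<B>" and bd: "\<And>u. \<bar>f (X b k u)\<bar> \<le> C"
  shows "integrable (\<nu> (b, k)) f" "(\<integral>x. f x \<partial>\<nu> (b, k)) = (\<integral>u. f (X b k u) \<partial>Bn b)" "integrable (Bn b) (\<lambda>u. f (X b k u))"
proof -
  interpret B: prob_space "Bn b" by (rule prob_Bn)
  have m: "(\<lambda>u. f (X b k u)) \<in> borel_measurable (Bn b)" by (rule measurable_compose[OF X_measurable f])
  then show i: "integrable (Bn b) (\<lambda>u. f (X b k u))"
    by (rule B.integrable_const_bound[rotated, of _ C]) (use bd in simp)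
  show "integrable (\<nu> (b, k)) f" unfolding \<nu>_def
    using integrable_distr_eq[OF X_measurable f, of b k] i by simp
  show "(\<integral>x. f x \<partial>\<nu> (b, k)) = (\<integral>u. f (X b k u) \<partial>Bn b)"
    unfolding \<nu>_def using integral_distr[OF X_measurable f, of b k] by simp
qed

lemma phi_X: "\<bar>\<phi> (X b k u)\<bar> \<le> \<Phi> L (Wb b) + B"
  unfolding X_def by (rule phi_blocks[OF Wb_props(1,2) L ow_blocks])

lemma E_X: "\<bar>(\<Sum>k<L. \<phi> (X b k u)) - real L * \<alpha> - E (cl b (u 0))\<bar> \<le> B"
proof -
  have "\<bar>S L (ow b u) - S L (ext (cl b (u 0)))\<bar> \<le> B"
  proof (rule S_close)
    fix k assume k: "k \<le> L"
    then show "ow b u k = ext (cl b (u 0)) k"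
      using ow_block[of k b u 0] ow_hd[of b u 1] EW_D(1)[OF cl_EW[of b "u 0"]]
      by (cases "k = L") (auto simp: ext_def)
  qed
  moreover have "(\<Sum>k<L. \<phi> (X b k u)) = S L (ow b u)" by (simp add: S_def X_def)
  ultimately show ?thesis using EW_D(1)[OF cl_EW[of b "u 0"]] by (simp add: E_def algebra_simps)
qed

lemma X_\<Lambda>': "X b k u \<in> \<Lambda>'"
  using ow_good \<pi>_in by (simp add: \<Lambda>'_def X_def)

lemma lnB_X: "\<exists>C. \<forall>k u. \<bar>lnB (X b k u)\<bar> \<le> C"
proof -
  let ?A = "(\<lambda>(w, i). \<bar>ln (r [w ! i])\<bar>) ` (Wb b \<times> {..<L})"
  have fin: "finite ?A" using Wb_props(1) by auto
  have "\<bar>lnB (X b k u)\<bar> \<le> D0 + Max ?A" for k u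
  proof -
    have "pre (itin (X b k u)) 1 = [ow b u k]" by (simp add: itin_X pre_def shiftn_def)
    then have "\<bar>lnB (X b k u) + ln (r [ow b u k])\<bar> \<le> D0" using LB_r[OF X_\<Lambda>', of 1 b k u] by (simp add: LB_def)
    moreover have "\<bar>ln (r [ow b u k])\<bar> \<le> Max ?A"
    proof (rule Max_ge[OF fin])
      show "\<bar>ln (r [ow b u k])\<bar> \<in> ?A"
        using cl_in L by (intro image_eqI[of _ _ "(cl b (u (k div L)), k mod L)"]) (auto simp: ow_def)
    qed
    ultimately show ?thesis by linarith
  qed
  then show ?thesis by blast
qed

lemma LB_X: "(\<Sum>k<L. lnB (X b k u)) \<le> ln D - ln (r (cl b (u 0)))"
proof -
  have "pre (itin (X b 0 u)) L = cl b (u 0)"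
    using ow_block[of _ b u 0] EW_D(1)[OF cl_EW[of b "u 0"]]
    by (simp add: itin_X list_eq_iff_nth_eq shiftn_def)
  then have "\<bar>LB L (X b 0 u) + ln (r (cl b (u 0)))\<bar> \<le> D0" using LB_r[OF X_\<Lambda>', of L b 0 u] by simp
  moreover have "LB L (X b 0 u) = (\<Sum>k<L. lnB (X b k u))" by (simp add: LB_def X_T)
  ultimately show ?thesis using D0_nonneg by (simp add: D_def)
qed

text \<open>The mean information scale of one block: it bounds the expected logarithmic derivative
  over a block from above, and \<open>s\<close> times it bounds the entropy of a block from
  below.\<close>

definition \<Theta> :: "bool \<Rightarrow> real" where "\<Theta> b = (\<integral>u. ln D - ln (r (cl b (u 0))) \<partial>Bn b)"

lemma integrable_component: "integrable (Bn b) (\<lambda>u. g (cl b (u i)) :: real)"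
proof -
  interpret B: prob_space "Bn b" by (rule prob_Bn)
  have "(\<lambda>u. g (cl b (u i))) \<in> borel_measurable (Bn b)"
    by (rule measurable_compose[OF component_Bn]) simp
  moreover have "\<bar>g (cl b (u i))\<bar> \<le> Max ((\<lambda>w. \<bar>g w\<bar>) ` Wb b)" for u
    using Wb_props(1) cl_in by (intro Max_ge) auto
  ultimately show ?thesis by (intro B.integrable_const_bound) auto
qed

lemma integral_component: "(\<integral>u. g (cl b (u i)) \<partial>Bn b) = (\<integral>u. g (cl b (u 0)) \<partial>Bn b :: real)"
proof -
  have "(\<integral>u. g (cl b (u i)) \<partial>Bn b) = (\<integral>w. g (cl b w) \<partial>measure_pmf (Pb b))" for i
  proof -
    have "distr (PiM UNIV (\<lambda>_. measure_pmf (Pb b))) (measure_pmf (Pb b)) (\<lambda>u. u i) = measure_pmf (Pb b)"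
      by (rule distr_PiM_component) (auto intro: measure_pmf.prob_space_axioms)
    then show ?thesis
      unfolding Bn_def by (subst integral_distr[symmetric, of "\<lambda>u. u i" _ "measure_pmf (Pb b)"]) simp_all
  qed
  then show ?thesis by metis
qed

lemma \<Theta>_nonneg: "\<Theta> b \<ge> 0"
proof -
  have "ln D - ln (r w) \<ge> 0" for w
    using D_ge1 r_pos[of w] r_le1[of w] by (simp add: ln_mono order_trans[OF ln_le_zero_iff[THEN iffD2]])
  then show ?thesis unfolding \<Theta>_def by (intro integral_nonneg_AE) simp
qed

text \<open>Blocks are independent, and a block \<open>w\<close> has probability
  \<open>(r w / D) powr s\<close> divided by a normalisation at least 1, so its information is at
  least \<open>s * (ln D - ln (r w))\<close>. Block 0 is left out because an orbit started at a
  later phase sees it only in part.\<close>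

lemma words_entropy: "fent (Bn b) (\<lambda>u. map (\<lambda>j. cl b (u (Suc j))) [0..<N]) \<ge> real N * (s * \<Theta> b)"
proof -
  interpret B: prob_space "Bn b" by (rule prob_Bn)
  interpret PP: product_prob_space "\<lambda>_::nat. measure_pmf (Pb b)" UNIV by unfold_locales
  let ?f = "\<lambda>u. map (\<lambda>j. cl b (u (Suc j))) [0..<N]"
  have "?f ` space (Bn b) \<subseteq> {v. set v \<subseteq> Wb b \<and> length v = N}" using cl_in by auto
  then have fin: "finite (?f ` space (Bn b))" using finite_lists_length_eq[OF Wb_props(1)] finite_subset by blast
  have lev: "?f -` {?f u} \<inter> space (Bn b) = {v \<in> space (PiM UNIV (\<lambda>_. measure_pmf (Pb b))). \<forall>i\<in>{1..N}. v i \<in> {w. cl b w = cl b (u i)}}" for u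
  proof -
    have "(\<forall>j<N. cl b (v (Suc j)) = cl b (u (Suc j))) \<longleftrightarrow> (\<forall>i\<in>{1..N}. cl b (v i) = cl b (u i))" for v
    proof safe
      fix i assume *: "\<forall>j<N. cl b (v (Suc j)) = cl b (u (Suc j))" "i \<in> {1..N}"
      then obtain j where "i = Suc j" "j < N" by (cases i) auto
      then show "cl b (v i) = cl b (u i)" using *(1) by blast
    qed auto
    then show ?thesis by (auto simp: list_eq_iff_nth_eq space_PiM)
  qed
  have m: "?f -` {?f u} \<inter> space (Bn b) \<in> sets (Bn b)" for u
    unfolding lev unfolding Bn_def by measurable
  have sf: "simple_function (Bn b) ?f"
    unfolding simple_function_def using fin m by auto
  have meas: "measure (Bn b) (?f -` {?f u} \<inter> space (Bn b)) = (\<Prod>i\<in>{1..N}. measure (measure_pmf (Pb b)) {w. cl b w = cl b (u i)})" for u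
  proof -
    have "emeasure (Bn b) (?f -` {?f u} \<inter> space (Bn b)) = (\<Prod>i\<in>{1..N}. emeasure (measure_pmf (Pb b)) {w. cl b w = cl b (u i)})"
      unfolding lev unfolding Bn_def by (rule PP.emeasure_PiM_Collect) auto
    also have "\<dots> = ennreal (\<Prod>i\<in>{1..N}. measure (measure_pmf (Pb b)) {w. cl b w = cl b (u i)})"
      by (simp add: measure_pmf.emeasure_eq_measure prod_ennreal)
    finally show ?thesis by (intro measure_eq_emeasure_eq_ennreal prod_nonneg) simp_all
  qed
  have pm: "measure (measure_pmf (Pb b)) {w. cl b w = cl b v} = (r (cl b v) / D) powr s / Zb b" for v
  proof -
    have "measure (measure_pmf (Pb b)) {w. cl b w = cl b v} = measure (measure_pmf (Pb b)) {cl b v}"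
    proof (rule measure_pmf.finite_measure_eq_AE)
      show "AE x in measure_pmf (Pb b). (x \<in> {w. cl b w = cl b v}) = (x \<in> {cl b v})"
        using pmf_Pb(2)[of b] by (auto simp: AE_measure_pmf_iff cl_def)
    qed auto
    then show ?thesis using pmf_Pb(1)[OF cl_in] by (simp add: measure_pmf_single)
  qed
  have ln_pm: "- ln ((r w / D) powr s / Zb b) \<ge> s * (ln D - ln (r w))" for w
  proof -
    have "ln ((r w / D) powr s / Zb b) = s * (ln (r w) - ln D) - ln (Zb b)"
      using rD(1)[of w] Zb_ge1[of b] r_pos[of w] D_ge1 by (simp add: ln_div ln_powr)
    moreover have "ln (Zb b) \<ge> 0" using Zb_ge1 by simp
    ultimately show ?thesis by (simp add: algebra_simps)
  qed
  have pos: "(r w / D) powr s / Zb b > 0" for w using rD(1)[of w] Zb_ge1[of b] r_pos[of w] D_ge1 by simp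
  have "fent (Bn b) ?f = (\<integral>u. - ln (measure (Bn b) (?f -` {?f u} \<inter> space (Bn b))) \<partial>Bn b)"
    by (rule fent_eq_integral[OF prob_Bn sf])
  also have "\<dots> = (\<integral>u. (\<Sum>i\<in>{1..N}. - ln ((r (cl b (u i)) / D) powr s / Zb b)) \<partial>Bn b)"
  proof -
    have "ln (\<Prod>i\<in>{1..N}. (r (cl b (u i)) / D) powr s / Zb b) = (\<Sum>i\<in>{1..N}. ln ((r (cl b (u i)) / D) powr s / Zb b))" for u
    proof (rule ln_prod)
      show "(r (cl b (u i)) / D) powr s / Zb b \<noteq> 0" for i by (rule less_imp_neq[OF pos, symmetric])
    qed simp
    then show ?thesis unfolding meas pm by (simp only: sum_negf)
  qed
  also have "\<dots> = (\<Sum>i\<in>{1..N}. (\<integral>u. - ln ((r (cl b (u i)) / D) powr s / Zb b) \<partial>Bn b))"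
    using integrable_component[of b "\<lambda>w. - ln ((r w / D) powr s / Zb b)"]
    by (intro Bochner_Integration.integral_sum) auto
  also have "\<dots> \<ge> (\<Sum>i\<in>{1..N}. s * \<Theta> b)"
  proof (rule sum_mono)
    fix i
    have "s * \<Theta> b = (\<integral>u. s * (ln D - ln (r (cl b (u 0)))) \<partial>Bn b)" unfolding \<Theta>_def by simp
    also have "\<dots> = (\<integral>u. s * (ln D - ln (r (cl b (u i)))) \<partial>Bn b)"
      by (rule integral_component[where g="\<lambda>w. s * (ln D - ln (r w))" and b=b and i=i, symmetric])
    also have "\<dots> \<le> (\<integral>u. - ln ((r (cl b (u i)) / D) powr s / Zb b) \<partial>Bn b)"
      using integrable_component[of b "\<lambda>w. - ln ((r w / D) powr s / Zb b)" i]
        integrable_component[of b "\<lambda>w. s * (ln D - ln (r w))" i] ln_pm by (intro integral_mono) auto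
    finally show "s * \<Theta> b \<le> (\<integral>u. - ln ((r (cl b (u i)) / D) powr s / Zb b) \<partial>Bn b)" .
  qed
  finally show ?thesis by simp
qed

text \<open>Per block, entropy is at least \<open>s * \<Theta> b\<close> and the logarithmic
  derivative at most \<open>\<Theta> b\<close>. Both bounds survive mixing with the same weights, so
  the weights are free to be tuned to the integral \<open>\<alpha>\<close>.\<close>

lemma ex_equilibrium:
  "\<exists>\<mu>\<in>invariant_measures T I. has_bochner_integral \<mu> \<phi> \<alpha> \<and> lyapunov T I \<mu> < \<infinity> \<and>
    ereal s \<le> ks_entropy T \<mu> / lyapunov T I \<mu>"
proof -
  define d where "d b = (\<integral>u. (\<Sum>k<L. \<phi> (X b k u)) - real L * \<alpha> \<partial>Bn b)" for b
  have int_phi: "integrable (Bn b) (\<lambda>u. \<phi> (X b k u))" for b k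
    by (rule integrable_\<nu>(3)[OF phi_measurable phi_X])
  have int_d: "integrable (Bn b) (\<lambda>u. (\<Sum>k<L. \<phi> (X b k u)) - real L * \<alpha>)" for b
  proof -
    interpret B: prob_space "Bn b" by (rule prob_Bn)
    show ?thesis using int_phi by auto
  qed
  have d1: "d True \<ge> 0" unfolding d_def
  proof (rule integral_nonneg_AE)
    have "0 \<le> (\<Sum>k<L. \<phi> (X True k u)) - real L * \<alpha>" for u
      using E_X[of True u] up[of "cl True (u 0)"] cl_in[of True "u 0"] by (simp add: Wb_def abs_le_iff)
    then show "AE u in Bn True. 0 \<le> (\<Sum>k<L. \<phi> (X True k u)) - real L * \<alpha>" by simp
  qed
  have "- d False = (\<integral>u. - ((\<Sum>k<L. \<phi> (X False k u)) - real L * \<alpha>) \<partial>Bn False)"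
    unfolding d_def by (rule integral_minus[symmetric])
  also have "\<dots> \<ge> 0"
  proof (rule integral_nonneg_AE)
    have "0 \<le> - ((\<Sum>k<L. \<phi> (X False k u)) - real L * \<alpha>)" for u
      using E_X[of False u] down[of "cl False (u 0)"] cl_in[of False "u 0"] by (simp add: Wb_def abs_le_iff)
    then show "AE u in Bn False. 0 \<le> - ((\<Sum>k<L. \<phi> (X False k u)) - real L * \<alpha>)" by simp
  qed
  finally have d2: "d False \<le> 0" by simp
  \<comment> \<open>The mean deviations of the two families have opposite signs or vanish, so some
    convex combination of them is 0.\<close>
  obtain q where q: "0 \<le> q" "q \<le> 1" "q * d True + (1 - q) * d False = 0"
  proof (cases "d True - d False = 0")
    case True
    then have "d True = 0" "d False = 0" using d1 d2 by auto
    then show ?thesis using that[of 0] by simp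
  next
    case False
    then have pos: "d True - d False > 0" using d1 d2 by simp
    show ?thesis
    proof (rule that[of "- d False / (d True - d False)"])
      show "- d False / (d True - d False) * d True + (1 - - d False / (d True - d False)) * d False = 0"
        using pos by (simp add: field_simps)
    qed (use pos d1 d2 in \<open>auto simp: field_simps\<close>)
  qed
  define qb where "qb b = (if b then q else 1 - q)" for b
  define J where "J = (UNIV :: bool set) \<times> {..<L}"
  define c where "c j = qb (fst j) / real L" for j :: "bool \<times> nat"
  have sumJ: "(\<Sum>j\<in>J. c j * g j) = (\<Sum>b\<in>UNIV. qb b * ((\<Sum>k<L. g (b, k)) / real L))" for g :: "bool \<times> nat \<Rightarrow> real"
  proof -
    have "(\<Sum>j\<in>J. c j * g j) = (\<Sum>b\<in>UNIV. \<Sum>k<L. c (b, k) * g (b, k))"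
      unfolding J_def by (simp add: sum.cartesian_product)
    then show ?thesis by (simp add: c_def sum_distrib_left sum_divide_distrib)
  qed
  have finJ: "finite J" by (simp add: J_def)
  have c0: "0 \<le> c j" for j using q by (auto simp: c_def qb_def)
  have c1: "sum c J = 1"
    using sumJ[of "\<lambda>_. 1"] L by (simp add: qb_def UNIV_bool)
  from ex_mixture[where \<nu>=\<nu>, OF finJ c0 c1 \<nu>_props(1,2)] obtain \<mu> where \<mu>0: "prob_space \<mu>" "sets \<mu> = sets \<B>"
    "\<forall>A\<in>sets \<B>. measure \<mu> A = (\<Sum>j\<in>J. c j * measure (\<nu> j) A)"
    "\<forall>f\<in>borel_measurable \<B>. (\<forall>j\<in>J. integrable (\<nu> j) f) \<longrightarrow>
       has_bochner_integral \<mu> f (\<Sum>j\<in>J. c j * (\<integral>x. f x \<partial>\<nu> j) :: real)"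
    by (elim exE conjE) (rule that)
  have \<mu>: "prob_space \<mu>" "sets \<mu> = sets \<B>"
    "\<And>A. A \<in> sets \<B> \<Longrightarrow> measure \<mu> A = (\<Sum>j\<in>J. c j * measure (\<nu> j) A)"
    "\<And>f :: real \<Rightarrow> real. f \<in> borel_measurable \<B> \<Longrightarrow> (\<forall>j\<in>J. integrable (\<nu> j) f) \<Longrightarrow>
       has_bochner_integral \<mu> f (\<Sum>j\<in>J. c j * (\<integral>x. f x \<partial>\<nu> j))"
    by (rule \<mu>0(1), rule \<mu>0(2), rule bspec[OF \<mu>0(3)], assumption, rule mp[OF bspec[OF \<mu>0(4)]], assumption+)
  interpret P: prob_space \<mu> by (rule \<mu>(1))
  have sp: "space \<mu> = \<Lambda>" using sets_eq_imp_space_eq[OF \<mu>(2)] by (simp add: space_restrict_space)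
  have Tm: "T \<in> measurable \<mu> \<mu>" using T_measurable measurable_cong_sets[OF \<mu>(2) \<mu>(2)] by simp
  have mX: "measure (\<nu> (b, k)) A = measure (Bn b) (X b k -` A)" if "A \<in> sets \<B>" for b k A
    unfolding \<nu>_def using measure_distr[OF X_measurable that] by simp
  have inv: "distr \<mu> \<mu> T = \<mu>"
  proof (rule measure_eqI)
    fix A assume "A \<in> sets (distr \<mu> \<mu> T)"
    then have A: "A \<in> sets \<mu>" "A \<in> sets \<B>" using \<mu>(2) by auto
    have TA: "T -` A \<inter> \<Lambda> \<in> sets \<B>" using measurable_sets[OF Tm A(1)] sp \<mu>(2) by simp
    have "X b k -` (T -` A \<inter> \<Lambda>) = X b (Suc k) -` A" for b k
      using X_T[of 1 b k] \<pi>_in by (auto simp: X_def)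
    then have sh: "measure (\<nu> (b, k)) (T -` A \<inter> \<Lambda>) = measure (Bn b) (X b (Suc k) -` A)" for b k
      using mX[OF TA] by simp
    \<comment> \<open>One application of \<open>T\<close> moves phase \<open>k\<close> to
      \<open>k + 1\<close>, and phase \<open>L\<close> has the law of phase 0, so the sum over a
      full period does not change.\<close>
    have tel: "(\<Sum>k<L. measure (Bn b) (X b (Suc k) -` A)) = (\<Sum>k<L. measure (Bn b) (X b k -` A))" for b
    proof -
      have "measure (distr (Bn b) \<B> (X b L)) A = measure (distr (Bn b) \<B> (X b 0)) A" by (simp add: distr_X_L)
      then have "measure (Bn b) (X b L -` A) = measure (Bn b) (X b 0 -` A)"
        using measure_distr[OF X_measurable A(2)] by simp
      then show ?thesis
        using sum.lessThan_Suc_shift[of "\<lambda>k. measure (Bn b) (X b k -` A)" L]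
          sum.lessThan_Suc[of "\<lambda>k. measure (Bn b) (X b k -` A)" L] by linarith
    qed
    have "measure (distr \<mu> \<mu> T) A = measure \<mu> (T -` A \<inter> \<Lambda>)" using measure_distr[OF Tm A(1)] sp by simp
    also have "\<dots> = (\<Sum>b\<in>UNIV. qb b * ((\<Sum>k<L. measure (Bn b) (X b (Suc k) -` A)) / real L))"
      using \<mu>(3)[OF TA] sumJ[of "\<lambda>j. measure (\<nu> j) (T -` A \<inter> \<Lambda>)"] by (simp add: sh)
    also have "\<dots> = measure \<mu> A"
      using \<mu>(3)[OF A(2)] sumJ[of "\<lambda>j. measure (\<nu> j) A"] by (simp add: tel mX[OF A(2)])
    finally have m_eq: "measure (distr \<mu> \<mu> T) A = measure \<mu> A" .
    interpret Q: prob_space "distr \<mu> \<mu> T" by (rule P.prob_space_distr[OF Tm])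
    from m_eq show "emeasure (distr \<mu> \<mu> T) A = emeasure \<mu> A"
      by (simp add: P.emeasure_eq_measure Q.emeasure_eq_measure)
  qed simp
  have inv_prob: "invariant_prob T \<mu>" using \<mu>(1) Tm inv by (simp add: invariant_prob_def)
  have mu: "\<mu> \<in> invariant_measures T I" using sp \<mu>(2) inv_prob by (simp add: invariant_measures_def)

  have sum_int: "(\<Sum>k<L. (\<integral>x. \<phi> x \<partial>\<nu> (b, k))) = d b + real L * \<alpha>" for b
  proof -
    interpret B: prob_space "Bn b" by (rule prob_Bn)
    have "(\<Sum>k<L. (\<integral>x. \<phi> x \<partial>\<nu> (b, k))) = (\<integral>u. (\<Sum>k<L. \<phi> (X b k u)) \<partial>Bn b)"
      using integrable_\<nu>[OF phi_measurable phi_X] by simp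
    moreover have "d b = (\<integral>u. (\<Sum>k<L. \<phi> (X b k u)) \<partial>Bn b) - real L * \<alpha>"
      unfolding d_def using int_phi using B.prob_space[unfolded space_Bn] by (subst Bochner_Integration.integral_diff) auto
    ultimately show ?thesis by simp
  qed
  have phi_int: "has_bochner_integral \<mu> \<phi> \<alpha>"
  proof -
    have "has_bochner_integral \<mu> \<phi> (\<Sum>j\<in>J. c j * (\<integral>x. \<phi> x \<partial>\<nu> j))"
      using integrable_\<nu>(1)[OF phi_measurable phi_X] by (intro \<mu>(4)[OF phi_measurable]) auto
    moreover have "(\<Sum>j\<in>J. c j * (\<integral>x. \<phi> x \<partial>\<nu> j)) = (\<Sum>b\<in>UNIV. qb b * ((d b + real L * \<alpha>) / real L))"
      using sumJ[of "\<lambda>j. \<integral>x. \<phi> x \<partial>\<nu> j"] by (simp add: sum_int)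
    moreover have "\<dots> = (q * d True + (1 - q) * d False) / real L + \<alpha>"
      using L by (simp add: qb_def UNIV_bool field_simps)
    ultimately show ?thesis using q(3) by simp
  qed

  have lnB_int: "integrable (\<nu> (b, k)) lnB" "(\<integral>x. lnB x \<partial>\<nu> (b, k)) = (\<integral>u. lnB (X b k u) \<partial>Bn b)" "integrable (Bn b) (\<lambda>u. lnB (X b k u))" for b k
  proof -
    obtain C where "\<And>k u. \<bar>lnB (X b k u)\<bar> \<le> C" using lnB_X by blast
    then show "integrable (\<nu> (b, k)) lnB" "(\<integral>x. lnB x \<partial>\<nu> (b, k)) = (\<integral>u. lnB (X b k u) \<partial>Bn b)" "integrable (Bn b) (\<lambda>u. lnB (X b k u))"
      using integrable_\<nu>[OF lnB_measurable] by blast+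
  qed
  define \<Theta>' where "\<Theta>' = (\<Sum>b\<in>UNIV. qb b * (\<Theta> b / real L))"
  have lnB_mu: "has_bochner_integral \<mu> lnB (\<Sum>j\<in>J. c j * (\<integral>x. lnB x \<partial>\<nu> j))"
    using lnB_int by (intro \<mu>(4)[OF lnB_measurable]) auto
  have int_mu: "integrable \<mu> lnB" using lnB_mu by (rule integrable.intros)
  have lam_le: "(\<integral>x. lnB x \<partial>\<mu>) \<le> \<Theta>'"
  proof -
    have "(\<integral>x. lnB x \<partial>\<mu>) = (\<Sum>b\<in>UNIV. qb b * ((\<Sum>k<L. (\<integral>x. lnB x \<partial>\<nu> (b, k))) / real L))"
      using has_bochner_integral_integral_eq[OF lnB_mu] sumJ[of "\<lambda>j. \<integral>x. lnB x \<partial>\<nu> j"] by simp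
    also have "\<dots> \<le> \<Theta>'"
      unfolding \<Theta>'_def
    proof (intro sum_mono mult_left_mono divide_right_mono)
      fix b
      have "(\<Sum>k<L. (\<integral>x. lnB x \<partial>\<nu> (b, k))) = (\<integral>u. (\<Sum>k<L. lnB (X b k u)) \<partial>Bn b)"
        using lnB_int by simp
      also have "\<dots> \<le> \<Theta> b"
        unfolding \<Theta>_def using lnB_int(3) LB_X integrable_component[of b "\<lambda>w. ln D - ln (r w)" 0]
        by (intro integral_mono) auto
      finally show "(\<Sum>k<L. (\<integral>x. lnB x \<partial>\<nu> (b, k))) \<le> \<Theta> b" .
    qed (use q in \<open>auto simp: qb_def\<close>)
    finally show ?thesis .
  qed

  \<comment> \<open>Only letters from the finite set \<open>F\<close> occur on these paths, so
    recording the letter is a function with finitely many values; \<open>None\<close> keeps it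
    finite on the rest of the repeller.\<close>
  define F where "F = (\<Union>w\<in>W. set w)"
  have finF: "finite F" using finW by (auto simp: F_def)
  define f where "f x = (if letter x \<in> F then Some (letter x) else None)" for x
  have f_B: "simple_function \<B> f"
    unfolding simple_function_def
  proof (intro conjI ballI)
    show "finite (f ` space \<B>)"
      by (rule finite_subset[of _ "insert None (Some ` F)"]) (use finF in \<open>auto simp: f_def\<close>)
    have "(\<lambda>x. (\<lambda>i. if i \<in> F then Some i else None) (letter x)) \<in> measurable \<B> (count_space UNIV)"
      by (rule measurable_compose[OF measurable_restrict_space1[OF letter_measurable]]) simp
    then have "f \<in> measurable \<B> (count_space UNIV)" by (simp add: f_def[abs_def])
    then show "f -` {v} \<inter> space \<B> \<in> sets \<B>" for v by (rule measurable_sets) simp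
  qed
  have alg: "simple_function \<mu> g = simple_function \<B> g" for g :: "real \<Rightarrow> 'z"
    unfolding simple_function_def using \<mu>(2) sp by (simp add: space_restrict_space)
  have f_mu: "simple_function \<mu> f" using f_B by (simp add: alg)
  obtain Q where Q: "finite_partition \<mu> Q" "\<And>n. fent \<mu> (names T f n) \<le> fent \<mu> (names T (cell Q) n)"
    using ex_finite_partition_of_simple[OF inv_prob f_mu] by blast
  have Tpos: "0 \<le> s * \<Theta>'"
    using s \<Theta>_nonneg q by (auto simp: \<Theta>'_def qb_def intro!: mult_nonneg_nonneg sum_nonneg)
  have low: "real n * (s * \<Theta>') - 2 * real L * (s * \<Theta>') \<le> fent \<mu> (names T (cell Q) n)" for n
  proof -
    \<comment> \<open>A stretch of \<open>n\<close> letters from a phase \<open>k < L\<close>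
      contains the complete blocks with indices 1 to \<open>N\<close>; at most two block lengths are
      lost at the ends.\<close>
    define N where "N = n div L - 1"
    have names_B: "simple_function \<B> (names T f n)" by (rule simple_function_names[OF f_B T_measurable])
    have each: "fent (\<nu> (b, k)) (names T f n) \<ge> real N * (s * \<Theta> b)" if k: "k < L" for b k
    proof -
      interpret B: prob_space "Bn b" by (rule prob_Bn)
      have "fent (Bn b) (\<lambda>u. map (\<lambda>j. cl b (u (Suc j))) [0..<N]) \<le> fent (Bn b) (\<lambda>u. names T f n (X b k u))"
      proof (rule B.fent_comp_le[where h="\<lambda>z. map (\<lambda>j. map (\<lambda>i. the (z ! (Suc j * L + i - k))) [0..<L]) [0..<N]"])
        show "simple_function (Bn b) (\<lambda>u. names T f n (X b k u))"
          using simple_function_comp[OF X_measurable names_B, of b k] by (simp add: comp_def)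
        fix u
        have fX: "f (X b j u) = Some (ow b u j)" for j
        proof -
          have "letter (X b j u) = ow b u j"
            using fun_cong[OF itin_X[of b j u], of 0] by (simp add: itin_def shiftn_def)
          moreover have "ow b u j \<in> F"
          proof -
            have "cl b (u (j div L)) \<in> W" using cl_in Wb_props(4) by blast
            moreover have "j mod L < length (cl b (u (j div L)))" using EW_D(1)[OF cl_EW] L by simp
            ultimately show ?thesis unfolding F_def ow_def by (meson UN_I nth_mem)
          qed
          ultimately show ?thesis by (simp add: f_def)
        qed
        have nm: "names T f n (X b k u) ! i = Some (ow b u (k + i))" if "i < n" for i
          using that by (simp add: names_def X_T fX)
        have word: "map (\<lambda>i. the (names T f n (X b k u) ! (Suc j * L + i - k))) [0..<L] = cl b (u (Suc j))" if j: "j < N" for j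
        proof (rule nth_equalityI)
          fix i assume "i < length (map (\<lambda>i. the (names T f n (X b k u) ! (Suc j * L + i - k))) [0..<L])"
          then have i: "i < L" by simp
          have kl: "k \<le> Suc j * L + i" using k by simp
          have "Suc (Suc j) \<le> n div L" using j by (simp add: N_def)
          then have "Suc (Suc j) * L \<le> n div L * L" by (rule mult_right_mono) simp
          also have "\<dots> \<le> n" by simp
          finally have "Suc j * L + i - k < n" using i by simp
          then have "names T f n (X b k u) ! (Suc j * L + i - k) = Some (ow b u (Suc j * L + i))"
            using nm kl by (simp del: mult_Suc)
          then show "map (\<lambda>i. the (names T f n (X b k u) ! (Suc j * L + i - k))) [0..<L] ! i = cl b (u (Suc j)) ! i"
            using i ow_block[OF i, of b u "Suc j"] by (simp del: mult_Suc)
        qed (simp add: EW_D(1)[OF cl_EW])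
        show "map (\<lambda>j. cl b (u (Suc j))) [0..<N] =
            map (\<lambda>j. map (\<lambda>i. the (names T f n (X b k u) ! (Suc j * L + i - k))) [0..<L]) [0..<N]"
          using word by simp
      qed
      also have "\<dots> = fent (\<nu> (b, k)) (names T f n)"
        unfolding \<nu>_def using fent_comp_distr[OF X_measurable names_B, of b k] by simp
      finally show ?thesis using words_entropy[of N b] by simp
    qed
    have "(\<Sum>j\<in>J. c j * fent (\<nu> j) (names T f n)) \<le> fent \<mu> (names T f n)"
    proof (rule fent_mixture_ge[OF finJ c0 c1])
      show "finite (names T f n ` space \<mu>)" using simple_functionD(1)[OF names_B[folded alg]] .
      show "measure \<mu> (names T f n -` {v} \<inter> space \<mu>) = (\<Sum>j\<in>J. c j * measure (\<nu> j) (names T f n -` {v} \<inter> space \<mu>))" for v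
        using simple_functionD(2)[OF names_B[folded alg], of "{v}"] \<mu>(2) by (intro \<mu>(3)) simp
    qed (use \<nu>_props(3) sp in simp)
    also have "fent \<mu> (names T f n) \<le> fent \<mu> (names T (cell Q) n)" by (rule Q(2))
    finally have 1: "(\<Sum>j\<in>J. c j * fent (\<nu> j) (names T f n)) \<le> fent \<mu> (names T (cell Q) n)" .
    have "real N * real L * (s * \<Theta>') = (\<Sum>j\<in>J. c j * (real N * (s * \<Theta> (fst j))))"
      unfolding sumJ[of "\<lambda>j. real N * (s * \<Theta> (fst j))"] \<Theta>'_def using L
      by (simp add: UNIV_bool field_simps)
    also have "\<dots> \<le> (\<Sum>j\<in>J. c j * fent (\<nu> j) (names T f n))"
      using each c0 by (intro sum_mono mult_left_mono) (auto simp: J_def)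
    finally have 2: "real N * real L * (s * \<Theta>') \<le> fent \<mu> (names T (cell Q) n)" using 1 by simp
    have "real n - 2 * real L \<le> real N * real L"
    proof -
      have "n = n div L * L + n mod L" "n mod L < L" using L by auto
      moreover have "n div L \<le> N + 1" by (simp add: N_def)
      then have "n div L * L \<le> (N + 1) * L" by (rule mult_right_mono) simp
      ultimately have "n \<le> (N + 1) * L + L" by linarith
      then have "real n \<le> real ((N + 1) * L + L)" by (rule of_nat_mono)
      then show ?thesis by (simp add: algebra_simps)
    qed
    then have "(real n - 2 * real L) * (s * \<Theta>') \<le> real N * real L * (s * \<Theta>')" using Tpos by (rule mult_right_mono)
    then show ?thesis using 2 by (simp add: algebra_simps)
  qed
  have h: "ereal (s * \<Theta>') \<le> ks_entropy T \<mu>" by (rule ks_entropy_ge[OF inv_prob Q(1) low])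
  have lpos: "0 < (\<integral>x. lnB x \<partial>\<mu>)" by (rule lyapunov_pos[OF mu int_mu])
  have lam: "lyapunov T I \<mu> = ereal (\<integral>x. lnB x \<partial>\<mu>)" by (rule lyapunov_eq[OF int_mu])
  have "ereal ((\<integral>x. lnB x \<partial>\<mu>) * s) \<le> ks_entropy T \<mu>"
  proof -
    have "(\<integral>x. lnB x \<partial>\<mu>) * s \<le> s * \<Theta>'" using mult_left_mono[OF lam_le s] by (simp only: mult.commute)
    then have "ereal ((\<integral>x. lnB x \<partial>\<mu>) * s) \<le> ereal (s * \<Theta>')" by simp
    then show ?thesis using h by (rule order_trans)
  qed
  then have "ereal s \<le> ks_entropy T \<mu> / lyapunov T I \<mu>"
    unfolding lam using lpos by (subst ereal_le_divide_pos) auto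
  then show ?thesis using mu phi_int lam by auto
qed

end

context emr_level
begin

lemma measure_of_good:
  assumes "good s" "0 \<le> s"
  shows "\<exists>\<mu>\<in>invariant_measures T I. has_bochner_integral \<mu> \<phi> \<alpha> \<and> lyapunov T I \<mu> < \<infinity> \<and>
    ereal s \<le> ks_entropy T \<mu> / lyapunov T I \<mu>"
proof -
  obtain L Wp Wm where g: "L \<ge> 1" "finite Wp" "finite Wm" "Wp \<subseteq> EW L" "Wm \<subseteq> EW L"
    "\<forall>w\<in>Wp. E w \<ge> B" "\<forall>w\<in>Wm. E w \<le> - B"
    "(\<Sum>w\<in>Wp. (r w / D) powr s) \<ge> 1" "(\<Sum>w\<in>Wm. (r w / D) powr s) \<ge> 1"
    using assms(1) unfolding good_def by blast
  interpret steering T I \<pi> \<phi> \<alpha> s L Wp Wm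
    by unfold_locales (use g assms in auto)
  show ?thesis by (rule ex_equilibrium)
qed

end

section \<open>A finite weak law of large numbers\<close>

definition words_of :: "'a set \<Rightarrow> nat \<Rightarrow> 'a list set" where
  "words_of W N = {v. set v \<subseteq> W \<and> length v = N}"

lemma words_of_0: "words_of W 0 = {[]}" by (auto simp: words_of_def)

lemma finite_words_of: "finite W \<Longrightarrow> finite (words_of W N)"
  unfolding words_of_def by (rule finite_lists_length_eq)

lemma sum_words_of_Suc:
  assumes "finite W"
  shows "(\<Sum>v\<in>words_of W (Suc N). f v) = (\<Sum>x\<in>W. \<Sum>v\<in>words_of W N. f (x # v))"
proof -
  have eq: "words_of W (Suc N) = (\<lambda>(x, v). x # v) ` (W \<times> words_of W N)"
    by (auto simp: words_of_def length_Suc_conv image_iff)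
  have "inj_on (\<lambda>(x, v). x # v) (W \<times> words_of W N)" by (auto simp: inj_on_def)
  then have "(\<Sum>v\<in>words_of W (Suc N). f v) = (\<Sum>z\<in>W \<times> words_of W N. f (case z of (x, v) \<Rightarrow> x # v))"
    unfolding eq by (simp add: sum.reindex)
  also have "\<dots> = (\<Sum>x\<in>W. \<Sum>v\<in>words_of W N. f (x # v))"
    by (simp add: sum.cartesian_product case_prod_unfold)
  finally show ?thesis .
qed

text \<open>Split off the first entry. In the second moment the cross term vanishes because the
  remaining sum is centred.\<close>

lemma product_moments:
  fixes p Z :: "'a \<Rightarrow> real"
  assumes W: "finite W" and p: "(\<Sum>x\<in>W. p x) = 1" and Z: "(\<Sum>x\<in>W. p x * Z x) = 0"
  shows "(\<Sum>v\<in>words_of W N. prod_list (map p v)) = 1"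
    and "(\<Sum>v\<in>words_of W N. prod_list (map p v) * sum_list (map Z v)) = 0"
    and "(\<Sum>v\<in>words_of W N. prod_list (map p v) * (sum_list (map Z v))\<^sup>2) = real N * (\<Sum>x\<in>W. p x * (Z x)\<^sup>2)"
proof (induction N)
  case 0
  { case 1 show ?case by (simp add: words_of_0) }
  { case 2 show ?case by (simp add: words_of_0) }
  { case 3 show ?case by (simp add: words_of_0) }
next
  case (Suc N)
  let ?P = "\<lambda>v. prod_list (map p v)" and ?Z = "\<lambda>v. sum_list (map Z v)"
  { case 1
    have "(\<Sum>v\<in>words_of W (Suc N). ?P v) = (\<Sum>x\<in>W. p x * (\<Sum>v\<in>words_of W N. ?P v))"
      unfolding sum_words_of_Suc[OF W] by (simp add: sum_distrib_left)
    then show ?case using Suc(1) p by simp }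
  { case 2
    have "(\<Sum>v\<in>words_of W (Suc N). ?P v * ?Z v)
        = (\<Sum>x\<in>W. p x * Z x * (\<Sum>v\<in>words_of W N. ?P v) + p x * (\<Sum>v\<in>words_of W N. ?P v * ?Z v))"
      unfolding sum_words_of_Suc[OF W] by (simp add: sum_distrib_left sum.distrib algebra_simps)
    then show ?case using Suc(1,2) Z by simp }
  { case 3
    have "(\<Sum>v\<in>words_of W (Suc N). ?P v * (?Z v)\<^sup>2)
        = (\<Sum>x\<in>W. p x * (Z x)\<^sup>2 * (\<Sum>v\<in>words_of W N. ?P v) + 2 * p x * Z x * (\<Sum>v\<in>words_of W N. ?P v * ?Z v)
            + p x * (\<Sum>v\<in>words_of W N. ?P v * (?Z v)\<^sup>2))"
      unfolding sum_words_of_Suc[OF W]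
      by (simp add: sum_distrib_left sum.distrib algebra_simps power2_eq_square)
    also have "\<dots> = (\<Sum>x\<in>W. p x * (Z x)\<^sup>2) + real N * (\<Sum>x\<in>W. p x * (Z x)\<^sup>2)"
      unfolding Suc by (simp add: sum.distrib p flip: sum_distrib_right)
    finally show ?case by (simp add: algebra_simps) }
qed

text \<open>Chebyshev's inequality for the product weights; \<open>N0\<close> is where the variance
  bound \<open>V / (N * \<eta>\<^sup>2)\<close> falls below \<open>1 / 4\<close>.\<close>

lemma weak_law:
  fixes p Y :: "'a \<Rightarrow> real"
  assumes W: "finite W" and p: "(\<Sum>x\<in>W. p x) = 1" "\<And>x. x \<in> W \<Longrightarrow> 0 \<le> p x" and eta: "\<eta> > 0"
  shows "\<exists>N0. \<forall>N\<ge>N0. (\<Sum>v\<in>{v \<in> words_of W N. real N * \<eta> < \<bar>sum_list (map Y v) - real N * (\<Sum>x\<in>W. p x * Y x)\<bar>}.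
      prod_list (map p v)) \<le> 1 / 4"
proof -
  define m where "m = (\<Sum>x\<in>W. p x * Y x)"
  define Z where "Z x = Y x - m" for x
  have Z0: "(\<Sum>x\<in>W. p x * Z x) = 0"
    using p(1) by (simp add: Z_def m_def[symmetric] right_diff_distrib sum_subtractf flip: sum_distrib_right)
  define V where "V = (\<Sum>x\<in>W. p x * (Z x)\<^sup>2)"
  have V0: "V \<ge> 0" using p(2) by (simp add: V_def sum_nonneg)
  obtain N0 where N0: "real N0 > 4 * V / \<eta>\<^sup>2" using reals_Archimedean2 by blast
  have "(\<Sum>v\<in>{v \<in> words_of W N. real N * \<eta> < \<bar>sum_list (map Y v) - real N * m\<bar>}. prod_list (map p v)) \<le> 1 / 4"
    if N: "N \<ge> N0 + 1" for N
  proof -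
    let ?A = "{v \<in> words_of W N. real N * \<eta> < \<bar>sum_list (map Y v) - real N * m\<bar>}"
    let ?P = "\<lambda>v. prod_list (map p v)" and ?Z = "\<lambda>v. sum_list (map Z v)"
    have Pnn: "0 \<le> ?P v" if "v \<in> words_of W N" for v
      using that p(2) by (auto simp: words_of_def subset_iff intro!: prod_list_nonneg)
    have sZ: "?Z v = sum_list (map Y v) - real N * m" if "v \<in> words_of W N" for v
    proof -
      have "sum_list (map Z v) = sum_list (map Y v) - real (length v) * m" for v
        by (induction v) (auto simp: Z_def algebra_simps)
      then show ?thesis using that by (simp add: words_of_def)
    qed
    have "(\<Sum>v\<in>?A. ?P v) * (real N * \<eta>)\<^sup>2 = (\<Sum>v\<in>?A. ?P v * (real N * \<eta>)\<^sup>2)" by (simp add: sum_distrib_right)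
    also have "\<dots> \<le> (\<Sum>v\<in>?A. ?P v * (?Z v)\<^sup>2)"
    proof (rule sum_mono)
      fix v assume v: "v \<in> ?A"
      then have "\<bar>real N * \<eta>\<bar> \<le> \<bar>?Z v\<bar>" using sZ[of v] eta by auto
      then have "(real N * \<eta>)\<^sup>2 \<le> (?Z v)\<^sup>2" by (rule abs_le_square_iff[THEN iffD1])
      then show "?P v * (real N * \<eta>)\<^sup>2 \<le> ?P v * (?Z v)\<^sup>2" using Pnn v by (intro mult_left_mono) auto
    qed
    also have "\<dots> \<le> (\<Sum>v\<in>words_of W N. ?P v * (?Z v)\<^sup>2)"
      using finite_words_of[OF W] Pnn by (intro sum_mono2) auto
    also have "\<dots> = real N * V" unfolding V_def by (rule product_moments(3)[OF W p(1) Z0])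
    finally have "(\<Sum>v\<in>?A. ?P v) * (real N * \<eta>)\<^sup>2 \<le> real N * V" .
    then have "real N * ((\<Sum>v\<in>?A. ?P v) * (real N * \<eta>\<^sup>2)) \<le> real N * V"
      by (simp add: power2_eq_square algebra_simps)
    then have 1: "(\<Sum>v\<in>?A. ?P v) * (real N * \<eta>\<^sup>2) \<le> V" using N by simp
    have "4 * V / \<eta>\<^sup>2 < real N" using N0 N by linarith
    then have "4 * V < real N * \<eta>\<^sup>2" using eta by (simp add: field_simps)
    then have pos: "real N * \<eta>\<^sup>2 > 0" and le: "V \<le> 1 / 4 * (real N * \<eta>\<^sup>2)" using V0 by auto
    have "(\<Sum>v\<in>?A. ?P v) * (real N * \<eta>\<^sup>2) \<le> 1 / 4 * (real N * \<eta>\<^sup>2)" using 1 le by linarith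
    then show ?thesis using pos by (rule mult_right_le_imp_le)
  qed
  then show ?thesis unfolding m_def by blast
qed

lemma prod_list_pos:
  fixes xs :: "real list"
  shows "(\<And>x. x \<in> set xs \<Longrightarrow> 0 < x) \<Longrightarrow> 0 < prod_list xs"
  by (induction xs) auto

context emr_level
begin

text \<open>For \<open>X w = - ln (p w) + s * ln (r w / D)\<close> of mean \<open>a > 0\<close>, a
  typical list of \<open>N\<close> words has \<open>X\<close>-sum at least \<open>N * a / 2\<close>:
  the \<open>s\<close>-power of its cylinder then exceeds twice its probability. Typical lists for
  both \<open>X\<close> and \<open>E\<close> have total probability at least
  \<open>1 / 2\<close>.\<close>

lemma approx_good_of_distribution:
  assumes s: "0 \<le> s"
    and H: "\<And>\<epsilon>. \<epsilon> > 0 \<Longrightarrow> \<exists>m0. \<forall>m\<ge>m0. \<exists>W p. finite W \<and> W \<subseteq> EW (Suc m) \<and> (\<forall>w\<in>W. 0 < p w) \<and> (\<Sum>w\<in>W. p w) = 1 \<and>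
      0 < (\<Sum>w\<in>W. p w * (- ln (p w) + s * ln (r w / D))) \<and> \<bar>\<Sum>w\<in>W. p w * E w\<bar> \<le> \<epsilon> * real m"
  shows "approx_good s"
  unfolding approx_good_def
proof (intro allI impI)
  fix \<epsilon> :: real and L0 :: nat assume eps: "\<epsilon> > 0"
  obtain m0 where m0: "\<forall>m\<ge>m0. \<exists>W p. finite W \<and> W \<subseteq> EW (Suc m) \<and> (\<forall>w\<in>W. 0 < p w) \<and> (\<Sum>w\<in>W. p w) = 1 \<and>
      0 < (\<Sum>w\<in>W. p w * (- ln (p w) + s * ln (r w / D))) \<and> \<bar>\<Sum>w\<in>W. p w * E w\<bar> \<le> \<epsilon> / 2 * real m"
    using H[of "\<epsilon> / 2"] eps by auto
  \<comment> \<open>Per word the weak law tolerates an error 1 and concatenation an error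
    \<open>B\<close>; a word of length above \<open>m1\<close> makes both small compared with
    \<open>\<epsilon> / 2\<close> per letter.\<close>
  obtain m1 where m1: "real m1 > 2 * (1 + B) / \<epsilon>" using reals_Archimedean2 by blast
  define m where "m = m0 + m1"
  have "m \<ge> m0" by (simp add: m_def)
  from m0[rule_format, OF this] obtain W p where W: "finite W" "W \<subseteq> EW (Suc m)" "\<forall>w\<in>W. 0 < p w" "(\<Sum>w\<in>W. p w) = 1"
      "0 < (\<Sum>w\<in>W. p w * (- ln (p w) + s * ln (r w / D)))" "\<bar>\<Sum>w\<in>W. p w * E w\<bar> \<le> \<epsilon> / 2 * real m"
    by (elim exE conjE) (rule that)
  define X where "X w = - ln (p w) + s * ln (r w / D)" for w
  define a where "a = (\<Sum>w\<in>W. p w * X w)"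
  have a: "a > 0" using W(5) by (simp add: a_def X_def)
  have p0: "\<And>w. w \<in> W \<Longrightarrow> 0 \<le> p w" using W(3) by (auto intro: less_imp_le)
  obtain N1 where N1: "\<And>N. N \<ge> N1 \<Longrightarrow> (\<Sum>v\<in>{v \<in> words_of W N. real N * 1 < \<bar>sum_list (map E v) - real N * (\<Sum>x\<in>W. p x * E x)\<bar>}.
      prod_list (map p v)) \<le> 1 / 4" using weak_law[OF W(1,4) p0, of 1 E] by auto
  obtain N2 where N2: "\<And>N. N \<ge> N2 \<Longrightarrow> (\<Sum>v\<in>{v \<in> words_of W N. real N * (a / 2) < \<bar>sum_list (map X v) - real N * (\<Sum>x\<in>W. p x * X x)\<bar>}.
      prod_list (map p v)) \<le> 1 / 4" using weak_law[OF W(1,4) p0, of "a / 2" X] a by auto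
  \<comment> \<open>Makes the gain \<open>N * a / 2\<close> cover the factor 2 and the factor
    \<open>M\<close> that comes from the empty word.\<close>
  obtain N3 where N3: "real N3 > (ln 2 - s * ln M) / (a / 2)" using reals_Archimedean2 by blast
  define N where "N = N1 + N2 + N3 + L0 + 1"
  let ?P = "\<lambda>v. prod_list (map p v)"
  let ?A1 = "{v \<in> words_of W N. real N * 1 < \<bar>sum_list (map E v) - real N * (\<Sum>x\<in>W. p x * E x)\<bar>}"
  let ?A2 = "{v \<in> words_of W N. real N * (a / 2) < \<bar>sum_list (map X v) - real N * (\<Sum>x\<in>W. p x * X x)\<bar>}"
  define G where "G = words_of W N - (?A1 \<union> ?A2)"
  have finw: "finite (words_of W N)" by (rule finite_words_of[OF W(1)])
  have Ppos: "0 < ?P v" if "v \<in> words_of W N" for v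
    using that W(3) by (auto simp: words_of_def subset_iff intro!: prod_list_pos)
  have "(\<Sum>v\<in>words_of W N. ?P v) = (\<Sum>v\<in>G. ?P v) + (\<Sum>v\<in>?A1 \<union> ?A2. ?P v)"
    unfolding G_def by (rule sum.subset_diff[OF _ finw]) auto
  then have total: "(\<Sum>v\<in>G. ?P v) + (\<Sum>v\<in>?A1 \<union> ?A2. ?P v) = 1"
    using product_moments(1)[OF W(1,4), of "\<lambda>_. 0" N] by simp
  have "0 \<le> (\<Sum>v\<in>?A1 \<inter> ?A2. ?P v)" using Ppos by (intro sum_nonneg) (auto intro: less_imp_le)
  then have union: "(\<Sum>v\<in>?A1 \<union> ?A2. ?P v) \<le> (\<Sum>v\<in>?A1. ?P v) + (\<Sum>v\<in>?A2. ?P v)"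
    using sum_Un[of ?A1 ?A2 ?P] finw by simp
  have A1: "(\<Sum>v\<in>?A1. ?P v) \<le> 1 / 4" by (rule N1) (simp add: N_def)
  have A2: "(\<Sum>v\<in>?A2. ?P v) \<le> 1 / 4" by (rule N2) (simp add: N_def)
  have G: "1 / 2 \<le> (\<Sum>v\<in>G. ?P v)" using total union A1 A2 by linarith
  have len: "length w = Suc m" if "v \<in> words_of W N" "w \<in> set v" for v w
    using that W(2) EW_D(1) by (auto simp: words_of_def)
  have eW: "w \<noteq> [] \<and> hd w = e0" if "v \<in> words_of W N" "w \<in> set v" for v w
    using that W(2) EW_D(2,3) unfolding words_of_def by blast
  have inj: "inj_on concat (words_of W N)"
  proof (rule inj_onI)
    fix v v' assume v: "v \<in> words_of W N" "v' \<in> words_of W N" "concat v = concat v'"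
    have "length x = length y" if "(x, y) \<in> set (zip v v')" for x y
      using set_zip_leftD[OF that] set_zip_rightD[OF that] len v by simp
    then have "\<forall>(x, y)\<in>set (zip v v'). length x = length y" by blast
    then show "v = v'" using v by (intro concat_injective) (auto simp: words_of_def)
  qed
  show "\<exists>L\<ge>L0. \<exists>W. finite W \<and> W \<subseteq> EW L \<and> (\<forall>w\<in>W. \<bar>E w\<bar> \<le> \<epsilon> * real L) \<and> 1 \<le> (\<Sum>w\<in>W. r w powr s)"
  proof (intro exI[of _ "N * Suc m"] conjI exI[of _ "concat ` G"])
    show "L0 \<le> N * Suc m" by (simp add: N_def)
    show "finite (concat ` G)" using finw by (simp add: G_def)
    have in_EW: "concat v \<in> EW (N * Suc m)" if v: "v \<in> words_of W N" for v
    proof -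
      have lv: "length v = N" using v by (simp add: words_of_def)
      then obtain w v' where vv: "v = w # v'" by (cases v) (auto simp: N_def)
      then have "w \<noteq> [] \<and> hd w = e0" using eW[OF v] by simp
      then have "concat v \<noteq> [] \<and> hd (concat v) = e0" using vv by simp
      moreover have "length (concat v) = N * Suc m" using length_concat_const[of v "Suc m"] len[OF v] lv by simp
      ultimately show ?thesis by (simp add: EW_def)
    qed
    then show "concat ` G \<subseteq> EW (N * Suc m)" by (auto simp: G_def)
    show "\<forall>w\<in>concat ` G. \<bar>E w\<bar> \<le> \<epsilon> * real (N * Suc m)"
    proof
      fix w assume "w \<in> concat ` G"
      then obtain v where v: "v \<in> G" "w = concat v" by blast
      have vw: "v \<in> words_of W N" using v(1) by (simp add: G_def)
      have 1: "\<bar>E (concat v) - sum_list (map E v)\<bar> \<le> B * real N"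
        using E_concat[of v] eW[OF vw] vw by (simp add: words_of_def)
      have 2: "\<bar>sum_list (map E v) - real N * (\<Sum>x\<in>W. p x * E x)\<bar> \<le> real N"
        using v(1) by (auto simp: G_def)
      have 3: "\<bar>real N * (\<Sum>x\<in>W. p x * E x)\<bar> \<le> real N * (\<epsilon> / 2 * real m)"
        using mult_left_mono[OF W(6), of "real N"] by (simp add: abs_mult)
      have "2 * (1 + B) / \<epsilon> < real m" using m1 by (simp add: m_def)
      then have "1 + B \<le> \<epsilon> / 2 * real m" using eps by (simp add: field_simps)
      then have "real N * (1 + B) \<le> real N * (\<epsilon> / 2 * real m)" by (rule mult_left_mono) simp
      then have "\<bar>E (concat v)\<bar> \<le> real N * (\<epsilon> / 2 * real m) + real N * (\<epsilon> / 2 * real m)"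
        using 1 2 3 by (simp add: algebra_simps)
      also have "\<dots> \<le> \<epsilon> * real (N * Suc m)" using eps by (simp add: algebra_simps)
      finally show "\<bar>E w\<bar> \<le> \<epsilon> * real (N * Suc m)" using v(2) by simp
    qed
    have each: "2 * ?P v \<le> r (concat v) powr s" if v: "v \<in> G" for v
    proof -
      have vw: "v \<in> words_of W N" using v by (simp add: G_def)
      have lv: "length v = N" using vw by (simp add: words_of_def)
      have "\<bar>sum_list (map X v) - real N * a\<bar> \<le> real N * (a / 2)"
        using v by (auto simp: G_def a_def)
      moreover have "real N * (a / 2) = real N * a / 2" by simp
      ultimately have Xlow: "sum_list (map X v) \<ge> real N * (a / 2)" by linarith
      have rr: "ln (r (concat v)) \<ge> ln M + sum_list (map (\<lambda>w. ln (r w / D)) v)" for v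
      proof (induction v)
        case (Cons w v)
        have "ln (r (w @ concat v)) \<ge> ln (r w) - 3 * D0 + ln (r (concat v))"
          using r_append[of w "concat v"] by (simp add: abs_le_iff)
        moreover have "ln (r w / D) = ln (r w) - 3 * D0" using r_pos[of w] by (simp add: D_def ln_div)
        ultimately show ?case using Cons by simp
      qed (simp add: r_Nil)
      have lnP: "ln (?P v) = sum_list (map (\<lambda>w. ln (p w)) v)" if "set v \<subseteq> W" for v
        using that
      proof (induction v)
        case (Cons w v)
        have "?P v > 0" using Cons.prems W(3) by (auto simp: subset_iff intro!: prod_list_pos)
        moreover have "p w \<noteq> 0" using Cons.prems W(3) by force
        ultimately show ?case using Cons by (simp add: ln_mult)
      qed simp
      have sX: "sum_list (map X v) = - sum_list (map (\<lambda>w. ln (p w)) v) + s * sum_list (map (\<lambda>w. ln (r w / D)) v)" for v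
        by (induction v) (auto simp: X_def algebra_simps)
      have "(ln 2 - s * ln M) / (a / 2) \<le> real N" using N3 by (simp add: N_def)
      then have big: "ln 2 - s * ln M \<le> real N * (a / 2)" using a by (simp add: field_simps)
      have "ln (2 * ?P v) = ln 2 + ln (?P v)" using Ppos[OF vw] by (subst ln_mult) auto
      also have "\<dots> \<le> s * ln M + sum_list (map X v) + ln (?P v)" using big Xlow by linarith
      also have "\<dots> = s * (ln M + sum_list (map (\<lambda>w. ln (r w / D)) v))"
        using lnP[of v] vw sX[of v] by (simp add: words_of_def algebra_simps)
      also have "\<dots> \<le> s * ln (r (concat v))" using rr s by (rule mult_left_mono)
      also have "\<dots> = ln (r (concat v) powr s)" using r_pos[of "concat v"] by (simp add: ln_powr)
      finally show ?thesis using Ppos[OF vw] r_pos[of "concat v"] by (subst (asm) ln_le_cancel_iff) auto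
    qed
    have "1 \<le> (\<Sum>v\<in>G. 2 * ?P v)" using G by (simp flip: sum_distrib_left)
    also have "\<dots> \<le> (\<Sum>v\<in>G. r (concat v) powr s)" using each by (rule sum_mono)
    also have "\<dots> = (\<Sum>w\<in>concat ` G. r w powr s)"
    proof -
      have "inj_on concat G" by (rule inj_on_subset[OF inj]) (auto simp: G_def)
      then show ?thesis by (simp add: sum.reindex)
    qed
    finally show "1 \<le> (\<Sum>w\<in>concat ` G. r w powr s)" .
  qed
qed

end

section \<open>Word distributions from invariant measures\<close>

lemma neg_xlnx_le_sqrt: "0 \<le> x \<Longrightarrow> - (x * ln x) \<le> 2 * sqrt x" for x :: real
proof (cases "x = 0")
  case False
  assume "0 \<le> x"
  then have x: "x > 0" using False by simp
  have "ln (1 / sqrt x) \<le> 1 / sqrt x - 1" using x by (intro ln_le_minus_one) simp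
  then have "- ln x \<le> 2 * (1 / sqrt x)" using x by (simp add: ln_div ln_sqrt)
  then have "x * (- ln x) \<le> x * (2 * (1 / sqrt x))" using x by (intro mult_left_mono) auto
  also have "\<dots> = 2 * sqrt x" using x by (simp add: real_div_sqrt field_simps)
  finally show ?thesis by simp
qed simp

lemma neg_xlnx_le: "0 \<le> x \<Longrightarrow> - (x * ln x) \<le> 1 - x" for x :: real
  using xlnx_ge[of x 1] by simp

context prob_space
begin

lemma fent_eq_sum_superset:
  assumes "simple_function M f" "finite A" "f ` space M \<subseteq> A"
  shows "fent M f = (\<Sum>v\<in>A. - (prob (f -` {v} \<inter> space M) * ln (prob (f -` {v} \<inter> space M))))"
proof -
  have z: "prob (f -` {v} \<inter> space M) = 0" if "v \<notin> f ` space M" for v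
  proof -
    have "f -` {v} \<inter> space M = {}" using that by auto
    then show ?thesis by simp
  qed
  have "fent M f = (\<Sum>v\<in>f ` space M. - (prob (f -` {v} \<inter> space M) * ln (prob (f -` {v} \<inter> space M))))"
    by (simp add: fent_def sum_negf)
  also have "\<dots> = (\<Sum>v\<in>A. - (prob (f -` {v} \<inter> space M) * ln (prob (f -` {v} \<inter> space M))))"
    using assms z by (intro sum.mono_neutral_left) auto
  finally show ?thesis .
qed

text \<open>The value \<open>None\<close> has mass close to 1 and contributes at most its defect
  \<open>\<delta>\<close>; any other value has mass at most \<open>\<delta>\<close> and contributes
  at most \<open>2 * sqrt \<delta>\<close>.\<close>

lemma fent_error_small:
  assumes R: "simple_function M R" and P: "finite P" and ran: "R ` space M \<subseteq> insert None (Some ` P)"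
    and small: "prob {x \<in> space M. R x \<noteq> None} \<le> \<delta>"
  shows "fent M R \<le> \<delta> + real (card P) * (2 * sqrt \<delta>)"
proof -
  let ?m = "\<lambda>v. prob (R -` {v} \<inter> space M)"
  have ev: "R -` V \<inter> space M \<in> events" for V by (rule simple_functionD(2)[OF R])
  have seteq: "{x \<in> space M. R x \<noteq> None} = R -` (- {None}) \<inter> space M" by auto
  have None: "1 - ?m None \<le> \<delta>"
  proof -
    have "{x \<in> space M. R x \<noteq> None} = space M - (R -` {None} \<inter> space M)" by auto
    then have "prob {x \<in> space M. R x \<noteq> None} = 1 - ?m None" using prob_compl[OF ev] by simp
    then show ?thesis using small by simp
  qed
  have Some: "- (?m (Some v) * ln (?m (Some v))) \<le> 2 * sqrt \<delta>" for v
  proof -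
    have "?m (Some v) \<le> prob {x \<in> space M. R x \<noteq> None}"
      using ev unfolding seteq by (intro finite_measure_mono) auto
    then have "sqrt (?m (Some v)) \<le> sqrt \<delta>" using small by simp
    moreover have "- (?m (Some v) * ln (?m (Some v))) \<le> 2 * sqrt (?m (Some v))" by (rule neg_xlnx_le_sqrt) simp
    ultimately show ?thesis by linarith
  qed
  have "fent M R = (\<Sum>v\<in>insert None (Some ` P). - (?m v * ln (?m v)))"
    using P ran by (intro fent_eq_sum_superset[OF R]) auto
  also have "\<dots> = - (?m None * ln (?m None)) + (\<Sum>v\<in>P. - (?m (Some v) * ln (?m (Some v))))"
    using P by (subst sum.insert) (auto simp: sum.reindex)
  also have "\<dots> \<le> \<delta> + (\<Sum>v\<in>P. 2 * sqrt \<delta>)"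
    using neg_xlnx_le[of "?m None"] None Some by (intro add_mono sum_mono) auto
  finally show ?thesis by simp
qed

text \<open>Only a finite set \<open>GW\<close> of words can be used, and the words outside it may
  carry unbounded entropy. There the finite-valued \<open>Y\<close> is recorded instead: on mass
  \<open>b \<le> \<beta>\<close> and at most \<open>Nc\<close> values this costs at most
  \<open>\<beta> * ln Nc + 1\<close>.\<close>

lemma fent_le_words:
  assumes V: "V \<in> measurable M (count_space UNIV)" and GW: "finite GW"
    and Y: "simple_function M Y" "\<And>x. x \<in> space M \<Longrightarrow> Y x = H (V x)"
    and card: "real (card (Y ` space M)) \<le> Nc" "Nc \<ge> 1" and bad: "prob {x \<in> space M. V x \<notin> GW} \<le> \<beta>"
  shows "fent M Y \<le> (\<Sum>w\<in>GW. - (prob {x \<in> space M. V x = w} * ln (prob {x \<in> space M. V x = w}))) + \<beta> * ln Nc + 1"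
proof -
  define Z where "Z x = (if V x \<in> GW then Inl (V x) else Inr (Y x))" for x
  have Vev: "V -` S \<inter> space M \<in> events" for S by (rule measurable_sets[OF V]) simp
  let ?YS = "Y ` space M"
  have fY: "finite ?YS" by (rule simple_functionD(1)[OF Y(1)])
  have ran: "Z ` space M \<subseteq> Inl ` GW \<union> Inr ` ?YS" by (auto simp: Z_def)
  have finS: "finite (Inl ` GW \<union> Inr ` ?YS)" using GW fY by auto
  have lev1: "Z -` {Inl w} \<inter> space M = (if w \<in> GW then {x \<in> space M. V x = w} else {})" for w
    by (auto simp: Z_def split: if_splits)
  have lev2: "Z -` {Inr y} \<inter> space M = {x \<in> space M. V x \<notin> GW \<and> Y x = y}" for y
    by (auto simp: Z_def split: if_splits)
  have ev1: "{x \<in> space M. V x = w} \<in> events" for w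
  proof -
    have "{x \<in> space M. V x = w} = V -` {w} \<inter> space M" by auto
    then show ?thesis using Vev by simp
  qed
  have evb: "{x \<in> space M. V x \<notin> GW} \<in> events"
  proof -
    have "{x \<in> space M. V x \<notin> GW} = V -` (- GW) \<inter> space M" by auto
    then show ?thesis using Vev by simp
  qed
  have ev2: "{x \<in> space M. V x \<notin> GW \<and> Y x = y} \<in> events" for y
  proof -
    have "{x \<in> space M. V x \<notin> GW \<and> Y x = y} = {x \<in> space M. V x \<notin> GW} \<inter> (Y -` {y} \<inter> space M)" by auto
    then show ?thesis using evb simple_functionD(2)[OF Y(1)] by auto
  qed
  have Z: "simple_function M Z"
    unfolding simple_function_def
  proof (intro conjI ballI)
    show "finite (Z ` space M)" using ran finS by (rule finite_subset)
    fix z assume "z \<in> Z ` space M"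
    show "Z -` {z} \<inter> space M \<in> events"
      using ev1 ev2 by (cases z) (simp_all add: lev1 lev2)
  qed
  define q where "q y = prob {x \<in> space M. V x \<notin> GW \<and> Y x = y}" for y
  define b where "b = prob {x \<in> space M. V x \<notin> GW}"
  have q0: "q y \<ge> 0" for y by (simp add: q_def)
  have sq: "(\<Sum>y\<in>?YS. q y) = b"
  proof -
    have "{x \<in> space M. V x \<notin> GW} = (\<Union>y\<in>?YS. {x \<in> space M. V x \<notin> GW \<and> Y x = y})" by auto
    then show ?thesis unfolding b_def q_def
      using ev2 fY by (subst finite_measure_finite_Union[symmetric]) (auto simp: disjoint_family_on_def)
  qed
  have low: "(\<Sum>y\<in>?YS. q y * ln (q y)) \<ge> b * ln b - b * ln Nc"
  proof (cases "b = 0")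
    case True
    then have "q y = 0" if "y \<in> ?YS" for y using sq sum_nonneg_eq_0_iff[OF fY, of q] q0 that by auto
    then show ?thesis using True by simp
  next
    case False
    then have b: "b > 0" by (simp add: b_def zero_less_measure_iff)
    have "(\<Sum>y\<in>?YS. q y * ln (q y)) \<ge> (\<Sum>y\<in>?YS. q y * ln (b / Nc) + q y - b / Nc)"
      using q0 b card(2) by (intro sum_mono xlnx_ge) auto
    moreover have "(\<Sum>y\<in>?YS. q y * ln (b / Nc) + q y - b / Nc) = b * ln (b / Nc) + b - real (card ?YS) * (b / Nc)"
      by (simp add: sum.distrib sum_subtractf sq flip: sum_distrib_right)
    moreover have "real (card ?YS) * (b / Nc) \<le> Nc * (b / Nc)" using card b by (intro mult_right_mono) auto
    moreover have "b * ln (b / Nc) = b * ln b - b * ln Nc" using b card(2) by (simp add: ln_div algebra_simps)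
    ultimately show ?thesis using card(2) by simp
  qed
  have "fent M Y \<le> fent M Z"
    by (rule fent_comp_le[OF Z, where h="\<lambda>z. case z of Inl v \<Rightarrow> H v | Inr y \<Rightarrow> y"]) (auto simp: Z_def Y(2))
  also have "fent M Z = (\<Sum>v\<in>Inl ` GW \<union> Inr ` ?YS. - (prob (Z -` {v} \<inter> space M) * ln (prob (Z -` {v} \<inter> space M))))"
    by (rule fent_eq_sum_superset[OF Z finS ran])
  also have "\<dots> = (\<Sum>w\<in>GW. - (prob {x \<in> space M. V x = w} * ln (prob {x \<in> space M. V x = w}))) + (\<Sum>y\<in>?YS. - (q y * ln (q y)))"
    using GW fY by (subst sum.union_disjoint) (auto simp: sum.reindex lev1 lev2 q_def)
  also have "(\<Sum>y\<in>?YS. - (q y * ln (q y))) \<le> b * ln Nc - b * ln b" using low by (simp add: sum_negf)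
  also have "b * ln Nc - b * ln b \<le> \<beta> * ln Nc + 1"
  proof -
    have "b * ln Nc \<le> \<beta> * ln Nc" using bad card(2) by (intro mult_right_mono) (auto simp: b_def)
    moreover have "- (b * ln b) \<le> 1 - b" "0 \<le> b" by (auto simp: b_def intro!: neg_xlnx_le)
    ultimately show ?thesis by simp
  qed
  finally show ?thesis by simp
qed

lemma sum_words_integral:
  fixes h :: "'b \<Rightarrow> real"
  assumes V: "V \<in> measurable M (count_space UNIV)" and GW: "finite GW"
  shows "(\<Sum>w\<in>GW. prob {x \<in> space M. V x = w} * h w) = (\<integral>x. (if V x \<in> GW then h (V x) else 0) \<partial>M)"
    and "integrable M (\<lambda>x. if V x \<in> GW then h (V x) else 0)"
proof -
  have ev: "{x \<in> space M. V x = w} \<in> events" for w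
  proof -
    have "{x \<in> space M. V x = w} = V -` {w} \<inter> space M" by auto
    then show ?thesis using measurable_sets[OF V, of "{w}"] by simp
  qed
  have eq: "(if V x \<in> GW then h (V x) else 0) = (\<Sum>w\<in>GW. indicator {x \<in> space M. V x = w} x * h w)" if "x \<in> space M" for x
  proof -
    have "(\<Sum>w\<in>GW. indicator {x \<in> space M. V x = w} x * h w) = (\<Sum>w\<in>GW. if w = V x then h w else 0)"
      using that by (intro sum.cong) (auto simp: indicator_def)
    then show ?thesis using GW by (simp add: sum.delta')
  qed
  have i: "integrable M (\<lambda>x. indicator {x \<in> space M. V x = w} x * h w)" for w
    using ev by (intro integrable_mult_left) (auto simp: less_top[symmetric])
  show "integrable M (\<lambda>x. if V x \<in> GW then h (V x) else 0)"
    using i by (subst Bochner_Integration.integrable_cong[OF refl eq]) auto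
  show "(\<Sum>w\<in>GW. prob {x \<in> space M. V x = w} * h w) = (\<integral>x. (if V x \<in> GW then h (V x) else 0) \<partial>M)"
    using i ev by (subst Bochner_Integration.integral_cong[OF refl eq]) (auto simp: Bochner_Integration.integral_sum intro!: sum.cong)
qed

end

lemma fent_names_le:
  assumes inv: "invariant_prob T \<mu>" and f: "simple_function \<mu> f"
  shows "fent \<mu> (names T f n) \<le> real n * fent \<mu> f"
proof (induction n)
  case 0
  interpret prob_space \<mu> using inv by (simp add: invariant_prob_def)
  have "names T f 0 = (\<lambda>_. [])" by (auto simp: names_def)
  then show ?case using not_empty prob_space by (simp add: fent_def image_constant_conv vimage_def)
next
  case (Suc n)
  interpret prob_space \<mu> using inv by (simp add: invariant_prob_def)
  have "fent \<mu> (names T f 1) \<le> fent \<mu> f"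
    by (rule fent_comp_le[OF f, where h="\<lambda>v. [v]"]) (simp add: names_def)
  then show ?case using fent_names_subadditive[OF inv f, of n 1] Suc by (simp add: algebra_simps)
qed

context emr_coding
begin

section \<open>Approximation by cylinders and control of exceptional sets\<close>

lemma pre_itin_measurable_mu:
  assumes "\<mu> \<in> invariant_measures T I"
  shows "(\<lambda>x. pre (itin x) n) \<in> measurable \<mu> (count_space UNIV)"
  using pre_itin_measurable[of n] measurable_cong_sets[OF invariant_measures_D(2)[OF assms] refl] by blast

text \<open>Regularity encloses the set, up to mass \<open>\<delta>\<close>, between a compact
  \<open>K\<close> and an open \<open>O'\<close>. Cylinders shorter than the distance from
  \<open>K\<close> to the complement of \<open>O'\<close> that touch \<open>K\<close> stay inside
  \<open>O'\<close>, so selecting those that touch \<open>K\<close> errs only on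
  \<open>O' - K\<close>.\<close>

lemma approx_cylinder:
  assumes mu: "\<mu> \<in> invariant_measures T I" and A: "A \<in> sets \<mu>" and d: "\<delta> > 0"
  shows "\<exists>k0. \<forall>k\<ge>k0. \<exists>Bs. measure \<mu> {x \<in> \<Lambda>. (x \<in> A) \<noteq> (pre (itin x) k \<in> Bs)} \<le> \<delta>"
proof -
  note m = invariant_measures_D[OF mu]
  interpret prob_space \<mu> by (rule m(3))
  obtain S where S: "S \<in> sets borel" "A = \<Lambda> \<inter> S" using A m(2) by (auto simp: sets_restrict_space)
  have idm: "(\<lambda>x. x) \<in> measurable \<mu> borel"
    using measurable_restrict_space1[OF measurable_ident_sets[OF refl], of borel \<Lambda>] measurable_cong_sets[OF m(2) refl] by blast
  define N where "N = distr \<mu> borel (\<lambda>x. x)"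
  interpret N: prob_space N unfolding N_def by (rule prob_space_distr[OF idm])
  have sN: "sets N = sets borel" by (simp add: N_def)
  have mN: "measure N X = measure \<mu> (X \<inter> \<Lambda>)" if "X \<in> sets borel" for X
    unfolding N_def using measure_distr[OF idm that] m(1) by simp
  have fin: "emeasure N (space N) \<noteq> \<infinity>" by (simp add: N.emeasure_space_1)
  have "(INF U \<in> {U. S \<subseteq> U \<and> open U}. emeasure N U) < ennreal (measure N S + \<delta> / 2)"
  proof -
    have "emeasure N S < ennreal (measure N S + \<delta> / 2)"
      using d by (simp add: N.emeasure_eq_measure ennreal_less_iff)
    then show ?thesis unfolding outer_regular[OF sN fin S(1)] .
  qed
  then obtain O' where O': "S \<subseteq> O'" "open O'" "measure N O' < measure N S + \<delta> / 2"
    by (auto simp: INF_less_iff N.emeasure_eq_measure ennreal_less_iff)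
  have "\<exists>K. K \<subseteq> S \<and> compact K \<and> measure N S - \<delta> / 2 \<le> measure N K"
  proof (cases "measure N S = 0")
    case True
    then show ?thesis using d by (intro exI[of _ "{}"]) auto
  next
    case False
    then have "ennreal (measure N S - \<delta> / 2) < ennreal (measure N S)"
      using d by (intro ennreal_lessI) (auto simp: zero_less_measure_iff)
    also have "\<dots> = (SUP K \<in> {K. K \<subseteq> S \<and> compact K}. emeasure N K)"
      using inner_regular[OF sN fin S(1)] by (simp add: N.emeasure_eq_measure)
    finally obtain K where "K \<subseteq> S" "compact K" "ennreal (measure N S - \<delta> / 2) < ennreal (measure N K)"
      by (auto simp: less_SUP_iff N.emeasure_eq_measure)
    moreover from this have "measure N S - \<delta> / 2 \<le> measure N K" by (metis ennreal_leI leD linear)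
    ultimately show ?thesis by blast
  qed
  then obtain K where K: "K \<subseteq> S" "compact K" "measure N S - \<delta> / 2 \<le> measure N K" by blast
  have bK: "K \<in> sets borel" "O' \<in> sets borel" using K(2) O'(2) by (auto simp: compact_imp_closed)
  have "measure N (O' - K) = measure N O' - measure N K"
    using bK sN K(1) O'(1) by (intro N.finite_measure_Diff) auto
  then have small: "measure \<mu> ((O' - K) \<inter> \<Lambda>) \<le> \<delta>" using K(3) O'(3) mN[of "O' - K"] bK by simp
  have "\<exists>e>0. \<forall>x\<in>K. \<forall>y\<in>- O'. e \<le> dist x y"
    using K O' by (intro separate_compact_closed) auto
  then obtain e where e: "e > 0" "\<And>x y. x \<in> K \<Longrightarrow> y \<notin> O' \<Longrightarrow> e \<le> dist x y" by auto
  have "(\<lambda>k. C0 * (1 / \<xi>) ^ k) \<longlonglongrightarrow> C0 * 0"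
    using \<xi>_gt1 by (intro tendsto_mult tendsto_const LIMSEQ_power_zero) simp
  then have "\<forall>\<^sub>F k in sequentially. C0 * (1 / \<xi>) ^ k < e" using e by (intro order_tendstoD(2)) auto
  then obtain k0 where k0: "\<And>k. k \<ge> k0 \<Longrightarrow> C0 * (1 / \<xi>) ^ k < e" by (auto simp: eventually_sequentially)
  have "measure \<mu> {x \<in> \<Lambda>. (x \<in> A) \<noteq> (pre (itin x) k \<in> {w. closure (U w) \<inter> K \<noteq> {}})} \<le> \<delta>" if k: "k \<ge> k0" for k
  proof -
    have "AE x in \<mu>. x \<in> {x \<in> \<Lambda>. (x \<in> A) \<noteq> (pre (itin x) k \<in> {w. closure (U w) \<inter> K \<noteq> {}})} \<longrightarrow> x \<in> (O' - K) \<inter> \<Lambda>"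
      using AE_\<Lambda>'[OF mu]
    proof eventually_elim
      case (elim x)
      have xc: "x \<in> closure (U (pre (itin x) k))" using \<pi>_closure[of "itin x" k] \<pi>_itin[OF elim] by simp
      have xO: "x \<in> O'" if "z \<in> closure (U (pre (itin x) k))" "z \<in> K" for z
      proof (rule ccontr)
        assume "x \<notin> O'"
        then have "e \<le> dist z x" using e(2) that(2) by blast
        also have "\<dots> \<le> r (pre (itin x) k)" using r_ge[OF that(1) xc] by (simp add: dist_real_def)
        also have "\<dots> < e" using r_small[of "pre (itin x) k"] k0[OF k] by simp
        finally show False by simp
      qed
      show ?case
      proof (intro impI)
        assume "x \<in> {x \<in> \<Lambda>. (x \<in> A) \<noteq> (pre (itin x) k \<in> {w. closure (U w) \<inter> K \<noteq> {}})}"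
        then have x: "x \<in> \<Lambda>" "(x \<in> A) \<noteq> (closure (U (pre (itin x) k)) \<inter> K \<noteq> {})" by auto
        have "x \<notin> K" using x xc K(1) S(2) by blast
        moreover have "x \<in> O'" using x xO O'(1) S(2) by blast
        ultimately show "x \<in> (O' - K) \<inter> \<Lambda>" using x(1) by simp
      qed
    qed
    moreover have "(O' - K) \<inter> \<Lambda> \<in> sets \<mu>" using bK m(2) by (auto simp: sets_restrict_space)
    ultimately show ?thesis using finite_measure_mono_AE small by (meson order_trans)
  qed
  then show ?thesis by blast
qed

text \<open>Each word is assigned some partition set whose cylinder approximation contains it. A
  wrong assignment at \<open>x\<close> forces an error of one of these approximations at
  \<open>x\<close>.\<close>

lemma approx_partition:
  assumes mu: "\<mu> \<in> invariant_measures T I" and P: "finite_partition \<mu> P" and d: "\<delta> > 0"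
  shows "\<exists>k G. (\<forall>w. G w \<in> P) \<and> measure \<mu> {x \<in> \<Lambda>. cell P x \<noteq> G (pre (itin x) k)} \<le> \<delta>"
proof -
  note m = invariant_measures_D[OF mu]
  interpret prob_space \<mu> by (rule m(3))
  have part: "partition_on \<Lambda> P" and fP: "finite P" and sP: "P \<subseteq> sets \<mu>"
    using P m(1) by (auto simp: finite_partition_def)
  have ne: "P \<noteq> {}" using not_empty m(1) part by (auto simp: partition_on_def)
  then have c: "real (card P) > 0" using fP by (simp add: card_gt_0_iff)
  have "\<forall>A\<in>P. \<exists>k0. \<forall>k\<ge>k0. \<exists>Bs. measure \<mu> {x \<in> \<Lambda>. (x \<in> A) \<noteq> (pre (itin x) k \<in> Bs)} \<le> \<delta> / real (card P)"
    using approx_cylinder[OF mu] sP d c by auto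
  then obtain k0 where k0: "\<forall>A\<in>P. \<forall>k\<ge>k0 A. \<exists>Bs. measure \<mu> {x \<in> \<Lambda>. (x \<in> A) \<noteq> (pre (itin x) k \<in> Bs)} \<le> \<delta> / real (card P)"
    by (rule bchoice[THEN exE])
  define k where "k = sum k0 P"
  have "\<forall>A\<in>P. \<exists>Bs. measure \<mu> {x \<in> \<Lambda>. (x \<in> A) \<noteq> (pre (itin x) k \<in> Bs)} \<le> \<delta> / real (card P)"
    using k0 fP by (auto simp: k_def intro: member_le_sum)
  then obtain Bs where Bs: "\<forall>A\<in>P. measure \<mu> {x \<in> \<Lambda>. (x \<in> A) \<noteq> (pre (itin x) k \<in> Bs A)} \<le> \<delta> / real (card P)"
    by (rule bchoice[THEN exE])
  define G where "G w = (if \<exists>A\<in>P. w \<in> Bs A then SOME A. A \<in> P \<and> w \<in> Bs A else SOME A. A \<in> P)" for w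
  have GP: "G w \<in> P" for w
  proof (cases "\<exists>A\<in>P. w \<in> Bs A")
    case True
    then have "\<exists>A. A \<in> P \<and> w \<in> Bs A" by blast
    from someI_ex[OF this] show ?thesis using True by (simp add: G_def)
  next
    case False
    then show ?thesis using ne by (simp add: G_def some_in_eq)
  qed
  let ?D = "\<lambda>A. {x \<in> \<Lambda>. (x \<in> A) \<noteq> (pre (itin x) k \<in> Bs A)}"
  have ev: "?D A \<in> sets \<mu>" if "A \<in> P" for A
  proof -
    let ?V = "(\<lambda>x. pre (itin x) k) -` Bs A \<inter> space \<mu>"
    have "?V \<in> sets \<mu>" by (rule measurable_sets[OF pre_itin_measurable_mu[OF mu]]) simp
    moreover have "A \<in> sets \<mu>" using that sP by blast
    moreover have "?D A = (A - ?V) \<union> (?V - A)" using m(1) sets.sets_into_space[OF \<open>A \<in> sets \<mu>\<close>] by auto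
    ultimately show ?thesis by auto
  qed
  have sub: "{x \<in> \<Lambda>. cell P x \<noteq> G (pre (itin x) k)} \<subseteq> (\<Union>A\<in>P. ?D A)"
  proof
    fix x assume "x \<in> {x \<in> \<Lambda>. cell P x \<noteq> G (pre (itin x) k)}"
    then have x: "x \<in> \<Lambda>" "cell P x \<noteq> G (pre (itin x) k)" by auto
    show "x \<in> (\<Union>A\<in>P. ?D A)"
    proof (rule ccontr)
      assume "\<not> ?thesis"
      then have eq: "\<And>A. A \<in> P \<Longrightarrow> (x \<in> A) = (pre (itin x) k \<in> Bs A)" using x(1) by blast
      have c: "cell P x \<in> P" "x \<in> cell P x" using cell_props[OF part x(1)] by auto
      then have ex: "\<exists>A. A \<in> P \<and> pre (itin x) k \<in> Bs A" using eq by blast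
      have "G (pre (itin x) k) \<in> P \<and> pre (itin x) k \<in> Bs (G (pre (itin x) k))"
        using someI_ex[OF ex] ex by (auto simp: G_def)
      then have "x \<in> G (pre (itin x) k)" "G (pre (itin x) k) \<in> P" using eq by auto
      then have "cell P x = G (pre (itin x) k)" using cell_eq[OF part] by blast
      then show False using x(2) by simp
    qed
  qed
  have "measure \<mu> {x \<in> \<Lambda>. cell P x \<noteq> G (pre (itin x) k)} \<le> measure \<mu> (\<Union>A\<in>P. ?D A)"
    using sub ev fP by (intro finite_measure_mono) auto
  also have "\<dots> \<le> (\<Sum>A\<in>P. measure \<mu> (?D A))" using ev fP by (intro finite_measure_subadditive_finite) auto
  also have "\<dots> \<le> (\<Sum>A\<in>P. \<delta> / real (card P))" using Bs by (intro sum_mono) auto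
  also have "\<dots> = \<delta>" using c by simp
  finally show ?thesis using GP by blast
qed

text \<open>The set \<open>F\<close> for the first and last letters must not depend on
  \<open>m\<close>, since constants are paid for these letters. The inner letters may be cut off at
  a bound depending on \<open>m\<close>, because by invariance each coordinate can be given error
  \<open>\<delta> / (2 * m)\<close>.\<close>

lemma ex_good_words:
  assumes mu: "\<mu> \<in> invariant_measures T I" and d: "\<delta> > 0"
  shows "\<exists>F. finite F \<and> (\<forall>m\<ge>1. \<exists>GW. finite GW \<and> (\<forall>w\<in>GW. length w = m \<and> hd w \<in> F \<and> last w \<in> F) \<and>
    measure \<mu> {x \<in> \<Lambda>. pre (itin x) m \<notin> GW} \<le> \<delta>)"
proof -
  note m = invariant_measures_D[OF mu]
  interpret prob_space \<mu> by (rule m(3))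
  let ?V = "\<lambda>j N. {x \<in> \<Lambda>. N \<le> itin x j}"
  have letm: "letter \<in> measurable \<mu> (count_space UNIV)"
    using measurable_restrict_space1[OF letter_measurable, of \<Lambda>] measurable_cong_sets[OF m(2) refl] by blast
  have ev: "?V j N \<in> sets \<mu>" for j N
  proof -
    have "(\<lambda>x. letter ((T ^^ j) x)) \<in> measurable \<mu> (count_space UNIV)"
      by (rule measurable_compose[OF distr_T_pow(1)[OF mu] letm])
    from measurable_sets[OF this, of "{N..}"] have "(\<lambda>x. letter ((T ^^ j) x)) -` {N..} \<inter> \<Lambda> \<in> sets \<mu>" using m(1) by simp
    moreover have "(\<lambda>x. letter ((T ^^ j) x)) -` {N..} \<inter> \<Lambda> = ?V j N" by (auto simp: itin_def)
    ultimately show ?thesis by simp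
  qed
  have shift: "measure \<mu> (?V j N) = measure \<mu> (?V 0 N)" for j N
  proof -
    have "measure (distr \<mu> \<mu> (T ^^ j)) (?V 0 N) = measure \<mu> ((T ^^ j) -` ?V 0 N \<inter> space \<mu>)"
      by (rule measure_distr[OF distr_T_pow(1)[OF mu] ev])
    moreover have "(T ^^ j) -` ?V 0 N \<inter> space \<mu> = ?V j N" using m(1) \<Lambda>_T by (auto simp: itin_def)
    ultimately show ?thesis using distr_T_pow(2)[OF mu] by simp
  qed
  have "(\<lambda>N. measure \<mu> (?V 0 N)) \<longlonglongrightarrow> measure \<mu> (\<Inter>N. ?V 0 N)"
    using ev by (intro finite_Lim_measure_decseq) (auto simp: decseq_def)
  moreover have "(\<Inter>N. ?V 0 N) = {}"
  proof (rule equals0I)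
    fix x assume "x \<in> (\<Inter>N. ?V 0 N)"
    then have "Suc (itin x 0) \<le> itin x 0" by blast
    then show False by simp
  qed
  ultimately have lim: "(\<lambda>N. measure \<mu> (?V 0 N)) \<longlonglongrightarrow> 0" by simp
  have small: "\<exists>N. measure \<mu> (?V 0 N) \<le> \<eta>" if "\<eta> > 0" for \<eta>
  proof -
    have "\<forall>\<^sub>F N in sequentially. measure \<mu> (?V 0 N) < \<eta>" by (rule order_tendstoD(2)[OF lim that])
    then show ?thesis by (auto simp: eventually_sequentially intro: less_imp_le)
  qed
  obtain NF where NF: "measure \<mu> (?V 0 NF) \<le> \<delta> / 4" using small[of "\<delta> / 4"] d by auto
  have "\<exists>GW. finite GW \<and> (\<forall>w\<in>GW. length w = n \<and> hd w \<in> {..<NF} \<and> last w \<in> {..<NF}) \<and>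
      measure \<mu> {x \<in> \<Lambda>. pre (itin x) n \<notin> GW} \<le> \<delta>" if n: "n \<ge> 1" for n
  proof -
    obtain N where N: "measure \<mu> (?V 0 N) \<le> \<delta> / (2 * real n)" using small[of "\<delta> / (2 * real n)"] d n by auto
    define GW where "GW = {w. set w \<subseteq> {..<N} \<and> length w = n} \<inter> {w. hd w \<in> {..<NF} \<and> last w \<in> {..<NF}}"
    have fin: "finite GW" unfolding GW_def using finite_lists_length_eq[of "{..<N}" n] by auto
    have sub: "{x \<in> \<Lambda>. pre (itin x) n \<notin> GW} \<subseteq> (\<Union>j\<in>{..<n}. ?V j N) \<union> (?V 0 NF \<union> ?V (n - 1) NF)"
    proof
      fix x assume x: "x \<in> {x \<in> \<Lambda>. pre (itin x) n \<notin> GW}"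
      have "pre (itin x) n \<noteq> []" using n by (auto simp: pre_def)
      then have hl: "hd (pre (itin x) n) = itin x 0" "last (pre (itin x) n) = itin x (n - 1)"
        using n by (simp_all add: hd_conv_nth last_conv_nth)
      show "x \<in> (\<Union>j\<in>{..<n}. ?V j N) \<union> (?V 0 NF \<union> ?V (n - 1) NF)"
      proof (rule ccontr)
        assume "\<not> ?thesis"
        then have "\<forall>j<n. itin x j < N" "itin x 0 < NF" "itin x (n - 1) < NF" using x by (auto simp: not_le)
        then have "pre (itin x) n \<in> GW" using hl by (auto simp: GW_def pre_def)
        then show False using x by simp
      qed
    qed
    have "measure \<mu> {x \<in> \<Lambda>. pre (itin x) n \<notin> GW} \<le> measure \<mu> ((\<Union>j\<in>{..<n}. ?V j N) \<union> (?V 0 NF \<union> ?V (n - 1) NF))"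
      using sub ev by (intro finite_measure_mono) auto
    also have "\<dots> \<le> measure \<mu> (\<Union>j\<in>{..<n}. ?V j N) + (measure \<mu> (?V 0 NF) + measure \<mu> (?V (n - 1) NF))"
      using ev by (intro order_trans[OF measure_Un_le] add_left_mono measure_Un_le) auto
    also have "measure \<mu> (\<Union>j\<in>{..<n}. ?V j N) \<le> (\<Sum>j<n. measure \<mu> (?V j N))"
      using ev by (intro finite_measure_subadditive_finite) auto
    also have "\<dots> \<le> (\<Sum>j<n. \<delta> / (2 * real n))" 
    proof (rule sum_mono)
      fix j
      show "measure \<mu> (?V j N) \<le> \<delta> / (2 * real n)" using N shift[of N j] by linarith
    qed
    also have "\<dots> = \<delta> / 2" using n by simp
    finally have "measure \<mu> {x \<in> \<Lambda>. pre (itin x) n \<notin> GW} \<le> \<delta>" using NF shift[of NF "n - 1"] by simp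
    then show ?thesis using fin by (intro exI[of _ GW]) (auto simp: GW_def)
  qed
  then show ?thesis by (intro exI[of _ "{..<NF}"]) auto
qed

text \<open>Cut \<open>\<psi>\<close> at a height \<open>N\<close>. The truncated part contributes
  at most \<open>N\<close> times the mass of \<open>A\<close>, and the integral of the tail is the
  same at every time by invariance.\<close>

lemma uniformly_integrable_iterates:
  fixes \<psi> :: "real \<Rightarrow> real"
  assumes mu: "\<mu> \<in> invariant_measures T I" and \<psi>: "integrable \<mu> \<psi>" and e: "e > 0"
  shows "\<exists>\<delta>>0. \<forall>A\<in>sets \<mu>. measure \<mu> A \<le> \<delta> \<longrightarrow> (\<forall>j. (\<integral>x. indicator A x * \<bar>\<psi> ((T ^^ j) x)\<bar> \<partial>\<mu>) \<le> e)"
proof -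
  note m = invariant_measures_D[OF mu]
  interpret prob_space \<mu> by (rule m(3))
  have pm: "\<psi> \<in> borel_measurable \<mu>" using \<psi> by simp
  define t where "t N x = (if real N < \<bar>\<psi> x\<bar> then \<bar>\<psi> x\<bar> else 0)" for N x
  have tm: "t N \<in> borel_measurable \<mu>" for N unfolding t_def using pm by measurable
  have ti: "integrable \<mu> (t N)" for N
    by (rule Bochner_Integration.integrable_bound[OF integrable_abs[OF \<psi>] tm]) (auto simp: t_def)
  have "(\<lambda>N. \<integral>x. t N x \<partial>\<mu>) \<longlonglongrightarrow> (\<integral>x. 0 \<partial>\<mu>)"
  proof (rule integral_dominated_convergence[where w="\<lambda>x. \<bar>\<psi> x\<bar>"])
    show "AE x in \<mu>. (\<lambda>N. t N x) \<longlonglongrightarrow> 0"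
    proof (rule AE_I2)
      fix x
      obtain N0 where "\<bar>\<psi> x\<bar> < real N0" using reals_Archimedean2 by blast
      then have "\<forall>\<^sub>F N in sequentially. t N x = 0"
        by (intro eventually_sequentiallyI[of N0]) (auto simp: t_def)
      then show "(\<lambda>N. t N x) \<longlonglongrightarrow> 0" by (rule tendsto_eventually)
    qed
  qed (use \<psi> tm in \<open>auto simp: t_def\<close>)
  then have "(\<lambda>N. \<integral>x. t N x \<partial>\<mu>) \<longlonglongrightarrow> 0" by simp
  then have "\<forall>\<^sub>F N in sequentially. (\<integral>x. t N x \<partial>\<mu>) < e / 2" using e by (intro order_tendstoD(2)) auto
  then obtain N where N: "(\<integral>x. t N x \<partial>\<mu>) < e / 2" by (auto simp: eventually_sequentially)
  have "(\<integral>x. indicator A x * \<bar>\<psi> ((T ^^ j) x)\<bar> \<partial>\<mu>) \<le> e"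
    if A: "A \<in> sets \<mu>" "measure \<mu> A \<le> e / (2 * (real N + 1))" for A j
  proof -
    have i1: "integrable \<mu> (\<lambda>x. real N * indicator A x + t N ((T ^^ j) x))"
      using A(1) integral_iterate(1)[OF mu ti] by (auto simp: less_top[symmetric])
    have i2: "integrable \<mu> (\<lambda>x. indicator A x * \<bar>\<psi> ((T ^^ j) x)\<bar>)"
      using integrable_mult_indicator[OF A(1) integrable_abs[OF integral_iterate(1)[OF mu \<psi>]], of j] by simp
    have "(\<integral>x. indicator A x * \<bar>\<psi> ((T ^^ j) x)\<bar> \<partial>\<mu>) \<le> (\<integral>x. real N * indicator A x + t N ((T ^^ j) x) \<partial>\<mu>)"
      by (rule integral_mono[OF i2 i1]) (auto simp: t_def indicator_def)
    also have "\<dots> = real N * measure \<mu> A + (\<integral>x. t N x \<partial>\<mu>)"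
      using A(1) integral_iterate[OF mu ti] by (subst Bochner_Integration.integral_add) (auto simp: less_top[symmetric])
    also have "\<dots> \<le> e / 2 + e / 2"
    proof (rule add_mono)
      have "real N * measure \<mu> A \<le> (real N + 1) * (e / (2 * (real N + 1)))"
        using A(2) by (intro mult_mono) auto
      also have "\<dots> = e / 2" by (simp add: field_simps)
      finally show "real N * measure \<mu> A \<le> e / 2" .
    qed (use N in simp)
    finally show ?thesis by simp
  qed
  then show ?thesis using e by (intro exI[of _ "e / (2 * (real N + 1))"]) auto
qed

end

context emr_level
begin

text \<open>The last value of \<open>\<phi>\<close> along the orbit cannot be compared with the
  padded word, since one common letter does not control \<open>\<phi>\<close>; it is kept as an
  explicit error term. The other boundary terms depend on letters in \<open>F\<close> only.\<close>

lemma E_code: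
  assumes m: "m \<ge> 1" and F: "finite F" "\<omega> 0 \<in> F" "\<omega> (m - 1) \<in> F"
  shows "\<bar>E (e0 # pre \<omega> m) - (S m \<omega> - real m * \<alpha>)\<bar>
    \<le> 2 * B + (\<Sum>i\<in>F. \<bar>\<phi> (\<pi> (ext [e0, i]))\<bar>) + (\<Sum>i\<in>F. \<bar>\<phi> (\<pi> (ext [i]))\<bar>) + \<bar>\<alpha>\<bar> + \<bar>\<phi> (\<pi> (shiftn (m - 1) \<omega>))\<bar>"
proof -
  obtain k where k: "m = Suc k" using m by (cases m) auto
  let ?\<omega>' = "case_nat e0 \<omega>" and ?w = "e0 # pre \<omega> m"
  have 1: "\<bar>S m (ext ?w) - S m ?\<omega>'\<bar> \<le> B"
  proof (rule S_close)
    fix j assume "j \<le> m"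
    then show "ext ?w j = ?\<omega>' j" by (cases j) (auto simp: ext_def)
  qed
  have sh: "shiftn m (ext ?w) = ext [\<omega> k]"
  proof -
    have "?w = (e0 # pre \<omega> k) @ [\<omega> k]" by (simp add: pre_def k)
    then show ?thesis using shiftn_ext_append[of "e0 # pre \<omega> k" "[\<omega> k]"] k by simp
  qed
  have 2: "S (m + 1) (ext ?w) = S m (ext ?w) + \<phi> (\<pi> (ext [\<omega> k]))"
    unfolding S_add[of m 1] sh S_single ..
  have "shiftn 1 ?\<omega>' = \<omega>" by (simp add: shiftn_def)
  then have 3: "S m ?\<omega>' = \<phi> (\<pi> ?\<omega>') + S k \<omega>"
    using S_add[of 1 k ?\<omega>'] S_single[of ?\<omega>'] k by simp
  have 4: "S m \<omega> = S k \<omega> + \<phi> (\<pi> (shiftn k \<omega>))" by (simp add: k S_def)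
  have "\<bar>S 1 ?\<omega>' - S 1 (ext [e0, \<omega> 0])\<bar> \<le> B"
  proof (rule S_close)
    fix j :: nat assume "j \<le> 1"
    then show "?\<omega>' j = ext [e0, \<omega> 0] j" by (cases j) (auto simp: ext_def)
  qed
  then have 5: "\<bar>\<phi> (\<pi> ?\<omega>') - \<phi> (\<pi> (ext [e0, \<omega> 0]))\<bar> \<le> B" by (simp only: S_single)
  have 6: "\<bar>\<phi> (\<pi> (ext [e0, \<omega> 0]))\<bar> \<le> (\<Sum>i\<in>F. \<bar>\<phi> (\<pi> (ext [e0, i]))\<bar>)" using F by (intro member_le_sum) auto
  have 7: "\<bar>\<phi> (\<pi> (ext [\<omega> k]))\<bar> \<le> (\<Sum>i\<in>F. \<bar>\<phi> (\<pi> (ext [i]))\<bar>)" using F k by (intro member_le_sum) auto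
  have "E ?w = S (m + 1) (ext ?w) - (real m + 1) * \<alpha>" by (simp add: E_def)
  then have "E ?w - (S m \<omega> - real m * \<alpha>) = (S m (ext ?w) - S m ?\<omega>') + \<phi> (\<pi> (ext [\<omega> k])) + \<phi> (\<pi> ?\<omega>')
      - \<phi> (\<pi> (shiftn k \<omega>)) - \<alpha>"
    unfolding 2 3 4 by (simp add: algebra_simps)
  then show ?thesis using 1 5 6 7 k by simp
qed

lemma S_itin: "x \<in> \<Lambda>' \<Longrightarrow> S n (itin x) = (\<Sum>j<n. \<phi> ((T ^^ j) x))"
  using \<pi>_itin[of x] T_pow_\<pi>[of _ "itin x"] by (simp add: S_def)

text \<open>A finite partition is approximated by a partition into unions of \<open>k\<close>-cylinders, at the cost
  of the entropy of an error variable.\<close>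

lemma entropy_cylinder_partition:
  assumes mu: "\<mu> \<in> invariant_measures T I" and P: "finite_partition \<mu> P" and g: "\<gamma> > 0"
  shows "\<exists>k G. (\<forall>w. G w \<in> P) \<and> simple_function \<mu> (\<lambda>x. G (pre (itin x) k)) \<and>
    (\<forall>n\<ge>1. real n * (entropy_wrt_partition \<mu> T P - \<gamma>) \<le> fent \<mu> (names T (\<lambda>x. G (pre (itin x) k)) n))"
proof -
  note m = invariant_measures_D[OF mu]
  interpret prob_space \<mu> by (rule m(3))
  have fP: "finite P" and part: "partition_on \<Lambda> P" using P m(1) by (auto simp: finite_partition_def)
  define c where "c = real (card P)"
  \<comment> \<open>Ensures \<open>\<delta> \<le> sqrt \<delta>\<close>, so that the bound
    \<open>\<delta> + c * (2 * sqrt \<delta>)\<close> on the error entropy is at most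
    \<open>\<gamma>\<close>.\<close>
  define \<delta> where "\<delta> = (min 1 (\<gamma> / (1 + 2 * c)))\<^sup>2"
  have c0: "0 < 1 + 2 * c" by (simp add: c_def add_pos_nonneg)
  have sq: "sqrt \<delta> = min 1 (\<gamma> / (1 + 2 * c))" using g c0 by (simp add: \<delta>_def)
  have "0 < min 1 (\<gamma> / (1 + 2 * c))" using g c0 by simp
  then have d: "\<delta> > 0" unfolding \<delta>_def by (rule zero_less_power)
  have "\<delta> \<le> sqrt \<delta>"
  proof -
    have "sqrt \<delta> \<le> 1" using sq by simp
    then have "sqrt \<delta> * sqrt \<delta> \<le> 1 * sqrt \<delta>" by (rule mult_right_mono) (use d in simp)
    then show ?thesis using d by simp
  qed
  then have "\<delta> + c * (2 * sqrt \<delta>) \<le> (1 + 2 * c) * sqrt \<delta>" by (simp add: algebra_simps)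
  also have "\<dots> \<le> (1 + 2 * c) * (\<gamma> / (1 + 2 * c))" using sq c0 by (intro mult_left_mono) auto
  also have "\<dots> = \<gamma>" using c0 by simp
  finally have small: "\<delta> + c * (2 * sqrt \<delta>) \<le> \<gamma>" .
  obtain k G where G: "\<And>w. G w \<in> P" "measure \<mu> {x \<in> \<Lambda>. cell P x \<noteq> G (pre (itin x) k)} \<le> \<delta>"
    using approx_partition[OF mu P d] by blast
  define f where "f = cell P"
  define h where "h x = G (pre (itin x) k)" for x
  define R where "R x = (if f x = h x then None else Some (f x))" for x
  have sf: "simple_function \<mu> f" unfolding f_def by (rule simple_function_cell[OF P])
  have sh: "simple_function \<mu> h"
    unfolding simple_function_def
  proof (intro conjI ballI)
    show "finite (h ` space \<mu>)" by (rule finite_subset[OF _ fP]) (use G(1) in \<open>auto simp: h_def\<close>)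
    have "(\<lambda>x. G (pre (itin x) k)) \<in> measurable \<mu> (count_space UNIV)"
      by (rule measurable_compose[OF pre_itin_measurable_mu[OF mu]]) simp
    then show "h -` {v} \<inter> space \<mu> \<in> sets \<mu>" for v unfolding h_def by (rule measurable_sets) simp
  qed
  have sR: "simple_function \<mu> R"
    using simple_function_compose[OF simple_function_Pair[OF sf sh], of "\<lambda>(a, b). if a = b then None else Some a"]
    by (simp add: comp_def R_def[abs_def])
  have R: "fent \<mu> R \<le> \<gamma>"
  proof -
    have "fent \<mu> R \<le> \<delta> + real (card P) * (2 * sqrt \<delta>)"
    proof (rule fent_error_small[OF sR fP])
      show "R ` space \<mu> \<subseteq> insert None (Some ` P)" using cell_props(1)[OF part] m(1) by (auto simp: R_def f_def)
      have "{x \<in> space \<mu>. R x \<noteq> None} = {x \<in> \<Lambda>. cell P x \<noteq> G (pre (itin x) k)}"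
        using m(1) by (auto simp: R_def f_def h_def)
      then show "prob {x \<in> space \<mu>. R x \<noteq> None} \<le> \<delta>" using G(2) by simp
    qed
    then show ?thesis using small by (simp add: c_def)
  qed
  have "real n * (entropy_wrt_partition \<mu> T P - \<gamma>) \<le> fent \<mu> (names T h n)" if n: "n \<ge> 1" for n
  proof -
    note sn = simple_function_names[OF _ m(4), of _ n]
    have "fent \<mu> (names T f n) \<le> fent \<mu> (\<lambda>x. (names T h n x, names T R n x))"
      by (rule fent_comp_le[OF simple_function_Pair[OF sn[OF sh] sn[OF sR]],
            where h="\<lambda>(u, v). map (\<lambda>(a, b). case b of None \<Rightarrow> a | Some c \<Rightarrow> c) (zip u v)"])
         (auto simp: list_eq_iff_nth_eq names_def R_def)
    also have "\<dots> \<le> fent \<mu> (names T h n) + fent \<mu> (names T R n)"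
      by (rule fent_pair_le[OF sn[OF sh] sn[OF sR]])
    also have "fent \<mu> (names T R n) \<le> real n * \<gamma>"
      using fent_names_le[OF m(6) sR, of n] mult_left_mono[OF R, of "real n"] by simp
    finally show ?thesis
      using entropy_wrt_partition_props(2)[OF m(6) P n] by (simp add: f_def right_diff_distrib)
  qed
  then show ?thesis using G(1) sh unfolding h_def by (intro exI[of _ k] exI[of _ G]) blast
qed

text \<open>The word distribution is the law of the first letters of a \<open>\<mu>\<close>-random
  point, conditioned on a finite set of words and preceded by \<open>e0\<close>. Its entropy comes
  from a partition into unions of cylinders, its mean size from the integral of \<open>LB\<close>,
  and its mean deviation from \<open>\<phi> - \<alpha>\<close> having integral 0.\<close>

lemma approx_good_of_measure:
  assumes mu: "\<mu> \<in> invariant_measures T I" and phi_int: "has_bochner_integral \<mu> \<phi> \<alpha>"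
    and fin: "lyapunov T I \<mu> < \<infinity>" and s: "0 \<le> s" and lt: "ereal s < ks_entropy T \<mu> / lyapunov T I \<mu>"
  shows "approx_good s"
proof (rule approx_good_of_distribution[OF s])
  fix \<epsilon> :: real assume eps: "\<epsilon> > 0"
  note m = invariant_measures_D[OF mu]
  interpret prob_space \<mu> by (rule m(3))
  have il: "integrable \<mu> lnB" by (rule integrable_lnB[OF mu fin])
  define l where "l = (\<integral>x. lnB x \<partial>\<mu>)"
  have l: "l > 0" unfolding l_def by (rule lyapunov_pos[OF mu il])
  have lam: "lyapunov T I \<mu> = ereal l" unfolding l_def by (rule lyapunov_eq[OF il])
  have "ereal (s * l) < ks_entropy T \<mu>"
    using lt l unfolding lam by (subst (asm) ereal_less_divide_pos) (auto simp: mult.commute)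
  then obtain P where P: "finite_partition \<mu> P" "s * l < entropy_wrt_partition \<mu> T P"
    unfolding ks_entropy_def less_SUP_iff by auto
  define hP where "hP = entropy_wrt_partition \<mu> T P"
  \<comment> \<open>The surplus of entropy: an eighth goes to the approximation of the partition, an
    eighth to the exceptional words, and \<open>3 / 4 * \<gamma>\<close> per letter is left to beat
    the constants.\<close>
  define \<gamma> where "\<gamma> = hP - s * l"
  have g: "\<gamma> > 0" using P(2) by (simp add: \<gamma>_def hP_def)
  have fP: "finite P" and part: "partition_on \<Lambda> P" using P(1) m(1) by (auto simp: finite_partition_def)
  have "P \<noteq> {}" using not_empty m(1) part by (auto simp: partition_on_def)
  then have c1: "real (card P) \<ge> 1" using fP by (simp add: Suc_le_eq card_gt_0_iff)
  define lc where "lc = ln (real (card P))"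
  have lc: "lc \<ge> 0" using c1 by (simp add: lc_def)
  obtain k G where kG: "\<And>w. G w \<in> P" "simple_function \<mu> (\<lambda>x. G (pre (itin x) k))"
    "\<And>n. n \<ge> 1 \<Longrightarrow> real n * (hP - \<gamma> / 8) \<le> fent \<mu> (names T (\<lambda>x. G (pre (itin x) k)) n)"
    using entropy_cylinder_partition[OF mu P(1), of "\<gamma> / 8"] g unfolding hP_def by auto
  define h where "h x = G (pre (itin x) k)" for x
  define \<psi> where "\<psi> x = \<phi> x - \<alpha>" for x
  have iphi: "integrable \<mu> \<phi>" using phi_int by (rule integrable.intros)
  have ipsi: "integrable \<mu> \<psi>" unfolding \<psi>_def[abs_def] using iphi by simp
  have psi0: "(\<integral>x. \<psi> x \<partial>\<mu>) = 0"
    unfolding \<psi>_def[abs_def] using iphi has_bochner_integral_integral_eq[OF phi_int]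
    by (subst Bochner_Integration.integral_diff) (auto simp: prob_space)
  obtain \<delta>1 where \<delta>1: "\<delta>1 > 0" "\<And>A j. A \<in> sets \<mu> \<Longrightarrow> measure \<mu> A \<le> \<delta>1 \<Longrightarrow>
      (\<integral>x. indicator A x * \<bar>\<psi> ((T ^^ j) x)\<bar> \<partial>\<mu>) \<le> \<epsilon> / 4"
    using uniformly_integrable_iterates[OF mu ipsi, of "\<epsilon> / 4"] eps by auto
  \<comment> \<open>The three bounds keep the conditioning harmless, make the exceptional integrals
    of \<open>\<psi>\<close> small, and limit the entropy of the exceptional set to
    \<open>\<gamma> / 8\<close> per symbol.\<close>
  define \<beta> where "\<beta> = min (min (1 / 2) \<delta>1) (\<gamma> / (8 * (lc + 1)))"
  have b0: "\<beta> > 0" using \<delta>1(1) g lc by (simp add: \<beta>_def)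
  have "\<beta> \<le> min (1 / 2) \<delta>1" unfolding \<beta>_def by (rule min.cobounded1)
  then have b1: "\<beta> \<le> 1 / 2" "\<beta> \<le> \<delta>1" by linarith+
  have b2: "\<beta> * lc \<le> \<gamma> / 8"
  proof -
    have "\<beta> * lc \<le> \<gamma> / (8 * (lc + 1)) * (lc + 1)"
      using lc b0 by (intro mult_mono) (auto simp: \<beta>_def)
    also have "\<dots> = \<gamma> / 8" using lc by (simp add: field_simps)
    finally show ?thesis .
  qed
  obtain F where F: "finite F" "\<And>n. n \<ge> 1 \<Longrightarrow> \<exists>GW. finite GW \<and> (\<forall>w\<in>GW. length w = n \<and> hd w \<in> F \<and> last w \<in> F) \<and>
      measure \<mu> {x \<in> \<Lambda>. pre (itin x) n \<notin> GW} \<le> \<beta>"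
    using ex_good_words[OF mu b0] by blast
  define Q where "Q = 2 * B + (\<Sum>i\<in>F. \<bar>\<phi> (\<pi> (ext [e0, i]))\<bar>) + (\<Sum>i\<in>F. \<bar>\<phi> (\<pi> (ext [i]))\<bar>) + \<bar>\<alpha>\<bar>"
  define Q' where "Q' = Q + (\<integral>x. \<bar>\<phi> x\<bar> \<partial>\<mu>)"
  define c2 where "c2 = 7 * D0 - ln (r [e0])"
  define c3 where "c3 = 1 + s * (real k * l + c2) + ln 2"
  obtain n1 where n1: "real n1 > c3 / (3 / 4 * \<gamma>)" using reals_Archimedean2 by blast
  obtain n2 where n2: "real n2 > 4 * Q' / \<epsilon>" using reals_Archimedean2 by blast
  show "\<exists>m0. \<forall>m\<ge>m0. \<exists>W p. finite W \<and> W \<subseteq> EW (Suc m) \<and> (\<forall>w\<in>W. 0 < p w) \<and> (\<Sum>w\<in>W. p w) = 1 \<and>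
      0 < (\<Sum>w\<in>W. p w * (- ln (p w) + s * ln (r w / D))) \<and> \<bar>\<Sum>w\<in>W. p w * E w\<bar> \<le> \<epsilon> * real m"
  proof (intro exI[of _ "n1 + n2 + k + 1"] allI impI)
    fix M' assume M': "n1 + n2 + k + 1 \<le> M'"
    \<comment> \<open>A name of length \<open>n\<close> in the partition into
      \<open>k\<close>-cylinders is determined by the first \<open>n + k = M'\<close>
      letters.\<close>
    define n where "n = M' - k"
    have n: "n \<ge> 1" "n + k = M'" "real n \<ge> real n1" "M' \<ge> 1" "real M' \<ge> real n2" using M' by (auto simp: n_def)
    obtain GW where GW: "finite GW" "\<And>w. w \<in> GW \<Longrightarrow> length w = M' \<and> hd w \<in> F \<and> last w \<in> F"
      "measure \<mu> {x \<in> \<Lambda>. pre (itin x) M' \<notin> GW} \<le> \<beta>" using F(2)[OF n(4)] by blast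
    let ?V = "\<lambda>x. pre (itin x) M'"
    have Vm: "?V \<in> measurable \<mu> (count_space UNIV)" by (rule pre_itin_measurable_mu[OF mu])
    define p where "p w = prob {x \<in> space \<mu>. ?V x = w}" for w
    have p0: "p w \<ge> 0" for w by (simp add: p_def)
    have swi: "(\<Sum>w\<in>GW. p w * u w) = (\<integral>x. (if ?V x \<in> GW then u (?V x) else 0) \<partial>\<mu>)"
        "integrable \<mu> (\<lambda>x. if ?V x \<in> GW then u (?V x) else 0)" for u :: "nat list \<Rightarrow> real"
      unfolding p_def using sum_words_integral[OF Vm GW(1)] by blast+

    define A where "A = {x \<in> space \<mu>. ?V x \<notin> GW}"
    have evA: "A \<in> sets \<mu>"
    proof -
      have "A = ?V -` (- GW) \<inter> space \<mu>" by (auto simp: A_def)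
      then show ?thesis using measurable_sets[OF Vm, of "- GW"] by simp
    qed
    have mA: "prob A \<le> \<beta>" using GW(3) m(1) by (simp add: A_def)

    define \<tau> where "\<tau> = (\<Sum>w\<in>GW. p w)"
    have \<tau>: "\<tau> = 1 - prob A"
    proof -
      have "\<tau> = (\<integral>x. (if ?V x \<in> GW then 1 else 0) \<partial>\<mu>)" using swi(1)[of "\<lambda>_. 1"] by (simp add: \<tau>_def)
      also have "\<dots> = (\<integral>x. 1 - indicator A x \<partial>\<mu>)"
        by (rule Bochner_Integration.integral_cong) (auto simp: A_def indicator_def)
      also have "\<dots> = 1 - prob A"
        using evA by (subst Bochner_Integration.integral_diff) (auto simp: prob_space less_top[symmetric])
      finally show ?thesis .
    qed
    have \<tau>b: "1 / 2 \<le> \<tau>" "\<tau> \<le> 1" using \<tau> mA b1(1) by auto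

    have entropy: "real n * (hP - \<gamma> / 4) - 1 \<le> (\<Sum>w\<in>GW. - (p w * ln (p w)))"
    proof -
      let ?Y = "names T h n"
      have Y: "simple_function \<mu> ?Y"
        using simple_function_names[OF kG(2) m(4)] unfolding h_def by blast
      have fact: "?Y x = map (\<lambda>i. G (take k (drop i (?V x)))) [0..<n]" for x
      proof -
        have "pre (itin ((T ^^ i) x)) k = take k (drop i (?V x))" if "i < n" for i
          using that n(2) by (auto simp: list_eq_iff_nth_eq itin_T)
        then show ?thesis by (simp add: names_def h_def)
      qed
      have "?Y ` space \<mu> \<subseteq> {v. set v \<subseteq> P \<and> length v = n}"
        using kG(1) by (auto simp: fact)
      then have "card (?Y ` space \<mu>) \<le> card {v. set v \<subseteq> P \<and> length v = n}"
        by (intro card_mono finite_lists_length_eq[OF fP])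
      then have card: "real (card (?Y ` space \<mu>)) \<le> real (card P) ^ n"
        unfolding card_lists_length_eq[OF fP] by (metis of_nat_le_iff of_nat_power)
      have "fent \<mu> ?Y \<le> (\<Sum>w\<in>GW. - (p w * ln (p w))) + \<beta> * ln (real (card P) ^ n) + 1"
        unfolding p_def
        by (rule fent_le_words[OF Vm GW(1) Y fact card]) (use c1 GW(3) m(1) in auto)
      moreover have "\<beta> * ln (real (card P) ^ n) = real n * (\<beta> * lc)" using c1 by (simp add: lc_def ln_realpow)
      moreover have "real n * (\<beta> * lc) \<le> real n * (\<gamma> / 8)" using b2 by (rule mult_left_mono) simp
      moreover have "real n * (hP - \<gamma> / 8) \<le> fent \<mu> ?Y" using kG(3)[OF n(1)] unfolding h_def .
      ultimately show ?thesis by (simp add: algebra_simps)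
    qed

    have size: "- (real M' * l + c2) \<le> (\<Sum>w\<in>GW. p w * ln (r (e0 # w) / D))"
    proof -
      have le: "- ln (r (e0 # w) / D) \<le> - ln (r w) + (6 * D0 - ln (r [e0]))" for w
        using r_append[of "[e0]" w] r_pos[of "e0 # w"] by (simp add: D_def ln_div abs_le_iff)
      have "(\<Sum>w\<in>GW. p w * (- ln (r (e0 # w) / D))) \<le> (\<Sum>w\<in>GW. p w * (- ln (r w) + (6 * D0 - ln (r [e0]))))"
        using le p0 by (intro sum_mono mult_left_mono)
      also have "\<dots> = (\<Sum>w\<in>GW. p w * (- ln (r w))) + \<tau> * (6 * D0 - ln (r [e0]))"
        by (simp only: \<tau>_def distrib_left sum.distrib sum_distrib_right)
      also have "\<tau> * (6 * D0 - ln (r [e0])) \<le> 1 * (6 * D0 - ln (r [e0]))"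
      proof (rule mult_right_mono[OF \<tau>b(2)])
        have "ln (r [e0]) \<le> 0" using r_pos r_le1 by simp
        then show "0 \<le> 6 * D0 - ln (r [e0])" using D0_nonneg by simp
      qed
      also have "(\<Sum>w\<in>GW. p w * (- ln (r w))) \<le> real M' * l + D0"
      proof -
        have "(\<Sum>w\<in>GW. p w * (- ln (r w))) = (\<integral>x. (if ?V x \<in> GW then - ln (r (?V x)) else 0) \<partial>\<mu>)" by (rule swi(1))
        \<comment> \<open>Off the good words the integrand on the left is 0, and there
          \<open>LB\<close> is at least \<open>- D0\<close>.\<close>
        also have "\<dots> \<le> (\<integral>x. LB M' x + D0 \<partial>\<mu>)"
        proof (rule integral_mono_AE[OF swi(2)])
          show "integrable \<mu> (\<lambda>x. LB M' x + D0)" using integral_LB(1)[OF mu il, of M'] by simp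
          show "AE x in \<mu>. (if ?V x \<in> GW then - ln (r (?V x)) else 0) \<le> LB M' x + D0"
            using AE_\<Lambda>'[OF mu]
          proof eventually_elim
            case (elim x)
            then show ?case using LB_r[OF elim, of M'] LB_ge(1)[OF elim, of M'] by (auto simp: abs_le_iff)
          qed
        qed
        also have "\<dots> = real M' * l + D0"
          using integral_LB[OF mu il, of M'] by (simp add: l_def prob_space)
        finally show ?thesis .
      qed
      finally have "(\<Sum>w\<in>GW. p w * (- ln (r (e0 # w) / D))) \<le> real M' * l + c2" by (simp add: c2_def)
      then show ?thesis by (simp add: sum_negf)
    qed

    have dev: "\<bar>\<Sum>w\<in>GW. p w * E (e0 # w)\<bar> \<le> real M' * (\<epsilon> / 4) + Q'"
    proof -
      define g where "g x = (if ?V x \<in> GW then E (e0 # ?V x) else 0)" for x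
      define S\<psi> where "S\<psi> x = (\<Sum>j<M'. \<psi> ((T ^^ j) x))" for x
      have ig: "integrable \<mu> g" unfolding g_def by (rule swi(2))
      have iS: "integrable \<mu> S\<psi>" unfolding S\<psi>_def[abs_def] using integral_iterate(1)[OF mu ipsi] by simp
      have S0: "(\<integral>x. S\<psi> x \<partial>\<mu>) = 0" unfolding S\<psi>_def using integral_iterate[OF mu ipsi] psi0 by simp
      have iAS: "integrable \<mu> (\<lambda>x. indicator A x * S\<psi> x)"
        using integrable_mult_indicator[OF evA iS] by simp
      define u where "u x = Q + \<bar>\<phi> ((T ^^ (M' - 1)) x)\<bar>" for x
      have iu: "integrable \<mu> u"
        unfolding u_def[abs_def] using integrable_abs[OF integral_iterate(1)[OF mu iphi, of "M' - 1"]] by simp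
      have Iu: "(\<integral>x. u x \<partial>\<mu>) = Q'"
        unfolding u_def Q'_def
        using integral_iterate[OF mu integrable_abs[OF iphi], of "M' - 1"] by (simp add: prob_space)
      have Q0: "Q \<ge> 0" using B_nonneg by (auto simp: Q_def intro!: add_nonneg_nonneg sum_nonneg)
      have pt: "AE x in \<mu>. \<bar>g x - (S\<psi> x - indicator A x * S\<psi> x)\<bar> \<le> u x"
        using AE_\<Lambda>'[OF mu] AE_space[of \<mu>]
      proof eventually_elim
        case (elim x)
        show ?case
        proof (cases "?V x \<in> GW")
          case True
          have "?V x \<noteq> []" using n(4) by (auto simp: pre_def)
          then have "itin x 0 \<in> F" "itin x (M' - 1) \<in> F"
            using GW(2)[OF True] n(4) by (simp_all add: hd_conv_nth last_conv_nth)
          then have "\<bar>E (e0 # ?V x) - (S M' (itin x) - real M' * \<alpha>)\<bar> \<le> Q + \<bar>\<phi> (\<pi> (shiftn (M' - 1) (itin x)))\<bar>"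
            unfolding Q_def by (rule E_code[OF n(4) F(1)])
          moreover have "\<pi> (shiftn (M' - 1) (itin x)) = (T ^^ (M' - 1)) x"
            using \<pi>_itin[OF elim(1)] T_pow_\<pi>[of "M' - 1" "itin x"] by simp
          moreover have "S M' (itin x) - real M' * \<alpha> = S\<psi> x"
            unfolding S_itin[OF elim(1)] S\<psi>_def \<psi>_def by (simp add: sum_subtractf)
          moreover have "x \<notin> A" using True by (simp add: A_def)
          ultimately show ?thesis using True by (simp add: g_def u_def)
        next
          case False
          then have "x \<in> A" using elim by (simp add: A_def)
          then show ?thesis using False Q0 by (simp add: g_def u_def)
        qed
      qed
      have iD: "integrable \<mu> (\<lambda>x. g x - (S\<psi> x - indicator A x * S\<psi> x))" using ig iS iAS by simp
      have "\<bar>\<integral>x. g x - (S\<psi> x - indicator A x * S\<psi> x) \<partial>\<mu>\<bar> \<le> (\<integral>x. \<bar>g x - (S\<psi> x - indicator A x * S\<psi> x)\<bar> \<partial>\<mu>)"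
        by (rule integral_abs_bound)
      also have "\<dots> \<le> (\<integral>x. u x \<partial>\<mu>)" by (rule integral_mono_AE[OF integrable_abs[OF iD] iu pt])
      finally have 1: "\<bar>\<integral>x. g x - (S\<psi> x - indicator A x * S\<psi> x) \<partial>\<mu>\<bar> \<le> Q'" using Iu by simp
      have 2: "(\<integral>x. g x - (S\<psi> x - indicator A x * S\<psi> x) \<partial>\<mu>) = (\<integral>x. g x \<partial>\<mu>) + (\<integral>x. indicator A x * S\<psi> x \<partial>\<mu>)"
        using ig iS iAS S0 by simp
      \<comment> \<open>On the good words the deviation is \<open>S\<psi>\<close> up to
        \<open>u\<close>. As \<open>S\<psi>\<close> has integral 0, only its integral over the
        exceptional set \<open>A\<close> matters, and uniform integrability bounds it by
        \<open>\<epsilon> / 4\<close> per step.\<close>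
      have 3: "\<bar>\<integral>x. indicator A x * S\<psi> x \<partial>\<mu>\<bar> \<le> real M' * (\<epsilon> / 4)"
      proof -
        have ij: "integrable \<mu> (\<lambda>x. indicator A x * \<bar>\<psi> ((T ^^ j) x)\<bar>)" for j
          using integrable_mult_indicator[OF evA integrable_abs[OF integral_iterate(1)[OF mu ipsi]], of j] by simp
        have "\<bar>\<integral>x. indicator A x * S\<psi> x \<partial>\<mu>\<bar> \<le> (\<integral>x. \<bar>indicator A x * S\<psi> x\<bar> \<partial>\<mu>)" by (rule integral_abs_bound)
        also have "\<dots> \<le> (\<integral>x. (\<Sum>j<M'. indicator A x * \<bar>\<psi> ((T ^^ j) x)\<bar>) \<partial>\<mu>)"
        proof (rule integral_mono)
          show "integrable \<mu> (\<lambda>x. \<bar>indicator A x * S\<psi> x\<bar>)" using iAS by (rule integrable_abs)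
          show "integrable \<mu> (\<lambda>x. \<Sum>j<M'. indicator A x * \<bar>\<psi> ((T ^^ j) x)\<bar>)"
            by (intro Bochner_Integration.integrable_sum ij)
          show "\<bar>indicator A x * S\<psi> x\<bar> \<le> (\<Sum>j<M'. indicator A x * \<bar>\<psi> ((T ^^ j) x)\<bar>)" for x
            by (simp add: S\<psi>_def indicator_def)
        qed
        also have "\<dots> = (\<Sum>j<M'. (\<integral>x. indicator A x * \<bar>\<psi> ((T ^^ j) x)\<bar> \<partial>\<mu>))"
          using ij by (rule Bochner_Integration.integral_sum)
        also have "\<dots> \<le> (\<Sum>j<M'. \<epsilon> / 4)" using \<delta>1(2)[OF evA] mA b1(2) by (intro sum_mono) simp
        finally show ?thesis by simp
      qed
      have "(\<Sum>w\<in>GW. p w * E (e0 # w)) = (\<integral>x. g x \<partial>\<mu>)" unfolding g_def by (rule swi(1))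
      then show ?thesis using 1 2 3 by linarith
    qed

    \<comment> \<open>Words of probability 0 are dropped, since positive weights are demanded; they
      contribute nothing to the sums.\<close>
    define GW' where "GW' = {w \<in> GW. p w > 0}"
    have fGW': "finite GW'" using GW(1) by (simp add: GW'_def)
    have restr: "(\<Sum>w\<in>GW'. p w * u w) = (\<Sum>w\<in>GW. p w * u w)" for u :: "nat list \<Rightarrow> real"
    proof -
      have "p w = 0" if "w \<in> GW - GW'" for w using that p0[of w] by (auto simp: GW'_def)
      then show ?thesis using GW(1) by (intro sum.mono_neutral_left) (auto simp: GW'_def)
    qed
    define W where "W = (#) e0 ` GW'"
    define p' where "p' w = p (tl w) / \<tau>" for w
    have inj: "inj_on ((#) e0) GW'" by (auto intro: inj_onI)
    have sumW: "(\<Sum>w\<in>W. p' w * u w) = (\<Sum>w\<in>GW. p w * u (e0 # w)) / \<tau>" for u :: "nat list \<Rightarrow> real"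
    proof -
      have "(\<Sum>w\<in>W. p' w * u w) = (\<Sum>w\<in>GW'. p w * u (e0 # w)) / \<tau>"
        by (simp add: W_def sum.reindex[OF inj] p'_def sum_divide_distrib)
      then show ?thesis by (simp only: restr)
    qed
    have tp: "\<tau> > 0" using \<tau>b by simp
    have "finite W" using fGW' by (simp add: W_def)
    moreover have "W \<subseteq> EW (Suc M')" using GW(2) by (auto simp: W_def EW_def GW'_def)
    moreover have "\<forall>w\<in>W. 0 < p' w" using tp by (auto simp: W_def p'_def GW'_def)
    moreover have "(\<Sum>w\<in>W. p' w) = 1" using sumW[of "\<lambda>_. 1"] tp by (simp add: \<tau>_def)
    moreover have "0 < (\<Sum>w\<in>W. p' w * (- ln (p' w) + s * ln (r w / D)))"
    proof -
      have "(\<Sum>w\<in>W. p' w * (- ln (p' w) + s * ln (r w / D)))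
          = (\<Sum>w\<in>GW'. p w * (- ln (p w) + ln \<tau> + s * ln (r (e0 # w) / D))) / \<tau>"
        unfolding W_def sum.reindex[OF inj] sum_divide_distrib
        by (intro sum.cong refl) (use tp in \<open>auto simp: p'_def ln_div GW'_def\<close>)
      also have "(\<Sum>w\<in>GW'. p w * (- ln (p w) + ln \<tau> + s * ln (r (e0 # w) / D)))
          = (\<Sum>w\<in>GW. p w * (- ln (p w) + ln \<tau> + s * ln (r (e0 # w) / D)))" by (rule restr)
      also have "\<dots> = (\<Sum>w\<in>GW. - (p w * ln (p w))) + \<tau> * ln \<tau> + s * (\<Sum>w\<in>GW. p w * ln (r (e0 # w) / D))"
      proof -
        have e: "p w * (- ln (p w) + ln \<tau> + s * ln (r (e0 # w) / D))
            = - (p w * ln (p w)) + p w * ln \<tau> + s * (p w * ln (r (e0 # w) / D))" for w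
          by (simp add: algebra_simps)
        have "(\<Sum>w\<in>GW. p w * ln \<tau>) = \<tau> * ln \<tau>" unfolding \<tau>_def by (rule sum_distrib_right[symmetric])
        moreover have "(\<Sum>w\<in>GW. s * (p w * ln (r (e0 # w) / D))) = s * (\<Sum>w\<in>GW. p w * ln (r (e0 # w) / D))"
          by (rule sum_distrib_left[symmetric])
        ultimately show ?thesis by (simp only: e sum.distrib)
      qed
      finally have eq: "(\<Sum>w\<in>W. p' w * (- ln (p' w) + s * ln (r w / D)))
          = ((\<Sum>w\<in>GW. - (p w * ln (p w))) + \<tau> * ln \<tau> + s * (\<Sum>w\<in>GW. p w * ln (r (e0 # w) / D))) / \<tau>" .
      have "\<tau> * ln \<tau> \<ge> - ln 2"
      proof -
        have "ln (1 / 2) \<le> ln \<tau>" using \<tau>b by (intro ln_mono) auto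
        then have "- ln 2 \<le> ln \<tau>" by (simp add: ln_div)
        moreover have "ln \<tau> \<le> 0" using \<tau>b by simp
        then have "1 * ln \<tau> \<le> \<tau> * ln \<tau>" using \<tau>b by (intro mult_right_mono_neg) auto
        ultimately show ?thesis by simp
      qed
      moreover have "s * (- (real M' * l + c2)) \<le> s * (\<Sum>w\<in>GW. p w * ln (r (e0 # w) / D))"
        using size s by (rule mult_left_mono)
      moreover have "real n * (hP - \<gamma> / 4) - 1 - ln 2 - s * (real M' * l + c2) = real n * (3 / 4 * \<gamma>) - c3"
        by (simp add: c3_def \<gamma>_def field_simps flip: n(2))
      moreover have "real n * (3 / 4 * \<gamma>) - c3 > 0"
      proof -
        have "c3 / (3 / 4 * \<gamma>) < real n" using n1 n(3) by linarith
        then show ?thesis using g by (simp add: field_simps)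
      qed
      ultimately have "0 < (\<Sum>w\<in>GW. - (p w * ln (p w))) + \<tau> * ln \<tau> + s * (\<Sum>w\<in>GW. p w * ln (r (e0 # w) / D))"
        using entropy by linarith
      then show ?thesis unfolding eq using tp by simp
    qed
    moreover have "\<bar>\<Sum>w\<in>W. p' w * E w\<bar> \<le> \<epsilon> * real M'"
    proof -
      have "4 * Q' / \<epsilon> < real M'" using n2 n(5) by linarith
      then have "Q' \<le> real M' * (\<epsilon> / 4)" using eps by (simp add: field_simps)
      moreover have "(\<epsilon> * real M') * (1 / 2) = real M' * (\<epsilon> / 4) + real M' * (\<epsilon> / 4)" by simp
      ultimately have "\<bar>\<Sum>w\<in>GW. p w * E (e0 # w)\<bar> \<le> (\<epsilon> * real M') * (1 / 2)" using dev by linarith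
      also have "\<dots> \<le> (\<epsilon> * real M') * \<tau>" using \<tau>b eps by (intro mult_left_mono) auto
      finally have "\<bar>\<Sum>w\<in>GW. p w * E (e0 # w)\<bar> \<le> \<epsilon> * real M' * \<tau>" .
      then show ?thesis unfolding sumW using tp by (simp add: abs_divide pos_divide_le_eq)
    qed
    ultimately show "\<exists>W p. finite W \<and> W \<subseteq> EW (Suc M') \<and> (\<forall>w\<in>W. 0 < p w) \<and> (\<Sum>w\<in>W. p w) = 1 \<and>
      0 < (\<Sum>w\<in>W. p w * (- ln (p w) + s * ln (r w / D))) \<and> \<bar>\<Sum>w\<in>W. p w * E w\<bar> \<le> \<epsilon> * real M'"
      by (intro exI[of _ W] exI[of _ p'] conjI)
  qed
qed

end

section \<open>The Birkhoff spectrum\<close>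

theorem theorem1p1:
  fixes T \<phi> :: "real \<Rightarrow> real"
    and I :: "nat \<Rightarrow> real set"
    and \<pi> :: "(nat \<Rightarrow> nat) \<Rightarrow> real"
    and \<alpha> :: real
  assumes "emr_map T I"
    and "{x. x islimpt endpoints I} = {0}"
    and "full_shift_coding T I \<pi>"
    and "\<phi> \<in> class_R T I \<pi>"
    and "ereal \<alpha> < alpha_max T I \<phi>"
  shows "birkhoff_spectrum T I \<phi> \<alpha> =
    Sup {ks_entropy T \<mu> / lyapunov T I \<mu> | \<mu>.
      \<mu> \<in> invariant_measures T I \<and> has_bochner_integral \<mu> \<phi> \<alpha> \<and> lyapunov T I \<mu> < \<infinity>}"
proof -
  interpret emr_level T I \<pi> \<phi> \<alpha>
    by unfold_locales (use assms in auto)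
  let ?M = "{ks_entropy T \<mu> / lyapunov T I \<mu> | \<mu>.
      \<mu> \<in> invariant_measures T I \<and> has_bochner_integral \<mu> \<phi> \<alpha> \<and> lyapunov T I \<mu> < \<infinity>}"
  let ?dim = "hausdorff_dim (level_set T I \<phi> \<alpha>)"
  have good_Sup: "ereal s \<le> Sup ?M" if g: "good s" "0 \<le> s" for s
  proof -
    obtain \<mu> where \<mu>: "\<mu> \<in> invariant_measures T I" "has_bochner_integral \<mu> \<phi> \<alpha>" "lyapunov T I \<mu> < \<infinity>"
      "ereal s \<le> ks_entropy T \<mu> / lyapunov T I \<mu>" using measure_of_good[OF g] by blast
    have "ks_entropy T \<mu> / lyapunov T I \<mu> \<le> Sup ?M" using \<mu> by (intro Sup_upper) blast
    then show ?thesis using \<mu>(4) by (rule order_trans[rotated])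
  qed
  have dim0: "0 \<le> ?dim" using dim_level_ge[OF good_0] by (simp add: zero_ereal_def)
  have sup0: "0 \<le> Sup ?M" using good_Sup[OF good_0] by (simp add: zero_ereal_def)
  have "?dim \<le> Sup ?M"
  proof (rule ccontr)
    assume "\<not> ?thesis"
    then have "Sup ?M < ?dim" by simp
    then obtain t where t: "Sup ?M < ereal t" "ereal t < ?dim" by (rule ereal_dense2[THEN exE]) blast
    \<comment> \<open>Two gaps are required: one between the exponent of the covering and
      \<open>approx_good\<close>, the other between \<open>approx_good\<close> and
      \<open>good\<close>.\<close>
    obtain t' where t': "Sup ?M < ereal t'" "ereal t' < ereal t" using ereal_dense2[OF t(1)] by blast
    obtain t'' where t'': "Sup ?M < ereal t''" "ereal t'' < ereal t'" using ereal_dense2[OF t'(1)] by blast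
    have pos: "0 \<le> t''" "t'' < t'" "t' < t" using sup0 t' t'' by (auto simp: zero_ereal_def dest: order.strict_trans1)
    have "\<not> good t''" using good_Sup[of t''] pos(1) t''(1) by auto
    then have "\<not> approx_good t'" using good_of_approx_good[of t' t''] pos by blast
    then have "?dim \<le> ereal t" using pos by (intro dim_level_le[of t']) auto
    then show False using t(2) by simp
  qed
  moreover have "Sup ?M \<le> ?dim"
  proof (rule Sup_least)
    fix x assume "x \<in> ?M"
    then obtain \<mu> where \<mu>: "x = ks_entropy T \<mu> / lyapunov T I \<mu>" "\<mu> \<in> invariant_measures T I"
      "has_bochner_integral \<mu> \<phi> \<alpha>" "lyapunov T I \<mu> < \<infinity>" by blast
    show "x \<le> ?dim"
    proof (rule ccontr)
      assume "\<not> ?thesis"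
      then have "?dim < x" by simp
      then obtain t where t: "?dim < ereal t" "ereal t < x" by (rule ereal_dense2[THEN exE]) blast
      obtain t' where t': "?dim < ereal t'" "ereal t' < ereal t" using ereal_dense2[OF t(1)] by blast
      have pos: "0 \<le> t'" "t' < t" using dim0 t' by (auto simp: zero_ereal_def dest: order.strict_trans1)
      have "approx_good t" using approx_good_of_measure[OF \<mu>(2-4), of t] t(2) pos \<mu>(1) by simp
      then have "good t'" using pos by (intro good_of_approx_good) auto
      then have "ereal t' \<le> ?dim" by (rule dim_level_ge)
      then show False using t'(1) by simp
    qed
  qed
  ultimately show ?thesis unfolding birkhoff_spectrum_def by (rule antisym)
qed

end
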